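(* For any monoidal signature $\Sigma$, the preordered category $\mathsf{DiscCospan}(\mathbf{Hyp}_\Sigma)$ and the preordered prop $\mathbb{CB}^{\leq}_{\Sigma}$ are isomorphic as preordered cartesian bicategories.
   Context: A monoidal signature $\Sigma$ is a set of symbols each with an arity $n$ and coarity $m$ ($\Sigma_{n,m}$ those with arity $n$, coarity $m$). A $\Sigma$-hypergraph $G$ is a set $G_V$ of vertices and, for each $R\in\Sigma_{n,m}$, a set $G_R$ with source and target functions $s_R:G_R\to(G_V)^n$, $t_R:G_R\to(G_V)^m$; a morphism $f:G\to G'$ is a function $f_V:G_V\to G'_V$ and functions $f_R:G_R\to G'_R$ commuting with sources and targets (componentwise $f_V$). $\mathbf{Hyp}_\Sigma$ is the category of finite $\Sigma$-hypergraphs (all $G_V,G_R$ finite). For a finitely cocomplete category $\mathcal C$, $\mathsf{Cospan}^{\leq}(\mathcal C)$ has the objects of $\mathcal C$, arrows $X\to Y$ isomorphism classes of cospans $X\to A\leftarrow Y$, composition by pushout, monoidal product by coproduct (unit the initial object), and preorder $(X\to A\leftarrow Y)\le(X\to B\leftarrow Y)$ iff there is a cospan morphism $B\to A$ (an arrow commuting with the legs). $\mathsf{DiscCospan}(\mathbf{Hyp}_\Sigma)$ is the full subcategory of $\mathsf{Cospan}^{\leq}(\mathbf{Hyp}_\Sigma)$ on the finite ordinals $n$, viewed as discrete hypergraphs with vertices $\{0,\dots,n-1\}$ and no edges; its monoid on $X$ is $X+X\xrightarrow{[\mathrm{id},\mathrm{id}]}X\xleftarrow{\mathrm{id}}X$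 and $0\to X\xleftarrow{\mathrm{id}}X$, its comonoid the reversed cospans. A preordered cartesian bicategory is a symmetric monoidal category $(\mathcal B,\oplus,I)$ whose hom-sets are preordered with composition and $\oplus$ monotone, such that every object $X$ carries a monoid $\mu_X:X\oplus X\to X$, $\eta_X:I\to X$ and comonoid $\delta_X:X\to X\oplus X$, $\varepsilon_X:X\to I$ forming a special commutative Frobenius bimonoid (associativity, unit, commutativity, their duals, Frobenius law $(\delta_X\oplus\mathrm{id});(\mathrm{id}\oplus\mu_X)=\mu_X;\delta_X=(\mathrm{id}\oplus\delta_X);(\mu_X\oplus\mathrm{id})$, speciality $\delta_X;\mu_X=\mathrm{id}_X$; $;$ is diagrammatic composition), with $\mathrm{id}_X\le\varepsilon_X;\eta_X$, $\eta_X;\varepsilon_X\le\mathrm{id}_I$, $\mathrm{id}_X\le\delta_X;\mu_X$, $\mu_X;\delta_X\le\mathrm{id}_{X\oplus X}$, and every arrow $R:X\to Y$ satisfying $R;\delta_Y\le\delta_X;(R\oplus R)$, $R;\varepsilon_Y\le\varepsilon_X$. Morphisms are monoidal functors preserving the preorders and the monoids and comonoids. GCQ terms over $\Sigma$ with sorts $(n,m)$ are generated by constants $\delta:(1,2)$, $\varepsilon:(1,0)$, $\mu:(2,1)$, $\eta:(0,1)$, $\mathrm{id}_0:(0,0)$, $\mathrm{id}_1:(1,1)$, $\sigma:(2,2)$, symbols $R\in\Sigma_{n,m}$ of sort $(n,m)$, sequential composition $c;d$ ($(n,z),(z,m)\mapsto(n,m)$) and $c\oplus d$ ($(n,m),(p,q)\mapsto(n+p,m+q)$).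 Write $\mathrm{id}_n$ for $n$-fold $\oplus$ of $\mathrm{id}_1$, $\sigma_{n,m}$ for symmetries built from $\sigma$, $\varepsilon_0=\mathrm{id}_0$, $\varepsilon_{n+1}=\varepsilon\oplus\varepsilon_n$, $\delta_0=\mathrm{id}_0$, $\delta_{n+1}=(\delta\oplus\delta_n);(\mathrm{id}_1\oplus\sigma_{1,n}\oplus\mathrm{id}_n)$. Equations (E): strict symmetric monoidal category laws with symmetry generated by $\sigma$; $\delta;(\delta\oplus\mathrm{id}_1)=\delta;(\mathrm{id}_1\oplus\delta)$, $\delta;(\varepsilon\oplus\mathrm{id}_1)=\mathrm{id}_1$, $\delta;\sigma=\delta$; $(\mu\oplus\mathrm{id}_1);\mu=(\mathrm{id}_1\oplus\mu);\mu$, $(\eta\oplus\mathrm{id}_1);\mu=\mathrm{id}_1$, $\sigma;\mu=\mu$; $(\delta\oplus\mathrm{id}_1);(\mathrm{id}_1\oplus\mu)=\mu;\delta=(\mathrm{id}_1\oplus\delta);(\mu\oplus\mathrm{id}_1)$; $\delta;\mu=\mathrm{id}_1$. Inequalities (I): $\mathrm{id}_1\le\varepsilon;\eta$, $\eta;\varepsilon\le\mathrm{id}_0$, $\mathrm{id}_1\le\delta;\mu$, $\mu;\delta\le\mathrm{id}_2$, and for each $R\in\Sigma_{n,m}$: $R;\delta_m\le\delta_n;(R\oplus R)$, $R;\varepsilon_m\le\varepsilon_n$. The preordered prop $\mathbb{CB}^{\leq}_{\Sigma}$ has objects natural numbers, arrows $n\to m$ the GCQ terms of sort $(n,m)$ modulo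 the smallest congruence (for $;$ and $\oplus$) generated by (E), ordered by the smallest precongruence generated by (I).
   Formalization: A finite Σ-hypergraph is taken to have finitely many edges in total over all symbols, not just each G_R finite; the two agree for finite Σ, and for infinite Σ the literal reading makes the claim false by cardinality of Hom(0,0). *)

theory Defs
  imports Main "HOL-Library.FuncSet"
begin

section \<open>Categories and symmetric monoidal categories\<close>

text \<open>Composition is written in diagrammatic order.\<close>

record ('o, 'a) cat =
  Obj :: "'o set"
  Hom :: "'o \<Rightarrow> 'o \<Rightarrow> 'a set"
  ident :: "'o \<Rightarrow> 'a"
  seq :: "'a \<Rightarrow> 'a \<Rightarrow> 'a" (infixl ";;\<index>" 65)

locale category =
  fixes C :: "('o, 'a, 'm) cat_scheme" (structure)
  assumes hom_disjoint:
      "\<lbrakk>X \<in> Obj C; Y \<in> Obj C; X' \<in> Obj C; Y' \<in> Obj C;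
        f \<in> Hom C X Y; f \<in> Hom C X' Y'\<rbrakk> \<Longrightarrow> X = X' \<and> Y = Y'"
    and ident_hom: "X \<in> Obj C \<Longrightarrow> ident C X \<in> Hom C X X"
    and seq_hom:
      "\<lbrakk>X \<in> Obj C; Y \<in> Obj C; Z \<in> Obj C; f \<in> Hom C X Y; g \<in> Hom C Y Z\<rbrakk>
       \<Longrightarrow> f ;; g \<in> Hom C X Z"
    and ident_seq: "\<lbrakk>X \<in> Obj C; Y \<in> Obj C; f \<in> Hom C X Y\<rbrakk> \<Longrightarrow> ident C X ;; f = f"
    and seq_ident: "\<lbrakk>X \<in> Obj C; Y \<in> Obj C; f \<in> Hom C X Y\<rbrakk> \<Longrightarrow> f ;; ident C Y = f"
    and seq_assoc:
      "\<lbrakk>W \<in> Obj C; X \<in> Obj C; Y \<in> Obj C; Z \<in> Obj C;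
        f \<in> Hom C W X; g \<in> Hom C X Y; h \<in> Hom C Y Z\<rbrakk>
       \<Longrightarrow> (f ;; g) ;; h = f ;; (g ;; h)"

definition is_inverse :: "('o, 'a, 'm) cat_scheme \<Rightarrow> 'o \<Rightarrow> 'o \<Rightarrow> 'a \<Rightarrow> 'a \<Rightarrow> bool" where
  "is_inverse C X Y f g \<longleftrightarrow>
     f \<in> Hom C X Y \<and> g \<in> Hom C Y X \<and> f ;;\<^bsub>C\<^esub> g = ident C X \<and> g ;;\<^bsub>C\<^esub> f = ident C Y"

definition is_iso :: "('o, 'a, 'm) cat_scheme \<Rightarrow> 'o \<Rightarrow> 'o \<Rightarrow> 'a \<Rightarrow> bool" where
  "is_iso C X Y f \<longleftrightarrow> (\<exists>g. is_inverse C X Y f g)"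

definition inverse_of :: "('o, 'a, 'm) cat_scheme \<Rightarrow> 'o \<Rightarrow> 'o \<Rightarrow> 'a \<Rightarrow> 'a" where
  "inverse_of C X Y f = (THE g. is_inverse C X Y f g)"

record ('o, 'a) smcat = "('o, 'a) cat" +
  oplus_obj :: "'o \<Rightarrow> 'o \<Rightarrow> 'o" (infixr "\<boxplus>\<index>" 70)
  oplus :: "'a \<Rightarrow> 'a \<Rightarrow> 'a" (infixr "\<oplus>\<index>" 70)
  unit_obj :: "'o"
  assoc :: "'o \<Rightarrow> 'o \<Rightarrow> 'o \<Rightarrow> 'a"
  lunit :: "'o \<Rightarrow> 'a"
  runit :: "'o \<Rightarrow> 'a"
  symm :: "'o \<Rightarrow> 'o \<Rightarrow> 'a"

locale symmetric_monoidal_category = category B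
  for B :: "('o, 'a, 'm) smcat_scheme" (structure) +
  assumes unit_obj: "unit_obj B \<in> Obj B"
    and oplus_obj: "\<lbrakk>X \<in> Obj B; Y \<in> Obj B\<rbrakk> \<Longrightarrow> X \<boxplus> Y \<in> Obj B"
    and oplus_hom:
      "\<lbrakk>X \<in> Obj B; Y \<in> Obj B; X' \<in> Obj B; Y' \<in> Obj B; f \<in> Hom B X Y; f' \<in> Hom B X' Y'\<rbrakk>
       \<Longrightarrow> f \<oplus> f' \<in> Hom B (X \<boxplus> X') (Y \<boxplus> Y')"
    and oplus_ident:
      "\<lbrakk>X \<in> Obj B; Y \<in> Obj B\<rbrakk> \<Longrightarrow> ident B X \<oplus> ident B Y = ident B (X \<boxplus> Y)"
    and interchange:
      "\<lbrakk>X \<in> Obj B; Y \<in> Obj B; Z \<in> Obj B; X' \<in> Obj B; Y' \<in> Obj B; Z' \<in> Obj B;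
        f \<in> Hom B X Y; g \<in> Hom B Y Z; f' \<in> Hom B X' Y'; g' \<in> Hom B Y' Z'\<rbrakk>
       \<Longrightarrow> (f ;; g) \<oplus> (f' ;; g') = (f \<oplus> f') ;; (g \<oplus> g')"
    and assoc_iso:
      "\<lbrakk>X \<in> Obj B; Y \<in> Obj B; Z \<in> Obj B\<rbrakk>
       \<Longrightarrow> is_iso B ((X \<boxplus> Y) \<boxplus> Z) (X \<boxplus> (Y \<boxplus> Z)) (assoc B X Y Z)"
    and assoc_natural:
      "\<lbrakk>X \<in> Obj B; Y \<in> Obj B; Z \<in> Obj B; X' \<in> Obj B; Y' \<in> Obj B; Z' \<in> Obj B;
        f \<in> Hom B X X'; g \<in> Hom B Y Y'; h \<in> Hom B Z Z'\<rbrakk>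
       \<Longrightarrow> ((f \<oplus> g) \<oplus> h) ;; assoc B X' Y' Z' = assoc B X Y Z ;; (f \<oplus> (g \<oplus> h))"
    and lunit_iso: "X \<in> Obj B \<Longrightarrow> is_iso B (unit_obj B \<boxplus> X) X (lunit B X)"
    and lunit_natural:
      "\<lbrakk>X \<in> Obj B; Y \<in> Obj B; f \<in> Hom B X Y\<rbrakk>
       \<Longrightarrow> (ident B (unit_obj B) \<oplus> f) ;; lunit B Y = lunit B X ;; f"
    and runit_iso: "X \<in> Obj B \<Longrightarrow> is_iso B (X \<boxplus> unit_obj B) X (runit B X)"
    and runit_natural:
      "\<lbrakk>X \<in> Obj B; Y \<in> Obj B; f \<in> Hom B X Y\<rbrakk>
       \<Longrightarrow> (f \<oplus> ident B (unit_obj B)) ;; runit B Y = runit B X ;; f"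
    and pentagon:
      "\<lbrakk>W \<in> Obj B; X \<in> Obj B; Y \<in> Obj B; Z \<in> Obj B\<rbrakk>
       \<Longrightarrow> assoc B (W \<boxplus> X) Y Z ;; assoc B W X (Y \<boxplus> Z) =
           (assoc B W X Y \<oplus> ident B Z) ;; assoc B W (X \<boxplus> Y) Z ;; (ident B W \<oplus> assoc B X Y Z)"
    and triangle:
      "\<lbrakk>X \<in> Obj B; Y \<in> Obj B\<rbrakk>
       \<Longrightarrow> assoc B X (unit_obj B) Y ;; (ident B X \<oplus> lunit B Y) = runit B X \<oplus> ident B Y"
    and symm_hom: "\<lbrakk>X \<in> Obj B; Y \<in> Obj B\<rbrakk> \<Longrightarrow> symm B X Y \<in> Hom B (X \<boxplus> Y) (Y \<boxplus> X)"
    and symm_natural: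
      "\<lbrakk>X \<in> Obj B; Y \<in> Obj B; X' \<in> Obj B; Y' \<in> Obj B; f \<in> Hom B X X'; g \<in> Hom B Y Y'\<rbrakk>
       \<Longrightarrow> (f \<oplus> g) ;; symm B X' Y' = symm B X Y ;; (g \<oplus> f)"
    and symm_symm:
      "\<lbrakk>X \<in> Obj B; Y \<in> Obj B\<rbrakk> \<Longrightarrow> symm B X Y ;; symm B Y X = ident B (X \<boxplus> Y)"
    and hexagon:
      "\<lbrakk>X \<in> Obj B; Y \<in> Obj B; Z \<in> Obj B\<rbrakk>
       \<Longrightarrow> assoc B X Y Z ;; symm B X (Y \<boxplus> Z) ;; assoc B Y Z X =
           (symm B X Y \<oplus> ident B Z) ;; assoc B Y X Z ;; (ident B Y \<oplus> symm B X Z)"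


section \<open>Preordered cartesian bicategories\<close>

record ('o, 'a) pcb = "('o, 'a) smcat" +
  le :: "'a \<Rightarrow> 'a \<Rightarrow> bool" (infix "\<sqsubseteq>\<index>" 50)
  mu :: "'o \<Rightarrow> 'a"
  eta :: "'o \<Rightarrow> 'a"
  delta :: "'o \<Rightarrow> 'a"
  eps :: "'o \<Rightarrow> 'a"

locale preordered_cartesian_bicategory = symmetric_monoidal_category B
  for B :: "('o, 'a, 'm) pcb_scheme" (structure) +
  assumes le_refl: "\<lbrakk>X \<in> Obj B; Y \<in> Obj B; f \<in> Hom B X Y\<rbrakk> \<Longrightarrow> f \<sqsubseteq> f"
    and le_trans:
      "\<lbrakk>X \<in> Obj B; Y \<in> Obj B; f \<in> Hom B X Y; g \<in> Hom B X Y; h \<in> Hom B X Y;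
        f \<sqsubseteq> g; g \<sqsubseteq> h\<rbrakk> \<Longrightarrow> f \<sqsubseteq> h"
    and seq_mono:
      "\<lbrakk>X \<in> Obj B; Y \<in> Obj B; Z \<in> Obj B; f \<in> Hom B X Y; f' \<in> Hom B X Y;
        g \<in> Hom B Y Z; g' \<in> Hom B Y Z; f \<sqsubseteq> f'; g \<sqsubseteq> g'\<rbrakk> \<Longrightarrow> f ;; g \<sqsubseteq> f' ;; g'"
    and oplus_mono:
      "\<lbrakk>X \<in> Obj B; Y \<in> Obj B; X' \<in> Obj B; Y' \<in> Obj B; f \<in> Hom B X Y; g \<in> Hom B X Y;
        f' \<in> Hom B X' Y'; g' \<in> Hom B X' Y'; f \<sqsubseteq> g; f' \<sqsubseteq> g'\<rbrakk> \<Longrightarrow> f \<oplus> f' \<sqsubseteq> g \<oplus> g'"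
    \<comment> \<open>monoids and comonoids\<close>
    and mu_hom: "X \<in> Obj B \<Longrightarrow> mu B X \<in> Hom B (X \<boxplus> X) X"
    and eta_hom: "X \<in> Obj B \<Longrightarrow> eta B X \<in> Hom B (unit_obj B) X"
    and delta_hom: "X \<in> Obj B \<Longrightarrow> delta B X \<in> Hom B X (X \<boxplus> X)"
    and eps_hom: "X \<in> Obj B \<Longrightarrow> eps B X \<in> Hom B X (unit_obj B)"
    and mu_assoc:
      "X \<in> Obj B \<Longrightarrow>
       (mu B X \<oplus> ident B X) ;; mu B X = assoc B X X X ;; (ident B X \<oplus> mu B X) ;; mu B X"
    and mu_lunit: "X \<in> Obj B \<Longrightarrow> (eta B X \<oplus> ident B X) ;; mu B X = lunit B X"
    and mu_runit: "X \<in> Obj B \<Longrightarrow> (ident B X \<oplus> eta B X) ;; mu B X = runit B X"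
    and mu_comm: "X \<in> Obj B \<Longrightarrow> symm B X X ;; mu B X = mu B X"
    and delta_assoc:
      "X \<in> Obj B \<Longrightarrow>
       delta B X ;; (delta B X \<oplus> ident B X) ;; assoc B X X X =
       delta B X ;; (ident B X \<oplus> delta B X)"
    and delta_lunit: "X \<in> Obj B \<Longrightarrow> delta B X ;; (eps B X \<oplus> ident B X) ;; lunit B X = ident B X"
    and delta_runit: "X \<in> Obj B \<Longrightarrow> delta B X ;; (ident B X \<oplus> eps B X) ;; runit B X = ident B X"
    and delta_comm: "X \<in> Obj B \<Longrightarrow> delta B X ;; symm B X X = delta B X"
    and frobenius_left:
      "X \<in> Obj B \<Longrightarrow>
       (delta B X \<oplus> ident B X) ;; assoc B X X X ;; (ident B X \<oplus> mu B X) = mu B X ;; delta B X"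
    and frobenius_right:
      "X \<in> Obj B \<Longrightarrow>
       (ident B X \<oplus> delta B X) ;; inverse_of B ((X \<boxplus> X) \<boxplus> X) (X \<boxplus> (X \<boxplus> X)) (assoc B X X X)
         ;; (mu B X \<oplus> ident B X) = mu B X ;; delta B X"
    and special: "X \<in> Obj B \<Longrightarrow> delta B X ;; mu B X = ident B X"
    \<comment> \<open>adjointness\<close>
    and ident_le_eps_eta: "X \<in> Obj B \<Longrightarrow> ident B X \<sqsubseteq> eps B X ;; eta B X"
    and eta_eps_le_ident: "X \<in> Obj B \<Longrightarrow> eta B X ;; eps B X \<sqsubseteq> ident B (unit_obj B)"
    and ident_le_delta_mu: "X \<in> Obj B \<Longrightarrow> ident B X \<sqsubseteq> delta B X ;; mu B X"
    and mu_delta_le_ident: "X \<in> Obj B \<Longrightarrow> mu B X ;; delta B X \<sqsubseteq> ident B (X \<boxplus> X)"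
    \<comment> \<open>every arrow is a lax comonoid homomorphism\<close>
    and lax_delta:
      "\<lbrakk>X \<in> Obj B; Y \<in> Obj B; R \<in> Hom B X Y\<rbrakk>
       \<Longrightarrow> R ;; delta B Y \<sqsubseteq> delta B X ;; (R \<oplus> R)"
    and lax_eps: "\<lbrakk>X \<in> Obj B; Y \<in> Obj B; R \<in> Hom B X Y\<rbrakk> \<Longrightarrow> R ;; eps B Y \<sqsubseteq> eps B X"

text \<open>
  Morphisms are (strong, symmetric) monoidal functors with structure isomorphisms
  \<open>phi X Y : F X \<boxplus> F Y \<rightarrow> F (X \<boxplus> Y)\<close> and \<open>phi0 : I \<rightarrow> F I\<close>; the preservation of monoids and
  comonoids is mediated by these.
\<close>

locale pcb_morphism =
  A: preordered_cartesian_bicategory A + B: preordered_cartesian_bicategory B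
  for A :: "('o, 'a, 'm) pcb_scheme" and B :: "('p, 'b, 'n) pcb_scheme" +
  fixes Fo :: "'o \<Rightarrow> 'p" and Fa :: "'a \<Rightarrow> 'b" and phi :: "'o \<Rightarrow> 'o \<Rightarrow> 'b" and phi0 :: "'b"
  assumes obj_map: "X \<in> Obj A \<Longrightarrow> Fo X \<in> Obj B"
    and hom_map: "\<lbrakk>X \<in> Obj A; Y \<in> Obj A; f \<in> Hom A X Y\<rbrakk> \<Longrightarrow> Fa f \<in> Hom B (Fo X) (Fo Y)"
    and map_ident: "X \<in> Obj A \<Longrightarrow> Fa (ident A X) = ident B (Fo X)"
    and map_seq:
      "\<lbrakk>X \<in> Obj A; Y \<in> Obj A; Z \<in> Obj A; f \<in> Hom A X Y; g \<in> Hom A Y Z\<rbrakk>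
       \<Longrightarrow> Fa (f ;;\<^bsub>A\<^esub> g) = Fa f ;;\<^bsub>B\<^esub> Fa g"
    and phi_iso:
      "\<lbrakk>X \<in> Obj A; Y \<in> Obj A\<rbrakk> \<Longrightarrow> is_iso B (Fo X \<boxplus>\<^bsub>B\<^esub> Fo Y) (Fo (X \<boxplus>\<^bsub>A\<^esub> Y)) (phi X Y)"
    and phi0_iso: "is_iso B (unit_obj B) (Fo (unit_obj A)) phi0"
    and phi_natural:
      "\<lbrakk>X \<in> Obj A; Y \<in> Obj A; X' \<in> Obj A; Y' \<in> Obj A; f \<in> Hom A X Y; f' \<in> Hom A X' Y'\<rbrakk>
       \<Longrightarrow> (Fa f \<oplus>\<^bsub>B\<^esub> Fa f') ;;\<^bsub>B\<^esub> phi Y Y' = phi X X' ;;\<^bsub>B\<^esub> Fa (f \<oplus>\<^bsub>A\<^esub> f')"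
    and phi_assoc:
      "\<lbrakk>X \<in> Obj A; Y \<in> Obj A; Z \<in> Obj A\<rbrakk>
       \<Longrightarrow> (phi X Y \<oplus>\<^bsub>B\<^esub> ident B (Fo Z)) ;;\<^bsub>B\<^esub> phi (X \<boxplus>\<^bsub>A\<^esub> Y) Z ;;\<^bsub>B\<^esub> Fa (assoc A X Y Z) =
           assoc B (Fo X) (Fo Y) (Fo Z) ;;\<^bsub>B\<^esub> (ident B (Fo X) \<oplus>\<^bsub>B\<^esub> phi Y Z)
             ;;\<^bsub>B\<^esub> phi X (Y \<boxplus>\<^bsub>A\<^esub> Z)"
    and phi_lunit:
      "X \<in> Obj A \<Longrightarrow>
       (phi0 \<oplus>\<^bsub>B\<^esub> ident B (Fo X)) ;;\<^bsub>B\<^esub> phi (unit_obj A) X ;;\<^bsub>B\<^esub> Fa (lunit A X) = lunit B (Fo X)"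
    and phi_runit:
      "X \<in> Obj A \<Longrightarrow>
       (ident B (Fo X) \<oplus>\<^bsub>B\<^esub> phi0) ;;\<^bsub>B\<^esub> phi X (unit_obj A) ;;\<^bsub>B\<^esub> Fa (runit A X) = runit B (Fo X)"
    and phi_symm:
      "\<lbrakk>X \<in> Obj A; Y \<in> Obj A\<rbrakk>
       \<Longrightarrow> phi X Y ;;\<^bsub>B\<^esub> Fa (symm A X Y) = symm B (Fo X) (Fo Y) ;;\<^bsub>B\<^esub> phi Y X"
    and map_mono:
      "\<lbrakk>X \<in> Obj A; Y \<in> Obj A; f \<in> Hom A X Y; g \<in> Hom A X Y; f \<sqsubseteq>\<^bsub>A\<^esub> g\<rbrakk>
       \<Longrightarrow> Fa f \<sqsubseteq>\<^bsub>B\<^esub> Fa g"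
    and map_mu: "X \<in> Obj A \<Longrightarrow> phi X X ;;\<^bsub>B\<^esub> Fa (mu A X) = mu B (Fo X)"
    and map_eta: "X \<in> Obj A \<Longrightarrow> phi0 ;;\<^bsub>B\<^esub> Fa (eta A X) = eta B (Fo X)"
    and map_delta: "X \<in> Obj A \<Longrightarrow> Fa (delta A X) = delta B (Fo X) ;;\<^bsub>B\<^esub> phi X X"
    and map_eps: "X \<in> Obj A \<Longrightarrow> Fa (eps A X) = eps B (Fo X) ;;\<^bsub>B\<^esub> phi0"

text \<open>
  The composite of \<open>(Fo, Fa, phi, phi0)\<close> followed by \<open>(Go, Ga, psi, psi0)\<close> is the identity
  monoidal functor of \<open>A\<close>; the last two conjuncts concern its composite structure maps.
\<close>

definition composite_is_identity ::
    "('o, 'a, 'm) pcb_scheme \<Rightarrow> ('o \<Rightarrow> 'p) \<Rightarrow> ('a \<Rightarrow> 'b) \<Rightarrow> ('o \<Rightarrow> 'o \<Rightarrow> 'b) \<Rightarrow> 'b \<Rightarrow>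
     ('p \<Rightarrow> 'o) \<Rightarrow> ('b \<Rightarrow> 'a) \<Rightarrow> ('p \<Rightarrow> 'p \<Rightarrow> 'a) \<Rightarrow> 'a \<Rightarrow> bool" where
  "composite_is_identity A Fo Fa phi phi0 Go Ga psi psi0 \<longleftrightarrow>
     (\<forall>X\<in>Obj A. Go (Fo X) = X) \<and>
     (\<forall>X\<in>Obj A. \<forall>Y\<in>Obj A. \<forall>f\<in>Hom A X Y. Ga (Fa f) = f) \<and>
     (\<forall>X\<in>Obj A. \<forall>Y\<in>Obj A.
        psi (Fo X) (Fo Y) ;;\<^bsub>A\<^esub> Ga (phi X Y) = ident A (X \<boxplus>\<^bsub>A\<^esub> Y)) \<and>
     psi0 ;;\<^bsub>A\<^esub> Ga phi0 = ident A (unit_obj A)"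

definition pcb_isomorphic ::
    "('o, 'a, 'm) pcb_scheme \<Rightarrow> ('p, 'b, 'n) pcb_scheme \<Rightarrow> bool" where
  "pcb_isomorphic A B \<longleftrightarrow>
     (\<exists>Fo Fa phi phi0 Go Ga psi psi0.
        pcb_morphism A B Fo Fa phi phi0 \<and>
        pcb_morphism B A Go Ga psi psi0 \<and>
        composite_is_identity A Fo Fa phi phi0 Go Ga psi psi0 \<and>
        composite_is_identity B Go Ga psi psi0 Fo Fa phi phi0)"


section \<open>Pushouts, coproducts and cospans\<close>

definition is_pushout ::
    "('o, 'a, 'm) cat_scheme \<Rightarrow> 'o \<Rightarrow> 'o \<Rightarrow> 'o \<Rightarrow> 'o \<Rightarrow> 'a \<Rightarrow> 'a \<Rightarrow> 'a \<Rightarrow> 'a \<Rightarrow> bool" where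
  "is_pushout C Y A B D f g i j \<longleftrightarrow>
     {Y, A, B, D} \<subseteq> Obj C \<and>
     f \<in> Hom C Y A \<and> g \<in> Hom C Y B \<and> i \<in> Hom C A D \<and> j \<in> Hom C B D \<and>
     f ;;\<^bsub>C\<^esub> i = g ;;\<^bsub>C\<^esub> j \<and>
     (\<forall>E\<in>Obj C. \<forall>u\<in>Hom C A E. \<forall>v\<in>Hom C B E. f ;;\<^bsub>C\<^esub> u = g ;;\<^bsub>C\<^esub> v \<longrightarrow>
        (\<exists>!h. h \<in> Hom C D E \<and> i ;;\<^bsub>C\<^esub> h = u \<and> j ;;\<^bsub>C\<^esub> h = v))"

definition is_coproduct ::
    "('o, 'a, 'm) cat_scheme \<Rightarrow> 'o \<Rightarrow> 'o \<Rightarrow> 'o \<Rightarrow> 'a \<Rightarrow> 'a \<Rightarrow> bool" where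
  "is_coproduct C A B S i j \<longleftrightarrow>
     {A, B, S} \<subseteq> Obj C \<and> i \<in> Hom C A S \<and> j \<in> Hom C B S \<and>
     (\<forall>E\<in>Obj C. \<forall>u\<in>Hom C A E. \<forall>v\<in>Hom C B E.
        (\<exists>!h. h \<in> Hom C S E \<and> i ;;\<^bsub>C\<^esub> h = u \<and> j ;;\<^bsub>C\<^esub> h = v))"

text \<open>A cospan \<open>X \<rightarrow> A \<leftarrow> Y\<close> is the triple of its left leg, its apex and its right leg.\<close>

type_synonym ('o, 'a) cospan = "'a \<times> 'o \<times> 'a"

definition cospans :: "('o, 'a, 'm) cat_scheme \<Rightarrow> 'o \<Rightarrow> 'o \<Rightarrow> ('o, 'a) cospan set" where
  "cospans C X Y = {(l, A, r). A \<in> Obj C \<and> l \<in> Hom C X A \<and> r \<in> Hom C Y A}"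

definition cospan_morphism ::
    "('o, 'a, 'm) cat_scheme \<Rightarrow> ('o, 'a) cospan \<Rightarrow> ('o, 'a) cospan \<Rightarrow> 'a \<Rightarrow> bool" where
  "cospan_morphism C = (\<lambda>(l, A, r) (l', B, r') h.
     h \<in> Hom C A B \<and> l ;;\<^bsub>C\<^esub> h = l' \<and> r ;;\<^bsub>C\<^esub> h = r')"

definition cospan_rel ::
    "('o, 'a, 'm) cat_scheme \<Rightarrow> 'o \<Rightarrow> 'o \<Rightarrow> ('o, 'a) cospan rel" where
  "cospan_rel C X Y =
     {(c, d). c \<in> cospans C X Y \<and> d \<in> cospans C X Y \<and>
        (\<exists>h. cospan_morphism C c d h \<and> is_iso C (fst (snd c)) (fst (snd d)) h)}"

definition cospan_class ::
    "('o, 'a, 'm) cat_scheme \<Rightarrow> 'o \<Rightarrow> 'o \<Rightarrow> ('o, 'a) cospan \<Rightarrow> ('o, 'a) cospan set" where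
  "cospan_class C X Y c = cospan_rel C X Y `` {c}"

text \<open>
  Pushouts (and coproducts) are determined up to isomorphism only, so collecting the composites
  obtained from all representatives and all pushouts yields precisely one isomorphism class.
\<close>

definition cospan_seq ::
    "('o, 'a, 'm) cat_scheme \<Rightarrow> ('o, 'a) cospan set \<Rightarrow> ('o, 'a) cospan set \<Rightarrow>
     ('o, 'a) cospan set" where
  "cospan_seq C P Q =
     {(l ;;\<^bsub>C\<^esub> i, D, r' ;;\<^bsub>C\<^esub> j) | l A r l' B r' Y D i j.
        (l, A, r) \<in> P \<and> (l', B, r') \<in> Q \<and> is_pushout C Y A B D r l' i j}"

text \<open>The order is opposite to the direction of cospan morphisms.\<close>

definition cospan_le ::
    "('o, 'a, 'm) cat_scheme \<Rightarrow> ('o, 'a) cospan set \<Rightarrow> ('o, 'a) cospan set \<Rightarrow> bool" where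
  "cospan_le C P Q \<longleftrightarrow> (\<exists>c\<in>P. \<exists>d\<in>Q. \<exists>h. cospan_morphism C d c h)"

definition right_way :: "('o, 'a, 'm) cat_scheme \<Rightarrow> 'o \<Rightarrow> 'o \<Rightarrow> 'a \<Rightarrow> ('o, 'a) cospan set" where
  "right_way C X Y f = cospan_class C X Y (f, Y, ident C Y)"

definition wrong_way :: "('o, 'a, 'm) cat_scheme \<Rightarrow> 'o \<Rightarrow> 'o \<Rightarrow> 'a \<Rightarrow> ('o, 'a) cospan set" where
  "wrong_way C X Y f = cospan_class C Y X (ident C Y, Y, f)"

text \<open>
  A family of objects \<open>ob i\<close>, indexed by a type, together with an initial object and a choice of
  binary coproducts inside the family.
\<close>

record ('i, 'o, 'a) sums =
  ob :: "'i \<Rightarrow> 'o"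
  zero :: "'i"
  plus :: "'i \<Rightarrow> 'i \<Rightarrow> 'i"
  inl :: "'i \<Rightarrow> 'i \<Rightarrow> 'a"
  inr :: "'i \<Rightarrow> 'i \<Rightarrow> 'a"

definition from_zero :: "('o, 'a, 'm) cat_scheme \<Rightarrow> ('i, 'o, 'a) sums \<Rightarrow> 'o \<Rightarrow> 'a" where
  "from_zero C S E = (THE h. h \<in> Hom C (ob S (zero S)) E)"

definition copair ::
    "('o, 'a, 'm) cat_scheme \<Rightarrow> ('i, 'o, 'a) sums \<Rightarrow> 'i \<Rightarrow> 'i \<Rightarrow> 'o \<Rightarrow> 'a \<Rightarrow> 'a \<Rightarrow> 'a" where
  "copair C S x y E u v =
     (THE h. h \<in> Hom C (ob S (plus S x y)) E \<and> inl S x y ;;\<^bsub>C\<^esub> h = u \<and> inr S x y ;;\<^bsub>C\<^esub> h = v)"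

definition cospan_oplus ::
    "('o, 'a, 'm) cat_scheme \<Rightarrow> ('i, 'o, 'a) sums \<Rightarrow>
     ('o, 'a) cospan set \<Rightarrow> ('o, 'a) cospan set \<Rightarrow> ('o, 'a) cospan set" where
  "cospan_oplus C S P Q =
     {(copair C S x x' D (l ;;\<^bsub>C\<^esub> i) (l' ;;\<^bsub>C\<^esub> j), D, copair C S y y' D (r ;;\<^bsub>C\<^esub> i) (r' ;;\<^bsub>C\<^esub> j))
      | x y x' y' l A r l' B r' D i j.
        (l, A, r) \<in> P \<and> (l, A, r) \<in> cospans C (ob S x) (ob S y) \<and>
        (l', B, r') \<in> Q \<and> (l', B, r') \<in> cospans C (ob S x') (ob S y') \<and>
        is_coproduct C A B D i j}"

text \<open>
  The full subcategory of the preordered category of cospans in \<open>C\<close> on the objects \<open>ob S x\<close>. Its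
  coherence isomorphisms are the canonical maps between coproducts, viewed as cospans.
\<close>

definition Cospan ::
    "('o, 'a, 'm) cat_scheme \<Rightarrow> ('i, 'o, 'a) sums \<Rightarrow> ('i, ('o, 'a) cospan set) pcb" where
  "Cospan C S = \<lparr>
     Obj = UNIV,
     Hom = (\<lambda>x y. cospans C (ob S x) (ob S y) // cospan_rel C (ob S x) (ob S y)),
     ident = (\<lambda>x. right_way C (ob S x) (ob S x) (ident C (ob S x))),
     seq = cospan_seq C,
     oplus_obj = plus S,
     oplus = cospan_oplus C S,
     unit_obj = zero S,
     assoc = (\<lambda>x y z.
       let E = ob S (plus S x (plus S y z)) in
       right_way C (ob S (plus S (plus S x y) z)) E
         (copair C S (plus S x y) z E
            (copair C S x y E (inl S x (plus S y z)) (inl S y z ;;\<^bsub>C\<^esub> inr S x (plus S y z)))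
            (inr S y z ;;\<^bsub>C\<^esub> inr S x (plus S y z)))),
     lunit = (\<lambda>x. right_way C (ob S (plus S (zero S) x)) (ob S x)
       (copair C S (zero S) x (ob S x) (from_zero C S (ob S x)) (ident C (ob S x)))),
     runit = (\<lambda>x. right_way C (ob S (plus S x (zero S))) (ob S x)
       (copair C S x (zero S) (ob S x) (ident C (ob S x)) (from_zero C S (ob S x)))),
     symm = (\<lambda>x y. right_way C (ob S (plus S x y)) (ob S (plus S y x))
       (copair C S x y (ob S (plus S y x)) (inr S y x) (inl S y x))),
     le = cospan_le C,
     mu = (\<lambda>x. right_way C (ob S (plus S x x)) (ob S x)
       (copair C S x x (ob S x) (ident C (ob S x)) (ident C (ob S x)))),
     eta = (\<lambda>x. right_way C (ob S (zero S)) (ob S x) (from_zero C S (ob S x))),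
     delta = (\<lambda>x. wrong_way C (ob S (plus S x x)) (ob S x)
       (copair C S x x (ob S x) (ident C (ob S x)) (ident C (ob S x)))),
     eps = (\<lambda>x. wrong_way C (ob S (zero S)) (ob S x) (from_zero C S (ob S x))) \<rparr>"


section \<open>Monoidal signatures and hypergraphs\<close>

record 's msig =
  symbols :: "'s set"
  ar :: "'s \<Rightarrow> nat"
  coar :: "'s \<Rightarrow> nat"

text \<open>
  Tuples are lists of the appropriate length. Vertices and (for each symbol) edges are natural
  numbers: this is no restriction for finite hypergraphs up to isomorphism. Outside the symbols
  of the signature there are no edges, and functions are extensional.
\<close>

record 's hypergraph =
  verts :: "nat set"
  edges :: "'s \<Rightarrow> nat set"
  src :: "'s \<Rightarrow> nat \<Rightarrow> nat list"
  tgt :: "'s \<Rightarrow> nat \<Rightarrow> nat list"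

definition tuples :: "'v set \<Rightarrow> nat \<Rightarrow> 'v list set" where
  "tuples V n = {vs. set vs \<subseteq> V \<and> length vs = n}"

text \<open>
  Finiteness means that there are finitely many vertices and finitely many edges in total. For an
  infinite signature, requiring only that each single set of edges be finite would admit apexes with
  infinitely many edges, while a term mentions only finitely many symbols. For a finite signature
  the two readings agree.
\<close>

definition hypergraph :: "'s msig \<Rightarrow> 's hypergraph \<Rightarrow> bool" where
  "hypergraph \<Sigma> G \<longleftrightarrow>
     (\<forall>R. R \<notin> symbols \<Sigma> \<longrightarrow> edges G R = {}) \<and>
     (\<forall>R. src G R \<in> edges G R \<rightarrow>\<^sub>E tuples (verts G) (ar \<Sigma> R)) \<and>
     (\<forall>R. tgt G R \<in> edges G R \<rightarrow>\<^sub>E tuples (verts G) (coar \<Sigma> R))"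

definition finite_hypergraph :: "'s msig \<Rightarrow> 's hypergraph \<Rightarrow> bool" where
  "finite_hypergraph \<Sigma> G \<longleftrightarrow>
     hypergraph \<Sigma> G \<and> finite (verts G) \<and> finite (Sigma (symbols \<Sigma>) (edges G))"

record 's hyper_mor =
  source :: "'s hypergraph"
  target :: "'s hypergraph"
  vmap :: "nat \<Rightarrow> nat"
  emap :: "'s \<Rightarrow> nat \<Rightarrow> nat"

definition hyper_hom :: "'s hypergraph \<Rightarrow> 's hypergraph \<Rightarrow> 's hyper_mor set" where
  "hyper_hom G H =
     {f. source f = G \<and> target f = H \<and>
         vmap f \<in> verts G \<rightarrow>\<^sub>E verts H \<and>
         (\<forall>R. emap f R \<in> edges G R \<rightarrow>\<^sub>E edges H R) \<and>
         (\<forall>R. \<forall>e\<in>edges G R. src H R (emap f R e) = map (vmap f) (src G R e) \<and>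
                            tgt H R (emap f R e) = map (vmap f) (tgt G R e))}"

definition Hyp :: "'s msig \<Rightarrow> ('s hypergraph, 's hyper_mor) cat" where
  "Hyp \<Sigma> = \<lparr>
     Obj = {G. finite_hypergraph \<Sigma> G},
     Hom = hyper_hom,
     ident = (\<lambda>G. \<lparr> source = G, target = G,
       vmap = (\<lambda>v\<in>verts G. v), emap = (\<lambda>R. \<lambda>e\<in>edges G R. e) \<rparr>),
     seq = (\<lambda>f g. \<lparr> source = source f, target = target g,
       vmap = (\<lambda>v\<in>verts (source f). vmap g (vmap f v)),
       emap = (\<lambda>R. \<lambda>e\<in>edges (source f) R. emap g R (emap f R e)) \<rparr>) \<rparr>"

definition disc :: "nat \<Rightarrow> 's hypergraph" where
  "disc n = \<lparr> verts = {0..<n}, edges = (\<lambda>R. {}),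
     src = (\<lambda>R e. undefined), tgt = (\<lambda>R e. undefined) \<rparr>"

definition disc_mor :: "nat \<Rightarrow> nat \<Rightarrow> (nat \<Rightarrow> nat) \<Rightarrow> 's hyper_mor" where
  "disc_mor n m f = \<lparr> source = disc n, target = disc m,
     vmap = restrict f {0..<n}, emap = (\<lambda>R e. undefined) \<rparr>"

definition ordinals :: "(nat, 's hypergraph, 's hyper_mor) sums" where
  "ordinals = \<lparr> ob = disc, zero = 0, plus = (+),
     inl = (\<lambda>n m. disc_mor n (n + m) (\<lambda>v. v)),
     inr = (\<lambda>n m. disc_mor m (n + m) (\<lambda>v. n + v)) \<rparr>"

definition DiscCospan ::
    "'s msig \<Rightarrow> (nat, ('s hypergraph, 's hyper_mor) cospan set) pcb" where
  "DiscCospan \<Sigma> = Cospan (Hyp \<Sigma>) ordinals"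


section \<open>GCQ terms and the prop they generate\<close>

datatype 's gcq =
    Copy | Discard | Merge | New | Id0 | Id1 | Swap
  | Sym 's
  | Seq "'s gcq" "'s gcq" (infixl "\<triangleright>" 65)
  | Par "'s gcq" "'s gcq" (infixr "\<otimes>" 70)

inductive has_sort :: "'s msig \<Rightarrow> 's gcq \<Rightarrow> nat \<Rightarrow> nat \<Rightarrow> bool" for \<Sigma> where
  "has_sort \<Sigma> Copy 1 2"
| "has_sort \<Sigma> Discard 1 0"
| "has_sort \<Sigma> Merge 2 1"
| "has_sort \<Sigma> New 0 1"
| "has_sort \<Sigma> Id0 0 0"
| "has_sort \<Sigma> Id1 1 1"
| "has_sort \<Sigma> Swap 2 2"
| "R \<in> symbols \<Sigma> \<Longrightarrow> has_sort \<Sigma> (Sym R) (ar \<Sigma> R) (coar \<Sigma> R)"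
| "\<lbrakk>has_sort \<Sigma> c n z; has_sort \<Sigma> d z m\<rbrakk> \<Longrightarrow> has_sort \<Sigma> (c \<triangleright> d) n m"
| "\<lbrakk>has_sort \<Sigma> c n m; has_sort \<Sigma> d p q\<rbrakk> \<Longrightarrow> has_sort \<Sigma> (c \<otimes> d) (n + p) (m + q)"

fun idn :: "nat \<Rightarrow> 's gcq" where
  "idn 0 = Id0"
| "idn (Suc n) = Id1 \<otimes> idn n"

text \<open>\<open>swap1 m\<close> is the symmetry of sort \<open>(1 + m, m + 1)\<close>, \<open>swap n m\<close> that of sort \<open>(n + m, m + n)\<close>.\<close>

fun swap1 :: "nat \<Rightarrow> 's gcq" where
  "swap1 0 = Id1"
| "swap1 (Suc m) = (Swap \<otimes> idn m) \<triangleright> (Id1 \<otimes> swap1 m)"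

fun swap :: "nat \<Rightarrow> nat \<Rightarrow> 's gcq" where
  "swap 0 m = idn m"
| "swap (Suc n) m = (Id1 \<otimes> swap n m) \<triangleright> (swap1 m \<otimes> idn n)"

fun discard :: "nat \<Rightarrow> 's gcq" where
  "discard 0 = Id0"
| "discard (Suc n) = Discard \<otimes> discard n"

fun copy :: "nat \<Rightarrow> 's gcq" where
  "copy 0 = Id0"
| "copy (Suc n) = (Copy \<otimes> copy n) \<triangleright> (Id1 \<otimes> swap 1 n \<otimes> idn n)"

text \<open>The monoid structure on \<open>n\<close> is the mirror image of the comonoid structure.\<close>

fun new :: "nat \<Rightarrow> 's gcq" where
  "new 0 = Id0"
| "new (Suc n) = New \<otimes> new n"

fun merge :: "nat \<Rightarrow> 's gcq" where
  "merge 0 = Id0"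
| "merge (Suc n) = (Id1 \<otimes> swap n 1 \<otimes> idn n) \<triangleright> (Merge \<otimes> merge n)"

inductive axE :: "'s msig \<Rightarrow> nat \<Rightarrow> nat \<Rightarrow> 's gcq \<Rightarrow> 's gcq \<Rightarrow> bool" for \<Sigma> where
  \<comment> \<open>strict symmetric monoidal categories\<close>
  "\<lbrakk>has_sort \<Sigma> c n x; has_sort \<Sigma> d x y; has_sort \<Sigma> e y m\<rbrakk>
   \<Longrightarrow> axE \<Sigma> n m ((c \<triangleright> d) \<triangleright> e) (c \<triangleright> (d \<triangleright> e))"
| "has_sort \<Sigma> c n m \<Longrightarrow> axE \<Sigma> n m (idn n \<triangleright> c) c"
| "has_sort \<Sigma> c n m \<Longrightarrow> axE \<Sigma> n m (c \<triangleright> idn m) c"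
| "\<lbrakk>has_sort \<Sigma> c n m; has_sort \<Sigma> d p q; has_sort \<Sigma> e x y\<rbrakk>
   \<Longrightarrow> axE \<Sigma> (n + p + x) (m + q + y) ((c \<otimes> d) \<otimes> e) (c \<otimes> (d \<otimes> e))"
| "has_sort \<Sigma> c n m \<Longrightarrow> axE \<Sigma> n m (Id0 \<otimes> c) c"
| "has_sort \<Sigma> c n m \<Longrightarrow> axE \<Sigma> n m (c \<otimes> Id0) c"
| "\<lbrakk>has_sort \<Sigma> c n x; has_sort \<Sigma> d x m; has_sort \<Sigma> c' p y; has_sort \<Sigma> d' y q\<rbrakk>
   \<Longrightarrow> axE \<Sigma> (n + p) (m + q) ((c \<triangleright> d) \<otimes> (c' \<triangleright> d')) ((c \<otimes> c') \<triangleright> (d \<otimes> d'))"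
| "axE \<Sigma> (n + m) (n + m) (idn n \<otimes> idn m) (idn (n + m))"
| "\<lbrakk>has_sort \<Sigma> c n m; has_sort \<Sigma> d p q\<rbrakk>
   \<Longrightarrow> axE \<Sigma> (n + p) (q + m) ((c \<otimes> d) \<triangleright> swap m q) (swap n p \<triangleright> (d \<otimes> c))"
| "axE \<Sigma> (n + m) (n + m) (swap n m \<triangleright> swap m n) (idn (n + m))"
| "axE \<Sigma> (n + m + p) (m + p + n)
     (swap n (m + p)) ((swap n m \<otimes> idn p) \<triangleright> (idn m \<otimes> swap n p))"
  \<comment> \<open>commutative comonoid\<close>
| "axE \<Sigma> 1 3 (Copy \<triangleright> (Copy \<otimes> Id1)) (Copy \<triangleright> (Id1 \<otimes> Copy))"
| "axE \<Sigma> 1 1 (Copy \<triangleright> (Discard \<otimes> Id1)) Id1"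
| "axE \<Sigma> 1 2 (Copy \<triangleright> Swap) Copy"
  \<comment> \<open>commutative monoid\<close>
| "axE \<Sigma> 3 1 ((Merge \<otimes> Id1) \<triangleright> Merge) ((Id1 \<otimes> Merge) \<triangleright> Merge)"
| "axE \<Sigma> 1 1 ((New \<otimes> Id1) \<triangleright> Merge) Id1"
| "axE \<Sigma> 2 1 (Swap \<triangleright> Merge) Merge"
  \<comment> \<open>Frobenius and speciality\<close>
| "axE \<Sigma> 2 2 ((Copy \<otimes> Id1) \<triangleright> (Id1 \<otimes> Merge)) (Merge \<triangleright> Copy)"
| "axE \<Sigma> 2 2 (Merge \<triangleright> Copy) ((Id1 \<otimes> Copy) \<triangleright> (Merge \<otimes> Id1))"
| "axE \<Sigma> 1 1 (Copy \<triangleright> Merge) Id1"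

inductive axI :: "'s msig \<Rightarrow> nat \<Rightarrow> nat \<Rightarrow> 's gcq \<Rightarrow> 's gcq \<Rightarrow> bool" for \<Sigma> where
  "axI \<Sigma> 1 1 Id1 (Discard \<triangleright> New)"
| "axI \<Sigma> 0 0 (New \<triangleright> Discard) Id0"
| "axI \<Sigma> 1 1 Id1 (Copy \<triangleright> Merge)"
| "axI \<Sigma> 2 2 (Merge \<triangleright> Copy) (idn 2)"
| "R \<in> symbols \<Sigma> \<Longrightarrow>
   axI \<Sigma> (ar \<Sigma> R) (2 * coar \<Sigma> R)
     (Sym R \<triangleright> copy (coar \<Sigma> R)) (copy (ar \<Sigma> R) \<triangleright> (Sym R \<otimes> Sym R))"
| "R \<in> symbols \<Sigma> \<Longrightarrow> axI \<Sigma> (ar \<Sigma> R) 0 (Sym R \<triangleright> discard (coar \<Sigma> R)) (discard (ar \<Sigma> R))"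

text \<open>\<open>gcq_eq \<Sigma> n m\<close> and \<open>gcq_le \<Sigma> n m\<close> relate terms of sort \<open>(n, m)\<close> only.\<close>

inductive gcq_eq :: "'s msig \<Rightarrow> nat \<Rightarrow> nat \<Rightarrow> 's gcq \<Rightarrow> 's gcq \<Rightarrow> bool" for \<Sigma> where
  "axE \<Sigma> n m c d \<Longrightarrow> gcq_eq \<Sigma> n m c d"
| "has_sort \<Sigma> c n m \<Longrightarrow> gcq_eq \<Sigma> n m c c"
| "gcq_eq \<Sigma> n m c d \<Longrightarrow> gcq_eq \<Sigma> n m d c"
| "\<lbrakk>gcq_eq \<Sigma> n m c d; gcq_eq \<Sigma> n m d e\<rbrakk> \<Longrightarrow> gcq_eq \<Sigma> n m c e"
| "\<lbrakk>gcq_eq \<Sigma> n z c c'; gcq_eq \<Sigma> z m d d'\<rbrakk> \<Longrightarrow> gcq_eq \<Sigma> n m (c \<triangleright> d) (c' \<triangleright> d')"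
| "\<lbrakk>gcq_eq \<Sigma> n m c c'; gcq_eq \<Sigma> p q d d'\<rbrakk> \<Longrightarrow> gcq_eq \<Sigma> (n + p) (m + q) (c \<otimes> d) (c' \<otimes> d')"

inductive gcq_le :: "'s msig \<Rightarrow> nat \<Rightarrow> nat \<Rightarrow> 's gcq \<Rightarrow> 's gcq \<Rightarrow> bool" for \<Sigma> where
  "axI \<Sigma> n m c d \<Longrightarrow> gcq_le \<Sigma> n m c d"
| "gcq_eq \<Sigma> n m c d \<Longrightarrow> gcq_le \<Sigma> n m c d"
| "\<lbrakk>gcq_le \<Sigma> n m c d; gcq_le \<Sigma> n m d e\<rbrakk> \<Longrightarrow> gcq_le \<Sigma> n m c e"
| "\<lbrakk>gcq_le \<Sigma> n z c c'; gcq_le \<Sigma> z m d d'\<rbrakk> \<Longrightarrow> gcq_le \<Sigma> n m (c \<triangleright> d) (c' \<triangleright> d')"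
| "\<lbrakk>gcq_le \<Sigma> n m c c'; gcq_le \<Sigma> p q d d'\<rbrakk> \<Longrightarrow> gcq_le \<Sigma> (n + p) (m + q) (c \<otimes> d) (c' \<otimes> d')"

definition gcq_class :: "'s msig \<Rightarrow> nat \<Rightarrow> nat \<Rightarrow> 's gcq \<Rightarrow> 's gcq set" where
  "gcq_class \<Sigma> n m c = {d. gcq_eq \<Sigma> n m c d}"

text \<open>
  The arrows of sort \<open>(n, m)\<close> are the congruence classes of terms of that sort; operations and
  order are those induced on classes by the ones on terms. Since the prop is strict, the
  associators and unitors are identities.
\<close>

definition CB :: "'s msig \<Rightarrow> (nat, 's gcq set) pcb" where
  "CB \<Sigma> = \<lparr>
     Obj = UNIV,
     Hom = (\<lambda>n m. {gcq_class \<Sigma> n m c | c. has_sort \<Sigma> c n m}),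
     ident = (\<lambda>n. gcq_class \<Sigma> n n (idn n)),
     seq = (\<lambda>P Q. {t. \<exists>c\<in>P. \<exists>d\<in>Q. \<exists>n m. gcq_eq \<Sigma> n m (c \<triangleright> d) t}),
     oplus_obj = (+),
     oplus = (\<lambda>P Q. {t. \<exists>c\<in>P. \<exists>d\<in>Q. \<exists>n m. gcq_eq \<Sigma> n m (c \<otimes> d) t}),
     unit_obj = 0,
     assoc = (\<lambda>n m p. gcq_class \<Sigma> (n + m + p) (n + m + p) (idn (n + m + p))),
     lunit = (\<lambda>n. gcq_class \<Sigma> n n (idn n)),
     runit = (\<lambda>n. gcq_class \<Sigma> n n (idn n)),
     symm = (\<lambda>n m. gcq_class \<Sigma> (n + m) (m + n) (swap n m)),
     le = (\<lambda>P Q. \<exists>c\<in>P. \<exists>d\<in>Q. \<exists>n m. gcq_le \<Sigma> n m c d),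
     mu = (\<lambda>n. gcq_class \<Sigma> (2 * n) n (merge n)),
     eta = (\<lambda>n. gcq_class \<Sigma> 0 n (new n)),
     delta = (\<lambda>n. gcq_class \<Sigma> n (2 * n) (copy n)),
     eps = (\<lambda>n. gcq_class \<Sigma> n 0 (discard n)) \<rparr>"

end

theory Submission imports Defs "HOL-Library.Multiset"
begin

text \<open>
  Both preordered categories are embedded into one and the same model. There, an arrow from \<open>n\<close> to
  \<open>m\<close> assigns to every finite hypergraph \<open>H\<close> a matrix of natural numbers, indexed by \<open>n\<close>-tuples and
  \<open>m\<close>-tuples of vertices of \<open>H\<close>; the operations are the matrix product and the Kronecker product, and
  the order is inclusion of supports.

  A cospan is sent to the numbers of those morphisms from its apex to \<open>H\<close> which map the two legs to
  the given tuples. The universal property of pushouts turns composition into the matrix product.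
  By Lovasz's theorem the counts determine the cospan up to isomorphism, and the supports at the
  apex itself detect the cospan morphisms out of another cospan.

  A term is evaluated by sending \<open>R\<close> to the numbers of \<open>R\<close>-edges from \<open>a\<close> to \<open>b\<close>. Modulo the equations,
  every term is a conjunctive query (equations and atoms in \<open>n + k\<close> variables, \<open>k\<close> of them
  existential), which presents a cospan with the same matrix, and all cospans arise in this way up
  to isomorphism. Isomorphisms and morphisms of the presented cospans translate into substitutions
  of variables, which prove the queries equal or comparable. So both embeddings are full onto the
  same image.
\<close>


section \<open>Strict props\<close>

locale strict_prop =
  fixes V :: "'a \<Rightarrow> bool" and dm cd :: "'a \<Rightarrow> nat"
    and sq :: "'a \<Rightarrow> 'a \<Rightarrow> 'a" (infixr "\<cdot>" 65)
    and pr :: "'a \<Rightarrow> 'a \<Rightarrow> 'a" (infixr "\<odot>" 70)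
    and I :: "nat \<Rightarrow> 'a" and sw :: "nat \<Rightarrow> nat \<Rightarrow> 'a"
  assumes V_sq [simp]: "\<lbrakk>V f; V g; cd f = dm g\<rbrakk> \<Longrightarrow> V (f \<cdot> g)"
    and dm_sq [simp]: "\<lbrakk>V f; V g; cd f = dm g\<rbrakk> \<Longrightarrow> dm (f \<cdot> g) = dm f"
    and cd_sq [simp]: "\<lbrakk>V f; V g; cd f = dm g\<rbrakk> \<Longrightarrow> cd (f \<cdot> g) = cd g"
    and V_pr [simp]: "\<lbrakk>V f; V g\<rbrakk> \<Longrightarrow> V (f \<odot> g)"
    and dm_pr [simp]: "\<lbrakk>V f; V g\<rbrakk> \<Longrightarrow> dm (f \<odot> g) = dm f + dm g"
    and cd_pr [simp]: "\<lbrakk>V f; V g\<rbrakk> \<Longrightarrow> cd (f \<odot> g) = cd f + cd g"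
    and V_I [simp]: "V (I n)" and dm_I [simp]: "dm (I n) = n" and cd_I [simp]: "cd (I n) = n"
    and V_sw [simp]: "V (sw n m)" and dm_sw [simp]: "dm (sw n m) = n + m"
    and cd_sw [simp]: "cd (sw n m) = m + n"
    and sq_assoc: "\<lbrakk>V f; V g; V h; cd f = dm g; cd g = dm h\<rbrakk> \<Longrightarrow> (f \<cdot> g) \<cdot> h = f \<cdot> (g \<cdot> h)"
    and I_sq: "V f \<Longrightarrow> dm f = n \<Longrightarrow> I n \<cdot> f = f"
    and sq_I: "V f \<Longrightarrow> cd f = n \<Longrightarrow> f \<cdot> I n = f"
    and pr_assoc: "\<lbrakk>V f; V g; V h\<rbrakk> \<Longrightarrow> (f \<odot> g) \<odot> h = f \<odot> (g \<odot> h)"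
    and I0_pr: "V f \<Longrightarrow> I 0 \<odot> f = f"
    and pr_I0: "V f \<Longrightarrow> f \<odot> I 0 = f"
    and interchange: "\<lbrakk>V f; V g; V f'; V g'; cd f = dm g; cd f' = dm g'\<rbrakk>
       \<Longrightarrow> (f \<cdot> g) \<odot> (f' \<cdot> g') = (f \<odot> f') \<cdot> (g \<odot> g')"
    and I_pr_I: "I n \<odot> I m = I (n + m)"
    and sw_natural: "\<lbrakk>V f; V g; cd f = n; cd g = m\<rbrakk> \<Longrightarrow>
        (f \<odot> g) \<cdot> sw n m = sw (dm f) (dm g) \<cdot> (g \<odot> f)"
    and sw_sw: "sw n m \<cdot> sw m n = I (n + m)"
    and sw_add_right: "sw n (m + p) = (sw n m \<odot> I p) \<cdot> (I m \<odot> sw n p)"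
begin

definition L :: "nat \<Rightarrow> 'a \<Rightarrow> nat \<Rightarrow> 'a" where
  "L a f b = I a \<odot> f \<odot> I b"

lemma V_L [simp]: "V f \<Longrightarrow> V (L a f b)"
  and dm_L [simp]: "V f \<Longrightarrow> dm (L a f b) = a + dm f + b"
  and cd_L [simp]: "V f \<Longrightarrow> cd (L a f b) = a + cd f + b"
  by (simp_all add: L_def)

lemma L_00: "V f \<Longrightarrow> L 0 f 0 = f"
  by (simp add: L_def I0_pr pr_I0)

lemma L_I: "L a (I n) b = I (a + n + b)"
  by (simp add: L_def I_pr_I add.assoc)

lemma pr_I_assoc: "V f \<Longrightarrow> I a \<odot> I b \<odot> f = I (a + b) \<odot> f"
  by (simp add: pr_assoc [symmetric] I_pr_I)

lemma L_L: "V f \<Longrightarrow> L a (L c f d) b = L (a + c) f (d + b)"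
  by (simp add: L_def pr_assoc I_pr_I pr_I_assoc)

lemma L_pr_left: "V f \<Longrightarrow> I a \<odot> f = L a f 0"
  by (simp add: L_def pr_I0)

lemma L_pr_right: "V f \<Longrightarrow> f \<odot> I b = L 0 f b"
  by (simp add: L_def I0_pr)

lemma pr_sq_left: "\<lbrakk>V f; V g; V h; cd f = dm g\<rbrakk> \<Longrightarrow> (f \<cdot> g) \<odot> h = (f \<odot> h) \<cdot> (g \<odot> I (cd h))"
  using interchange [of f g h "I (cd h)"] by (simp add: sq_I)

lemma pr_sq_right: "\<lbrakk>V f; V g; V h; cd f = dm g\<rbrakk> \<Longrightarrow> h \<odot> (f \<cdot> g) = (h \<odot> f) \<cdot> (I (cd h) \<odot> g)"
  using interchange [of h "I (cd h)" f g] by (simp add: sq_I)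

lemma I_pr_sq: "\<lbrakk>V f; V g; cd f = dm g\<rbrakk> \<Longrightarrow> I n \<odot> (f \<cdot> g) = (I n \<odot> f) \<cdot> (I n \<odot> g)"
  by (simp add: pr_sq_right)

lemma sq_pr_I: "\<lbrakk>V f; V g; cd f = dm g\<rbrakk> \<Longrightarrow> (f \<cdot> g) \<odot> I n = (f \<odot> I n) \<cdot> (g \<odot> I n)"
  by (simp add: pr_sq_left)

lemma L_sq: "\<lbrakk>V f; V g; cd f = dm g\<rbrakk> \<Longrightarrow> L a (f \<cdot> g) b = L a f b \<cdot> L a g b"
  by (simp add: L_def I_pr_sq sq_pr_I)

lemma pr_eq_sq: "\<lbrakk>V f; V g\<rbrakk> \<Longrightarrow> f \<odot> g = (f \<odot> I (dm g)) \<cdot> (I (cd f) \<odot> g)"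
  using interchange [of f "I (cd f)" "I (dm g)" g] by (simp add: sq_I I_sq)

lemma pr_eq_sq': "\<lbrakk>V f; V g\<rbrakk> \<Longrightarrow> f \<odot> g = (I (dm f) \<odot> g) \<cdot> (f \<odot> I (cd g))"
  using interchange [of "I (dm f)" f g "I (cd g)"] by (simp add: sq_I I_sq)

lemma pr_L: "\<lbrakk>V f; V g\<rbrakk> \<Longrightarrow> f \<odot> g = L 0 f (dm g) \<cdot> L (cd f) g 0"
  by (simp add: pr_eq_sq [of f g] L_pr_left L_pr_right)

lemma L_exchange:
  assumes "V f" "V g"
  shows "L (a + dm f + b) g c \<cdot> L a f (b + cd g + c) = L a f (b + dm g + c) \<cdot> L (a + cd f + b) g c"
proof -
  have "f \<odot> (I b \<odot> g) = (I (dm f) \<odot> I b \<odot> g) \<cdot> (f \<odot> I (b + cd g))"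
    "f \<odot> (I b \<odot> g) = (f \<odot> I (b + dm g)) \<cdot> (I (cd f) \<odot> I b \<odot> g)"
    using assms pr_eq_sq' [of f "I b \<odot> g"] pr_eq_sq [of f "I b \<odot> g"] by simp_all
  then have "L (dm f + b) g 0 \<cdot> L 0 f (b + cd g) = L 0 f (b + dm g) \<cdot> L (cd f + b) g 0"
    using assms by (simp add: L_pr_left L_pr_right L_L)
  then have "L a (L (dm f + b) g 0 \<cdot> L 0 f (b + cd g)) c = L a (L 0 f (b + dm g) \<cdot> L (cd f + b) g 0) c"
    by simp
  then show ?thesis
    using assms by (simp add: L_sq L_L add.assoc)
qed

text \<open>Oriented interchange: a layer further to the left is performed first.\<close>

lemma L_sort:
  assumes "V f" "V g" "a + dm f \<le> x" "x + cd g + c = a + dm f + d"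
  shows "L x g c \<cdot> L a f d = L a f (x + dm g + c - (a + dm f)) \<cdot> L (x - dm f + cd f) g c"
proof -
  obtain b where b: "x = a + dm f + b" using assms(3) le_Suc_ex by blast
  then have "d = b + cd g + c" using assms(4) by simp
  then show ?thesis using L_exchange [OF assms(1,2), of a b c] b by (simp add: add.commute add.left_commute)
qed

lemma L_sort_tail:
  assumes "V f" "V g" "V h" "a + dm f \<le> x" "x + cd g + c = a + dm f + d" "dm h = a + cd f + d"
  shows "L x g c \<cdot> (L a f d \<cdot> h) = L a f (x + dm g + c - (a + dm f)) \<cdot> (L (x - dm f + cd f) g c \<cdot> h)"
  using assms L_sort [OF assms(1,2,4,5)]
  by (simp add: sq_assoc [symmetric])

lemma sw_0_right: "sw n 0 = I n"
proof -
  have 1: "sw n 0 = sw n 0 \<cdot> sw n 0"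
    using sw_add_right [of n 0 0] by (simp add: pr_I0 I0_pr)
  then have "sw n 0 \<cdot> sw 0 n = (sw n 0 \<cdot> sw n 0) \<cdot> sw 0 n" by simp
  then show ?thesis using sw_sw [of n 0] by (simp add: sq_assoc sq_I)
qed

lemma sw_0_left: "sw 0 n = I n"
  using sw_sw [of n 0] by (simp add: sw_0_right I_sq)

lemma inverse_unique:
  assumes "V f" "V g" "V h" "cd f = dm g" "cd g = dm h" "dm f = dm h" "g \<cdot> h = I (dm g)" "f \<cdot> g = I (dm f)"
    "cd h = dm g"
  shows "f = h"
proof -
  have "f = f \<cdot> (g \<cdot> h)" using assms by (simp add: sq_I)
  also have "\<dots> = (f \<cdot> g) \<cdot> h" using assms(1-6) by (simp add: sq_assoc)
  also have "\<dots> = h" using assms by (simp add: I_sq)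
  finally show ?thesis .
qed

lemma sw_add_left: "sw (n + m) p = (I n \<odot> sw m p) \<cdot> (sw n p \<odot> I m)"
proof (rule sym, rule inverse_unique [where g = "sw p (n + m)"])
  have [simp]: "L 0 (sw n p) m \<cdot> L 0 (sw p n) m \<cdot> L n (sw p m) 0 = L n (sw p m) 0"
    by (simp add: sq_assoc [symmetric] L_sq [symmetric] sw_sw L_I I_sq)
  show "((I n \<odot> sw m p) \<cdot> (sw n p \<odot> I m)) \<cdot> sw p (n + m) = I (dm ((I n \<odot> sw m p) \<cdot> (sw n p \<odot> I m)))"
    by (simp add: sw_add_right L_pr_left L_pr_right sq_assoc L_sq [symmetric] sw_sw L_I add.assoc add.commute [of p m])
qed (auto simp: sw_sw add_ac)

end


section \<open>Comonoids and selections of wires\<close>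

locale comonoid_prop = strict_prop +
  fixes C E :: 'a
  assumes V_C [simp]: "V C" and dm_C [simp]: "dm C = 1" and cd_C [simp]: "cd C = 2"
    and V_E [simp]: "V E" and dm_E [simp]: "dm E = 1" and cd_E [simp]: "cd E = 0"
    and C_assoc: "C \<cdot> (C \<odot> I 1) = C \<cdot> (I 1 \<odot> C)"
    and C_unit: "C \<cdot> (E \<odot> I 1) = I 1"
    and C_comm: "C \<cdot> sw 1 1 = C"
begin

primrec cp :: "nat \<Rightarrow> 'a" where
  "cp 0 = I 0"
| "cp (Suc n) = (C \<odot> cp n) \<cdot> (I 1 \<odot> sw 1 n \<odot> I n)"

primrec dc :: "nat \<Rightarrow> 'a" where
  "dc 0 = I 0"
| "dc (Suc n) = E \<odot> dc n"

lemma cp_sort [simp]: "V (cp n)" "dm (cp n) = n" "cd (cp n) = n + n"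
  by (induction n) auto

lemma dc_sort [simp]: "V (dc n)" "dm (dc n) = n" "cd (dc n) = 0"
  by (induction n) auto

lemma cp_1: "cp (Suc 0) = C"
  by (simp add: pr_I0 sw_0_right I_pr_I sq_I)

lemma dc_1: "dc (Suc 0) = E"
  by (simp add: pr_I0)

lemma dc_add: "dc (n + m) = dc n \<odot> dc m"
  by (induction n) (simp_all add: I0_pr pr_assoc)

lemma L_sw_sq_L_sw: 
  "L a (sw b c) d \<cdot> L a (sw c b) d = I (a + b + c + d)"
  "\<lbrakk>V f; dm f = a + (b + c) + d\<rbrakk> \<Longrightarrow> L a (sw b c) d \<cdot> L a (sw c b) d \<cdot> f = f"
  by (simp_all add: L_sq [symmetric] sq_assoc [symmetric] sw_sw L_I add_ac I_sq)

lemma pair_comm: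
  assumes f: "V f" "dm f = a" "cd f = a + a" "f \<cdot> sw a a = f"
    and g: "V g" "dm g = b" "cd g = b + b" "g \<cdot> sw b b = g"
  shows "((f \<odot> g) \<cdot> L a (sw a b) b) \<cdot> sw (a + b) (a + b) = (f \<odot> g) \<cdot> L a (sw a b) b"
proof -
  have "L a (sw a b) b \<cdot> sw (a + b) (a + b) = (sw a a \<odot> sw b b) \<cdot> L a (sw a b) b"
    by (simp add: sw_add_right sw_add_left L_pr_left L_pr_right L_sq L_L L_sw_sq_L_sw L_I I_sq sq_I
        sq_assoc pr_L add_ac)
  then have "((f \<odot> g) \<cdot> L a (sw a b) b) \<cdot> sw (a + b) (a + b)
      = ((f \<odot> g) \<cdot> (sw a a \<odot> sw b b)) \<cdot> L a (sw a b) b"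
    using f g by (simp add: sq_assoc)
  then show ?thesis using f g by (simp add: interchange [symmetric])
qed

lemma pair_assoc:
  assumes f: "V f" "dm f = a" "cd f = a + a" "f \<cdot> (f \<odot> I a) = f \<cdot> (I a \<odot> f)"
    and g: "V g" "dm g = b" "cd g = b + b" "g \<cdot> (g \<odot> I b) = g \<cdot> (I b \<odot> g)"
  defines "h \<equiv> (f \<odot> g) \<cdot> L a (sw a b) b"
  shows "h \<cdot> (h \<odot> I (a + b)) = h \<cdot> (I (a + b) \<odot> h)"
proof -
  have nat1: "sw a b \<cdot> L 0 g a = L a g 0 \<cdot> sw a (b + b)"
    using sw_natural [of "I a" g a "b + b"] g by (simp add: L_pr_left L_pr_right)
  have nat2: "sw a b \<cdot> L b f 0 = L 0 f b \<cdot> sw (a + a) b"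
    using sw_natural [of f "I b" "a + a" b] f by (simp add: L_pr_left L_pr_right)
  have "h \<cdot> (h \<odot> I (a + b)) =
     (f \<odot> g) \<cdot> L a (sw a b) b \<cdot> L 0 f (b + a + b) \<cdot> L (a + a) g (a + b) \<cdot> L a (sw a b) (b + a + b)"
    using f(1-3) g(1-3) by (simp add: h_def L_pr_right pr_L L_sq L_L L_I I_sq sq_I sq_assoc add_ac)
  also have "\<dots> = (f \<odot> g) \<cdot> L 0 f (a + b + b) \<cdot> L (a + a) (sw a b \<cdot> L 0 g a) b \<cdot> L a (sw a b) (b + a + b)"
    using f(1-3) g(1-3) by (simp add: L_sort_tail L_sq L_L L_I I_sq sq_I sq_assoc add_ac)
  also have "\<dots> = (f \<odot> g) \<cdot> L 0 f (a + b + b) \<cdot> L (a + a + a) g b \<cdot> L (a + a) (sw a (b + b)) b \<cdot> L a (sw a b) (b + a + b)"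
    unfolding nat1 using f(1-3) g(1-3) by (simp add: L_sq L_L L_I I_sq sq_I sq_assoc add_ac)
  also have "\<dots> = ((f \<cdot> (f \<odot> I a)) \<odot> (g \<cdot> (g \<odot> I b))) \<cdot> L (a + a) (sw a (b + b)) b \<cdot> L a (sw a b) (b + a + b)"
    using f(1-3) g(1-3) by (simp add: pr_L L_sq L_L L_pr_right L_I I_sq sq_I sq_assoc add_ac L_sort_tail)
  finally have 1: "h \<cdot> (h \<odot> I (a + b)) = \<dots>" .
  have "h \<cdot> (I (a + b) \<odot> h) =
     (f \<odot> g) \<cdot> L a (sw a b \<cdot> L b f 0) b \<cdot> L (a + b + a + a) g 0 \<cdot> L (a + b + a) (sw a b) b"
    using f(1-3) g(1-3) by (simp add: h_def L_pr_left pr_L L_sq L_L L_I I_sq sq_I sq_assoc add_ac)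
  also have "\<dots> = (f \<odot> g) \<cdot> L a f (b + b) \<cdot> L (a + a + a + b) g 0 \<cdot> L a (sw (a + a) b) (b + b) \<cdot> L (a + b + a) (sw a b) b"
    unfolding nat2 using f(1-3) g(1-3)
    by (simp add: L_sort_tail L_sq L_L L_I I_sq sq_I sq_assoc add_ac)
  also have "\<dots> = ((f \<cdot> (I a \<odot> f)) \<odot> (g \<cdot> (I b \<odot> g))) \<cdot> L a (sw (a + a) b) (b + b) \<cdot> L (a + b + a) (sw a b) b"
    using f(1-3) g(1-3) by (simp add: pr_L L_sq L_L L_pr_left L_I I_sq sq_I sq_assoc add_ac L_sort_tail)
  also have "L a (sw (a + a) b) (b + b) \<cdot> L (a + b + a) (sw a b) b =
       L (a + a) (sw a (b + b)) b \<cdot> L a (sw a b) (b + a + b)"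
    by (simp add: sw_add_left sw_add_right L_pr_left L_pr_right L_sq L_L sq_assoc add_ac L_sort_tail L_sort)
  finally show ?thesis using 1 f g by simp
qed

lemma cp_Suc: "cp (Suc n) = (C \<odot> cp n) \<cdot> L 1 (sw 1 n) n"
  by (simp add: L_def)

lemma cp_comm: "cp n \<cdot> sw n n = cp n"
proof (induction n)
  case (Suc n)
  then show ?case using pair_comm [of C 1 "cp n" n] C_comm by (simp add: cp_Suc del: cp.simps)
qed (simp add: sw_0_left I_sq)

lemma cp_assoc: "cp n \<cdot> (cp n \<odot> I n) = cp n \<cdot> (I n \<odot> cp n)"
proof (induction n)
  case (Suc n)
  then show ?case using pair_assoc [of C 1 "cp n" n] C_assoc by (simp add: cp_Suc del: cp.simps)
qed simp

lemma sw_dc: "sw n m \<cdot> (dc m \<odot> I n) = I n \<odot> dc m"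
  using sw_natural [of "I n" "dc m" n 0] by (simp add: sw_0_right sq_I)

lemma cp_unit: "cp n \<cdot> (dc n \<odot> I n) = I n"
proof (induction n)
  case (Suc n)
  have "L 1 (sw 1 n) n \<cdot> (dc (Suc n) \<odot> I (Suc n)) = (I 1 \<odot> (sw 1 n \<odot> I n)) \<cdot> (E \<odot> ((dc n \<odot> I 1) \<odot> I n))"
    by (simp add: L_def pr_assoc I_pr_I)
  also have "\<dots> = E \<odot> ((sw 1 n \<cdot> (dc n \<odot> I 1)) \<odot> I n)"
    by (simp add: interchange [symmetric] I_sq sq_I del: One_nat_def)
  also have "\<dots> = (E \<odot> I 1) \<odot> (dc n \<odot> I n)"
    by (simp add: sw_dc pr_assoc del: One_nat_def)
  finally have "cp (Suc n) \<cdot> (dc (Suc n) \<odot> I (Suc n)) = (C \<odot> cp n) \<cdot> ((E \<odot> I 1) \<odot> (dc n \<odot> I n))"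
    by (simp add: cp_Suc sq_assoc del: cp.simps dc.simps)
  also have "\<dots> = I (Suc n)"
    using Suc C_unit by (simp add: interchange [symmetric] I_pr_I)
  finally show ?case .
qed (simp add: I_pr_I I_sq)

lemma cp_unit': "cp n \<cdot> (I n \<odot> dc n) = I n"
proof -
  have "cp n \<cdot> (I n \<odot> dc n) = cp n \<cdot> (sw n n \<cdot> (dc n \<odot> I n))" by (simp add: sw_dc)
  then show ?thesis by (simp add: sq_assoc [symmetric] cp_comm cp_unit)
qed

lemma cp_add: "cp (n + m) = (cp n \<odot> cp m) \<cdot> L n (sw n m) m"
proof (induction n)
  case 0
  show ?case by (simp add: I0_pr sw_0_left L_I sq_I)
next
  case (Suc n)
  have "cp (Suc n + m) = (C \<odot> ((cp n \<odot> cp m) \<cdot> L n (sw n m) m)) \<cdot> L 1 (sw 1 (n + m)) (n + m)"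
    using Suc by (simp add: cp_Suc del: cp.simps(2))
  also have "\<dots> = ((C \<odot> cp n) \<odot> cp m) \<cdot> L (2 + n) (sw n m) m \<cdot> L 1 (sw 1 (n + m)) (n + m)"
    by (simp add: pr_sq_right pr_assoc L_pr_left L_L sq_assoc del: One_nat_def)
  also have "L (2 + n) (sw n m) m \<cdot> L 1 (sw 1 (n + m)) (n + m) = L 1 (sw 1 n) (n + m + m) \<cdot> L (1 + n) (sw (1 + n) m) m"
    unfolding sw_add_right [of 1 n m] sw_add_left [of 1 n m]
    by (simp add: L_pr_left L_pr_right L_sq L_L sq_assoc add_ac L_sort_tail L_sort)
  also have "((C \<odot> cp n) \<odot> cp m) \<cdot> (L 1 (sw 1 n) (n + m + m) \<cdot> L (1 + n) (sw (1 + n) m) m) =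
     (cp (Suc n) \<odot> cp m) \<cdot> L (Suc n) (sw (Suc n) m) m"
    by (simp add: cp_Suc pr_sq_left sq_assoc L_pr_right L_L add.assoc del: cp.simps(2) One_nat_def) simp
  finally show ?case .
qed

definition comap :: "'a \<Rightarrow> bool" where
  "comap f \<longleftrightarrow> V f \<and> f \<cdot> cp (cd f) = cp (dm f) \<cdot> (f \<odot> f) \<and> f \<cdot> dc (cd f) = dc (dm f)"

lemma comap_V: "comap f \<Longrightarrow> V f"
  and comap_cp: "comap f \<Longrightarrow> cd f = m \<Longrightarrow> f \<cdot> cp m = cp (dm f) \<cdot> (f \<odot> f)"
  and comap_dc: "comap f \<Longrightarrow> cd f = m \<Longrightarrow> f \<cdot> dc m = dc (dm f)"
  by (auto simp: comap_def)

lemma comap_I: "comap (I n)"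
  by (simp add: comap_def I_sq sq_I I_pr_I)

lemma comap_sq:
  assumes "comap f" "comap g" "cd f = dm g"
  shows "comap (f \<cdot> g)"
proof -
  note [simp] = comap_V [OF assms(1)] comap_V [OF assms(2)] assms(3)
  have "(f \<cdot> g) \<cdot> cp (cd g) = (f \<cdot> cp (dm g)) \<cdot> (g \<odot> g)"
    by (simp add: sq_assoc comap_cp [OF assms(2)])
  also have "\<dots> = cp (dm f) \<cdot> ((f \<cdot> g) \<odot> (f \<cdot> g))"
    using comap_cp [OF assms(1)] by (simp add: sq_assoc [symmetric]) (simp add: sq_assoc interchange)
  finally show ?thesis
    using comap_dc [OF assms(1)] comap_dc [OF assms(2)] by (simp add: comap_def sq_assoc)
qed

lemma L_sw_pr:
  assumes "V f" "V g" "V h" "V k"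
  shows "(f \<odot> (g \<odot> h) \<odot> k) \<cdot> L (cd f) (sw (cd g) (cd h)) (cd k) = L (dm f) (sw (dm g) (dm h)) (dm k) \<cdot> (f \<odot> (h \<odot> g) \<odot> k)"
  using assms by (simp add: L_def interchange [symmetric] sw_natural I_sq sq_I)

lemma comap_pr:
  assumes "comap f" "comap g"
  shows "comap (f \<odot> g)"
proof -
  note [simp] = comap_V [OF assms(1)] comap_V [OF assms(2)]
  have "(f \<odot> g) \<cdot> cp (cd f + cd g) = ((f \<cdot> cp (cd f)) \<odot> (g \<cdot> cp (cd g))) \<cdot> L (cd f) (sw (cd f) (cd g)) (cd g)"
    by (simp add: cp_add sq_assoc interchange)
  also have "\<dots> = (cp (dm f) \<odot> cp (dm g)) \<cdot> (f \<odot> (f \<odot> g) \<odot> g) \<cdot> L (cd f) (sw (cd f) (cd g)) (cd g)"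
    using assms by (simp add: comap_cp sq_assoc interchange pr_assoc)
  also have "\<dots> = cp (dm f + dm g) \<cdot> ((f \<odot> g) \<odot> (f \<odot> g))"
    using L_sw_pr [of f f g g] by (simp add: cp_add sq_assoc pr_assoc)
  finally show ?thesis
    using comap_dc [OF assms(1)] comap_dc [OF assms(2)]
    by (simp add: comap_def dc_add interchange [symmetric])
qed

lemma comap_dc_n: "comap (dc n)"
proof -
  have "cp n \<cdot> (dc n \<odot> dc n) = (cp n \<cdot> (dc n \<odot> I n)) \<cdot> dc n"
    using pr_eq_sq [of "dc n" "dc n"] by (simp add: sq_assoc I0_pr)
  then show ?thesis by (simp add: comap_def cp_unit I_sq sq_I)
qed

lemma comap_cp_n: "comap (cp n)"
proof -
  have 1: "cp n \<cdot> (cp n \<odot> cp n) = cp n \<cdot> (I n \<odot> (cp n \<cdot> (cp n \<odot> I n)))"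
  proof -
    have "cp n \<cdot> (cp n \<odot> cp n) = (cp n \<cdot> (cp n \<odot> I n)) \<cdot> (I (n + n) \<odot> cp n)"
      using pr_eq_sq [of "cp n" "cp n"] by (simp add: sq_assoc)
    also have "\<dots> = cp n \<cdot> (I n \<odot> cp n) \<cdot> (I n \<odot> (I n \<odot> cp n))"
      by (simp add: cp_assoc sq_assoc pr_I_assoc)
    finally show ?thesis by (simp add: I_pr_sq [symmetric] cp_assoc)
  qed
  have "cp n \<cdot> cp (n + n) = (cp n \<cdot> (cp n \<odot> cp n)) \<cdot> L n (sw n n) n"
    by (simp add: cp_add sq_assoc)
  also have "\<dots> = cp n \<cdot> (I n \<odot> (cp n \<cdot> ((cp n \<cdot> sw n n) \<odot> I n)))"
    unfolding 1 by (simp add: L_def sq_assoc I_pr_sq sq_pr_I)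
  also have "\<dots> = cp n \<cdot> (cp n \<odot> cp n)"
    by (simp add: cp_comm 1)
  finally have "cp n \<cdot> cp (n + n) = cp n \<cdot> (cp n \<odot> cp n)" .
  moreover have "cp n \<cdot> (dc n \<odot> dc n) = dc n"
    using comap_dc_n [of n] by (simp add: comap_def sq_I)
  ultimately show ?thesis by (simp add: comap_def dc_add)
qed

lemma comap_pair: "\<lbrakk>comap f; comap g; dm f = n; dm g = n\<rbrakk> \<Longrightarrow> comap (cp n \<cdot> (f \<odot> g))"
  by (intro comap_sq comap_pr comap_cp_n) (auto simp: comap_V)

lemma sw_eq_pair: "sw n m = cp (n + m) \<cdot> ((dc n \<odot> I m) \<odot> (I n \<odot> dc m))"
proof -
  have "cp (n + m) \<cdot> ((dc n \<odot> I m) \<odot> (I n \<odot> dc m))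
      = (cp n \<odot> cp m) \<cdot> L n (sw n m) m \<cdot> (dc n \<odot> (I m \<odot> I n) \<odot> dc m)"
    by (simp add: cp_add sq_assoc pr_assoc)
  also have "\<dots> = (cp n \<odot> cp m) \<cdot> (dc n \<odot> (I n \<odot> I m) \<odot> dc m) \<cdot> L 0 (sw n m) 0"
    using L_sw_pr [of "dc n" "I n" "I m" "dc m"] by simp
  also have "\<dots> = (cp n \<odot> cp m) \<cdot> ((dc n \<odot> I n) \<odot> (I m \<odot> dc m)) \<cdot> sw n m"
    by (simp add: L_00 pr_assoc)
  also have "\<dots> = sw n m"
    by (simp add: sq_assoc [symmetric] interchange [symmetric] cp_unit cp_unit' I_pr_I I_sq)
  finally show ?thesis by simp
qed

lemma pair_fst: "\<lbrakk>V f; comap g; dm f = n; dm g = n; cd f = a; cd g = b\<rbrakk> \<Longrightarrow> cp n \<cdot> (f \<odot> g) \<cdot> (I a \<odot> dc b) = f"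
  using interchange [of f "I a" g "dc b"] interchange [of "I n" f "dc n" "I 0"]
  by (simp add: comap_V comap_dc sq_I I_sq pr_I0 cp_unit' sq_assoc [symmetric])

lemma pair_snd: "\<lbrakk>comap f; V g; dm f = n; dm g = n; cd f = a; cd g = b\<rbrakk> \<Longrightarrow> cp n \<cdot> (f \<odot> g) \<cdot> (dc a \<odot> I b) = g"
  using interchange [of f "dc a" g "I b"] interchange [of "dc n" "I 0" "I n" g]
  by (simp add: comap_V comap_dc sq_I I_sq I0_pr cp_unit sq_assoc [symmetric])

lemma pair_projections:
  assumes "comap f" "cd f = a + b"
  shows "cp (dm f) \<cdot> ((f \<cdot> (I a \<odot> dc b)) \<odot> (f \<cdot> (dc a \<odot> I b))) = f"
proof -
  note [simp] = comap_V [OF assms(1)] assms(2)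
  have 1: "cp (a + b) \<cdot> ((I a \<odot> dc b) \<odot> (dc a \<odot> I b)) = I (a + b)"
  proof -
    have "L a (sw a b) b \<cdot> (I a \<odot> (dc b \<odot> dc a) \<odot> I b) = (I a \<odot> (dc a \<odot> dc b) \<odot> I b) \<cdot> I (a + b)"
      using L_sw_pr [of "I a" "dc a" "dc b" "I b"] by (simp add: sw_0_left L_I)
    then have "cp (a + b) \<cdot> ((I a \<odot> dc b) \<odot> (dc a \<odot> I b)) = (cp a \<odot> cp b) \<cdot> ((I a \<odot> dc a) \<odot> (dc b \<odot> I b))"
      by (simp add: cp_add sq_assoc pr_assoc sq_I)
    then show ?thesis by (simp add: interchange [symmetric] cp_unit cp_unit' I_pr_I)
  qed
  have "f = f \<cdot> cp (a + b) \<cdot> ((I a \<odot> dc b) \<odot> (dc a \<odot> I b))" by (simp add: 1 sq_I)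
  also have "\<dots> = cp (dm f) \<cdot> (f \<odot> f) \<cdot> ((I a \<odot> dc b) \<odot> (dc a \<odot> I b))"
    using comap_cp [OF assms(1)] by (simp add: sq_assoc [symmetric])
  finally show ?thesis by (simp add: interchange)
qed

end

lemma ivl_subset_lessThan [simp]: "{a..<b} \<subseteq> {..<c::nat} \<longleftrightarrow> b \<le> a \<or> b \<le> c"
  using ivl_subset [of a b 0 c] by (simp add: atLeast0LessThan)

lemma nth_lessThan: "set t \<subseteq> {..<n::nat} \<Longrightarrow> i < length t \<Longrightarrow> t ! i < n"
  by (meson lessThan_iff nth_mem subsetD)

lemma map_nth_lessThan:
  "\<lbrakk>set s \<subseteq> {..<K::nat}; set t \<subseteq> {..<length s}\<rbrakk> \<Longrightarrow> set (map ((!) s) t) \<subseteq> {..<K}"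
  by (auto simp: subset_eq intro!: nth_lessThan)

context comonoid_prop
begin

definition proj :: "nat \<Rightarrow> nat \<Rightarrow> 'a" where
  "proj K i = dc i \<odot> I 1 \<odot> dc (K - Suc i)"

primrec sel :: "nat \<Rightarrow> nat list \<Rightarrow> 'a" where
  "sel K [] = dc K"
| "sel K (i # s) = cp K \<cdot> (proj K i \<odot> sel K s)"

lemma proj_sort [simp]: "V (proj K i)" "i < K \<Longrightarrow> dm (proj K i) = K" "cd (proj K i) = 1"
  by (auto simp: proj_def)

lemma comap_proj: "comap (proj K i)"
  unfolding proj_def by (intro comap_pr comap_dc_n comap_I)

lemma sel_sort [simp]:
  assumes "set s \<subseteq> {..<K}"
  shows "V (sel K s)" "dm (sel K s) = K" "cd (sel K s) = length s"
  using assms by (induction s) auto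

lemma comap_sel: "set s \<subseteq> {..<K} \<Longrightarrow> comap (sel K s)"
  by (induction s) (auto intro!: comap_pair comap_proj comap_dc_n)

lemma proj_add_left: "i < n \<Longrightarrow> proj (n + m) i = proj n i \<odot> dc m"
  using dc_add [of "n - Suc i" m] by (simp add: proj_def pr_assoc)

lemma proj_add_right: "proj (n + m) (n + i) = dc n \<odot> proj m i"
  by (simp add: proj_def dc_add pr_assoc)

lemma proj_sel:
  assumes "set s \<subseteq> {..<K}" "i < length s"
  shows "sel K s \<cdot> proj (length s) i = proj K (s ! i)"
  using assms
proof (induction s arbitrary: i)
  case (Cons j s)
  show ?case
  proof (cases i)
    case 0
    have "proj (length (j # s)) i = I 1 \<odot> dc (length s)" by (simp add: proj_def 0 I0_pr)
    then show ?thesis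
      using Cons.prems 0 pair_fst [of "proj K j" "sel K s" K 1 "length s"]
      by (simp add: comap_sel sq_assoc)
  next
    case (Suc i')
    have "proj (length (j # s)) i = dc 1 \<odot> proj (length s) i'"
      using proj_add_right [of 1 "length s" i'] Suc by simp
    also have "\<dots> = (dc 1 \<odot> I (length s)) \<cdot> proj (length s) i'"
      using pr_eq_sq [of "dc 1" "proj (length s) i'"] Cons.prems Suc by (simp add: I0_pr)
    finally have "sel K (j # s) \<cdot> proj (length (j # s)) i
        = (cp K \<cdot> (proj K j \<odot> sel K s) \<cdot> (dc 1 \<odot> I (length s))) \<cdot> proj (length s) i'"
      using Cons.prems Suc by (simp add: sq_assoc)
    also have "\<dots> = proj K ((j # s) ! i)"
      using Cons pair_snd [of "proj K j" "sel K s" K 1 "length s"] Suc by (simp add: comap_proj)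
    finally show ?thesis .
  qed
qed simp

lemma comap_eq_sel:
  assumes "comap f" "dm f = K" "cd f = length s" "set s \<subseteq> {..<K}"
    and "\<And>i. i < length s \<Longrightarrow> f \<cdot> proj (length s) i = proj K (s ! i)"
  shows "f = sel K s"
  using assms
proof (induction s arbitrary: f)
  case Nil
  then show ?case using comap_dc [of f 0] by (simp add: sq_I comap_V)
next
  case (Cons j s)
  note V = comap_V [OF Cons.prems(1)]
  let ?g = "f \<cdot> (dc 1 \<odot> I (length s))"
  have "f \<cdot> (I 1 \<odot> dc (length s)) = proj K j"
    using Cons.prems(5) [of 0] by (simp add: proj_def I0_pr)
  moreover have "?g = sel K s"
  proof (rule Cons.IH)
    show "comap ?g"
      using Cons.prems(1,3) by (intro comap_sq comap_pr comap_dc_n comap_I) auto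
    show "?g \<cdot> proj (length s) i = proj K (s ! i)" if "i < length s" for i
    proof -
      have "?g \<cdot> proj (length s) i = f \<cdot> ((dc 1 \<odot> I (length s)) \<cdot> proj (length s) i)"
        using that V Cons.prems(3) by (simp add: sq_assoc)
      also have "(dc 1 \<odot> I (length s)) \<cdot> proj (length s) i = proj (length (j # s)) (Suc i)"
        using proj_add_right [of 1 "length s" i] pr_eq_sq [of "dc 1" "proj (length s) i"] that
        by (simp add: I0_pr)
      also have "f \<cdot> proj (length (j # s)) (Suc i) = proj K (s ! i)"
        using Cons.prems(5) [of "Suc i"] that by simp
      finally show ?thesis .
    qed
  qed (use Cons.prems(2-4) V in auto)
  ultimately show ?case
    using pair_projections [of f 1 "length s"] Cons.prems(1-3) by simp
qed

lemma sel_sq: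
  assumes "set s \<subseteq> {..<K}" "length s = n" "set t \<subseteq> {..<n}"
  shows "sel K s \<cdot> sel n t = sel K (map ((!) s) t)"
proof (rule comap_eq_sel)
  show "comap (sel K s \<cdot> sel n t)" using assms by (intro comap_sq comap_sel) auto
  show "set (map ((!) s) t) \<subseteq> {..<K}" using assms map_nth_lessThan by simp
  fix i assume "i < length (map ((!) s) t)"
  then have i: "i < length t" by simp
  then have "t ! i < n" using assms(3) nth_lessThan by simp
  then show "(sel K s \<cdot> sel n t) \<cdot> proj (length (map ((!) s) t)) i = proj K (map ((!) s) t ! i)"
    using assms i proj_sel [of t n i] proj_sel [of s K "t ! i"] by (simp add: sq_assoc)
qed (use assms in auto)

lemma sel_id: "sel K [0..<K] = I K"
  by (rule comap_eq_sel [symmetric]) (auto simp: comap_I I_sq)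

lemma sel_pr:
  assumes "set s \<subseteq> {..<K}" "set t \<subseteq> {..<K'}"
  shows "sel K s \<odot> sel K' t = sel (K + K') (s @ map ((+) K) t)"
proof (rule comap_eq_sel)
  show "comap (sel K s \<odot> sel K' t)" using assms by (intro comap_pr comap_sel)
  show "set (s @ map ((+) K) t) \<subseteq> {..<K + K'}" using assms by auto
  fix i assume i: "i < length (s @ map ((+) K) t)"
  show "(sel K s \<odot> sel K' t) \<cdot> proj (length (s @ map ((+) K) t)) i = proj (K + K') ((s @ map ((+) K) t) ! i)"
  proof (cases "i < length s")
    case True
    then have "s ! i < K" using assms(1) nth_lessThan by simp
    then show ?thesis
      using True assms proj_sel [of s K i] comap_dc [OF comap_sel [of t K']]
      by (simp add: proj_add_left interchange [symmetric] nth_append)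
  next
    case False
    then obtain j where j: "i = length s + j" "j < length t" using i by (auto simp: le_iff_add not_less)
    then have "t ! j < K'" using assms(2) nth_lessThan by simp
    then show ?thesis
      using j assms proj_sel [of t K' j] comap_dc [OF comap_sel [of s K]]
      by (simp add: proj_add_right interchange [symmetric] nth_append)
  qed
qed (use assms in auto)

lemma map_nth_upt_add: "length s = n \<Longrightarrow> length t = m \<Longrightarrow> map ((!) (s @ t)) [n..<n + m] = t"
  by (auto intro!: nth_equalityI simp: nth_append)

lemma map_add_upt': "map ((+) n) [0..<m] = [n..<n + m]"
  by (rule nth_equalityI) auto

lemma sel_append:
  assumes "set s \<subseteq> {..<K}" "set t \<subseteq> {..<K}"
  shows "sel K (s @ t) = cp K \<cdot> (sel K s \<odot> sel K t)"
proof (rule comap_eq_sel [symmetric])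
  show "comap (cp K \<cdot> (sel K s \<odot> sel K t))" using assms by (intro comap_pair comap_sel) auto
  fix i assume i: "i < length (s @ t)"
  show "(cp K \<cdot> (sel K s \<odot> sel K t)) \<cdot> proj (length (s @ t)) i = proj K ((s @ t) ! i)"
  proof (cases "i < length s")
    case True
    have "proj (length (s @ t)) i = (I (length s) \<odot> dc (length t)) \<cdot> (proj (length s) i \<odot> I 0)"
      using True proj_add_left [of i "length s" "length t"] by (simp add: interchange [symmetric] I_sq sq_I)
    then have "(cp K \<cdot> (sel K s \<odot> sel K t)) \<cdot> proj (length (s @ t)) i
        = (cp K \<cdot> (sel K s \<odot> sel K t) \<cdot> (I (length s) \<odot> dc (length t))) \<cdot> proj (length s) i"
      using assms True by (simp add: sq_assoc pr_I0)
    also have "\<dots> = proj K ((s @ t) ! i)"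
      using assms True pair_fst [of "sel K s" "sel K t"] by (simp add: comap_sel proj_sel nth_append)
    finally show ?thesis .
  next
    case False
    then obtain j where j: "i = length s + j" "j < length t" using i by (auto simp: le_iff_add not_less)
    have "proj (length (s @ t)) i = (dc (length s) \<odot> I (length t)) \<cdot> (I 0 \<odot> proj (length t) j)"
      using j proj_add_right [of "length s" "length t" j] by (simp add: interchange [symmetric] I_sq sq_I)
    then have "(cp K \<cdot> (sel K s \<odot> sel K t)) \<cdot> proj (length (s @ t)) i
        = (cp K \<cdot> (sel K s \<odot> sel K t) \<cdot> (dc (length s) \<odot> I (length t))) \<cdot> proj (length t) j"
      using assms j by (simp add: sq_assoc I0_pr)
    also have "\<dots> = proj K ((s @ t) ! i)"
      using assms j pair_snd [of "sel K s" "sel K t"] by (simp add: comap_sel proj_sel nth_append)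
    finally show ?thesis .
  qed
qed (use assms in auto)

lemma cp_sel: "cp K = sel K ([0..<K] @ [0..<K])"
  by (subst sel_append) (auto simp: sel_id I_pr_I sq_I)

lemma sw_sel: "sw n m = sel (n + m) ([n..<n + m] @ [0..<n])"
proof -
  have "dc n \<odot> I m = sel (n + m) [n..<n + m]"
    using sel_pr [of "[]" n "[0..<m]" m] by (simp add: sel_id map_add_upt')
  moreover have "I n \<odot> dc m = sel (n + m) [0..<n]"
    using sel_pr [of "[0..<n]" n "[]" m] by (simp add: sel_id)
  moreover have "set [0..<n] \<subseteq> {..<n + m}" "set [n..<n + m] \<subseteq> {..<n + m}" by auto
  ultimately show ?thesis by (simp add: sw_eq_pair sel_append)
qed

lemma sel_single: "i < K \<Longrightarrow> sel K [i] = proj K i"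
  using interchange [of "I K" "proj K i" "dc K" "I 0"] by (simp add: sq_assoc [symmetric] I_sq sq_I cp_unit' pr_I0)

definition eff :: "nat \<Rightarrow> 'a \<Rightarrow> bool" where
  "eff K e \<longleftrightarrow> V e \<and> dm e = K \<and> cd e = 0"

lemma effD [simp]: "eff K e \<Longrightarrow> V e" "eff K e \<Longrightarrow> dm e = K" "eff K e \<Longrightarrow> cd e = 0"
  by (auto simp: eff_def)

text \<open>An effect \<open>e : K \<rightarrow> 0\<close> is a formula with free variables in \<open>K\<close>; \<open>e \<star> f\<close> is its
  conjunction with an arrow \<open>f\<close> out of \<open>K\<close>.\<close>

definition meet :: "'a \<Rightarrow> 'a \<Rightarrow> 'a" (infixr "\<star>" 67) where
  "e \<star> f = cp (dm e) \<cdot> (e \<odot> f)"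

lemma meet_sort [simp]:
  assumes "eff (dm f) e" "V f"
  shows "V (e \<star> f)" "dm (e \<star> f) = dm f" "cd (e \<star> f) = cd f"
  using assms by (auto simp: meet_def)

lemma eff_meet [simp]: "eff K e \<Longrightarrow> eff K f \<Longrightarrow> eff K (e \<star> f)"
  by (simp add: eff_def [of K "e \<star> f"])

lemma eff_dc [simp]: "eff K (dc K)"
  by (simp add: eff_def)

lemma eff_sel_sq [simp]: "set s \<subseteq> {..<K} \<Longrightarrow> length s = n \<Longrightarrow> eff n e \<Longrightarrow> eff K (sel K s \<cdot> e)"
  by (simp add: eff_def [of K "sel K s \<cdot> e"])

lemma meet_swap: "eff K e \<Longrightarrow> V f \<Longrightarrow> dm f = K \<Longrightarrow> e \<star> f = cp K \<cdot> (f \<odot> e)"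
  using sw_natural [of f e "cd f" 0] cp_comm [of K]
  by (simp add: meet_def sw_0_right sq_I sq_assoc [symmetric])

lemma dc_meet: "V f \<Longrightarrow> dm f = K \<Longrightarrow> dc K \<star> f = f"
  using interchange [of "dc K" "I 0" "I K" f]
  by (simp add: meet_def I_sq sq_I I0_pr cp_unit sq_assoc [symmetric])

lemma cp_assoc_pr:
  assumes "V f" "V g" "V h" "dm f = K" "dm g = K" "dm h = K"
  shows "cp K \<cdot> ((cp K \<cdot> (f \<odot> g)) \<odot> h) = cp K \<cdot> (f \<odot> (cp K \<cdot> (g \<odot> h)))"
proof -
  have "cp K \<cdot> ((cp K \<cdot> (f \<odot> g)) \<odot> h) = (cp K \<cdot> (cp K \<odot> I K)) \<cdot> (f \<odot> g \<odot> h)"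
    using assms interchange [of "cp K" "f \<odot> g" "I K" h] by (simp add: I_sq sq_assoc pr_assoc)
  also have "\<dots> = cp K \<cdot> (f \<odot> (cp K \<cdot> (g \<odot> h)))"
    using assms interchange [of "I K" f "cp K" "g \<odot> h"] by (simp add: cp_assoc I_sq sq_assoc)
  finally show ?thesis .
qed

lemma meet_cp_left:
  "\<lbrakk>eff K e; V f; V g; dm f = K; dm g = K\<rbrakk> \<Longrightarrow> cp K \<cdot> ((e \<star> f) \<odot> g) = e \<star> (cp K \<cdot> (f \<odot> g))"
  by (simp add: meet_def cp_assoc_pr)

lemma meet_cp_right:
  assumes "eff K e" "V f" "V g" "dm f = K" "dm g = K"
  shows "cp K \<cdot> (f \<odot> (e \<star> g)) = e \<star> (cp K \<cdot> (f \<odot> g))"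
proof -
  have "cp K \<cdot> (f \<odot> (e \<star> g)) = cp K \<cdot> ((cp K \<cdot> (f \<odot> e)) \<odot> g)"
    using assms by (simp add: meet_def cp_assoc_pr)
  also have "\<dots> = cp K \<cdot> ((e \<star> f) \<odot> g)" using assms by (simp add: meet_swap)
  finally show ?thesis using assms by (simp add: meet_cp_left)
qed

lemma meet_assoc: "\<lbrakk>eff K e; eff K e'; V f; dm f = K\<rbrakk> \<Longrightarrow> (e \<star> e') \<star> f = e \<star> (e' \<star> f)"
  using meet_cp_left [of K e e' f] by (simp add: meet_def [of "e \<star> e'"] meet_def [of e'])

lemma meet_commute: "\<lbrakk>eff K e; eff K e'\<rbrakk> \<Longrightarrow> e \<star> e' = e' \<star> e"
  using meet_swap [of K e e'] by (simp add: meet_def [of e'])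

lemma meet_left_commute: "\<lbrakk>eff K e; eff K e'; V f; dm f = K\<rbrakk> \<Longrightarrow> e \<star> (e' \<star> f) = e' \<star> (e \<star> f)"
  using meet_assoc [of K e e' f] meet_assoc [of K e' e f] meet_commute [of K e e'] by simp

lemma meet_dc: "eff K e \<Longrightarrow> e \<star> dc K = e"
  using meet_commute [of K e "dc K"] by (simp add: dc_meet)

lemma comap_meet:
  assumes "comap s" "eff K e" "V f" "dm f = K" "cd s = K"
  shows "s \<cdot> (e \<star> f) = (s \<cdot> e) \<star> (s \<cdot> f)"
proof -
  note [simp] = comap_V [OF assms(1)]
  have "s \<cdot> (e \<star> f) = (s \<cdot> cp K) \<cdot> (e \<odot> f)" using assms by (simp add: meet_def sq_assoc)
  then show ?thesis using assms by (simp add: comap_cp sq_assoc interchange meet_def)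
qed

lemma meet_sq: "\<lbrakk>eff K e; V f; dm f = K; V g; cd f = dm g\<rbrakk> \<Longrightarrow> (e \<star> f) \<cdot> g = e \<star> (f \<cdot> g)"
  using interchange [of e "I 0" f g] by (simp add: meet_def sq_assoc sq_I I0_pr)

end


section \<open>Equations between variables\<close>

definition eqv :: "(nat \<times> nat) list \<Rightarrow> nat rel" where
  "eqv ps = (set ps \<union> (set ps)\<inverse>)\<^sup>*"

lemma eqv_refl [simp]: "(i, i) \<in> eqv ps"
  by (simp add: eqv_def)

lemma eqv_sym: "(i, j) \<in> eqv ps \<Longrightarrow> (j, i) \<in> eqv ps"
  unfolding eqv_def by (rule symD [OF sym_rtrancl]) (auto simp: sym_def)

lemma eqv_trans: "(i, j) \<in> eqv ps \<Longrightarrow> (j, k) \<in> eqv ps \<Longrightarrow> (i, k) \<in> eqv ps"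
  by (simp add: eqv_def)

lemma eqv_mem: "(i, j) \<in> set ps \<Longrightarrow> (i, j) \<in> eqv ps"
  by (auto simp: eqv_def)

lemma eqv_least:
  assumes "\<And>i j. (i, j) \<in> set ps \<Longrightarrow> P i j" "\<And>i. P i i" "\<And>i j. P i j \<Longrightarrow> P j i"
    "\<And>i j k. P i j \<Longrightarrow> P j k \<Longrightarrow> P i k" "(i, j) \<in> eqv ps"
  shows "P i j"
  using assms(5) unfolding eqv_def
  by (induction rule: rtrancl_induct) (use assms(1-4) in blast)+

lemma eqv_subset:
  assumes "(i, j) \<in> eqv ps" "\<And>i j. (i, j) \<in> set ps \<Longrightarrow> (i, j) \<in> eqv qs"
  shows "(i, j) \<in> eqv qs"
  by (rule eqv_least [OF assms(2) _ _ _ assms(1)]) (auto elim: eqv_sym eqv_trans)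

lemma eqv_map:
  assumes "(i, j) \<in> eqv ps"
  shows "(h i, h j) \<in> eqv (map (map_prod h h) ps)"
proof (rule eqv_least [OF _ _ _ _ assms])
  show "(h i, h j) \<in> eqv (map (map_prod h h) ps)" if "(i, j) \<in> set ps" for i j
    using that by (intro eqv_mem) force
qed (auto elim: eqv_sym eqv_trans)

locale frobenius_prop = comonoid_prop +
  fixes M N :: 'a
  assumes V_M [simp]: "V M" and dm_M [simp]: "dm M = 2" and cd_M [simp]: "cd M = 1"
    and V_N [simp]: "V N" and dm_N [simp]: "dm N = 0" and cd_N [simp]: "cd N = 1"
    and M_unit: "(N \<odot> I 1) \<cdot> M = I 1"
    and M_comm: "sw 1 1 \<cdot> M = M"
    and frobenius_left: "(C \<odot> I 1) \<cdot> (I 1 \<odot> M) = M \<cdot> C"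
    and frobenius_right: "(I 1 \<odot> C) \<cdot> (M \<odot> I 1) = M \<cdot> C"
    and special: "C \<cdot> M = I 1"
begin

primrec nw :: "nat \<Rightarrow> 'a" where
  "nw 0 = I 0"
| "nw (Suc n) = N \<odot> nw n"

lemma nw_sort [simp]: "V (nw n)" "dm (nw n) = 0" "cd (nw n) = n"
  by (induction n) auto

lemma nw_add: "nw (n + m) = nw n \<odot> nw m"
  by (induction n) (simp_all add: I0_pr pr_assoc)

definition eq :: "nat \<Rightarrow> nat \<Rightarrow> nat \<Rightarrow> 'a" where
  "eq K i j = sel K [i, j] \<cdot> M \<cdot> E"

lemma eff_eq [simp]: "\<lbrakk>i < K; j < K\<rbrakk> \<Longrightarrow> eff K (eq K i j)"
  by (simp add: eq_def eff_def [of K "sel K [i, j] \<cdot> M \<cdot> E"] del: sel.simps)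

lemma eq_sort [simp]:
  assumes "i < K" "j < K"
  shows "V (eq K i j)" "dm (eq K i j) = K" "cd (eq K i j) = 0"
  using eff_eq [OF assms] by simp_all

lemma sel_1_00: "sel 1 [0, 0] = C"
  using cp_sel [of 1] cp_1 by (simp del: cp.simps sel.simps)

lemma sel_1_0: "sel 1 [0] = I 1"
  using sel_id [of 1] by (simp del: sel.simps)

lemma sel_2_001: "sel 2 [0, 0, 1] = C \<odot> I 1"
  using sel_pr [of "[0,0]" 1 "[0]" 1] by (simp add: sel_1_00 sel_1_0 numeral_2_eq_2 del: sel.simps One_nat_def)

lemma sel_2_011: "sel 2 [0, 1, 1] = I 1 \<odot> C"
  using sel_pr [of "[0]" 1 "[0,0]" 1] by (simp add: sel_1_00 sel_1_0 numeral_2_eq_2 del: sel.simps One_nat_def)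

lemma sel_Cons_pr: "\<lbrakk>i < K; set s \<subseteq> {..<K}\<rbrakk> \<Longrightarrow> cp K \<cdot> (proj K i \<odot> sel K s) = sel K (i # s)"
  by simp

lemma eq_meet_proj_left:
  assumes "i < K" "j < K"
  shows "eq K i j \<star> proj K i = sel K [i, j] \<cdot> M"
proof -
  have "eq K i j \<star> proj K i = cp K \<cdot> (proj K i \<odot> eq K i j)"
    using assms by (intro meet_swap) simp_all
  also have "\<dots> = cp K \<cdot> (proj K i \<odot> (sel K [i, j] \<cdot> (M \<cdot> E)))"
    by (simp add: eq_def del: sel.simps)
  also have "\<dots> = sel K [i, i, j] \<cdot> (I 1 \<odot> (M \<cdot> E))"
    using assms interchange [of "proj K i" "I 1" "sel K [i, j]" "M \<cdot> E"]
    by (simp add: sq_I sq_assoc del: sel.simps) (simp add: sel_Cons_pr [symmetric] sq_assoc del: sel.simps)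
  also have "sel K [i, i, j] = sel K [i, j] \<cdot> sel 2 [0, 0, 1]"
    using assms by (subst sel_sq) (auto simp del: sel.simps)
  also have "(sel K [i, j] \<cdot> sel 2 [0, 0, 1]) \<cdot> (I 1 \<odot> (M \<cdot> E)) = sel K [i, j] \<cdot> ((C \<odot> I 1) \<cdot> (I 1 \<odot> M)) \<cdot> (I 1 \<odot> E)"
    using assms unfolding sel_2_001 by (simp add: sq_assoc I_pr_sq del: sel.simps)
  also have "\<dots> = sel K [i, j] \<cdot> M \<cdot> (C \<cdot> (I 1 \<odot> E))"
    using assms unfolding frobenius_left by (simp add: sq_assoc del: sel.simps)
  also have "C \<cdot> (I 1 \<odot> E) = I 1"
    using cp_unit' [of 1] by (simp add: cp_1 dc_1 del: cp.simps dc.simps)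
  finally show ?thesis using assms by (simp add: sq_I del: sel.simps)
qed

lemma eq_meet_proj_right:
  assumes "i < K" "j < K"
  shows "eq K i j \<star> proj K j = sel K [i, j] \<cdot> M"
proof -
  have "eq K i j \<star> proj K j = cp K \<cdot> ((sel K [i, j] \<cdot> (M \<cdot> E)) \<odot> sel K [j])"
    using assms by (simp add: sel_single meet_def del: sel.simps) (simp add: eq_def sq_assoc del: sel.simps)
  also have "\<dots> = (cp K \<cdot> (sel K [i, j] \<odot> sel K [j])) \<cdot> ((M \<cdot> E) \<odot> I 1)"
    using assms interchange [of "sel K [i, j]" "M \<cdot> E" "sel K [j]" "I 1"]
    by (simp add: sq_I sq_assoc del: sel.simps)
  also have "cp K \<cdot> (sel K [i, j] \<odot> sel K [j]) = sel K [i, j, j]"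
    using assms sel_append [of "[i, j]" K "[j]"] by (simp del: sel.simps)
  also have "sel K [i, j, j] = sel K [i, j] \<cdot> sel 2 [0, 1, 1]"
    using assms by (subst sel_sq) (auto simp del: sel.simps)
  also have "(sel K [i, j] \<cdot> sel 2 [0, 1, 1]) \<cdot> ((M \<cdot> E) \<odot> I 1) = sel K [i, j] \<cdot> ((I 1 \<odot> C) \<cdot> (M \<odot> I 1)) \<cdot> (E \<odot> I 1)"
    using assms unfolding sel_2_011 by (simp add: sq_assoc sq_pr_I del: sel.simps)
  also have "\<dots> = sel K [i, j] \<cdot> M \<cdot> (C \<cdot> (E \<odot> I 1))"
    using assms unfolding frobenius_right by (simp add: sq_assoc del: sel.simps)
  finally show ?thesis using assms unfolding C_unit by (simp add: sq_I del: sel.simps)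
qed

lemma eq_same: "i < K \<Longrightarrow> eq K i i = dc K"
proof -
  assume i: "i < K"
  have "sel K [i, i] = proj K i \<cdot> C"
    using i sel_sq [of "[i]" K 1 "[0, 0]"] unfolding sel_1_00 by (simp add: sel_single del: sel.simps)
  then have "eq K i i = proj K i \<cdot> ((C \<cdot> M) \<cdot> E)"
    using i by (simp add: eq_def sq_assoc del: sel.simps)
  then show ?thesis
    using i comap_dc [OF comap_proj, of K i 1] dc_1 unfolding special by (simp add: I_sq del: dc.simps)
qed

lemma meet_sel_cong:
  assumes e: "eff K e" and "list_all2 (\<lambda>a b. e \<star> proj K a = e \<star> proj K b) s t"
    and "set s \<subseteq> {..<K}" "set t \<subseteq> {..<K}"
  shows "e \<star> sel K s = e \<star> sel K t"
  using assms(2-)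
proof (induction rule: list_all2_induct)
  case (Cons a s b t)
  then have *: "V (proj K a)" "dm (proj K a) = K" "V (proj K b)" "dm (proj K b) = K"
    "V (sel K s)" "dm (sel K s) = K" "V (sel K t)" "dm (sel K t) = K" by simp_all
  have "e \<star> sel K (a # s) = cp K \<cdot> ((e \<star> proj K a) \<odot> sel K s)"
    using * e by (simp add: meet_cp_left)
  also have "\<dots> = cp K \<cdot> (proj K b \<odot> (e \<star> sel K s))"
    using * e Cons.hyps by (simp add: meet_cp_left meet_cp_right)
  also have "\<dots> = e \<star> sel K (b # t)"
    using * e Cons by (simp add: meet_cp_right)
  finally show ?case .
qed simp

primrec eqs :: "nat \<Rightarrow> (nat \<times> nat) list \<Rightarrow> 'a" where
  "eqs K [] = dc K"
| "eqs K (p # ps) = eq K (fst p) (snd p) \<star> eqs K ps"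

lemma eff_eqs [simp]: "set ps \<subseteq> {..<K} \<times> {..<K} \<Longrightarrow> eff K (eqs K ps)"
  by (induction ps) auto

lemma eqs_sort [simp]:
  assumes "set ps \<subseteq> {..<K} \<times> {..<K}"
  shows "V (eqs K ps)" "dm (eqs K ps) = K" "cd (eqs K ps) = 0"
  using eff_eqs [OF assms] by simp_all

lemma eqs_append:
  "\<lbrakk>set ps \<subseteq> {..<K} \<times> {..<K}; set qs \<subseteq> {..<K} \<times> {..<K}\<rbrakk> \<Longrightarrow> eqs K (ps @ qs) = eqs K ps \<star> eqs K qs"
proof (induction ps)
  case Nil
  then show ?case by (simp add: dc_meet [of _ K])
next
  case (Cons p ps)
  then show ?case by (auto simp: meet_assoc [of K])
qed

lemma eqs_meet_proj_mem:
  assumes "set ps \<subseteq> {..<K} \<times> {..<K}" "(i, j) \<in> set ps"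
  shows "eqs K ps \<star> proj K i = eqs K ps \<star> proj K j"
  using assms
proof (induction ps)
  case (Cons p ps)
  from Cons.prems obtain a b where p: "p = (a, b)" "a < K" "b < K" and ps: "set ps \<subseteq> {..<K} \<times> {..<K}" by auto
  from Cons.prems have ij: "i < K" "j < K" by auto
  show ?case
  proof (cases "p = (i, j)")
    case True
    have "eqs K (p # ps) \<star> proj K i = eqs K ps \<star> (eq K i j \<star> proj K i)"
      using True ij ps by (simp add: meet_assoc [of K] meet_left_commute [of K])
    also have "\<dots> = eqs K ps \<star> (eq K i j \<star> proj K j)"
      using ij by (simp add: eq_meet_proj_left eq_meet_proj_right)
    also have "\<dots> = eqs K (p # ps) \<star> proj K j"
      using True ij ps by (simp add: meet_assoc [of K] meet_left_commute [of K])
    finally show ?thesis .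
  next
    case False
    then show ?thesis using Cons p ps ij by (auto simp: meet_assoc [of K])
  qed
qed simp

lemma eqs_meet_proj:
  assumes "set ps \<subseteq> {..<K} \<times> {..<K}" "(i, j) \<in> eqv ps"
  shows "eqs K ps \<star> proj K i = eqs K ps \<star> proj K j"
  by (rule eqv_least [OF _ _ _ _ assms(2), of "\<lambda>i j. eqs K ps \<star> proj K i = eqs K ps \<star> proj K j"])
    (use assms(1) in \<open>auto intro: eqs_meet_proj_mem\<close>)

lemma eqs_meet_sel:
  assumes "set ps \<subseteq> {..<K} \<times> {..<K}" "list_all2 (\<lambda>i j. (i, j) \<in> eqv ps) s t" "set s \<subseteq> {..<K}" "set t \<subseteq> {..<K}"
  shows "eqs K ps \<star> sel K s = eqs K ps \<star> sel K t"
proof (rule meet_sel_cong)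
  show "list_all2 (\<lambda>a b. eqs K ps \<star> proj K a = eqs K ps \<star> proj K b) s t"
    by (rule list_all2_mono [OF assms(2)]) (simp add: eqs_meet_proj assms(1))
qed (use assms in auto)

lemma eqs_meet_eq:
  assumes "set ps \<subseteq> {..<K} \<times> {..<K}" "(i, j) \<in> eqv ps" "i < K" "j < K"
  shows "eqs K ps \<star> eq K i j = eqs K ps"
proof -
  have "eqs K ps \<star> eq K i j = (eqs K ps \<star> sel K [i, j]) \<cdot> (M \<cdot> E)"
    using assms by (simp add: eq_def meet_sq [of K] del: sel.simps)
  also have "eqs K ps \<star> sel K [i, j] = eqs K ps \<star> sel K [j, j]"
    using assms by (intro eqs_meet_sel) auto
  also have "\<dots> \<cdot> (M \<cdot> E) = eqs K ps \<star> eq K j j"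
    using assms by (simp add: eq_def meet_sq [of K] del: sel.simps)
  finally show ?thesis using assms by (simp add: eq_same meet_dc)
qed

lemma eqs_meet_eqs:
  assumes "set ps \<subseteq> {..<K} \<times> {..<K}" "set qs \<subseteq> {..<K} \<times> {..<K}" "set qs \<subseteq> eqv ps"
  shows "eqs K ps \<star> eqs K qs = eqs K ps"
  using assms(2-)
proof (induction qs)
  case (Cons q qs)
  then have "eqs K ps \<star> eqs K (q # qs) = (eqs K ps \<star> eq K (fst q) (snd q)) \<star> eqs K qs"
    using assms(1) by (auto simp: meet_assoc [of K "eqs K ps"])
  then show ?case using Cons assms(1) by (auto simp: eqs_meet_eq)
qed (use assms in \<open>simp add: meet_dc\<close>)

lemma eqs_eqI:
  assumes "set ps \<subseteq> {..<K} \<times> {..<K}" "set qs \<subseteq> {..<K} \<times> {..<K}" "set qs \<subseteq> eqv ps" "set ps \<subseteq> eqv qs"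
  shows "eqs K ps = eqs K qs"
  using eqs_meet_eqs [of ps K qs] eqs_meet_eqs [of qs K ps] meet_commute [of K "eqs K ps" "eqs K qs"] assms
  by simp

lemma sel_sq_eqs:
  assumes "set u \<subseteq> {..<K}" "length u = n" "set ps \<subseteq> {..<n} \<times> {..<n}"
  shows "sel K u \<cdot> eqs n ps = eqs K (map (map_prod ((!) u) ((!) u)) ps)"
  using assms(3)
proof (induction ps)
  case Nil
  then show ?case using assms comap_dc [OF comap_sel [of u K], of n] by simp
next
  case (Cons p ps)
  obtain a b where p: "p = (a, b)" "a < n" "b < n" using Cons.prems by auto
  have "sel K u \<cdot> eq n a b = eq K (u ! a) (u ! b)"
    using assms(1,2) p sel_sq [of u K n "[a, b]"] sq_assoc [of "sel K u" "sel n [a, b]" "M \<cdot> E"]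
    by (simp add: eq_def del: sel.simps)
  then show ?case
    using Cons assms(1,2) p comap_meet [OF comap_sel [of u K], of n "eq n a b" "eqs n ps"] by simp
qed

end

context frobenius_prop
begin

declare cp.simps(2) [simp del] dc.simps(2) [simp del] nw.simps(2) [simp del] sel.simps(2) [simp del]

lemma nw_1 [simp]: "nw (Suc 0) = N"
  by (simp add: nw.simps(2) pr_I0)

lemma N_unit_right: "(I 1 \<odot> N) \<cdot> M = I 1"
proof -
  have "(I 1 \<odot> N) \<cdot> (sw 1 1 \<cdot> M) = ((I 1 \<odot> N) \<cdot> sw 1 1) \<cdot> M" by (simp add: sq_assoc)
  also have "(I 1 \<odot> N) \<cdot> sw 1 1 = N \<odot> I 1"
    using sw_natural [of "I 1" N 1 1] by (simp add: sw_0_right I_sq)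
  finally show ?thesis unfolding M_comm M_unit .
qed

lemma I_dc: "I K \<odot> dc k = sel (K + k) [0..<K]"
  using sel_pr [of "[0..<K]" K "[]" k] by (simp add: sel_id)

lemma dc_I: "dc k \<odot> I K = sel (k + K) [k..<k + K]"
  using sel_pr [of "[]" k "[0..<K]" K] by (simp add: sel_id map_add_upt')

lemma sel_pr_I: "set s \<subseteq> {..<K} \<Longrightarrow> sel K s \<odot> I k = sel (K + k) (s @ [K..<K + k])"
  using sel_pr [of s K "[0..<k]" k] by (simp add: sel_id map_add_upt')

lemma I_pr_sel: "set s \<subseteq> {..<k} \<Longrightarrow> I K \<odot> sel k s = sel (K + k) ([0..<K] @ map ((+) K) s)"
  using sel_pr [of "[0..<K]" K s k] by (simp add: sel_id)

lemma cp_weaken: "cp (K + k) \<cdot> ((I K \<odot> dc k) \<odot> I (K + k)) = cp K \<odot> I k"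
proof -
  have "cp (K + k) \<cdot> ((I K \<odot> dc k) \<odot> I (K + k)) = sel (K + k) ([0..<K] @ [0..<K + k])"
    by (simp add: I_dc sel_append sel_id)
  also have "\<dots> = cp K \<odot> I k"
    by (simp add: cp_sel sel_pr_I upt_add_eq_append [of 0 K])
  finally show ?thesis .
qed

lemma cp_weaken_left: "cp (p + K) \<cdot> (I (p + K) \<odot> (dc p \<odot> I K)) = I p \<odot> cp K"
proof -
  have "cp (p + K) \<cdot> (I (p + K) \<odot> (dc p \<odot> I K)) = sel (p + K) ([0..<p + K] @ [p..<p + K])"
    by (simp add: dc_I sel_append sel_id)
  also have "\<dots> = I p \<odot> cp K"
    by (simp add: cp_sel I_pr_sel upt_add_eq_append [of 0 p] map_add_upt')
  finally show ?thesis .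
qed

text \<open>The weakening of an effect to \<open>k\<close> further variables is precomposition with \<open>I K \<odot> dc k\<close>.\<close>

lemma meet_pr:
  assumes "eff K e" "V f" "dm f = K" "V g" "dm g = k"
  shows "(e \<star> f) \<odot> g = ((I K \<odot> dc k) \<cdot> e) \<star> (f \<odot> g)"
proof -
  have "((I K \<odot> dc k) \<cdot> e) \<star> (f \<odot> g) = (cp (K + k) \<cdot> ((I K \<odot> dc k) \<odot> I (K + k))) \<cdot> (e \<odot> f \<odot> g)"
    using assms interchange [of "I K \<odot> dc k" e "I (K + k)" "f \<odot> g"] by (simp add: meet_def I_sq sq_assoc)
  also have "\<dots> = (e \<star> f) \<odot> g"
    unfolding cp_weaken using assms interchange [of "cp K" "e \<odot> f" "I k" g]
    by (simp add: meet_def I_sq pr_assoc)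
  finally show ?thesis by simp
qed

lemma pr_meet:
  assumes "eff K e" "V f" "dm f = K" "V g" "dm g = p"
  shows "g \<odot> (e \<star> f) = ((dc p \<odot> I K) \<cdot> e) \<star> (g \<odot> f)"
proof -
  have "((dc p \<odot> I K) \<cdot> e) \<star> (g \<odot> f) = cp (p + K) \<cdot> ((g \<odot> f) \<odot> ((dc p \<odot> I K) \<cdot> e))"
    using assms by (intro meet_swap) (auto simp: eff_def [of "p + K"])
  also have "\<dots> = (cp (p + K) \<cdot> (I (p + K) \<odot> (dc p \<odot> I K))) \<cdot> (g \<odot> f \<odot> e)"
    using assms interchange [of "I (p + K)" "g \<odot> f" "dc p \<odot> I K" e] by (simp add: I_sq sq_assoc pr_assoc)
  also have "\<dots> = g \<odot> (e \<star> f)"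
    unfolding cp_weaken_left using assms interchange [of "I p" g "cp K" "f \<odot> e"]
    by (simp add: meet_swap I_sq)
  finally show ?thesis by simp
qed

lemma ex_meet:
  assumes "eff K e" "V g" "dm g = K + k"
  shows "(I K \<odot> nw k) \<cdot> (((I K \<odot> dc k) \<cdot> e) \<star> g) = e \<star> ((I K \<odot> nw k) \<cdot> g)"
proof -
  have "((I K \<odot> dc k) \<cdot> e) \<star> g = (cp (K + k) \<cdot> ((I K \<odot> dc k) \<odot> I (K + k))) \<cdot> (e \<odot> g)"
    using assms interchange [of "I K \<odot> dc k" e "I (K + k)" g] by (simp add: meet_def I_sq sq_assoc)
  then have "(I K \<odot> nw k) \<cdot> (((I K \<odot> dc k) \<cdot> e) \<star> g) = ((I K \<odot> nw k) \<cdot> (cp K \<odot> I k)) \<cdot> (e \<odot> g)"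
    unfolding cp_weaken using assms by (simp add: sq_assoc)
  also have "(I K \<odot> nw k) \<cdot> (cp K \<odot> I k) = cp K \<cdot> (I K \<odot> (I K \<odot> nw k))"
    using pr_eq_sq [of "cp K" "nw k"] interchange [of "I K" "cp K" "nw k" "I k"]
    by (simp add: I_sq sq_I pr_I_assoc pr_I0)
  also have "\<dots> \<cdot> (e \<odot> g) = e \<star> ((I K \<odot> nw k) \<cdot> g)"
    using assms interchange [of "I K" e "I K \<odot> nw k" g] by (simp add: sq_assoc meet_def I_sq)
  finally show ?thesis .
qed

lemma ex_eq:
  assumes i: "i < K" and g: "V g" "dm g = Suc K"
  shows "(I K \<odot> N) \<cdot> (eq (Suc K) i K \<star> g) = sel K ([0..<K] @ [i]) \<cdot> g"
proof -
  let ?e = "eq (Suc K) i K"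
  have I: "I (Suc K) = cp (Suc K) \<cdot> (sel (Suc K) [0..<K] \<odot> sel (Suc K) [K])"
    using sel_append [of "[0..<K]" "Suc K" "[K]"] sel_id [of "Suc K"] by (simp)
  have "?e \<star> I (Suc K) = cp (Suc K) \<cdot> (sel (Suc K) [0..<K] \<odot> (?e \<star> sel (Suc K) [K]))"
    unfolding I using i by (subst meet_cp_right) auto
  also have "?e \<star> sel (Suc K) [K] = sel (Suc K) [i, K] \<cdot> M"
    using i eq_meet_proj_right [of i "Suc K" K] by (simp add: sel_single)
  also have "cp (Suc K) \<cdot> (sel (Suc K) [0..<K] \<odot> (sel (Suc K) [i, K] \<cdot> M)) =
     sel (Suc K) ([0..<K] @ [i, K]) \<cdot> (I K \<odot> M)"
    using i interchange [of "sel (Suc K) [0..<K]" "I K" "sel (Suc K) [i, K]" M] sel_append [of "[0..<K]" "Suc K" "[i, K]"]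
    by (simp add: sq_I sq_assoc)
  also have "sel (Suc K) ([0..<K] @ [i, K]) = sel K ([0..<K] @ [i]) \<odot> I 1"
    using i sel_pr_I [of "[0..<K] @ [i]" K 1] by (simp)
  finally have e: "?e \<star> I (Suc K) = (sel K ([0..<K] @ [i]) \<odot> I 1) \<cdot> (I K \<odot> M)" .
  have N: "(I K \<odot> N) \<cdot> (sel K ([0..<K] @ [i]) \<odot> I 1) = sel K ([0..<K] @ [i]) \<cdot> (I K \<odot> (I 1 \<odot> N))"
  proof -
    have "(I K \<odot> N) \<cdot> (sel K ([0..<K] @ [i]) \<odot> I 1) = sel K ([0..<K] @ [i]) \<odot> N"
      using i by (simp add: interchange [symmetric] I_sq sq_I)
    also have "\<dots> = sel K ([0..<K] @ [i]) \<cdot> (I (K + 1) \<odot> N)"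
      using i pr_eq_sq [of "sel K ([0..<K] @ [i])" N] by (simp add: pr_I0)
    finally show ?thesis by (simp add: pr_I_assoc)
  qed
  have "(I K \<odot> N) \<cdot> (?e \<star> I (Suc K)) = (sel K ([0..<K] @ [i]) \<cdot> (I K \<odot> (I 1 \<odot> N))) \<cdot> (I K \<odot> M)"
    unfolding e N [symmetric] using i by (simp add: sq_assoc)
  also have "\<dots> = sel K ([0..<K] @ [i])"
  proof -
    have "(I K \<odot> (I 1 \<odot> N)) \<cdot> (I K \<odot> M) = I (Suc K)"
      using I_pr_sq [of "I 1 \<odot> N" M K] unfolding N_unit_right by (simp add: I_pr_I)
    then show ?thesis using i by (simp add: sq_assoc sq_I)
  qed
  finally have *: "(I K \<odot> N) \<cdot> (?e \<star> I (Suc K)) = sel K ([0..<K] @ [i])" .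
  have "(I K \<odot> N) \<cdot> (?e \<star> g) = ((I K \<odot> N) \<cdot> (?e \<star> I (Suc K))) \<cdot> g"
    using i g meet_sq [of "Suc K" ?e "I (Suc K)" g] by (simp add: sq_assoc I_sq)
  then show ?thesis unfolding * .
qed

lemma eqs_weaken: "set ps \<subseteq> {..<K} \<times> {..<K} \<Longrightarrow> (I K \<odot> dc k) \<cdot> eqs K ps = eqs (K + k) ps"
  by (simp add: I_dc sel_sq_eqs) (rule arg_cong [where f = "eqs _"], rule map_idI, auto)

lemma eff_weaken [simp]: "eff K e \<Longrightarrow> eff (K + k) ((I K \<odot> dc k) \<cdot> e)"
  by (simp add: eff_def [of "K + k"])

lemma set_zip_lessThan: "\<lbrakk>set s \<subseteq> {..<K}; set t \<subseteq> {..<K}\<rbrakk> \<Longrightarrow> set (zip s t) \<subseteq> {..<K} \<times> {..<K}"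
  by (auto dest: set_zip_leftD set_zip_rightD)

text \<open>The one-point rule: an existential variable that is equated to another one is eliminated.\<close>

lemma ex_eqs:
  assumes "set s \<subseteq> {..<K}" "length s = m" "V g" "dm g = K + m"
  shows "(I K \<odot> nw m) \<cdot> (eqs (K + m) (zip s [K..<K + m]) \<star> g) = sel K ([0..<K] @ s) \<cdot> g"
  using assms
proof (induction s arbitrary: m g rule: rev_induct)
  case Nil
  then show ?case by (simp add: I_pr_I dc_meet sel_id)
next
  case (snoc i s)
  then obtain l where m: "m = Suc l" and l: "length s = l" and i: "i < K" and s: "set s \<subseteq> {..<K}" by auto
  let ?z = "zip s [K..<K + l]"
  have z: "set ?z \<subseteq> {..<K + l} \<times> {..<K + l}"
    using s by (intro set_zip_lessThan) auto
  then have z': "set ?z \<subseteq> {..<K + m} \<times> {..<K + m}" using m by auto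
  have w: "eff (Suc (K + l)) ((I (K + l) \<odot> dc (Suc 0)) \<cdot> eqs (K + l) ?z)"
    using eff_weaken [of "K + l" "eqs (K + l) ?z" 1] z by simp
  have "eqs (K + m) (zip (s @ [i]) [K..<K + m]) = eqs (K + m) ?z \<star> eq (K + m) i (K + l)"
    using z' i l m by (simp add: eqs_append meet_dc)
  also have "eqs (K + m) ?z = (I (K + l) \<odot> dc 1) \<cdot> eqs (K + l) ?z"
    using eqs_weaken [OF z, of 1] m by simp
  finally have 1: "eqs (K + m) (zip (s @ [i]) [K..<K + m]) \<star> g =
      ((I (K + l) \<odot> dc 1) \<cdot> eqs (K + l) ?z) \<star> (eq (Suc (K + l)) i (K + l) \<star> g)"
    using w i m snoc.prems meet_assoc [of "K + m" "(I (K + l) \<odot> dc 1) \<cdot> eqs (K + l) ?z" "eq (K + m) i (K + l)" g]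
    by simp
  have 2: "I K \<odot> nw m = (I K \<odot> nw l) \<cdot> (I (K + l) \<odot> nw 1)"
    using pr_eq_sq [of "nw l" "nw 1"] nw_add [of l 1] I_pr_sq [of "nw l" "I l \<odot> nw 1" K] m
    by (simp add: pr_I_assoc pr_I0)
  have "(I K \<odot> nw m) \<cdot> (eqs (K + m) (zip (s @ [i]) [K..<K + m]) \<star> g) =
     (I K \<odot> nw l) \<cdot> ((I (K + l) \<odot> nw 1) \<cdot> (((I (K + l) \<odot> dc 1) \<cdot> eqs (K + l) ?z) \<star> (eq (Suc (K + l)) i (K + l) \<star> g)))"
    unfolding 1 2 using w i m snoc.prems by (subst sq_assoc) auto
  also have "\<dots> = (I K \<odot> nw l) \<cdot> (eqs (K + l) ?z \<star> ((I (K + l) \<odot> N) \<cdot> (eq (Suc (K + l)) i (K + l) \<star> g)))"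
    using ex_meet [of "K + l" "eqs (K + l) ?z" "eq (Suc (K + l)) i (K + l) \<star> g" 1] z i m snoc.prems
    by (simp add: pr_I0)
  also have "\<dots> = (I K \<odot> nw l) \<cdot> (eqs (K + l) ?z \<star> (sel (K + l) ([0..<K + l] @ [i]) \<cdot> g))"
    using ex_eq [of i "K + l" g] i m snoc.prems by simp
  also have "\<dots> = sel K ([0..<K] @ s) \<cdot> (sel (K + l) ([0..<K + l] @ [i]) \<cdot> g)"
    using snoc.prems i m l s by (intro snoc.IH) auto
  also have "\<dots> = (sel K ([0..<K] @ s) \<cdot> sel (K + l) ([0..<K + l] @ [i])) \<cdot> g"
    using snoc.prems i m l s by (subst sq_assoc) auto
  also have "sel K ([0..<K] @ s) \<cdot> sel (K + l) ([0..<K + l] @ [i]) = sel K ([0..<K] @ (s @ [i]))"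
  proof -
    have "map ((!) ([0..<K] @ s)) ([0..<K + l] @ [i]) = [0..<K] @ s @ [i]"
      using i l by (intro nth_equalityI) (auto simp: nth_append)
    then show ?thesis using i l s by (subst sel_sq) auto
  qed
  finally show ?case .
qed

definition cap :: "nat \<Rightarrow> 'a" where
  "cap m = eqs (m + m) (zip [0..<m] [m..<m + m])"

definition bend :: "'a \<Rightarrow> 'a" where
  "bend f = (f \<odot> I (cd f)) \<cdot> cap (cd f)"

lemma cap_sort [simp]: "V (cap m)" "dm (cap m) = m + m" "cd (cap m) = 0"
proof -
  have "set (zip [0..<m] [m..<m + m]) \<subseteq> {..<m + m} \<times> {..<m + m}"
    by (intro set_zip_lessThan) auto
  then show "V (cap m)" "dm (cap m) = m + m" "cd (cap m) = 0"
    unfolding cap_def by (auto simp del: set_zip)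
qed

lemma bend_sort [simp]: "V f \<Longrightarrow> V (bend f)" "V f \<Longrightarrow> dm (bend f) = dm f + cd f" "V f \<Longrightarrow> cd (bend f) = 0"
  by (simp_all add: bend_def)

lemma eff_bend [simp]: "V f \<Longrightarrow> dm f + cd f = K \<Longrightarrow> eff K (bend f)"
  by (simp add: eff_def [of K "bend f"])

lemma unbend:
  assumes "V f" "dm f = n" "cd f = m"
  shows "(I n \<odot> nw m) \<cdot> (bend f \<star> sel (n + m) [n..<n + m]) = f"
proof -
  have *: "bend f \<star> sel (n + m) [n..<n + m] = (f \<odot> I m) \<cdot> (I m \<odot> cp m) \<cdot> (cap m \<odot> I m)"
    if "V f" "dm f = n" "cd f = m" for f n
  proof -
    have "bend f \<star> sel (n + m) [n..<n + m] = cp (n + m) \<cdot> (bend f \<odot> (dc n \<odot> I m))"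
      using that by (simp add: meet_def dc_I bend_def)
    also have "\<dots> = (cp (n + m) \<cdot> (I (n + m) \<odot> (dc n \<odot> I m))) \<cdot> (bend f \<odot> I m)"
      using that interchange [of "I (n + m)" "bend f" "dc n \<odot> I m" "I m"] by (simp add: I_sq sq_I sq_assoc bend_def)
    also have "\<dots> = ((I n \<odot> cp m) \<cdot> (f \<odot> (I m \<odot> I m))) \<cdot> (cap m \<odot> I m)"
      unfolding cp_weaken_left using that sq_pr_I [of "f \<odot> I m" "cap m" m]
      by (simp add: bend_def sq_assoc pr_assoc)
    also have "(I n \<odot> cp m) \<cdot> (f \<odot> (I m \<odot> I m)) = (f \<odot> I m) \<cdot> (I m \<odot> cp m)"
      using that by (simp add: I_pr_I interchange [symmetric] I_sq sq_I)
    finally show ?thesis using that by (simp add: sq_assoc)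
  qed
  have "bend f \<star> sel (n + m) [n..<n + m] = (f \<odot> I m) \<cdot> (bend (I m) \<star> sel (m + m) [m..<m + m])"
    using * [OF assms] * [of "I m" m] by (simp add: I_pr_I I_sq)
  moreover have "(I n \<odot> nw m) \<cdot> (f \<odot> I m) = f \<cdot> (I m \<odot> nw m)"
    using assms interchange [of "I n" f "nw m" "I m"] pr_eq_sq [of f "nw m"] by (simp add: I_sq sq_I pr_I0)
  ultimately have "(I n \<odot> nw m) \<cdot> (bend f \<star> sel (n + m) [n..<n + m])
      = f \<cdot> ((I m \<odot> nw m) \<cdot> (bend (I m) \<star> sel (m + m) [m..<m + m]))"
    using assms sq_assoc [of "I n \<odot> nw m" "f \<odot> I m" "bend (I m) \<star> sel (m + m) [m..<m + m]"]
      sq_assoc [of f "I m \<odot> nw m" "bend (I m) \<star> sel (m + m) [m..<m + m]"] by simp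
  also have "(I m \<odot> nw m) \<cdot> (bend (I m) \<star> sel (m + m) [m..<m + m]) = sel m ([0..<m] @ [0..<m]) \<cdot> sel (m + m) [m..<m + m]"
  proof -
    have "bend (I m) = cap m" by (simp add: bend_def I_pr_I I_sq)
    then show ?thesis
      using ex_eqs [of "[0..<m]" m m "sel (m + m) [m..<m + m]"] by (simp add: cap_def)
  qed
  also have "\<dots> = I m"
    by (subst sel_sq) (auto simp: map_nth_upt_add sel_id)
  finally show ?thesis using assms by (simp add: sq_I)
qed

end


section \<open>Conjunctive queries and their normal form\<close>

text \<open>Variables are natural numbers; \<open>(R, s, t)\<close> is the atom \<open>R(s, t)\<close>.\<close>

type_synonym 's ratom = "'s \<times> nat list \<times> nat list"

definition ren :: "(nat \<Rightarrow> nat) \<Rightarrow> 's ratom \<Rightarrow> 's ratom" where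
  "ren h = (\<lambda>(R, s, t). (R, map h s, map h t))"

definition wf_rel :: "'s msig \<Rightarrow> nat \<Rightarrow> 's ratom \<Rightarrow> bool" where
  "wf_rel \<Sigma> K = (\<lambda>(R, s, t). R \<in> symbols \<Sigma> \<and> length s = ar \<Sigma> R \<and> length t = coar \<Sigma> R \<and>
     set s \<subseteq> {..<K} \<and> set t \<subseteq> {..<K})"

definition wf_body :: "'s msig \<Rightarrow> nat \<Rightarrow> (nat \<times> nat) list \<Rightarrow> 's ratom list \<Rightarrow> nat list \<Rightarrow> bool" where
  "wf_body \<Sigma> K es rs t \<longleftrightarrow> set es \<subseteq> {..<K} \<times> {..<K} \<and> (\<forall>r\<in>set rs. wf_rel \<Sigma> K r) \<and> set t \<subseteq> {..<K}"

lemma wf_ren: "\<lbrakk>wf_rel \<Sigma> n r; \<And>i. i < n \<Longrightarrow> h i < K\<rbrakk> \<Longrightarrow> wf_rel \<Sigma> K (ren h r)"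
  by (auto simp: wf_rel_def ren_def subset_iff)

lemma wf_rel_mono: "wf_rel \<Sigma> n r \<Longrightarrow> n \<le> K \<Longrightarrow> wf_rel \<Sigma> K r"
  by (force simp: wf_rel_def)

lemma wf_body_ren:
  "\<lbrakk>wf_body \<Sigma> n es rs t; \<And>i. i < n \<Longrightarrow> h i < K\<rbrakk> \<Longrightarrow> wf_body \<Sigma> K (map (map_prod h h) es) (map (ren h) rs) (map h t)"
  by (auto simp: wf_body_def subset_iff intro: wf_ren)

lemma wf_body_mono: "wf_body \<Sigma> n es rs t \<Longrightarrow> n \<le> K \<Longrightarrow> wf_body \<Sigma> K es rs t"
  by (force simp: wf_body_def intro: wf_rel_mono)

lemma ren_cong: "wf_rel \<Sigma> n r \<Longrightarrow> (\<And>i. i < n \<Longrightarrow> h i = h' i) \<Longrightarrow> ren h r = ren h' r"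
  by (auto simp: wf_rel_def ren_def subset_iff)

lemma ren_id: "ren (\<lambda>i. i) r = r"
  by (auto simp: ren_def)

lemma body_cong:
  assumes "wf_body \<Sigma> n es rs t" "\<And>i. i < n \<Longrightarrow> h i = h' i"
  shows "map (map_prod h h) es = map (map_prod h' h') es" "map (ren h) rs = map (ren h') rs" "map h t = map h' t"
  using assms by (auto simp: wf_body_def subset_iff intro: ren_cong)

locale query_prop = frobenius_prop V dm cd sq pr I sw C E M N
  for V :: "'a \<Rightarrow> bool" and dm and cd and sq (infixr "\<cdot>" 65) and pr (infixr "\<odot>" 70) and I and sw and C and E and M and N +
  fixes \<Sigma> :: "'s msig" and S :: "'s \<Rightarrow> 'a"
  assumes S_sort [simp]: "R \<in> symbols \<Sigma> \<Longrightarrow> V (S R)" "R \<in> symbols \<Sigma> \<Longrightarrow> dm (S R) = ar \<Sigma> R"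
    "R \<in> symbols \<Sigma> \<Longrightarrow> cd (S R) = coar \<Sigma> R"
begin

definition ratom :: "nat \<Rightarrow> 's ratom \<Rightarrow> 'a" where
  "ratom K = (\<lambda>(R, s, t). sel K (s @ t) \<cdot> bend (S R))"

primrec rels :: "nat \<Rightarrow> 's ratom list \<Rightarrow> 'a" where
  "rels K [] = dc K"
| "rels K (r # rs) = ratom K r \<star> rels K rs"

lemma eff_ratom [simp]: "wf_rel \<Sigma> K r \<Longrightarrow> eff K (ratom K r)"
  by (cases r) (simp add: ratom_def wf_rel_def)

lemma ratom_sort [simp]:
  assumes "wf_rel \<Sigma> K r"
  shows "V (ratom K r)" "dm (ratom K r) = K" "cd (ratom K r) = 0"
  using eff_ratom [OF assms] by simp_all

lemma eff_rels [simp]: "\<forall>r\<in>set rs. wf_rel \<Sigma> K r \<Longrightarrow> eff K (rels K rs)"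
  by (induction rs) auto

lemma rels_sort [simp]:
  assumes "\<forall>r\<in>set rs. wf_rel \<Sigma> K r"
  shows "V (rels K rs)" "dm (rels K rs) = K" "cd (rels K rs) = 0"
  using eff_rels [OF assms] by simp_all

lemma rels_append:
  "\<lbrakk>\<forall>r\<in>set rs. wf_rel \<Sigma> K r; \<forall>r\<in>set rs'. wf_rel \<Sigma> K r\<rbrakk> \<Longrightarrow> rels K (rs @ rs') = rels K rs \<star> rels K rs'"
  by (induction rs) (simp_all add: dc_meet [of _ K] meet_assoc [of K])

lemma rels_mset:
  assumes "\<forall>r\<in>set rs. wf_rel \<Sigma> K r" "mset rs = mset rs'"
  shows "rels K rs = rels K rs'"
  using assms
proof (induction rs arbitrary: rs')
  case (Cons r rs)
  have "r \<in> set rs'" using Cons.prems(2) by (metis list.set_intros(1) set_mset_mset)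
  then obtain as bs where rs': "rs' = as @ r # bs" by (meson split_list)
  then have m: "mset rs = mset (as @ bs)" using Cons.prems(2) by simp
  then have wf: "\<forall>r\<in>set as. wf_rel \<Sigma> K r" "\<forall>r\<in>set bs. wf_rel \<Sigma> K r" "wf_rel \<Sigma> K r"
    using Cons.prems(1) mset_eq_setD [OF m] by auto
  have "rels K rs = rels K (as @ bs)" using Cons.IH [OF _ m] Cons.prems(1) by simp
  then show ?case using wf unfolding rs' by (simp add: rels_append meet_left_commute [of K "rels K as"])
qed simp

lemma sel_sq_ratom:
  assumes "set u \<subseteq> {..<K}" "length u = n" "wf_rel \<Sigma> n r"
  shows "sel K u \<cdot> ratom n r = ratom K (ren ((!) u) r)"
proof -
  obtain R s t where r: "r = (R, s, t)" by (cases r)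
  have "sel K u \<cdot> (sel n (s @ t) \<cdot> bend (S R)) = (sel K u \<cdot> sel n (s @ t)) \<cdot> bend (S R)"
    using assms r by (intro sq_assoc [symmetric]) (auto simp: wf_rel_def)
  also have "sel K u \<cdot> sel n (s @ t) = sel K (map ((!) u) s @ map ((!) u) t)"
    using assms r by (subst sel_sq) (auto simp: wf_rel_def)
  finally show ?thesis by (simp add: ratom_def r ren_def)
qed

lemma sel_sq_rels:
  assumes "set u \<subseteq> {..<K}" "length u = n" "\<forall>r\<in>set rs. wf_rel \<Sigma> n r"
  shows "sel K u \<cdot> rels n rs = rels K (map (ren ((!) u)) rs)"
  using assms(3)
proof (induction rs)
  case Nil
  then show ?case using assms comap_dc [OF comap_sel [of u K], of n] by simp
next
  case (Cons r rs)
  then show ?case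
    using assms(1,2) comap_meet [OF comap_sel [of u K], of n "ratom n r" "rels n rs"]
    by (simp add: sel_sq_ratom)
qed

definition body :: "nat \<Rightarrow> (nat \<times> nat) list \<Rightarrow> 's ratom list \<Rightarrow> nat list \<Rightarrow> 'a" where
  "body K es rs t = eqs K es \<star> (rels K rs \<star> sel K t)"

lemma body_sort [simp]:
  assumes "wf_body \<Sigma> K es rs t"
  shows "V (body K es rs t)" "dm (body K es rs t) = K" "cd (body K es rs t) = length t"
  using assms by (auto simp: body_def wf_body_def)

lemma sel_sq_body:
  assumes "set u \<subseteq> {..<K}" "length u = n" "wf_body \<Sigma> n es rs t"
  shows "sel K u \<cdot> body n es rs t = body K (map (map_prod ((!) u) ((!) u)) es) (map (ren ((!) u)) rs) (map ((!) u) t)"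
  using assms comap_sel [of u K] unfolding body_def wf_body_def
  by (simp add: comap_meet [of _ n] sel_sq_eqs sel_sq_rels sel_sq)

lemma sel_sq_body':
  assumes "wf_body \<Sigma> n es rs t" "\<And>i. i < n \<Longrightarrow> h i < K"
  shows "sel K (map h [0..<n]) \<cdot> body n es rs t = body K (map (map_prod h h) es) (map (ren h) rs) (map h t)"
proof -
  have "sel K (map h [0..<n]) \<cdot> body n es rs t = body K (map (map_prod ((!) (map h [0..<n])) ((!) (map h [0..<n]))) es)
      (map (ren ((!) (map h [0..<n]))) rs) (map ((!) (map h [0..<n])) t)"
    using assms by (intro sel_sq_body) auto
  then show ?thesis
    using body_cong [OF assms(1), of "(!) (map h [0..<n])" h] by simp
qed

text \<open>The normal form: \<open>n\<close> input variables, \<open>k\<close> existential ones, a conjunction of equations \<open>es\<close>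
  and atoms \<open>rs\<close>, and the output variables \<open>t\<close>.\<close>

definition nf :: "nat \<Rightarrow> nat \<Rightarrow> (nat \<times> nat) list \<Rightarrow> 's ratom list \<Rightarrow> nat list \<Rightarrow> 'a" where
  "nf n k es rs t = (I n \<odot> nw k) \<cdot> body (n + k) es rs t"

lemma nf_sort [simp]:
  assumes "wf_body \<Sigma> (n + k) es rs t"
  shows "V (nf n k es rs t)" "dm (nf n k es rs t) = n" "cd (nf n k es rs t) = length t"
  using assms by (auto simp: nf_def)

lemma body_meet_ex:
  assumes "wf_body \<Sigma> K es rs []" "V g" "dm g = K + k"
  shows "eqs K es \<star> (rels K rs \<star> ((I K \<odot> nw k) \<cdot> g)) = (I K \<odot> nw k) \<cdot> (eqs (K + k) es \<star> (rels (K + k) rs \<star> g))"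
proof -
  have wf: "set es \<subseteq> {..<K} \<times> {..<K}" "\<forall>r\<in>set rs. wf_rel \<Sigma> K r" "\<forall>r\<in>set rs. wf_rel \<Sigma> (K + k) r"
    using assms by (auto simp: wf_body_def intro: wf_rel_mono)
  have "(I K \<odot> dc k) \<cdot> rels K rs = rels (K + k) rs"
    using wf by (simp add: I_dc sel_sq_rels)
      (rule arg_cong [where f = "rels _"], rule map_idI, auto intro: trans [OF ren_cong ren_id])
  then show ?thesis
    using wf assms ex_meet [of K "rels K rs" g k] ex_meet [of K "eqs K es" "rels (K + k) rs \<star> g" k]
    by (simp add: eqs_weaken)
qed

lemma I_pr_nw_add: "I n \<odot> nw (k + k') = (I n \<odot> nw k) \<cdot> (I (n + k) \<odot> nw k')"
  using pr_eq_sq [of "nw k" "nw k'"] nw_add [of k k'] I_pr_sq [of "nw k" "I k \<odot> nw k'" n]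
  by (simp add: pr_I_assoc pr_I0)

lemma nf_sq:
  assumes "wf_body \<Sigma> (n + k) es rs t" "length t = z" "wf_body \<Sigma> (z + k') es' rs' t'"
  defines "u \<equiv> t @ [n + k..<n + k + k']"
  shows "nf n k es rs t \<cdot> nf z k' es' rs' t' = nf n (k + k') (es @ map (map_prod ((!) u) ((!) u)) es')
     (rs @ map (ren ((!) u)) rs') (map ((!) u) t')"
proof -
  let ?K = "n + k"
  let ?B = "body (z + k') es' rs' t'"
  let ?es = "map (map_prod ((!) u) ((!) u)) es'" and ?rs = "map (ren ((!) u)) rs'" and ?t = "map ((!) u) t'"
  have t: "set t \<subseteq> {..<?K}" and es: "set es \<subseteq> {..<?K} \<times> {..<?K}" and rs: "\<forall>r\<in>set rs. wf_rel \<Sigma> ?K r"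
    and wf0: "wf_body \<Sigma> ?K es rs []"
    using assms(1) by (auto simp: wf_body_def)
  have u: "set u \<subseteq> {..<?K + k'}" "length u = z + k'"
    using t assms(2) by (auto simp: u_def)
  have wf': "wf_body \<Sigma> (?K + k') ?es ?rs ?t"
    using assms(3) u by (intro wf_body_ren) (auto intro: nth_lessThan)
  then have wf'': "set ?es \<subseteq> {..<?K + k'} \<times> {..<?K + k'}" "\<forall>r\<in>set ?rs. wf_rel \<Sigma> (?K + k') r"
    "set ?t \<subseteq> {..<?K + k'}"
    unfolding wf_body_def by blast+
  have "sel ?K t \<cdot> ((I z \<odot> nw k') \<cdot> ?B) = (I ?K \<odot> nw k') \<cdot> ((sel ?K t \<odot> I k') \<cdot> ?B)"
    using t assms(2,3) pr_eq_sq [of "sel ?K t" "nw k'"] interchange [of "I ?K" "sel ?K t" "nw k'" "I k'"]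
    by (simp add: sq_assoc [symmetric] pr_I0 I_sq sq_I)
  also have "(sel ?K t \<odot> I k') \<cdot> ?B = body (?K + k') ?es ?rs ?t"
    using t u assms(3) by (simp add: sel_pr_I u_def [symmetric] sel_sq_body)
  finally have 1: "sel ?K t \<cdot> nf z k' es' rs' t' = (I ?K \<odot> nw k') \<cdot> body (?K + k') ?es ?rs ?t"
    by (simp add: nf_def)
  have es2: "set es \<subseteq> {..<?K + k'} \<times> {..<?K + k'}" and rs2: "\<forall>r\<in>set rs. wf_rel \<Sigma> (?K + k') r"
    using es rs by (auto intro: wf_rel_mono)
  have "body ?K es rs t \<cdot> nf z k' es' rs' t' = eqs ?K es \<star> (rels ?K rs \<star> (sel ?K t \<cdot> nf z k' es' rs' t'))"
    using es rs t assms(2,3) by (simp add: body_def meet_sq [of ?K])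
  also have "\<dots> = (I ?K \<odot> nw k') \<cdot> (eqs (?K + k') es \<star> (rels (?K + k') rs \<star> body (?K + k') ?es ?rs ?t))"
    unfolding 1 using wf0 wf' by (intro body_meet_ex) simp_all
  also have "eqs (?K + k') es \<star> (rels (?K + k') rs \<star> body (?K + k') ?es ?rs ?t) = body (?K + k') (es @ ?es) (rs @ ?rs) ?t"
    unfolding body_def using es2 rs2 wf''
    by (simp add: eqs_append rels_append meet_assoc [of "?K + k'"] meet_left_commute [of "?K + k'" "rels (?K + k') rs"]
        del: set_map)
  finally have "nf n k es rs t \<cdot> nf z k' es' rs' t' = (I n \<odot> nw k) \<cdot> ((I ?K \<odot> nw k') \<cdot> body (?K + k') (es @ ?es) (rs @ ?rs) ?t)"
    using assms(1-3) by (simp add: nf_def sq_assoc)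
  moreover have "wf_body \<Sigma> (?K + k') (es @ ?es) (rs @ ?rs) ?t"
    using es2 rs2 wf'' by (auto simp: wf_body_def)
  ultimately show ?thesis
    using I_pr_nw_add [of n k k'] by (simp add: nf_def sq_assoc add.assoc)
qed

definition representable :: "'a \<Rightarrow> bool" where
  "representable f \<longleftrightarrow> (\<exists>n k es rs t. wf_body \<Sigma> (n + k) es rs t \<and> f = nf n k es rs t)"

lemma representable_sq:
  assumes "representable f" "representable g" "cd f = dm g"
  shows "representable (f \<cdot> g)"
proof -
  obtain n k es rs t where f: "wf_body \<Sigma> (n + k) es rs t" "f = nf n k es rs t"
    using assms(1) by (auto simp: representable_def)
  obtain n' k' es' rs' t' where g: "wf_body \<Sigma> (n' + k') es' rs' t'" "g = nf n' k' es' rs' t'"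
    using assms(2) by (auto simp: representable_def)
  have z: "length t = n'" using assms(3) f g by simp
  let ?u = "t @ [n + k..<n + k + k']"
  have "set ?u \<subseteq> {..<n + k + k'}" using f(1) by (auto simp: wf_body_def)
  then have "wf_body \<Sigma> (n + k + k') (map (map_prod ((!) ?u) ((!) ?u)) es') (map (ren ((!) ?u)) rs') (map ((!) ?u) t')"
    using g(1) z by (intro wf_body_ren) (auto intro!: nth_lessThan simp del: nth_append)
  then have "wf_body \<Sigma> (n + (k + k')) (es @ map (map_prod ((!) ?u) ((!) ?u)) es')
     (rs @ map (ren ((!) ?u)) rs') (map ((!) ?u) t')"
    using wf_body_mono [OF f(1), of "n + (k + k')"] by (auto simp: wf_body_def add.assoc)
  then show ?thesis
    unfolding representable_def using nf_sq [OF f(1) z g(1)] f(2) g(2) by blast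
qed

lemma representable_nfI: "wf_body \<Sigma> (n + k) es rs t \<Longrightarrow> representable (nf n k es rs t)"
  unfolding representable_def by blast

lemma sel_eq_nf: "set t \<subseteq> {..<K} \<Longrightarrow> sel K t = nf K 0 [] [] t"
  by (simp add: nf_def body_def dc_meet [of _ K] I_pr_I I_sq)

lemma representable_sel: "set t \<subseteq> {..<K} \<Longrightarrow> representable (sel K t)"
  by (simp add: sel_eq_nf) (rule representable_nfI, auto simp: wf_body_def)

lemma representable_N: "representable N"
proof -
  have "nf 0 1 [] [] [0] = N"
    using sel_1_0 by (simp add: nf_def body_def dc_meet [of _ 1] dc_meet [of _ "Suc 0"] I0_pr sq_I)
  then show ?thesis using representable_nfI [of 0 1 "[]" "[]" "[0]"] by (simp add: wf_body_def)
qed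

lemma representable_M: "representable M"
proof -
  have "sel 2 [0, 1] = I 2" using sel_id [of 2] by (simp add: upt_rec)
  then have "nf 2 0 [(0, 1)] [] [0] = M"
    using eq_meet_proj_left [of 0 2 1]
    by (simp add: nf_def body_def meet_dc dc_meet [of _ 2] sel_single I_pr_I I_sq)
  then show ?thesis using representable_nfI [of 2 0 "[(0, 1)]" "[]" "[0]"] by (simp add: wf_body_def)
qed

lemma representable_S:
  assumes "R \<in> symbols \<Sigma>"
  shows "representable (S R)"
proof -
  let ?n = "ar \<Sigma> R" and ?m = "coar \<Sigma> R"
  have "sel (?n + ?m) ([0..<?n] @ [?n..<?n + ?m]) = I (?n + ?m)"
    using sel_id [of "?n + ?m"] by (simp add: upt_add_eq_append [of 0 ?n])
  then have "nf ?n ?m [] [(R, [0..<?n], [?n..<?n + ?m])] [?n..<?n + ?m] = S R"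
    using assms unbend [of "S R" ?n ?m]
    by (simp add: nf_def body_def ratom_def I_sq meet_dc dc_meet [of _ "?n + ?m"])
  moreover have "wf_body \<Sigma> (?n + ?m) [] [(R, [0..<?n], [?n..<?n + ?m])] [?n..<?n + ?m]"
    using assms by (simp add: wf_body_def wf_rel_def)
  ultimately show ?thesis using representable_nfI by metis
qed

lemma representable_pr_I:
  assumes "representable f"
  shows "representable (f \<odot> I p)"
proof -
  obtain n k es rs t where wf: "wf_body \<Sigma> (n + k) es rs t" and f: "f = nf n k es rs t"
    using assms by (auto simp: representable_def)
  let ?K = "n + k"
  have es: "set es \<subseteq> {..<?K} \<times> {..<?K}" and rs: "\<forall>r\<in>set rs. wf_rel \<Sigma> ?K r" and t: "set t \<subseteq> {..<?K}"
    using wf by (auto simp: wf_body_def)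
  have rs': "\<forall>r\<in>set rs. wf_rel \<Sigma> (?K + p) r" using rs by (auto intro: wf_rel_mono)
  have w: "(I ?K \<odot> dc p) \<cdot> rels ?K rs = rels (?K + p) rs"
    using rs by (simp add: I_dc sel_sq_rels)
      (rule arg_cong [where f = "rels _"], rule map_idI, auto intro: trans [OF ren_cong ren_id])
  have "body ?K es rs t \<odot> I p = body (?K + p) es rs (t @ [?K..<?K + p])"
    using es rs t by (simp add: body_def meet_pr [of ?K] eqs_weaken w sel_pr_I)
  moreover have wf2: "wf_body \<Sigma> (?K + p) es rs (t @ [?K..<?K + p])"
    using wf wf_body_mono [OF wf, of "?K + p"] by (auto simp: wf_body_def)
  moreover have "(I n \<odot> nw k) \<odot> I p = (I (n + p) \<odot> nw k) \<cdot> (I n \<odot> sw p k)"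
    using sw_natural [of "I p" "nw k" p k] I_pr_sq [of "I p \<odot> nw k" "sw p k" n]
    by (simp add: sw_0_right I_sq pr_assoc pr_I_assoc)
  moreover have "I n \<odot> sw p k = sel (n + (p + k)) ([0..<n] @ map ((+) n) ([p..<p + k] @ [0..<p]))"
    by (simp add: sw_sel I_pr_sel)
  ultimately have "f \<odot> I p = (I (n + p) \<odot> nw k) \<cdot> (sel (n + p + k) ([0..<n] @ map ((+) n) ([p..<p + k] @ [0..<p]))
      \<cdot> body (?K + p) es rs (t @ [?K..<?K + p]))"
    using wf by (simp add: f nf_def sq_pr_I sq_assoc add.assoc)
  also have "\<dots> = nf (n + p) k (map (map_prod ((!) ([0..<n] @ map ((+) n) ([p..<p + k] @ [0..<p]))) ((!) ([0..<n] @ map ((+) n) ([p..<p + k] @ [0..<p])))) es)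
     (map (ren ((!) ([0..<n] @ map ((+) n) ([p..<p + k] @ [0..<p])))) rs) (map ((!) ([0..<n] @ map ((+) n) ([p..<p + k] @ [0..<p]))) (t @ [?K..<?K + p]))"
    unfolding nf_def using wf2 by (subst sel_sq_body [of _ _ "?K + p"]) auto
  finally show ?thesis
    using wf2 by (simp only:) (rule representable_nfI, rule wf_body_ren, assumption, rule nth_lessThan, auto)
qed

lemma representable_I_pr:
  assumes "representable f"
  shows "representable (I p \<odot> f)"
proof -
  obtain n k es rs t where wf: "wf_body \<Sigma> (n + k) es rs t" and f: "f = nf n k es rs t"
    using assms by (auto simp: representable_def)
  let ?K = "n + k" and ?u = "[p..<p + (n + k)]"
  have es: "set es \<subseteq> {..<?K} \<times> {..<?K}" and rs: "\<forall>r\<in>set rs. wf_rel \<Sigma> ?K r" and t: "set t \<subseteq> {..<?K}"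
    using wf by (auto simp: wf_body_def)
  have u: "set ?u \<subseteq> {..<p + ?K}" by auto
  have "I p \<odot> body ?K es rs t = body (p + ?K) (map (map_prod ((!) ?u) ((!) ?u)) es) (map (ren ((!) ?u)) rs) ([0..<p] @ map ((+) p) t)"
    using es rs t u by (simp add: body_def pr_meet [of ?K] dc_I sel_sq_eqs sel_sq_rels I_pr_sel del: set_upt)
  moreover have "I p \<odot> (I n \<odot> nw k) = I (p + n) \<odot> nw k" by (simp add: pr_I_assoc)
  ultimately have "I p \<odot> f = nf (p + n) k (map (map_prod ((!) ?u) ((!) ?u)) es) (map (ren ((!) ?u)) rs) ([0..<p] @ map ((+) p) t)"
    using wf by (simp add: f nf_def I_pr_sq add.assoc)
  moreover have "wf_body \<Sigma> (p + n + k) (map (map_prod ((!) ?u) ((!) ?u)) es) (map (ren ((!) ?u)) rs) (map ((!) ?u) t)"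
    using wf by (intro wf_body_ren) auto
  then have "wf_body \<Sigma> (p + n + k) (map (map_prod ((!) ?u) ((!) ?u)) es) (map (ren ((!) ?u)) rs) ([0..<p] @ map ((+) p) t)"
    using t by (auto simp: wf_body_def)
  ultimately show ?thesis using representable_nfI by simp
qed

lemma representable_V: "representable f \<Longrightarrow> V f"
  by (auto simp: representable_def)

lemma representable_pr:
  assumes "representable f" "representable g"
  shows "representable (f \<odot> g)"
proof -
  note V = representable_V [OF assms(1)] representable_V [OF assms(2)]
  have "representable ((f \<odot> I (dm g)) \<cdot> (I (cd f) \<odot> g))"
    using V assms by (intro representable_sq representable_pr_I representable_I_pr) simp_all
  then show ?thesis using pr_eq_sq [OF V] by simp
qed

end

definition rel_sim :: "(nat \<times> nat) list \<Rightarrow> 's ratom \<Rightarrow> 's ratom \<Rightarrow> bool" where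
  "rel_sim es = (\<lambda>(R, s, t) (R', s', t'). R = R' \<and> list_all2 (\<lambda>i j. (i, j) \<in> eqv es) s s' \<and>
     list_all2 (\<lambda>i j. (i, j) \<in> eqv es) t t')"

lemma rel_sim_mono:
  assumes "rel_sim es (ren f r) r'" "wf_rel \<Sigma> K r" "wf_rel \<Sigma> K' r'"
    "\<And>i j. i < K \<Longrightarrow> j < K' \<Longrightarrow> (f i, j) \<in> eqv es \<Longrightarrow> (h i, h' j) \<in> eqv es'"
  shows "rel_sim es' (ren h r) (ren h' r')"
  using assms by (auto simp: rel_sim_def ren_def wf_rel_def list_all2_conv_all_nth subset_iff)

context query_prop
begin

lemma eqs_meet_ratom:
  assumes "set es \<subseteq> {..<K} \<times> {..<K}" "rel_sim es r r'" "wf_rel \<Sigma> K r" "wf_rel \<Sigma> K r'"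
  shows "eqs K es \<star> ratom K r = eqs K es \<star> ratom K r'"
proof -
  obtain R s t s' t' where r: "r = (R, s, t)" "r' = (R, s', t')" using assms(2) by (auto simp: rel_sim_def)
  have "eqs K es \<star> sel K (s @ t) = eqs K es \<star> sel K (s' @ t')"
    using assms r by (intro eqs_meet_sel) (auto simp: rel_sim_def wf_rel_def intro: list_all2_appendI)
  then show ?thesis
    using assms r meet_sq [of K "eqs K es" "sel K (s @ t)" "bend (S R)"]
      meet_sq [of K "eqs K es" "sel K (s' @ t')" "bend (S R)"]
    by (simp add: ratom_def wf_rel_def)
qed

lemma eqs_meet_rels:
  assumes es: "set es \<subseteq> {..<K} \<times> {..<K}" and "list_all2 (rel_sim es) rs rs'"
    "\<forall>r\<in>set rs. wf_rel \<Sigma> K r" "\<forall>r\<in>set rs'. wf_rel \<Sigma> K r"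
  shows "eqs K es \<star> rels K rs = eqs K es \<star> rels K rs'"
  using assms(2-)
proof (induction rule: list_all2_induct)
  case (Cons r rs r' rs')
  then have "eqs K es \<star> rels K (r # rs) = (eqs K es \<star> ratom K r) \<star> rels K rs"
    using es by (simp add: meet_assoc [of K])
  also have "\<dots> = (eqs K es \<star> ratom K r') \<star> rels K rs"
    using es Cons eqs_meet_ratom [of es K r r'] by simp
  also have "\<dots> = ratom K r' \<star> (eqs K es \<star> rels K rs)"
    using es Cons.prems by (simp add: meet_assoc [of K] meet_left_commute [of K "ratom K r'"])
  also have "\<dots> = ratom K r' \<star> (eqs K es \<star> rels K rs')"
    using Cons by simp
  also have "\<dots> = eqs K es \<star> rels K (r' # rs')"
    using es Cons.prems by (simp add: meet_left_commute [of K "ratom K r'"])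
  finally show ?case .
qed simp

lemma body_sim:
  assumes "wf_body \<Sigma> K es rs t" "wf_body \<Sigma> K es rs' t'" "list_all2 (rel_sim es) rs rs'"
    "list_all2 (\<lambda>i j. (i, j) \<in> eqv es) t t'"
  shows "body K es rs t = body K es rs' t'"
proof -
  have wf: "set es \<subseteq> {..<K} \<times> {..<K}" "\<forall>r\<in>set rs. wf_rel \<Sigma> K r" "\<forall>r\<in>set rs'. wf_rel \<Sigma> K r"
    "set t \<subseteq> {..<K}" "set t' \<subseteq> {..<K}"
    using assms by (auto simp: wf_body_def)
  have "body K es rs t = (eqs K es \<star> rels K rs) \<star> sel K t"
    using wf by (simp add: body_def meet_assoc [of K])
  also have "\<dots> = rels K rs' \<star> (eqs K es \<star> sel K t)"
    using wf assms(3) by (simp add: eqs_meet_rels [of es K rs rs'] meet_assoc [of K] meet_left_commute [of K "rels K rs'"])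
  also have "\<dots> = body K es rs' t'"
    using wf assms(4) by (simp add: eqs_meet_sel [of es K t t'] body_def meet_left_commute [of K "rels K rs'"])
  finally show ?thesis .
qed

lemma nf_extend:
  assumes wf: "wf_body \<Sigma> (n + k) es rs t" and g: "set s \<subseteq> {..<n + k}" "length s = k'"
  shows "nf n k es rs t = nf n (k + k') (es @ zip s [n + k..<n + k + k']) rs t"
proof -
  let ?K = "n + k" and ?z = "zip s [n + k..<n + k + k']"
  have es: "set es \<subseteq> {..<?K + k'} \<times> {..<?K + k'}" and rs: "\<forall>r\<in>set rs. wf_rel \<Sigma> (?K + k') r" and t: "set t \<subseteq> {..<?K + k'}"
    and wf': "wf_body \<Sigma> (?K + k') es rs t"
    using wf_body_mono [OF wf, of "?K + k'"] by (auto simp: wf_body_def)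
  have z: "set ?z \<subseteq> {..<?K + k'} \<times> {..<?K + k'}"
    using g by (intro set_zip_lessThan) auto
  let ?u = "[0..<?K] @ s"
  have "body (?K + k') (es @ ?z) rs t = eqs (?K + k') ?z \<star> body (?K + k') es rs t"
    using es rs t z by (simp add: body_def eqs_append meet_assoc [of "?K + k'"] meet_left_commute [of "?K + k'" "eqs (?K + k') ?z"])
  then have "nf n (k + k') (es @ ?z) rs t = (I n \<odot> nw k) \<cdot> ((I ?K \<odot> nw k') \<cdot> (eqs (?K + k') ?z \<star> body (?K + k') es rs t))"
    using wf' z by (simp add: nf_def I_pr_nw_add sq_assoc add.assoc [symmetric])
  also have "(I ?K \<odot> nw k') \<cdot> (eqs (?K + k') ?z \<star> body (?K + k') es rs t) = sel ?K ?u \<cdot> body (?K + k') es rs t"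
    using g wf' by (intro ex_eqs) auto
  also have "\<dots> = body ?K (map (map_prod ((!) ?u) ((!) ?u)) es) (map (ren ((!) ?u)) rs) (map ((!) ?u) t)"
    using g wf' by (intro sel_sq_body) auto
  also have "\<dots> = body ?K (map (map_prod (\<lambda>i. i) (\<lambda>i. i)) es) (map (ren (\<lambda>i. i)) rs) (map (\<lambda>i. i) t)"
  proof -
    have "?u ! i = i" if "i < ?K" for i using that by (simp add: nth_append)
    from body_cong [OF wf, of "(!) ?u" "\<lambda>i. i", OF this] show ?thesis by (simp only:)
  qed
  also have "\<dots> = body ?K es rs t"
    by (simp add: ren_id map_idI prod.map_ident)
  finally show ?thesis by (simp add: nf_def)
qed

lemma nf_permute:
  assumes "wf_body \<Sigma> (n + (k' + k)) es rs t"
  defines "h \<equiv> \<lambda>i. if i < n then i else if i < n + k' then i + k else i - k'"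
  shows "nf n (k' + k) es rs t = nf n (k + k') (map (map_prod h h) es) (map (ren h) rs) (map h t)"
proof -
  have h: "map h [0..<n + (k' + k)] = [0..<n] @ map ((+) n) ([k..<k + k'] @ [0..<k])"
    by (rule nth_equalityI) (auto simp: h_def nth_append)
  have hs: "set (map h [0..<n + (k' + k)]) \<subseteq> {..<n + (k + k')}" by (auto simp: h_def)
  have "I n \<odot> nw (k' + k) = (I n \<odot> nw (k + k')) \<cdot> (I n \<odot> sw k k')"
    using sw_natural [of "nw k" "nw k'" k k'] I_pr_sq [of "nw k \<odot> nw k'" "sw k k'" n]
    by (simp add: nw_add sw_0_right I_sq)
  also have "I n \<odot> sw k k' = sel (n + (k + k')) (map h [0..<n + (k' + k)])"
    unfolding h by (simp add: sw_sel I_pr_sel)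
  finally have "nf n (k' + k) es rs t = (I n \<odot> nw (k + k')) \<cdot>
      (sel (n + (k + k')) (map h [0..<n + (k' + k)]) \<cdot> body (n + (k' + k)) es rs t)"
    using assms(1) hs by (simp add: nf_def sq_assoc del: set_map set_upt)
  also have "sel (n + (k + k')) (map h [0..<n + (k' + k)]) \<cdot> body (n + (k' + k)) es rs t =
     body (n + (k + k')) (map (map_prod h h) es) (map (ren h) rs) (map h t)"
    by (rule sel_sq_body' [OF assms(1)]) (auto simp: h_def)
  finally show ?thesis by (simp add: nf_def)
qed

text \<open>Both normal forms are extended by the existential variables of the other one, each of which is
  equated with its image under \<open>f\<close> or \<open>g\<close>. The extended conjunctions are equivalent.\<close>

lemma nf_eqI:
  assumes wf: "wf_body \<Sigma> (n + k) es rs t" and wf': "wf_body \<Sigma> (n + k') es' rs' t'"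
    and f: "\<And>i. i < n + k \<Longrightarrow> f i < n + k'" and g: "\<And>i. i < n + k' \<Longrightarrow> g i < n + k"
    and fi: "\<And>i. i < n \<Longrightarrow> (f i, i) \<in> eqv es'" and gi: "\<And>i. i < n \<Longrightarrow> (g i, i) \<in> eqv es"
    and fe: "\<And>i j. (i, j) \<in> set es \<Longrightarrow> (f i, f j) \<in> eqv es'"
    and ge: "\<And>i j. (i, j) \<in> set es' \<Longrightarrow> (g i, g j) \<in> eqv es"
    and gf: "\<And>i. i < n + k \<Longrightarrow> (g (f i), i) \<in> eqv es"
    and fg: "\<And>i. i < n + k' \<Longrightarrow> (f (g i), i) \<in> eqv es'"
    and rs: "list_all2 (rel_sim es') (map (ren f) rs) rs''" "mset rs'' = mset rs'"
    and t: "list_all2 (\<lambda>i j. (i, j) \<in> eqv es') (map f t) t'"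
  shows "nf n k es rs t = nf n k' es' rs' t'"
proof -
  let ?K = "n + k + k'"
  define h where "h i = (if i < n then i else if i < n + k' then i + k else i - k')" for i
  define P where "P = es @ zip (map g [n..<n + k']) [n + k..<n + k + k']"
  define Q where "Q = map (map_prod h h) (es' @ zip (map f [n..<n + k]) [n + k'..<n + k' + k])"
  have es: "set es \<subseteq> {..<n + k} \<times> {..<n + k}" and es': "set es' \<subseteq> {..<n + k'} \<times> {..<n + k'}"
    using wf wf' by (auto simp: wf_body_def)
  have h_id: "h i = i" if "i < n" for i using that by (simp add: h_def)
  have h_less: "h i < ?K" if "i < ?K" for i using that by (auto simp: h_def)
  have zP: "set (zip (map g [n..<n + k']) [n + k..<n + k + k']) = {(g v, v + k) | v. n \<le> v \<and> v < n + k'}"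
  proof -
    have "[n + k..<n + k + k'] = map (\<lambda>v. v + k) [n..<n + k']" by (rule nth_equalityI) auto
    then show ?thesis by (simp only: zip_map_map zip_same_conv_map) auto
  qed
  have zQ: "set (zip (map f [n..<n + k]) [n + k'..<n + k' + k]) = {(f v, v + k') | v. n \<le> v \<and> v < n + k}"
  proof -
    have "[n + k'..<n + k' + k] = map (\<lambda>v. v + k') [n..<n + k]" by (rule nth_equalityI) auto
    then show ?thesis by (simp only: zip_map_map zip_same_conv_map) auto
  qed
  have setP: "set P = set es \<union> {(g v, v + k) | v. n \<le> v \<and> v < n + k'}"
    by (simp only: P_def set_append zP)
  have setQ: "set Q = {(h a, h b) | a b. (a, b) \<in> set es'} \<union> {(h (f v), v) | v. n \<le> v \<and> v < n + k}"
  proof -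
    have "map_prod h h ` {(f v, v + k') | v. n \<le> v \<and> v < n + k} = {(h (f v), v) | v. n \<le> v \<and> v < n + k}"
      unfolding setcompr_eq_image image_image by (intro image_cong) (auto simp: h_def)
    moreover have "map_prod h h ` set es' = {(h a, h b) | a b. (a, b) \<in> set es'}" by force
    ultimately show ?thesis by (simp only: Q_def set_map set_append image_Un zQ)
  qed
  have esP: "(i, j) \<in> eqv es \<Longrightarrow> (i, j) \<in> eqv P" for i j
    by (erule eqv_subset) (simp add: setP eqv_mem)
  have hP: "(h v, g v) \<in> eqv P" if "v < n + k'" for v
  proof (cases "v < n")
    case True
    then have "h v = v" "(g v, v) \<in> eqv P" using esP gi h_id by blast+
    then show ?thesis using eqv_sym by simp
  next
    case False
    then have "(g v, h v) \<in> set P" using that by (auto simp: setP h_def)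
    then show ?thesis by (intro eqv_sym [OF eqv_mem])
  qed
  have esQ: "(i, j) \<in> eqv es' \<Longrightarrow> (h i, h j) \<in> eqv Q" for i j
    by (drule eqv_map [where h = h], erule eqv_subset, rule eqv_mem) (auto simp: setQ)
  have hQ: "(v, h (f v)) \<in> eqv Q" if "v < n + k" for v
  proof (cases "v < n")
    case True
    then have "h v = v" "(h (f v), h v) \<in> eqv Q" using esQ fi h_id by blast+
    then show ?thesis using eqv_sym by simp
  next
    case False
    then have "(h (f v), v) \<in> set Q" unfolding setQ using that by (intro UnI2 CollectI exI [of _ v]) simp
    then show ?thesis by (intro eqv_sym [OF eqv_mem])
  qed
  have QP: "(i, j) \<in> eqv P" if ij: "(i, j) \<in> set Q" for i j
  proof -
    consider a b where "(a, b) \<in> set es'" "i = h a" "j = h b" | "n \<le> j" "j < n + k" "i = h (f j)"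
      using ij unfolding setQ by blast
    then show ?thesis
    proof cases
      case 1
      have "a < n + k'" "b < n + k'" using 1 es' by auto
      moreover have "(g a, g b) \<in> eqv P" using ge [OF 1(1)] by (rule esP)
      ultimately show ?thesis using 1 hP [of a] hP [of b] by (blast intro: eqv_trans eqv_sym)
    next
      case 2
      then have "(h (f j), g (f j)) \<in> eqv P" "(g (f j), j) \<in> eqv P" using hP f esP gf by blast+
      then show ?thesis using 2 by (blast intro: eqv_trans)
    qed
  qed
  have PQ: "(i, j) \<in> eqv Q" if ij: "(i, j) \<in> set P" for i j
  proof -
    consider "(i, j) \<in> set es" | v where "n \<le> v" "v < n + k'" "i = g v" "j = v + k"
      using ij unfolding setP by blast
    then show ?thesis
    proof cases
      case 1
      have "i < n + k" "j < n + k" using 1 es by auto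
      moreover have "(h (f i), h (f j)) \<in> eqv Q" using fe [OF 1] by (rule esQ)
      ultimately show ?thesis using hQ [of i] hQ [of j] by (blast intro: eqv_trans eqv_sym)
    next
      case 2
      have "(g v, h (f (g v))) \<in> eqv Q" using hQ g 2 by blast
      moreover have "(h (f (g v)), h v) \<in> eqv Q" using esQ fg 2 by blast
      moreover have "h v = v + k" using 2 by (simp add: h_def)
      ultimately show ?thesis using 2 by (metis eqv_trans)
    qed
  qed
  have wfP: "wf_body \<Sigma> ?K P rs t"
    using wf_body_mono [OF wf, of ?K] g by (auto simp: wf_body_def setP) (meson add_lessD1 trans_less_add1 less_le_trans)+
  have f': "f v < n + (k' + k)" if "v < n + k" for v using f [OF that] by simp
  have wfQ0: "wf_body \<Sigma> (n + (k' + k)) (es' @ zip (map f [n..<n + k]) [n + k'..<n + k' + k]) rs' t'"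
    using wf_body_mono [OF wf', of "n + (k' + k)"] f' unfolding wf_body_def set_append zQ
    by auto
  have wfQ: "wf_body \<Sigma> ?K Q (map (ren h) rs') (map h t')"
    unfolding Q_def using wf_body_ren [OF wfQ0, of h ?K] h_less by (simp add: add_ac)
  have rs'': "\<forall>r\<in>set rs''. wf_rel \<Sigma> (n + k') r" using wf' mset_eq_setD [OF rs(2)] by (simp add: wf_body_def)
  have wfQ': "wf_body \<Sigma> ?K Q rs t" "wf_body \<Sigma> ?K Q (map (ren h) rs'') (map h t')"
    using wfP wfQ mset_eq_setD [OF rs(2)] by (auto simp: wf_body_def)
  have "nf n k es rs t = nf n (k + k') P rs t"
    unfolding P_def using wf g by (intro nf_extend) auto
  also have "\<dots> = (I n \<odot> nw (k + k')) \<cdot> body ?K Q rs t"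
  proof -
    have "eqs ?K P = eqs ?K Q"
      using wfP wfQ PQ QP by (intro eqs_eqI) (auto simp: wf_body_def)
    then show ?thesis by (simp add: nf_def body_def add.assoc)
  qed
  also have "body ?K Q rs t = body ?K Q (map (ren h) rs'') (map h t')"
  proof (rule body_sim [OF wfQ'])
    have "rel_sim Q r (ren h r'')" if r: "r \<in> set rs" "r'' \<in> set rs''" "rel_sim es' (ren f r) r''" for r r''
    proof -
      have "rel_sim Q (ren (\<lambda>i. i) r) (ren h r'')"
      proof (rule rel_sim_mono [OF r(3)])
        show "wf_rel \<Sigma> (n + k) r" "wf_rel \<Sigma> (n + k') r''" using wf rs'' r by (auto simp: wf_body_def)
        show "(i, h j) \<in> eqv Q" if "i < n + k" "(f i, j) \<in> eqv es'" for i j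
          using hQ [OF that(1)] esQ [OF that(2)] by (rule eqv_trans)
      qed
      then show ?thesis by (simp add: ren_id)
    qed
    then show "list_all2 (rel_sim Q) rs (map (ren h) rs'')"
      using rs(1) by (auto simp: list_all2_conv_all_nth)
    show "list_all2 (\<lambda>i j. (i, j) \<in> eqv Q) t (map h t')"
    proof -
      have "(t ! i, h (t' ! i)) \<in> eqv Q" if "i < length t" for i
      proof -
        have "t ! i < n + k" using wf that by (auto simp: wf_body_def intro: nth_lessThan)
        moreover have "(f (t ! i), t' ! i) \<in> eqv es'" using t that by (simp add: list_all2_conv_all_nth)
        ultimately show ?thesis using hQ esQ eqv_trans by blast
      qed
      then show ?thesis using t by (auto simp: list_all2_conv_all_nth)
    qed
  qed
  also have "body ?K Q (map (ren h) rs'') (map h t') = body ?K Q (map (ren h) rs') (map h t')"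
  proof -
    have "mset (map (ren h) rs'') = mset (map (ren h) rs')" using rs(2) by simp
    then have "rels ?K (map (ren h) rs'') = rels ?K (map (ren h) rs')"
      using wfQ'(2) by (intro rels_mset) (auto simp: wf_body_def)
    then show ?thesis by (simp add: body_def)
  qed
  also have "(I n \<odot> nw (k + k')) \<cdot> body ?K Q (map (ren h) rs') (map h t') = nf n (k + k') Q (map (ren h) rs') (map h t')"
    by (simp add: nf_def add.assoc)
  also have "\<dots> = nf n (k' + k) (es' @ zip (map f [n..<n + k]) [n + k'..<n + k' + k]) rs' t'"
    unfolding Q_def h_def using nf_permute [OF wfQ0] by simp
  also have "\<dots> = nf n k' es' rs' t'"
    using wf' f by (intro nf_extend [symmetric]) auto
  finally show ?thesis .
qed

end

locale ordered_query_prop = query_prop V dm cd sq pr I sw C E M N \<Sigma> S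
  for V :: "'a \<Rightarrow> bool" and dm and cd and sq (infixr "\<cdot>" 65) and pr (infixr "\<odot>" 70)
    and I and sw and C and E and M and N and \<Sigma> :: "'s msig" and S +
  fixes le :: "'a \<Rightarrow> 'a \<Rightarrow> bool" (infix "\<sqsubseteq>" 50)
  assumes le_refl: "V f \<Longrightarrow> f \<sqsubseteq> f"
    and le_trans [trans]: "\<lbrakk>f \<sqsubseteq> g; g \<sqsubseteq> h\<rbrakk> \<Longrightarrow> f \<sqsubseteq> h"
    and sq_mono: "\<lbrakk>f \<sqsubseteq> f'; g \<sqsubseteq> g'; cd f = dm g\<rbrakk> \<Longrightarrow> f \<cdot> g \<sqsubseteq> f' \<cdot> g'"
    and pr_mono: "\<lbrakk>f \<sqsubseteq> f'; g \<sqsubseteq> g'\<rbrakk> \<Longrightarrow> f \<odot> g \<sqsubseteq> f' \<odot> g'"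
    and I_le_E_N: "I 1 \<sqsubseteq> E \<cdot> N"
    and N_E_le_I: "N \<cdot> E \<sqsubseteq> I 0"
    and M_C_le_I: "M \<cdot> C \<sqsubseteq> I 2"
    and S_cp_le: "R \<in> symbols \<Sigma> \<Longrightarrow> S R \<cdot> cp (coar \<Sigma> R) \<sqsubseteq> cp (ar \<Sigma> R) \<cdot> (S R \<odot> S R)"
    and S_dc_le: "R \<in> symbols \<Sigma> \<Longrightarrow> S R \<cdot> dc (coar \<Sigma> R) \<sqsubseteq> dc (ar \<Sigma> R)"
begin

lemma sq_mono_left: "\<lbrakk>f \<sqsubseteq> f'; V g; cd f = dm g\<rbrakk> \<Longrightarrow> f \<cdot> g \<sqsubseteq> f' \<cdot> g"
  by (simp add: sq_mono le_refl)

lemma sq_mono_right: "\<lbrakk>f \<sqsubseteq> f'; V g; cd g = dm f\<rbrakk> \<Longrightarrow> g \<cdot> f \<sqsubseteq> g \<cdot> f'"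
  by (simp add: sq_mono le_refl)

lemma pr_mono_right: "\<lbrakk>f \<sqsubseteq> f'; V g\<rbrakk> \<Longrightarrow> g \<odot> f \<sqsubseteq> g \<odot> f'"
  by (simp add: pr_mono le_refl)

lemma nw_dc_le: "nw k \<cdot> dc k \<sqsubseteq> I 0"
proof (induction k)
  case (Suc k)
  have "(N \<cdot> E) \<odot> (nw k \<cdot> dc k) \<sqsubseteq> I 0 \<odot> I 0"
    using Suc N_E_le_I by (intro pr_mono)
  then show ?case by (simp add: nw.simps(2) dc.simps(2) interchange [symmetric] I_pr_I)
qed (simp add: I_sq le_refl)

lemma I_le_dc_nw: "I k \<sqsubseteq> dc k \<cdot> nw k"
proof (induction k)
  case (Suc k)
  have "I 1 \<odot> I k \<sqsubseteq> (E \<cdot> N) \<odot> (dc k \<cdot> nw k)"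
    using Suc I_le_E_N by (intro pr_mono)
  then show ?case by (simp add: nw.simps(2) dc.simps(2) interchange [symmetric] I_pr_I)
qed (simp add: I_sq le_refl)

lemma meet_mono: "\<lbrakk>e \<sqsubseteq> e'; f \<sqsubseteq> f'; eff K e; eff K e'; V f; dm f = K\<rbrakk> \<Longrightarrow> e \<star> f \<sqsubseteq> e' \<star> f'"
  by (simp add: meet_def pr_mono sq_mono_right)

lemma M_E_le: "M \<cdot> E \<sqsubseteq> dc 2"
proof -
  have "C \<cdot> (E \<odot> E) = E"
    using comap_dc_n [of 1] cp_1 dc_1 by (simp add: comap_def sq_I)
  then have "M \<cdot> E = (M \<cdot> C) \<cdot> (E \<odot> E)" by (simp add: sq_assoc)
  also have "\<dots> \<sqsubseteq> I 2 \<cdot> (E \<odot> E)" by (intro sq_mono_left M_C_le_I) auto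
  also have "I 2 \<cdot> (E \<odot> E) = dc 2" using dc_add [of 1 1] dc_1 by (simp add: I_sq numeral_2_eq_2)
  finally show ?thesis .
qed

lemma eq_le_dc: "\<lbrakk>i < K; j < K\<rbrakk> \<Longrightarrow> eq K i j \<sqsubseteq> dc K"
  using sq_mono_right [OF M_E_le, of "sel K [i, j]"] comap_dc [OF comap_sel [of "[i, j]" K], of 2]
  by (simp add: eq_def)

lemma meet_le: "\<lbrakk>e \<sqsubseteq> dc K; eff K e; V f; dm f = K\<rbrakk> \<Longrightarrow> e \<star> f \<sqsubseteq> f"
  using meet_mono [of e "dc K" f f K] by (simp add: le_refl dc_meet)

lemma eqs_le_dc: "set es \<subseteq> {..<K} \<times> {..<K} \<Longrightarrow> eqs K es \<sqsubseteq> dc K"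
proof (induction es)
  case (Cons p es)
  then have "eqs K (p # es) \<sqsubseteq> eqs K es"
    using meet_le [of "eq K (fst p) (snd p)" K "eqs K es"] eq_le_dc by auto
  also have "\<dots> \<sqsubseteq> dc K" using Cons by simp
  finally show ?case .
qed (simp add: le_refl)

lemma cap_le_dc: "cap m \<sqsubseteq> dc (m + m)"
  unfolding cap_def by (intro eqs_le_dc set_zip_lessThan) auto

lemma cap_cp: "cap m = cp (m + m) \<cdot> (cap m \<odot> cap m)"
proof -
  have z: "set (zip [0..<m] [m..<m + m]) \<subseteq> {..<m + m} \<times> {..<m + m}"
    by (intro set_zip_lessThan) auto
  have "set (zip [0..<m] [m..<m + m]) \<subseteq> eqv (zip [0..<m] [m..<m + m])"
    by (meson eqv_mem subrelI)
  from eqs_meet_eqs [OF z z this] show ?thesis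
    by (simp add: cap_def meet_def eqs_sort [OF z])
qed

lemma ratom_le_dc:
  assumes "wf_rel \<Sigma> K r"
  shows "ratom K r \<sqsubseteq> dc K"
proof -
  obtain R s t where r: "r = (R, s, t)" by (cases r)
  have R: "R \<in> symbols \<Sigma>" and s: "set (s @ t) \<subseteq> {..<K}" "length (s @ t) = ar \<Sigma> R + coar \<Sigma> R"
    using assms r by (auto simp: wf_rel_def)
  let ?m = "coar \<Sigma> R"
  have "bend (S R) \<sqsubseteq> (S R \<odot> I ?m) \<cdot> dc (?m + ?m)"
    using R by (simp add: bend_def) (intro sq_mono_right cap_le_dc, auto)
  also have "\<dots> = (S R \<cdot> dc ?m) \<odot> dc ?m"
    using R by (simp add: dc_add interchange [symmetric] I_sq)
  also have "\<dots> \<sqsubseteq> dc (ar \<Sigma> R) \<odot> dc ?m"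
    using R by (intro pr_mono S_dc_le le_refl) auto
  finally have "bend (S R) \<sqsubseteq> dc (ar \<Sigma> R + ?m)" by (simp add: dc_add)
  then have "sel K (s @ t) \<cdot> bend (S R) \<sqsubseteq> sel K (s @ t) \<cdot> dc (ar \<Sigma> R + ?m)"
    using R s by (intro sq_mono_right) auto
  then show ?thesis
    using s comap_dc [OF comap_sel [OF s(1)], of "ar \<Sigma> R + ?m"] by (simp add: r ratom_def)
qed

lemma ratom_le_meet:
  assumes "wf_rel \<Sigma> K r"
  shows "ratom K r \<sqsubseteq> ratom K r \<star> ratom K r"
proof -
  obtain R s t where r: "r = (R, s, t)" by (cases r)
  let ?n = "ar \<Sigma> R" and ?m = "coar \<Sigma> R"
  have R: "R \<in> symbols \<Sigma>" and s: "set (s @ t) \<subseteq> {..<K}" "length (s @ t) = ?n + ?m"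
    using assms r by (auto simp: wf_rel_def)
  let ?f = "S R \<odot> I ?m"
  let ?L = "L ?m (sw ?m ?m) ?m"
  have 1: "?f \<cdot> cp (?m + ?m) = ((S R \<cdot> cp ?m) \<odot> cp ?m) \<cdot> ?L"
    using R by (simp add: cp_add sq_assoc [symmetric] interchange [symmetric] I_sq)
  have 2: "((S R \<cdot> cp ?m) \<odot> cp ?m) \<cdot> ?L \<sqsubseteq> ((cp ?n \<cdot> (S R \<odot> S R)) \<odot> cp ?m) \<cdot> ?L"
    using R by (intro sq_mono_left pr_mono S_cp_le le_refl) auto
  have 3: "(cp ?n \<cdot> (S R \<odot> S R)) \<odot> cp ?m = (cp ?n \<odot> cp ?m) \<cdot> ((S R \<odot> S R) \<odot> I (?m + ?m))"
    using R by (subst pr_sq_left) simp_all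
  have 4: "(S R \<odot> S R) \<odot> I (?m + ?m) = S R \<odot> (S R \<odot> I ?m) \<odot> I ?m"
    using R by (simp add: pr_assoc I_pr_I)
  have 5: "((cp ?n \<cdot> (S R \<odot> S R)) \<odot> cp ?m) \<cdot> ?L = cp (?n + ?m) \<cdot> (?f \<odot> ?f)"
    unfolding 3 4 using R L_sw_pr [of "S R" "S R" "I ?m" "I ?m"] by (simp add: cp_add sq_assoc pr_assoc)
  have f: "?f \<cdot> cp (?m + ?m) \<sqsubseteq> cp (?n + ?m) \<cdot> (?f \<odot> ?f)" using 2 unfolding 1 5 .
  have 6: "bend (S R) = (?f \<cdot> cp (?m + ?m)) \<cdot> (cap ?m \<odot> cap ?m)"
    using R by (simp add: bend_def sq_assoc cap_cp [symmetric])
  have 7: "(?f \<cdot> cp (?m + ?m)) \<cdot> (cap ?m \<odot> cap ?m) \<sqsubseteq> (cp (?n + ?m) \<cdot> (?f \<odot> ?f)) \<cdot> (cap ?m \<odot> cap ?m)"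
    using R f by (intro sq_mono_left) auto
  have 8: "(?f \<odot> ?f) \<cdot> (cap ?m \<odot> cap ?m) = bend (S R) \<odot> bend (S R)"
    using R by (subst interchange [symmetric]) (simp_all add: bend_def)
  have 9: "(cp (?n + ?m) \<cdot> (?f \<odot> ?f)) \<cdot> (cap ?m \<odot> cap ?m) = bend (S R) \<star> bend (S R)"
    using R by (simp add: meet_def 8 sq_assoc)
  have "bend (S R) \<sqsubseteq> bend (S R) \<star> bend (S R)" using 7 unfolding 6 [symmetric] 9 .
  then have "sel K (s @ t) \<cdot> bend (S R) \<sqsubseteq> sel K (s @ t) \<cdot> (bend (S R) \<star> bend (S R))"
    using R s by (intro sq_mono_right) auto
  then show ?thesis
    using R s comap_meet [OF comap_sel [OF s(1)], of "?n + ?m" "bend (S R)" "bend (S R)"] by (simp add: r ratom_def)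
qed

lemma rels_le_dc: "\<forall>r\<in>set rs. wf_rel \<Sigma> K r \<Longrightarrow> rels K rs \<sqsubseteq> dc K"
proof (induction rs)
  case (Cons r rs)
  then have "rels K (r # rs) \<sqsubseteq> rels K rs"
    using meet_le [of "ratom K r" K "rels K rs"] ratom_le_dc by auto
  also have "\<dots> \<sqsubseteq> dc K" using Cons by simp
  finally show ?case .
qed (simp add: le_refl)

lemma rels_le_ratom_meet:
  assumes "\<forall>r\<in>set rs. wf_rel \<Sigma> K r" "r \<in> set rs"
  shows "rels K rs \<sqsubseteq> ratom K r \<star> rels K rs"
  using assms
proof (induction rs)
  case (Cons r' rs)
  have wf: "wf_rel \<Sigma> K r" "wf_rel \<Sigma> K r'" "\<forall>r\<in>set rs. wf_rel \<Sigma> K r" using Cons.prems by auto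
  show ?case
  proof (cases "r = r'")
    case True
    have "ratom K r \<star> rels K rs \<sqsubseteq> (ratom K r \<star> ratom K r) \<star> rels K rs"
      using wf ratom_le_meet by (intro meet_mono le_refl) auto
    then show ?thesis using True wf by (simp add: meet_assoc [of K])
  next
    case False
    then have "ratom K r' \<star> rels K rs \<sqsubseteq> ratom K r' \<star> (ratom K r \<star> rels K rs)"
      using wf Cons by (intro meet_mono le_refl) auto
    then show ?thesis using wf by (simp add: meet_left_commute [of K "ratom K r'" "ratom K r"])
  qed
qed simp

lemma rels_le_subset:
  assumes "\<forall>r\<in>set rs. wf_rel \<Sigma> K r" "set rs' \<subseteq> set rs"
  shows "rels K rs \<sqsubseteq> rels K rs'"
  using assms(2)
proof (induction rs')
  case Nil
  then show ?case using assms(1) by (simp add: rels_le_dc)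
next
  case (Cons r rs')
  have "rels K rs \<sqsubseteq> ratom K r \<star> rels K rs" using assms(1) Cons.prems by (intro rels_le_ratom_meet) auto
  also have "\<dots> \<sqsubseteq> ratom K r \<star> rels K rs'"
    using assms(1) Cons by (intro meet_mono le_refl) auto
  finally show ?case by simp
qed

lemma nf_leI:
  assumes wf: "wf_body \<Sigma> (n + k) es rs t" and wf': "wf_body \<Sigma> (n + k') es' rs' t'"
    and f: "\<And>i. i < n + k' \<Longrightarrow> f i < n + k"
    and fi: "\<And>i. i < n \<Longrightarrow> (f i, i) \<in> eqv es"
    and fe: "\<And>i j. (i, j) \<in> set es' \<Longrightarrow> (f i, f j) \<in> eqv es"
    and rs: "\<And>r'. r' \<in> set rs' \<Longrightarrow> \<exists>r\<in>set rs. rel_sim es (ren f r') r"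
    and t: "list_all2 (\<lambda>i j. (i, j) \<in> eqv es) (map f t') t"
  shows "nf n k es rs t \<sqsubseteq> nf n k' es' rs' t'"
proof -
  let ?K = "n + k"
  define h where "h i = (if i < n then i else f i)" for i
  have hf: "(h i, f i) \<in> eqv es" for i using eqv_sym [OF fi [of i]] by (simp add: h_def)
  have h: "h i < ?K" if "i < n + k'" for i using that f by (simp add: h_def)
  let ?es = "map (map_prod h h) es'" and ?rs = "map (ren h) rs'" and ?t = "map h t'"
  have wf_h: "wf_body \<Sigma> ?K ?es ?rs ?t" using wf' h by (rule wf_body_ren)
  have "\<exists>r. r \<in> set rs \<and> rel_sim es r (ren h r')" if r': "r' \<in> set rs'" for r'
  proof -
    obtain r where r: "r \<in> set rs" "rel_sim es (ren f r') r" using rs [OF r'] by blast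
    have "rel_sim es r (ren h r')"
      using r(2) hf by (cases r', cases r) (auto simp: rel_sim_def ren_def list_all2_conv_all_nth, (meson eqv_sym eqv_trans)+)
    then show ?thesis using r(1) by blast
  qed
  then obtain \<phi> where \<phi>: "\<And>r'. r' \<in> set rs' \<Longrightarrow> \<phi> r' \<in> set rs \<and> rel_sim es (\<phi> r') (ren h r')" by metis
  have set\<phi>: "set (map \<phi> rs') \<subseteq> set rs" using \<phi> by auto
  have es: "set es \<subseteq> {..<?K} \<times> {..<?K}" "\<forall>r\<in>set rs. wf_rel \<Sigma> ?K r" "set t \<subseteq> {..<?K}"
    and es': "set ?es \<subseteq> {..<?K} \<times> {..<?K}" "\<forall>r\<in>set ?rs. wf_rel \<Sigma> ?K r" "set ?t \<subseteq> {..<?K}"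
    using wf wf_h unfolding wf_body_def by blast+
  have wf\<phi>: "\<forall>r\<in>set (map \<phi> rs'). wf_rel \<Sigma> ?K r" using set\<phi> es(2) by blast
  have "set ?es \<subseteq> eqv es" using fe hf by auto (meson eqv_trans eqv_sym)
  then have E: "eqs ?K es \<star> eqs ?K ?es = eqs ?K es" by (rule eqs_meet_eqs [OF es(1) es'(1)])
  have "body ?K es rs t \<sqsubseteq> body ?K es (map \<phi> rs') t"
    unfolding body_def using es wf\<phi> set\<phi>
    by (intro meet_mono [where K = ?K] le_refl rels_le_subset) simp_all
  also have "\<dots> = body ?K es ?rs ?t"
  proof (rule body_sim)
    show "wf_body \<Sigma> ?K es (map \<phi> rs') t" "wf_body \<Sigma> ?K es ?rs ?t"
      using es es' wf\<phi> by (auto simp: wf_body_def)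
    show "list_all2 (rel_sim es) (map \<phi> rs') ?rs" using \<phi> by (auto simp: list_all2_conv_all_nth)
    show "list_all2 (\<lambda>i j. (i, j) \<in> eqv es) t ?t"
      using t hf by (auto simp: list_all2_conv_all_nth) (meson eqv_sym eqv_trans)
  qed
  also have "\<dots> = eqs ?K es \<star> body ?K ?es ?rs ?t"
    using E es es' meet_assoc [of ?K "eqs ?K es" "eqs ?K ?es" "rels ?K ?rs \<star> sel ?K ?t"] by (simp add: body_def)
  also have "\<dots> \<sqsubseteq> body ?K ?es ?rs ?t"
    using es(1) wf_h by (intro meet_le [where K = ?K] eqs_le_dc) simp_all
  also have "\<dots> = sel ?K (map h [0..<n + k']) \<cdot> body (n + k') es' rs' t'"
    using sel_sq_body' [OF wf' h] by simp
  finally have "nf n k es rs t \<sqsubseteq> (I n \<odot> nw k) \<cdot> (sel ?K (map h [0..<n + k']) \<cdot> body (n + k') es' rs' t')"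
    unfolding nf_def using wf by (intro sq_mono_right) simp_all
  moreover have m: "set (map h [0..<n + k']) \<subseteq> {..<?K}" using h by auto
  have "sel ?K (map h [0..<n + k']) \<sqsubseteq> I n \<odot> (dc k \<cdot> nw k')"
  proof -
    have "sel ?K (map h [0..<n + k']) \<cdot> (I n \<odot> I k') \<sqsubseteq> sel ?K (map h [0..<n + k']) \<cdot> (I n \<odot> (dc k' \<cdot> nw k'))"
      using m by (intro sq_mono_right pr_mono_right I_le_dc_nw) auto
    also have "\<dots> = (sel ?K (map h [0..<n + k']) \<cdot> sel (n + k') [0..<n]) \<cdot> (I n \<odot> nw k')"
      using m by (simp add: I_pr_sq I_dc sq_assoc)
    also have "sel ?K (map h [0..<n + k']) \<cdot> sel (n + k') [0..<n] = I n \<odot> dc k"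
    proof -
      have "map ((!) (map h [0..<n + k'])) [0..<n] = [0..<n]"
        by (rule nth_equalityI) (auto simp: h_def)
      then show ?thesis using m by (simp add: sel_sq I_dc)
    qed
    finally show ?thesis using m by (simp add: sq_I I_pr_I I_pr_sq)
  qed
  then have "(I n \<odot> nw k) \<cdot> (sel ?K (map h [0..<n + k']) \<cdot> body (n + k') es' rs' t')
      \<sqsubseteq> (I n \<odot> nw k) \<cdot> ((I n \<odot> (dc k \<cdot> nw k')) \<cdot> body (n + k') es' rs' t')"
    using m wf' by (intro sq_mono_right sq_mono_left) (simp_all del: set_map)
  moreover have "(I n \<odot> nw k) \<cdot> ((I n \<odot> (dc k \<cdot> nw k')) \<cdot> body (n + k') es' rs' t')
      \<sqsubseteq> (I n \<odot> nw k') \<cdot> body (n + k') es' rs' t'"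
  proof -
    let ?B = "(I n \<odot> nw k') \<cdot> body (n + k') es' rs' t'"
    have 1: "(I n \<odot> nw k) \<cdot> ((I n \<odot> (dc k \<cdot> nw k')) \<cdot> body (n + k') es' rs' t') = (I n \<odot> (nw k \<cdot> dc k)) \<cdot> ?B"
      using wf' by (simp add: I_pr_sq sq_assoc)
    have 2: "(I n \<odot> (nw k \<cdot> dc k)) \<cdot> ?B \<sqsubseteq> (I n \<odot> I 0) \<cdot> ?B"
      using wf' by (intro sq_mono_left pr_mono_right nw_dc_le) auto
    have 3: "(I n \<odot> I 0) \<cdot> ?B = ?B"
      using wf' by (simp add: pr_I0 I_sq)
    show ?thesis using 2 unfolding 1 3 .
  qed
  ultimately show ?thesis unfolding nf_def by (blast intro: le_trans)
qed

end


section \<open>Families of natural number matrices\<close>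

lemma length_eq_add_split: "length a = n + p \<Longrightarrow> \<exists>a1 a2. a = a1 @ a2 \<and> length a1 = n \<and> length a2 = p"
  by (intro exI [of _ "take n a"] exI [of _ "drop n a"]) simp

text \<open>The arity and the coarity are recorded in order to make the hom-sets disjoint.\<close>

type_synonym ('h, 'v) matrix = "nat \<times> nat \<times> ('h \<Rightarrow> 'v list \<Rightarrow> 'v list \<Rightarrow> nat)"

locale matrices =
  fixes tup :: "'h \<Rightarrow> nat \<Rightarrow> 'v list set"
  assumes finite_tup: "finite (tup H n)"
    and length_tup: "a \<in> tup H n \<Longrightarrow> length a = n"
    and append_tup: "\<lbrakk>length a = n; length b = m\<rbrakk> \<Longrightarrow> a @ b \<in> tup H (n + m) \<longleftrightarrow> a \<in> tup H n \<and> b \<in> tup H m"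
    and set_tup: "\<lbrakk>a \<in> tup H n; b \<in> tup H m; set c \<subseteq> set a \<union> set b; length c = z\<rbrakk> \<Longrightarrow> c \<in> tup H z"
begin

definition mats :: "nat \<Rightarrow> nat \<Rightarrow> ('h, 'v) matrix set" where
  "mats n m = {(n, m, \<phi>) | \<phi>. \<forall>H a b. \<phi> H a b \<noteq> 0 \<longrightarrow> a \<in> tup H n \<and> b \<in> tup H m}"

definition val :: "('h, 'v) matrix \<Rightarrow> 'h \<Rightarrow> 'v list \<Rightarrow> 'v list \<Rightarrow> nat" where
  "val X = snd (snd X)"

definition matseq :: "('h, 'v) matrix \<Rightarrow> ('h, 'v) matrix \<Rightarrow> ('h, 'v) matrix" where
  "matseq X Y = (fst X, fst (snd Y), \<lambda>H a b. \<Sum>c\<in>tup H (fst (snd X)). val X H a c * val Y H c b)"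

definition matpar :: "('h, 'v) matrix \<Rightarrow> ('h, 'v) matrix \<Rightarrow> ('h, 'v) matrix" where
  "matpar X Y = (fst X + fst Y, fst (snd X) + fst (snd Y),
     \<lambda>H a b. val X H (take (fst X) a) (take (fst (snd X)) b) * val Y H (drop (fst X) a) (drop (fst (snd X)) b))"

definition matle :: "('h, 'v) matrix \<Rightarrow> ('h, 'v) matrix \<Rightarrow> bool" where
  "matle X Y \<longleftrightarrow> (\<forall>H a b. val X H a b > 0 \<longrightarrow> val Y H a b > 0)"

definition rel :: "nat \<Rightarrow> nat \<Rightarrow> ('v list \<Rightarrow> 'v list \<Rightarrow> bool) \<Rightarrow> ('h, 'v) matrix" where
  "rel n m r = (n, m, \<lambda>H a b. of_bool (a \<in> tup H n \<and> b \<in> tup H m \<and> r a b))"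

definition Mat :: "(nat, ('h, 'v) matrix) pcb" where
  "Mat = \<lparr>
     Obj = UNIV,
     Hom = mats,
     ident = (\<lambda>n. rel n n (=)),
     seq = matseq,
     oplus_obj = (+),
     oplus = matpar,
     unit_obj = 0,
     assoc = (\<lambda>n m p. rel (n + m + p) (n + m + p) (=)),
     lunit = (\<lambda>n. rel n n (=)),
     runit = (\<lambda>n. rel n n (=)),
     symm = (\<lambda>n m. rel (n + m) (m + n) (\<lambda>a b. b = drop n a @ take n a)),
     le = matle,
     mu = (\<lambda>n. rel (n + n) n (\<lambda>a b. a = b @ b)),
     eta = (\<lambda>n. rel 0 n (\<lambda>a b. True)),
     delta = (\<lambda>n. rel n (n + n) (\<lambda>a b. b = a @ a)),
     eps = (\<lambda>n. rel n 0 (\<lambda>a b. True)) \<rparr>"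

lemma Mat_simps [simp]:
  "Obj Mat = UNIV" "Hom Mat = mats" "ident Mat = (\<lambda>n. rel n n (=))" "seq Mat = matseq"
  "oplus_obj Mat = (+)" "oplus Mat = matpar" "unit_obj Mat = 0"
  "assoc Mat = (\<lambda>n m p. rel (n + m + p) (n + m + p) (=))"
  "lunit Mat = (\<lambda>n. rel n n (=))" "runit Mat = (\<lambda>n. rel n n (=))"
  "symm Mat = (\<lambda>n m. rel (n + m) (m + n) (\<lambda>a b. b = drop n a @ take n a))"
  "le Mat = matle"
  "mu Mat = (\<lambda>n. rel (n + n) n (\<lambda>a b. a = b @ b))"
  "eta Mat = (\<lambda>n. rel 0 n (\<lambda>a b. True))"
  "delta Mat = (\<lambda>n. rel n (n + n) (\<lambda>a b. b = a @ a))"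
  "eps Mat = (\<lambda>n. rel n 0 (\<lambda>a b. True))"
  by (simp_all add: Mat_def)

lemma take_drop_tup: "a \<in> tup H (n + m) \<longleftrightarrow> length a = n + m \<and> take n a \<in> tup H n \<and> drop n a \<in> tup H m"
  using append_tup [of "take n a" n "drop n a" m H] length_tup [of a H "n + m"] by fastforce

lemma take_tup: "a \<in> tup H (n + m) \<Longrightarrow> take n a \<in> tup H n"
  and drop_tup: "a \<in> tup H (n + m) \<Longrightarrow> drop n a \<in> tup H m"
  by (auto simp: take_drop_tup)

lemma append_tupI: "\<lbrakk>a \<in> tup H n; b \<in> tup H m\<rbrakk> \<Longrightarrow> a @ b \<in> tup H (n + m)"
  by (simp add: append_tup length_tup)

lemma Nil_tup: "a \<in> tup H n \<Longrightarrow> [] \<in> tup H 0"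
  using append_tup [of "[]" 0 a n H] length_tup [of a H n] by simp

lemma tup_0: "a \<in> tup H 0 \<Longrightarrow> a = []"
  using length_tup by fastforce

lemma matsD: "X \<in> mats n m \<Longrightarrow> fst X = n \<and> fst (snd X) = m"
  by (auto simp: mats_def)

lemma mats_val: "X \<in> mats n m \<Longrightarrow> val X H a b \<noteq> 0 \<Longrightarrow> a \<in> tup H n \<and> b \<in> tup H m"
  by (auto simp: mats_def val_def)

lemma matsI: "\<lbrakk>fst X = n; fst (snd X) = m; \<And>H a b. val X H a b \<noteq> 0 \<Longrightarrow> a \<in> tup H n \<and> b \<in> tup H m\<rbrakk> \<Longrightarrow> X \<in> mats n m"
  unfolding mats_def val_def by (cases X) auto

lemma mats_eqI:
  assumes "X \<in> mats n m" "Y \<in> mats n m" "\<And>H a b. \<lbrakk>a \<in> tup H n; b \<in> tup H m\<rbrakk> \<Longrightarrow> val X H a b = val Y H a b"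
  shows "X = Y"
proof -
  have "val X H a b = val Y H a b" for H a b
  proof (cases "a \<in> tup H n \<and> b \<in> tup H m")
    case False
    then have "val X H a b = 0" "val Y H a b = 0" using mats_val assms(1,2) by blast+
    then show ?thesis by simp
  qed (use assms(3) in blast)
  then have "val X = val Y" by blast
  then show ?thesis using matsD [OF assms(1)] matsD [OF assms(2)] by (simp add: val_def prod_eq_iff)
qed

lemma rel_mats [simp]: "rel n m r \<in> mats n m"
  by (rule matsI) (auto simp: rel_def val_def split: if_splits)

lemma val_rel: "val (rel n m r) H a b = of_bool (a \<in> tup H n \<and> b \<in> tup H m \<and> r a b)"
  by (simp add: rel_def val_def)

lemma val_seq: "X \<in> mats n z \<Longrightarrow> val (matseq X Y) H a b = (\<Sum>c\<in>tup H z. val X H a c * val Y H c b)"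
  using matsD [of X n z] by (simp add: matseq_def val_def)

lemma val_par: "X \<in> mats n m \<Longrightarrow>
   val (matpar X Y) H a b = val X H (take n a) (take m b) * val Y H (drop n a) (drop m b)"
  using matsD [of X n m] by (simp add: matpar_def val_def)

lemma matseq_mats [simp]:
  assumes "X \<in> mats n z" "Y \<in> mats z m"
  shows "matseq X Y \<in> mats n m"
proof (rule matsI)
  fix H a b
  assume "val (matseq X Y) H a b \<noteq> 0"
  then obtain c where "val X H a c * val Y H c b \<noteq> 0"
    unfolding val_seq [OF assms(1)] by (meson sum.not_neutral_contains_not_neutral)
  then show "a \<in> tup H n \<and> b \<in> tup H m" using mats_val assms by fastforce
qed (use matsD assms in \<open>auto simp: matseq_def\<close>)

lemma matpar_mats [simp]:
  assumes "X \<in> mats n m" "Y \<in> mats p q"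
  shows "matpar X Y \<in> mats (n + p) (m + q)"
proof (rule matsI)
  fix H a b
  assume "val (matpar X Y) H a b \<noteq> 0"
  then have "val X H (take n a) (take m b) \<noteq> 0" "val Y H (drop n a) (drop m b) \<noteq> 0"
    using val_par [OF assms(1)] by auto
  then have "take n a \<in> tup H n" "take m b \<in> tup H m" "drop n a \<in> tup H p" "drop m b \<in> tup H q"
    using mats_val assms by blast+
  then show "a \<in> tup H (n + p) \<and> b \<in> tup H (m + q)"
    using append_tupI [of "take n a" H n "drop n a" p] append_tupI [of "take m b" H m "drop m b" q] by simp
qed (use matsD assms in \<open>auto simp: matpar_def\<close>)

lemma val_rel_seq:
  assumes "\<And>c. c \<in> tup H z \<Longrightarrow> r a c \<Longrightarrow> c = g"
  shows "val (matseq (rel n z r) Y) H a b = of_bool (a \<in> tup H n \<and> g \<in> tup H z \<and> r a g) * val Y H g b"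
proof -
  have "val (matseq (rel n z r) Y) H a b = (\<Sum>c\<in>tup H z. if c = g then of_bool (a \<in> tup H n \<and> r a g) * val Y H g b else 0)"
    unfolding val_seq [OF rel_mats] by (rule sum.cong) (use assms in \<open>auto simp: val_rel\<close>)
  then show ?thesis by (simp add: sum.delta finite_tup)
qed

lemma val_seq_rel:
  assumes "X \<in> mats n z" "\<And>c. c \<in> tup H z \<Longrightarrow> r c b \<Longrightarrow> c = g"
  shows "val (matseq X (rel z m r)) H a b = val X H a g * of_bool (b \<in> tup H m \<and> g \<in> tup H z \<and> r g b)"
proof -
  have "val (matseq X (rel z m r)) H a b = (\<Sum>c\<in>tup H z. if c = g then val X H a g * of_bool (b \<in> tup H m \<and> r g b) else 0)"
    unfolding val_seq [OF assms(1)] by (rule sum.cong) (use assms in \<open>auto simp: val_rel\<close>)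
  then show ?thesis by (simp add: sum.delta finite_tup)
qed

lemma ident_matseq:
  assumes "X \<in> mats n m"
  shows "matseq (rel n n (=)) X = X"
proof (rule mats_eqI)
  show "matseq (rel n n (=)) X \<in> mats n m" using rel_mats assms by (rule matseq_mats)
  show "val (matseq (rel n n (=)) X) H a b = val X H a b" if "a \<in> tup H n" for H a b
    using that by (subst val_rel_seq [where g = a]) auto
qed (rule assms)

lemma matseq_ident:
  assumes "X \<in> mats n m"
  shows "matseq X (rel m m (=)) = X"
proof (rule mats_eqI)
  show "matseq X (rel m m (=)) \<in> mats n m" using assms rel_mats by (rule matseq_mats)
  show "val (matseq X (rel m m (=))) H a b = val X H a b" if "b \<in> tup H m" for H a b
    using that by (subst val_seq_rel [OF assms, where g = b]) auto
qed (rule assms)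

lemma matseq_assoc:
  assumes "X \<in> mats n p" "Y \<in> mats p q" "Z \<in> mats q m"
  shows "matseq (matseq X Y) Z = matseq X (matseq Y Z)"
proof (rule mats_eqI)
  fix H a b
  have "(\<Sum>d\<in>tup H q. (\<Sum>c\<in>tup H p. val X H a c * val Y H c d) * val Z H d b) =
     (\<Sum>c\<in>tup H p. val X H a c * (\<Sum>d\<in>tup H q. val Y H c d * val Z H d b))"
    unfolding sum_distrib_left sum_distrib_right by (subst sum.swap) (simp add: mult.assoc)
  then show "val (matseq (matseq X Y) Z) H a b = val (matseq X (matseq Y Z)) H a b"
    using assms by (simp add: val_seq [of _ n q] val_seq [of _ n p] val_seq [of _ p q])
qed (use assms matseq_mats in blast)+

lemma sum_tup_add:
  "(\<Sum>c\<in>tup H (n + m). F (take n c) (drop n c)) = (\<Sum>c\<in>tup H n. \<Sum>d\<in>tup H m. F c d)"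
proof -
  have "(\<Sum>c\<in>tup H (n + m). F (take n c) (drop n c)) = (\<Sum>(c, d)\<in>tup H n \<times> tup H m. F c d)"
    by (rule sum.reindex_bij_witness [of _ "\<lambda>(c, d). c @ d" "\<lambda>c. (take n c, drop n c)"])
      (auto simp: append_tupI take_tup drop_tup length_tup)
  then show ?thesis by (simp add: sum.cartesian_product)
qed

lemma mat_interchange:
  assumes "f \<in> mats n z" "g \<in> mats z m" "f' \<in> mats n' z'" "g' \<in> mats z' m'"
  shows "matpar (matseq f g) (matseq f' g') = matseq (matpar f f') (matpar g g')"
proof (rule mats_eqI)
  fix H a b
  have "val (matpar (matseq f g) (matseq f' g')) H a b =
    (\<Sum>c\<in>tup H z. \<Sum>d\<in>tup H z'. (val f H (take n a) c * val g H c (take m b)) * (val f' H (drop n a) d * val g' H d (drop m b)))"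
    using assms by (simp add: val_par [of _ n m] val_seq [of f n z] val_seq [of f' n' z'] sum_product)
  also have "\<dots> = (\<Sum>c\<in>tup H (z + z'). (val f H (take n a) (take z c) * val g H (take z c) (take m b)) *
      (val f' H (drop n a) (drop z c) * val g' H (drop z c) (drop m b)))"
    by (rule sum_tup_add [symmetric])
  also have "\<dots> = val (matseq (matpar f f') (matpar g g')) H a b"
    using assms by (simp add: val_seq [of _ "n + n'" "z + z'"] val_par [of f n z] val_par [of g z m] mult_ac)
  finally show "val (matpar (matseq f g) (matseq f' g')) H a b = val (matseq (matpar f f') (matpar g g')) H a b" .
qed (use assms matseq_mats matpar_mats in blast)+

lemma rel_par: "matpar (rel n m r) (rel p q s) =
    rel (n + p) (m + q) (\<lambda>a b. r (take n a) (take m b) \<and> s (drop n a) (drop m b))"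
  by (rule mats_eqI [of _ "n + p" "m + q"]) (auto simp: val_par [of _ n m] val_rel take_tup drop_tup)

lemma rel_cong: "(\<And>a b. length a = n \<Longrightarrow> length b = m \<Longrightarrow> r a b = s a b) \<Longrightarrow> rel n m r = rel n m s"
  by (rule mats_eqI [of _ n m]) (auto simp: val_rel length_tup)

lemma ident_par: "matpar (rel n n (=)) (rel m m (=)) = rel (n + m) (n + m) (=)"
  unfolding rel_par by (rule rel_cong) (metis append_take_drop_id)

lemma matpar_assoc:
  assumes "f \<in> mats n m" "g \<in> mats n' m'" "h \<in> mats n'' m''"
  shows "matpar (matpar f g) h = matpar f (matpar g h)"
proof (rule mats_eqI)
  show "matpar (matpar f g) h \<in> mats (n + n' + n'') (m + m' + m'')" using assms matpar_mats by blast
  show "matpar f (matpar g h) \<in> mats (n + n' + n'') (m + m' + m'')"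
    using assms matpar_mats [OF assms(1) matpar_mats [OF assms(2,3)]] by (simp add: add.assoc)
qed (use assms in \<open>simp add: val_par [of f n m] val_par [of g n' m'] val_par [of _ "n + n'" "m + m'"]
      mult.assoc drop_take add.commute [of n' n] add.commute [of m' m]\<close>)

lemma unit_matpar: "f \<in> mats n m \<Longrightarrow> matpar (rel 0 0 (=)) f = f"
  by (rule mats_eqI [of _ n m]) (use matpar_mats [of "rel 0 0 (=)" 0 0 f n m] in \<open>auto simp: val_par [of _ 0 0] val_rel Nil_tup\<close>)

lemma matpar_unit: "f \<in> mats n m \<Longrightarrow> matpar f (rel 0 0 (=)) = f"
  by (rule mats_eqI [of _ n m]) (use matpar_mats [of f n m "rel 0 0 (=)" 0 0] in \<open>auto simp: val_par [of _ n m] val_rel Nil_tup length_tup\<close>)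

lemma rel_seq_rel:
  assumes t: "\<And>a b. \<lbrakk>length a = n; length b = m\<rbrakk> \<Longrightarrow> t a b \<longleftrightarrow> (\<exists>c. length c = z \<and> r a c \<and> s c b)"
    and unique: "\<And>a b c c'. \<lbrakk>length a = n; length b = m; length c = z; length c' = z; r a c; s c b; r a c'; s c' b\<rbrakk> \<Longrightarrow> c = c'"
    and sub: "\<And>a b c. \<lbrakk>length a = n; length b = m; length c = z; r a c; s c b\<rbrakk> \<Longrightarrow> set c \<subseteq> set a \<union> set b"
  shows "matseq (rel n z r) (rel z m s) = rel n m t"
proof (rule mats_eqI)
  fix H a b assume ab: "a \<in> tup H n" "b \<in> tup H m"
  then have l: "length a = n" "length b = m" by (auto simp: length_tup)
  have v: "val (matseq (rel n z r) (rel z m s)) H a b = (\<Sum>c\<in>tup H z. of_bool (r a c \<and> s c b))"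
    unfolding val_seq [OF rel_mats] using ab by (intro sum.cong) (auto simp: val_rel)
  show "val (matseq (rel n z r) (rel z m s)) H a b = val (rel n m t) H a b"
  proof (cases "t a b")
    case True
    then obtain g where g: "length g = z" "r a g" "s g b" using t [OF l] by blast
    then have gz: "g \<in> tup H z" using set_tup [OF ab sub [OF l]] by blast
    have "r a c \<and> s c b \<longleftrightarrow> c = g" if "c \<in> tup H z" for c
      using unique [OF l length_tup [OF that] g(1) _ _ g(2,3)] g by blast
    then have "(\<Sum>c\<in>tup H z. of_bool (r a c \<and> s c b)) = (\<Sum>c\<in>tup H z. if c = g then 1 else (0 :: nat))"
      by (intro sum.cong) auto
    then show ?thesis using v gz ab True by (simp add: sum.delta finite_tup val_rel)
  next
    case False
    then have "\<not> (r a c \<and> s c b)" if "c \<in> tup H z" for c using t [OF l] length_tup [OF that] by blast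
    then have "(\<Sum>c\<in>tup H z. of_bool (r a c \<and> s c b)) = (0 :: nat)" by (intro sum.neutral) auto
    then show ?thesis using v False by (simp add: val_rel)
  qed
qed (use matseq_mats rel_mats in blast)+

lemma symm_natural':
  assumes "f \<in> mats n n'" "g \<in> mats m m'"
  shows "matseq (matpar f g) (rel (n' + m') (m' + n') (\<lambda>a b. b = drop n' a @ take n' a)) =
    matseq (rel (n + m) (m + n) (\<lambda>a b. b = drop n a @ take n a)) (matpar g f)"
proof (rule mats_eqI)
  fix H a b
  assume a: "a \<in> tup H (n + m)" and b: "b \<in> tup H (m' + n')"
  have b': "drop m' b @ take m' b \<in> tup H (n' + m')" using b take_drop_tup by (intro append_tupI) auto
  have a': "drop n a @ take n a \<in> tup H (m + n)" using a take_drop_tup by (intro append_tupI) auto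
  have len: "length b = m' + n'" "length a = n + m" using a b length_tup by auto
  have "val (matseq (matpar f g) (rel (n' + m') (m' + n') (\<lambda>a b. b = drop n' a @ take n' a))) H a b =
     val (matpar f g) H a (drop m' b @ take m' b) * of_bool (b \<in> tup H (m' + n') \<and> drop m' b @ take m' b \<in> tup H (n' + m') \<and> True)"
    using len by (subst val_seq_rel [OF matpar_mats [OF assms], where g = "drop m' b @ take m' b"]) (auto simp: length_tup)
  also have "\<dots> = val (matseq (rel (n + m) (m + n) (\<lambda>a b. b = drop n a @ take n a)) (matpar g f)) H a b"
    using assms a b a' b' len
    by (simp add: val_rel_seq [where g = "drop n a @ take n a"] val_par [of f n n'] val_par [of g m m'] mult.commute)
  finally show "val (matseq (matpar f g) (rel (n' + m') (m' + n') (\<lambda>a b. b = drop n' a @ take n' a))) H a b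
    = val (matseq (rel (n + m) (m + n) (\<lambda>a b. b = drop n a @ take n a)) (matpar g f)) H a b" .
qed (use assms matseq_mats matpar_mats rel_mats in blast)+

lemma matle_refl: "matle f f"
  and matle_trans: "\<lbrakk>matle f g; matle g h\<rbrakk> \<Longrightarrow> matle f h"
  by (auto simp: matle_def)

lemma val_seq_pos: "X \<in> mats n z \<Longrightarrow> val (matseq X Y) H a b > 0 \<longleftrightarrow> (\<exists>c\<in>tup H z. val X H a c > 0 \<and> val Y H c b > 0)"
  by (simp add: val_seq [of X n z] zero_less_iff_neq_zero finite_tup del: neq0_conv)

lemma matseq_mono:
  "\<lbrakk>f \<in> mats n z; f' \<in> mats n z; matle f f'; matle g g'\<rbrakk> \<Longrightarrow> matle (matseq f g) (matseq f' g')"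
  unfolding matle_def by (simp add: val_seq_pos [of f n z] val_seq_pos [of f' n z]) blast

lemma matpar_mono:
  "\<lbrakk>f \<in> mats n z; f' \<in> mats n z; matle f f'; matle g g'\<rbrakk> \<Longrightarrow> matle (matpar f g) (matpar f' g')"
  unfolding matle_def by (simp add: val_par [of f n z] val_par [of f' n z])

end

context matrices
begin

lemma take_drop_eq_iff: "\<lbrakk>length u = k; k \<le> length a\<rbrakk> \<Longrightarrow> take k a = u \<and> drop k a = v \<longleftrightarrow> a = u @ v"
  by (metis append_eq_conv_conj)

lemma symm_add_right:
  "matseq (matpar (rel (x + y) (y + x) (\<lambda>a b. b = drop x a @ take x a)) (rel z z (=)))
     (matpar (rel y y (=)) (rel (x + z) (z + x) (\<lambda>a b. b = drop x a @ take x a))) =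
   rel (x + (y + z)) (y + z + x) (\<lambda>a b. b = drop x a @ take x a)"
proof -
  have 1: "matpar (rel (x + y) (y + x) (\<lambda>a b. b = drop x a @ take x a)) (rel z z (=)) =
    rel (x + (y + z)) (y + (x + z)) (\<lambda>a b. b = drop x (take (x + y) a) @ take x a @ drop (x + y) a)"
    unfolding rel_par add.assoc [symmetric]
  proof (rule rel_cong)
    fix a b :: "'v list"
    assume "length a = x + y + z" "length b = y + x + z"
    then show "take (y + x) b = drop x (take (x + y) a) @ take x (take (x + y) a) \<and> drop (x + y) a = drop (y + x) b
        \<longleftrightarrow> b = drop x (take (x + y) a) @ take x a @ drop (x + y) a"
      using take_drop_eq_iff [of "drop x (take (x + y) a) @ take x (take (x + y) a)" "y + x" b "drop (x + y) a"] by auto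
  qed
  have 2: "matpar (rel y y (=)) (rel (x + z) (z + x) (\<lambda>a b. b = drop x a @ take x a)) =
    rel (y + (x + z)) (y + (z + x)) (\<lambda>a b. b = take y a @ drop x (drop y a) @ take x (drop y a))"
    unfolding rel_par
  proof (rule rel_cong)
    fix a b :: "'v list"
    assume "length a = y + (x + z)" "length b = y + (z + x)"
    then show "take y a = take y b \<and> drop y b = drop x (drop y a) @ take x (drop y a)
        \<longleftrightarrow> b = take y a @ drop x (drop y a) @ take x (drop y a)"
      using take_drop_eq_iff [of "take y a" y b "drop x (drop y a) @ take x (drop y a)"] by auto
  qed
  have "matseq (rel (x + (y + z)) (y + (x + z)) (\<lambda>a b. b = drop x (take (x + y) a) @ take x a @ drop (x + y) a))
      (rel (y + (x + z)) (y + (z + x)) (\<lambda>a b. b = take y a @ drop x (drop y a) @ take x (drop y a))) =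
    rel (x + (y + z)) (y + (z + x)) (\<lambda>a b. b = drop x a @ take x a)"
  proof (rule rel_seq_rel)
    fix a b :: "'v list"
    assume "length a = x + (y + z)"
    then obtain a1 a2 a3 where "a = a1 @ a2 @ a3" "length a1 = x" "length a2 = y" "length a3 = z"
      by (metis length_eq_add_split)
    then show "b = drop x a @ take x a \<longleftrightarrow> (\<exists>c. length c = y + (x + z) \<and>
        c = drop x (take (x + y) a) @ take x a @ drop (x + y) a \<and>
        b = take y c @ drop x (drop y c) @ take x (drop y c))"
      by simp
  qed (auto dest: in_set_takeD in_set_dropD)
  then show ?thesis unfolding 1 2 by (simp add: add.assoc)
qed

lemma symm_symm': 
  "matseq (rel (x + y) (y + x) (\<lambda>a b. b = drop x a @ take x a)) (rel (y + x) (x + y) (\<lambda>a b. b = drop y a @ take y a))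
   = rel (x + y) (x + y) (=)"
  by (rule rel_seq_rel) (auto dest: in_set_takeD in_set_dropD)

abbreviation (input) Mu :: "nat \<Rightarrow> ('h, 'v) matrix" where "Mu n \<equiv> rel (n + n) n (\<lambda>a b. a = b @ b)"
abbreviation (input) Delta :: "nat \<Rightarrow> ('h, 'v) matrix" where "Delta n \<equiv> rel n (n + n) (\<lambda>a b. b = a @ a)"
abbreviation (input) Eta :: "nat \<Rightarrow> ('h, 'v) matrix" where "Eta n \<equiv> rel 0 n (\<lambda>a b. True)"
abbreviation (input) Eps :: "nat \<Rightarrow> ('h, 'v) matrix" where "Eps n \<equiv> rel n 0 (\<lambda>a b. True)"
abbreviation (input) Id :: "nat \<Rightarrow> ('h, 'v) matrix" where "Id n \<equiv> rel n n (=)"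

lemma Mu_par_Id: "matpar (Mu n) (Id p) = rel (n + (n + p)) (n + p) (\<lambda>a b. a = take n b @ take n b @ drop n b)"
  unfolding rel_par add.assoc [symmetric]
proof (rule rel_cong)
  fix a b :: "'v list"
  assume "length a = n + n + p" "length b = n + p"
  then show "take (n + n) a = take n b @ take n b \<and> drop (n + n) a = drop n b \<longleftrightarrow> a = take n b @ take n b @ drop n b"
    using take_drop_eq_iff [of "take n b @ take n b" "n + n" a "drop n b"] by simp
qed

lemma Id_par_Mu: "matpar (Id p) (Mu n) = rel (p + (n + n)) (p + n) (\<lambda>a b. a = take p b @ drop p b @ drop p b)"
  unfolding rel_par
proof (rule rel_cong)
  fix a b :: "'v list"
  assume "length a = p + (n + n)" "length b = p + n"
  then show "take p a = take p b \<and> drop p a = drop p b @ drop p b \<longleftrightarrow> a = take p b @ drop p b @ drop p b"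
    using take_drop_eq_iff [of "take p b" p a "drop p b @ drop p b"] by simp
qed

lemma Delta_par_Id: "matpar (Delta n) (Id p) = rel (n + p) (n + (n + p)) (\<lambda>a b. b = take n a @ take n a @ drop n a)"
  unfolding rel_par add.assoc [symmetric]
proof (rule rel_cong)
  fix a b :: "'v list"
  assume "length a = n + p" "length b = n + n + p"
  then show "take (n + n) b = take n a @ take n a \<and> drop n a = drop (n + n) b \<longleftrightarrow> b = take n a @ take n a @ drop n a"
    using take_drop_eq_iff [of "take n a @ take n a" "n + n" b "drop n a"] by auto
qed

lemma Id_par_Delta: "matpar (Id p) (Delta n) = rel (p + n) (p + (n + n)) (\<lambda>a b. b = take p a @ drop p a @ drop p a)"
  unfolding rel_par
proof (rule rel_cong)
  fix a b :: "'v list"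
  assume "length a = p + n" "length b = p + (n + n)"
  then show "take p a = take p b \<and> drop p b = drop p a @ drop p a \<longleftrightarrow> b = take p a @ drop p a @ drop p a"
    using take_drop_eq_iff [of "take p a" p b "drop p a @ drop p a"] by auto
qed

lemma Mu_assoc:
  "matseq (matpar (Mu n) (Id n)) (Mu n) = matseq (matpar (Id n) (Mu n)) (Mu n)"
proof -
  have "matseq (matpar (Mu n) (Id n)) (Mu n) = rel (n + (n + n)) n (\<lambda>a b. a = b @ b @ b)"
    unfolding Mu_par_Id by (rule rel_seq_rel) auto
  moreover have "matseq (matpar (Id n) (Mu n)) (Mu n) = rel (n + (n + n)) n (\<lambda>a b. a = b @ b @ b)"
    unfolding Id_par_Mu by (rule rel_seq_rel) auto
  ultimately show ?thesis by simp
qed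

lemma Mu_lunit: "matseq (matpar (Eta n) (Id n)) (Mu n) = Id n"
  unfolding rel_par add_0 by (rule rel_seq_rel) (auto dest: in_set_takeD in_set_dropD)

lemma Mu_runit: "matseq (matpar (Id n) (Eta n)) (Mu n) = Id n"
  unfolding rel_par add_0_right by (rule rel_seq_rel) (auto dest: in_set_takeD in_set_dropD)

lemma Mu_comm: "matseq (rel (n + n) (n + n) (\<lambda>a b. b = drop n a @ take n a)) (Mu n) = Mu n"
proof (rule rel_seq_rel)
  fix a b :: "'v list"
  assume "length a = n + n" "length b = n"
  moreover from this(1) obtain a1 a2 where "a = a1 @ a2" "length a1 = n" "length a2 = n" by (metis length_eq_add_split)
  ultimately show "a = b @ b \<longleftrightarrow> (\<exists>c. length c = n + n \<and> c = drop n a @ take n a \<and> c = b @ b)" by auto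
qed auto

lemma Delta_assoc:
  "matseq (Delta n) (matpar (Delta n) (Id n)) = matseq (Delta n) (matpar (Id n) (Delta n))"
proof -
  have "matseq (Delta n) (matpar (Delta n) (Id n)) = rel n (n + (n + n)) (\<lambda>a b. b = a @ a @ a)"
    unfolding Delta_par_Id by (rule rel_seq_rel) auto
  moreover have "matseq (Delta n) (matpar (Id n) (Delta n)) = rel n (n + (n + n)) (\<lambda>a b. b = a @ a @ a)"
    unfolding Id_par_Delta by (rule rel_seq_rel) auto
  ultimately show ?thesis by simp
qed

lemma Delta_lunit: "matseq (Delta n) (matpar (Eps n) (Id n)) = Id n"
  unfolding rel_par add_0 by (rule rel_seq_rel) auto

lemma Delta_runit: "matseq (Delta n) (matpar (Id n) (Eps n)) = Id n"
  unfolding rel_par add_0_right by (rule rel_seq_rel) auto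

lemma Delta_comm: "matseq (Delta n) (rel (n + n) (n + n) (\<lambda>a b. b = drop n a @ take n a)) = Delta n"
  by (rule rel_seq_rel) auto

lemma Mu_Delta: "matseq (Mu n) (Delta n) = rel (n + n) (n + n) (\<lambda>a b. \<exists>c. length c = n \<and> a = c @ c \<and> b = c @ c)"
  by (rule rel_seq_rel) auto

lemma double_pair_iff:
  assumes "length a1 = n" "length a2 = n" "length b1 = n" "length b2 = n"
  shows "(\<exists>c. length c = n \<and> a1 @ a2 = c @ c \<and> b1 @ b2 = c @ c) \<longleftrightarrow> a2 = a1 \<and> b1 = a1 \<and> b2 = a1"
proof
  assume "\<exists>c. length c = n \<and> a1 @ a2 = c @ c \<and> b1 @ b2 = c @ c"
  then obtain c where "length c = n" "a1 @ a2 = c @ c" "b1 @ b2 = c @ c" by blast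
  then show "a2 = a1 \<and> b1 = a1 \<and> b2 = a1" using assms by simp
qed (use assms in blast)

lemma Frobenius_left: "matseq (matpar (Delta n) (Id n)) (matpar (Id n) (Mu n)) = matseq (Mu n) (Delta n)"
  unfolding Mu_Delta Delta_par_Id Id_par_Mu
proof (rule rel_seq_rel)
  fix a b :: "'v list"
  assume "length a = n + n" "length b = n + n"
  then obtain a1 a2 b1 b2 where ab: "a = a1 @ a2" "b = b1 @ b2"
    and len: "length a1 = n" "length a2 = n" "length b1 = n" "length b2 = n"
    by (metis length_eq_add_split)
  have "(\<exists>c. length c = n + (n + n) \<and> c = take n a @ take n a @ drop n a \<and> c = take n b @ drop n b @ drop n b)
      \<longleftrightarrow> a2 = a1 \<and> b1 = a1 \<and> b2 = a1"
    using ab len by (simp, blast)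
  then show "(\<exists>c. length c = n \<and> a = c @ c \<and> b = c @ c) \<longleftrightarrow> (\<exists>c. length c = n + (n + n) \<and>
      c = take n a @ take n a @ drop n a \<and> c = take n b @ drop n b @ drop n b)"
    using double_pair_iff [OF len] ab by simp
qed (auto dest: in_set_takeD in_set_dropD)

lemma Frobenius_right: "matseq (matpar (Id n) (Delta n)) (matpar (Mu n) (Id n)) = matseq (Mu n) (Delta n)"
  unfolding Mu_Delta Id_par_Delta Mu_par_Id
proof (rule rel_seq_rel)
  fix a b :: "'v list"
  assume "length a = n + n" "length b = n + n"
  then obtain a1 a2 b1 b2 where ab: "a = a1 @ a2" "b = b1 @ b2"
    and len: "length a1 = n" "length a2 = n" "length b1 = n" "length b2 = n"
    by (metis length_eq_add_split)
  have "(\<exists>c. length c = n + (n + n) \<and> c = take n a @ drop n a @ drop n a \<and> c = take n b @ take n b @ drop n b)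
      \<longleftrightarrow> a2 = a1 \<and> b1 = a1 \<and> b2 = a1"
    using ab len by (simp, blast)
  then show "(\<exists>c. length c = n \<and> a = c @ c \<and> b = c @ c) \<longleftrightarrow> (\<exists>c. length c = n + (n + n) \<and>
      c = take n a @ drop n a @ drop n a \<and> c = take n b @ take n b @ drop n b)"
    using double_pair_iff [OF len] ab by simp
qed (auto dest: in_set_takeD in_set_dropD)

lemma Special: "matseq (Delta n) (Mu n) = Id n"
  by (rule rel_seq_rel) auto

lemma Id_le_Eps_Eta: "matle (Id n) (matseq (Eps n) (Eta n))"
  unfolding matle_def by (auto simp: val_seq_pos [OF rel_mats] val_rel intro: Nil_tup)

lemma Eta_Eps_le_Id: "matle (matseq (Eta n) (Eps n)) (Id 0)"
  unfolding matle_def by (auto simp: val_seq_pos [OF rel_mats] val_rel dest: tup_0)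

lemma Lax_Delta:
  assumes "R \<in> mats n m"
  shows "matle (matseq R (Delta m)) (matseq (Delta n) (matpar R R))"
proof -
  have "a @ a \<in> tup H (n + n) \<and> take n (a @ a) = a \<and> drop n (a @ a) = a \<and> a \<in> tup H n \<and>
      take m (c @ c) = c \<and> drop m (c @ c) = c" if "val R H a c > 0" for H a c
    using mats_val [OF assms, of H a c] that by (auto simp: length_tup append_tupI)
  then show ?thesis
    unfolding matle_def val_seq_pos [OF assms] val_seq_pos [OF rel_mats] val_par [OF assms] val_rel
    by force
qed

lemma Lax_Eps: "R \<in> mats n m \<Longrightarrow> matle (matseq R (Eps m)) (Eps n)"
  unfolding matle_def using mats_val by (fastforce simp: val_seq_pos [of R n m] val_rel)

lemma Id_iso: "is_iso Mat n n (Id n)"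
  unfolding is_iso_def is_inverse_def by (intro exI [of _ "Id n"]) (simp add: ident_matseq [OF rel_mats])

lemma Id_inverse: "inverse_of Mat n n (Id n) = Id n"
  unfolding inverse_of_def
proof (rule the_equality)
  show "is_inverse Mat n n (Id n) (Id n)" by (simp add: is_inverse_def ident_matseq [OF rel_mats])
  show "g = Id n" if "is_inverse Mat n n (Id n) g" for g
  proof -
    have "g \<in> mats n n" "matseq (Id n) g = Id n" using that by (simp_all add: is_inverse_def)
    then show ?thesis by (simp add: ident_matseq)
  qed
qed

lemma Mu_Delta_le_Id: "matle (matseq (Mu n) (Delta n)) (Id (n + n))"
  unfolding Mu_Delta by (auto simp: matle_def val_rel)

lemma Id_seq_par: "\<lbrakk>f \<in> mats n m; g \<in> mats p q\<rbrakk> \<Longrightarrow> matseq (Id (n + p)) (matpar f g) = matpar f g"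
  by (rule ident_matseq, rule matpar_mats)

lemma par_seq_Id: "\<lbrakk>f \<in> mats n m; g \<in> mats p q\<rbrakk> \<Longrightarrow> matseq (matpar f g) (Id (m + q)) = matpar f g"
  by (rule matseq_ident, rule matpar_mats)

lemmas Id_simps = ident_par ident_matseq [OF rel_mats] matseq_ident [OF rel_mats] Id_iso Id_inverse
  Id_seq_par [OF rel_mats rel_mats] par_seq_Id [OF rel_mats rel_mats]

lemma Mat_pcb: "preordered_cartesian_bicategory Mat"
proof (unfold_locales, simp_all add: Id_simps ident_matseq matseq_ident matseq_assoc mat_interchange symm_natural'
    symm_symm' matpar_assoc unit_matpar matpar_unit Id_seq_par par_seq_Id
    Mu_lunit Mu_runit Mu_comm Delta_lunit Delta_runit Delta_comm Special
    Id_le_Eps_Eta Eta_Eps_le_Id matle_refl Lax_Delta Lax_Eps add.assoc, goal_cases)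
  case 1
  then show ?case using matsD by metis
next
  case (2 X Y Z X' Y' Z' f g h)
  then have "matpar f (matpar g h) \<in> mats (X + (Y + Z)) (X' + (Y' + Z'))" by simp
  then show ?case by (simp add: ident_matseq matseq_ident)
next
  case (3 X Y Z)
  let ?A = "matpar (rel (X + Y) (Y + X) (\<lambda>a b. b = drop X a @ take X a)) (Id Z)"
  have "?A \<in> mats (X + Y + Z) (Y + X + Z)" by (rule matpar_mats [OF rel_mats rel_mats])
  then have "matseq ?A (Id (Y + (X + Z))) = ?A" using matseq_ident [of ?A] by (simp add: add.assoc)
  then show ?case using symm_add_right [of X Y Z] by (simp add: add.assoc)
next
  case 4
  then show ?case using matle_trans by blast
next
  case 5
  then show ?case using matseq_mono by blast
next
  case 6
  then show ?case using matpar_mono by blast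
next
  case 7
  show ?case by (rule Mu_assoc)
next
  case (8 X)
  let ?A = "matseq (Delta X) (matpar (Delta X) (Id X))"
  have "?A \<in> mats X (X + X + X)" by (rule matseq_mats [OF rel_mats matpar_mats [OF rel_mats rel_mats]])
  then have "matseq ?A (Id (X + (X + X))) = ?A" using matseq_ident [of ?A] by (simp add: add.assoc)
  then show ?case using Delta_assoc by simp
next
  case (9 X)
  let ?A = "matpar (Delta X) (Id X)"
  have "?A \<in> mats (X + X) (X + X + X)" by (rule matpar_mats [OF rel_mats rel_mats])
  then have "matseq ?A (Id (X + (X + X))) = ?A" using matseq_ident [of ?A] by (simp add: add.assoc)
  then show ?case using Frobenius_left by simp
next
  case 10
  show ?case by (rule Frobenius_right)
next
  case 11
  show ?case by (rule Mu_Delta_le_Id)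
qed

end


section \<open>Transport along embeddings\<close>

locale strict_pcb = preordered_cartesian_bicategory M for M :: "(nat, 'b) pcb" (structure) +
  assumes Obj_M [simp]: "Obj M = UNIV" and oplus_obj_M [simp]: "oplus_obj M = (+)" and unit_obj_M [simp]: "unit_obj M = 0"
    and assoc_M [simp]: "assoc M X Y Z = ident M (X + Y + Z)"
    and lunit_M [simp]: "lunit M X = ident M X" and runit_M [simp]: "runit M X = ident M X"

locale pcb_embedding = M: strict_pcb M
  for M :: "(nat, 'b) pcb" +
  fixes A :: "(nat, 'a) pcb" and F :: "'a \<Rightarrow> 'b"
  assumes Obj_A [simp]: "Obj A = UNIV" and oplus_obj_A [simp]: "oplus_obj A = (+)" and unit_obj_A [simp]: "unit_obj A = 0"
    and F_hom: "f \<in> Hom A X Y \<Longrightarrow> F f \<in> Hom M X Y"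
    and F_inj: "\<lbrakk>f \<in> Hom A X Y; g \<in> Hom A X Y; F f = F g\<rbrakk> \<Longrightarrow> f = g"
    and ident_A: "ident A X \<in> Hom A X X" "F (ident A X) = ident M X"
    and seq_A: "\<lbrakk>f \<in> Hom A X Y; g \<in> Hom A Y Z\<rbrakk> \<Longrightarrow> f ;;\<^bsub>A\<^esub> g \<in> Hom A X Z"
      "\<lbrakk>f \<in> Hom A X Y; g \<in> Hom A Y Z\<rbrakk> \<Longrightarrow> F (f ;;\<^bsub>A\<^esub> g) = F f ;;\<^bsub>M\<^esub> F g"
    and oplus_A: "\<lbrakk>f \<in> Hom A X Y; g \<in> Hom A X' Y'\<rbrakk> \<Longrightarrow> f \<oplus>\<^bsub>A\<^esub> g \<in> Hom A (X + X') (Y + Y')"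
      "\<lbrakk>f \<in> Hom A X Y; g \<in> Hom A X' Y'\<rbrakk> \<Longrightarrow> F (f \<oplus>\<^bsub>A\<^esub> g) = F f \<oplus>\<^bsub>M\<^esub> F g"
    and assoc_A: "assoc A X Y Z \<in> Hom A (X + Y + Z) (X + Y + Z)" "F (assoc A X Y Z) = ident M (X + Y + Z)"
    and lunit_A: "lunit A X \<in> Hom A X X" "F (lunit A X) = ident M X"
    and runit_A: "runit A X \<in> Hom A X X" "F (runit A X) = ident M X"
    and symm_A: "symm A X Y \<in> Hom A (X + Y) (Y + X)" "F (symm A X Y) = symm M X Y"
    and le_A: "\<lbrakk>f \<in> Hom A X Y; g \<in> Hom A X Y\<rbrakk> \<Longrightarrow> f \<sqsubseteq>\<^bsub>A\<^esub> g \<longleftrightarrow> F f \<sqsubseteq>\<^bsub>M\<^esub> F g"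
    and mu_A: "mu A X \<in> Hom A (X + X) X" "F (mu A X) = mu M X"
    and eta_A: "eta A X \<in> Hom A 0 X" "F (eta A X) = eta M X"
    and delta_A: "delta A X \<in> Hom A X (X + X)" "F (delta A X) = delta M X"
    and eps_A: "eps A X \<in> Hom A X 0" "F (eps A X) = eps M X"
begin

definition V :: "'a \<Rightarrow> bool" where "V f \<longleftrightarrow> (\<exists>X Y. f \<in> Hom A X Y)"
definition dm :: "'a \<Rightarrow> nat" where "dm f = (THE X. \<exists>Y. f \<in> Hom A X Y)"
definition cd :: "'a \<Rightarrow> nat" where "cd f = (THE Y. \<exists>X. f \<in> Hom A X Y)"

lemma Hom_A_unique: "\<lbrakk>f \<in> Hom A X Y; f \<in> Hom A X' Y'\<rbrakk> \<Longrightarrow> X = X' \<and> Y = Y'"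
  using M.hom_disjoint [of X Y X' Y' "F f"] F_hom by simp

lemma Hom_A_sort: "f \<in> Hom A X Y \<Longrightarrow> V f \<and> dm f = X \<and> cd f = Y"
  unfolding V_def dm_def cd_def by (blast intro: the_equality dest: Hom_A_unique)

lemma Hom_A_iff: "f \<in> Hom A X Y \<longleftrightarrow> V f \<and> dm f = X \<and> cd f = Y"
  using Hom_A_sort V_def by metis

lemma F_M [simp]: "V f \<Longrightarrow> dm f = X \<Longrightarrow> cd f = Y \<Longrightarrow> F f \<in> Hom M X Y"
  using F_hom Hom_A_iff by blast

lemma F_eqI: "\<lbrakk>F f = F g; V f; V g; dm f = dm g; cd f = cd g\<rbrakk> \<Longrightarrow> f = g"
  using F_inj Hom_A_iff by blast

lemma sorts [simp]:
  "V (ident A X)" "dm (ident A X) = X" "cd (ident A X) = X"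
  "V (symm A X Y)" "dm (symm A X Y) = X + Y" "cd (symm A X Y) = Y + X"
  "V (mu A X)" "dm (mu A X) = X + X" "cd (mu A X) = X"
  "V (eta A X)" "dm (eta A X) = 0" "cd (eta A X) = X"
  "V (delta A X)" "dm (delta A X) = X" "cd (delta A X) = X + X"
  "V (eps A X)" "dm (eps A X) = X" "cd (eps A X) = 0"
  using ident_A(1) symm_A(1) mu_A(1) eta_A(1) delta_A(1) eps_A(1) Hom_A_sort by blast+

lemma seq_sorts [simp]:
  assumes "V f" "V g" "cd f = dm g"
  shows "V (f ;;\<^bsub>A\<^esub> g)" "dm (f ;;\<^bsub>A\<^esub> g) = dm f" "cd (f ;;\<^bsub>A\<^esub> g) = cd g" "F (f ;;\<^bsub>A\<^esub> g) = F f ;;\<^bsub>M\<^esub> F g"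
  using seq_A [of f "dm f" "dm g" g "cd g"] assms by (auto simp: Hom_A_iff)

lemma oplus_sorts [simp]:
  assumes "V f" "V g"
  shows "V (f \<oplus>\<^bsub>A\<^esub> g)" "dm (f \<oplus>\<^bsub>A\<^esub> g) = dm f + dm g" "cd (f \<oplus>\<^bsub>A\<^esub> g) = cd f + cd g" "F (f \<oplus>\<^bsub>A\<^esub> g) = F f \<oplus>\<^bsub>M\<^esub> F g"
  using oplus_A [of f "dm f" "cd f" g "dm g" "cd g"] assms by (auto simp: Hom_A_iff)

lemma F_simps [simp]:
  "F (ident A X) = ident M X" "F (symm A X Y) = symm M X Y" "F (mu A X) = mu M X" "F (eta A X) = eta M X"
  "F (delta A X) = delta M X" "F (eps A X) = eps M X"
  by (fact ident_A symm_A mu_A eta_A delta_A eps_A)+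

lemma assoc_ident [simp]: "assoc A X Y Z = ident A (X + Y + Z)"
  using assoc_A [of X Y Z] ident_A [of "X + Y + Z"] by (metis F_inj)

lemma lunit_ident [simp]: "lunit A X = ident A X" and runit_ident [simp]: "runit A X = ident A X"
  using lunit_A [of X] runit_A [of X] ident_A [of X] by (metis F_inj)+

lemma ident_seq_A [simp]: "V f \<Longrightarrow> dm f = X \<Longrightarrow> ident A X ;;\<^bsub>A\<^esub> f = f"
  by (rule F_eqI) (simp_all add: M.ident_seq [of X "cd f"])

lemma seq_ident_A [simp]: "V f \<Longrightarrow> cd f = X \<Longrightarrow> f ;;\<^bsub>A\<^esub> ident A X = f"
  by (rule F_eqI) (simp_all add: M.seq_ident [of "dm f" X])

lemma oplus_ident_A [simp]: "ident A X \<oplus>\<^bsub>A\<^esub> ident A Y = ident A (X + Y)"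
  using M.oplus_ident [of X Y] by (intro F_eqI) simp_all

lemma ident_is_inverse: "is_inverse A X X (ident A X) (ident A X)"
  by (simp add: is_inverse_def Hom_A_iff)

lemma ident_iso: "is_iso A X X (ident A X)"
  using ident_is_inverse unfolding is_iso_def by blast

lemma ident_inverse [simp]: "inverse_of A X X (ident A X) = ident A X"
  unfolding inverse_of_def
proof (rule the_equality)
  show "is_inverse A X X (ident A X) (ident A X)" by (rule ident_is_inverse)
  show "g = ident A X" if "is_inverse A X X (ident A X) g" for g
    using that ident_seq_A [of g X] by (auto simp: is_inverse_def Hom_A_iff)
qed

lemma M_inverse [simp]: "inverse_of M X X (ident M X) = ident M X"
  unfolding inverse_of_def
proof (rule the_equality)
  have I: "ident M X \<in> Hom M X X" using M.ident_hom [of X] by simp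
  then show "is_inverse M X X (ident M X) (ident M X)"
    using M.ident_seq [of X X "ident M X"] by (simp add: is_inverse_def)
  show "g = ident M X" if "is_inverse M X X (ident M X) g" for g
    using that M.ident_seq [of X X g] by (simp add: is_inverse_def)
qed

lemma M_ident_seq [simp]: "V f \<Longrightarrow> dm f = X \<Longrightarrow> ident M X ;;\<^bsub>M\<^esub> F f = F f"
  and M_seq_ident [simp]: "V f \<Longrightarrow> cd f = X \<Longrightarrow> F f ;;\<^bsub>M\<^esub> ident M X = F f"
  using M.ident_seq [of X "cd f" "F f"] M.seq_ident [of "dm f" X "F f"] by simp_all

lemma le_iff: "\<lbrakk>V f; V g; dm f = dm g; cd f = cd g\<rbrakk> \<Longrightarrow> f \<sqsubseteq>\<^bsub>A\<^esub> g \<longleftrightarrow> F f \<sqsubseteq>\<^bsub>M\<^esub> F g"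
  using le_A Hom_A_iff by blast

lemma pcb_A: "preordered_cartesian_bicategory A"
proof (unfold_locales, simp_all add: Hom_A_iff ident_iso add.assoc, goal_cases)
  case (1 f g h)
  then show ?case
    using M.seq_assoc [of "dm f" "cd f" "cd g" "cd h" "F f" "F g" "F h"] by (intro F_eqI) simp_all
next
  case (2 f g f' g')
  then show ?case
    using M.interchange [of "dm f" "cd f" "cd g" "dm f'" "cd f'" "cd g'" "F f" "F g" "F f'" "F g'"]
    by (intro F_eqI) simp_all
next
  case (3 f g h)
  have "(F f \<oplus>\<^bsub>M\<^esub> F g) \<oplus>\<^bsub>M\<^esub> F h = F f \<oplus>\<^bsub>M\<^esub> (F g \<oplus>\<^bsub>M\<^esub> F h)"
    using 3 M.assoc_natural [of "dm f" "dm g" "dm h" "cd f" "cd g" "cd h" "F f" "F g" "F h"]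
      M_seq_ident [of "(f \<oplus>\<^bsub>A\<^esub> g) \<oplus>\<^bsub>A\<^esub> h" "cd f + cd g + cd h"]
      M_ident_seq [of "f \<oplus>\<^bsub>A\<^esub> (g \<oplus>\<^bsub>A\<^esub> h)" "dm f + dm g + dm h"] by simp
  then show ?case using 3 by (intro F_eqI) simp_all
next
  case (4 f)
  then show ?case
    using M.lunit_natural [of "dm f" "cd f" "F f"] M_seq_ident [of "ident A 0 \<oplus>\<^bsub>A\<^esub> f" "cd f"] by (intro F_eqI) simp_all
next
  case (5 f)
  then show ?case
    using M.runit_natural [of "dm f" "cd f" "F f"] M_seq_ident [of "f \<oplus>\<^bsub>A\<^esub> ident A 0" "cd f"] by (intro F_eqI) simp_all
next
  case (6 f g)
  then show ?case
    using M.symm_natural [of "dm f" "dm g" "cd f" "cd g" "F f" "F g"] by (intro F_eqI) simp_all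
next
  case (7 X Y)
  then show ?case using M.symm_symm [of X Y] by (intro F_eqI) simp_all
next
  case (8 X Y Z)
  then show ?case
    using M.hexagon [of X Y Z] M_ident_seq [of "symm A X (Y + Z)" "X + Y + Z"] M_seq_ident [of "symm A X (Y + Z)" "Y + Z + X"]
      M_seq_ident [of "symm A X Y \<oplus>\<^bsub>A\<^esub> ident A Z" "Y + X + Z"]
    by (intro F_eqI) (simp_all add: add.assoc)
next
  case (9 f)
  then show ?case using M.le_refl [of "dm f" "cd f" "F f"] by (simp add: le_iff)
next
  case (10 f g h)
  then show ?case using M.le_trans [of "dm f" "cd f" "F f" "F g" "F h"] by (simp add: le_iff)
next
  case (11 f f' g g')
  then show ?case using M.seq_mono [of "dm f" "cd f" "cd g" "F f" "F f'" "F g" "F g'"] by (simp add: le_iff)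
next
  case (12 f g f' g')
  then show ?case using M.oplus_mono [of "dm f" "cd f" "dm f'" "cd f'" "F f" "F g" "F f'" "F g'"] by (simp add: le_iff)
next
  case (13 X)
  then show ?case
    using M.mu_assoc [of X] M_ident_seq [of "ident A X \<oplus>\<^bsub>A\<^esub> mu A X" "X + X + X"]
    by (intro F_eqI) (simp_all add: add.assoc)
next
  case (14 X)
  then show ?case using M.mu_lunit [of X] by (intro F_eqI) simp_all
next
  case (15 X)
  then show ?case using M.mu_runit [of X] by (intro F_eqI) simp_all
next
  case (16 X)
  then show ?case using M.mu_comm [of X] by (intro F_eqI) simp_all
next
  case (17 X)
  then show ?case
    using M.delta_assoc [of X] M_seq_ident [of "delta A X ;;\<^bsub>A\<^esub> (delta A X \<oplus>\<^bsub>A\<^esub> ident A X)" "X + X + X"]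
    by (intro F_eqI) (simp_all add: add.assoc)
next
  case (18 X)
  then show ?case
    using M.delta_lunit [of X] M_seq_ident [of "delta A X ;;\<^bsub>A\<^esub> (eps A X \<oplus>\<^bsub>A\<^esub> ident A X)" X]
    by (intro F_eqI) simp_all
next
  case (19 X)
  then show ?case
    using M.delta_runit [of X] M_seq_ident [of "delta A X ;;\<^bsub>A\<^esub> (ident A X \<oplus>\<^bsub>A\<^esub> eps A X)" X]
    by (intro F_eqI) simp_all
next
  case (20 X)
  then show ?case using M.delta_comm [of X] by (intro F_eqI) simp_all
next
  case (21 X)
  then show ?case
    using M.frobenius_left [of X] M_seq_ident [of "delta A X \<oplus>\<^bsub>A\<^esub> ident A X" "X + X + X"]
    by (intro F_eqI) (simp_all add: add.assoc)
next
  case (22 X)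
  then show ?case
    using M.frobenius_right [of X] M_seq_ident [of "ident A X \<oplus>\<^bsub>A\<^esub> delta A X" "X + X + X"]
    by (intro F_eqI) (simp_all add: add.assoc)
next
  case (23 X)
  then show ?case using M.special [of X] by (intro F_eqI) simp_all
next
  case (24 X)
  then show ?case using M.ident_le_eps_eta [of X] by (simp add: le_iff)
next
  case (25 X)
  then show ?case using M.eta_eps_le_ident [of X] by (simp add: le_iff)
next
  case (26 X)
  then show ?case using M.ident_le_delta_mu [of X] by (simp add: le_iff)
next
  case (27 X)
  then show ?case using M.mu_delta_le_ident [of X] by (simp add: le_iff)
next
  case (28 R)
  then show ?case using M.lax_delta [of "dm R" "cd R" "F R"] by (simp add: le_iff)
next
  case (29 R)
  then show ?case using M.lax_eps [of "dm R" "cd R" "F R"] by (simp add: le_iff)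
qed

end

locale pcb_embeddings =
  A: pcb_embedding M A FA + B: pcb_embedding M B FB
  for M :: "(nat, 'm) pcb" and A :: "(nat, 'a) pcb" and FA :: "'a \<Rightarrow> 'm" and B :: "(nat, 'b) pcb" and FB :: "'b \<Rightarrow> 'm" +
  assumes image_subset: "f \<in> Hom A X Y \<Longrightarrow> \<exists>g \<in> Hom B X Y. FB g = FA f"
begin

definition transfer :: "'a \<Rightarrow> 'b" where
  "transfer f = (THE g. g \<in> Hom B (A.dm f) (A.cd f) \<and> FB g = FA f)"

lemma transfer_Hom: "f \<in> Hom A X Y \<Longrightarrow> transfer f \<in> Hom B X Y \<and> FB (transfer f) = FA f"
proof -
  assume f: "f \<in> Hom A X Y"
  then have "\<exists>!g. g \<in> Hom B X Y \<and> FB g = FA f"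
    using image_subset B.F_inj by metis
  then show ?thesis
    using theI' [of "\<lambda>g. g \<in> Hom B X Y \<and> FB g = FA f"] A.Hom_A_sort [OF f] by (simp add: transfer_def)
qed

lemma transfer_sort [simp]:
  assumes "A.V f"
  shows "B.V (transfer f)" "B.dm (transfer f) = A.dm f" "B.cd (transfer f) = A.cd f" "FB (transfer f) = FA f"
  using transfer_Hom [of f "A.dm f" "A.cd f"] assms by (auto simp: A.Hom_A_iff B.Hom_A_iff)

lemma transfer_structure [simp]:
  "transfer (ident A X) = ident B X" "transfer (symm A X Y) = symm B X Y" "transfer (mu A X) = mu B X"
  "transfer (eta A X) = eta B X" "transfer (delta A X) = delta B X" "transfer (eps A X) = eps B X"
  by (rule B.F_eqI; simp)+

lemma transfer_seq [simp]: "\<lbrakk>A.V f; A.V g; A.cd f = A.dm g\<rbrakk> \<Longrightarrow> transfer (f ;;\<^bsub>A\<^esub> g) = transfer f ;;\<^bsub>B\<^esub> transfer g"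
  by (rule B.F_eqI) simp_all

lemma transfer_oplus [simp]: "\<lbrakk>A.V f; A.V g\<rbrakk> \<Longrightarrow> transfer (f \<oplus>\<^bsub>A\<^esub> g) = transfer f \<oplus>\<^bsub>B\<^esub> transfer g"
  by (rule B.F_eqI) simp_all

lemma transfer_le: "\<lbrakk>A.V f; A.V g; A.dm f = A.dm g; A.cd f = A.cd g\<rbrakk> \<Longrightarrow> f \<sqsubseteq>\<^bsub>A\<^esub> g \<Longrightarrow> transfer f \<sqsubseteq>\<^bsub>B\<^esub> transfer g"
  by (simp add: A.le_iff B.le_iff)

lemma transfer_morphism: "pcb_morphism A B (\<lambda>X. X) transfer (\<lambda>X Y. ident B (X + Y)) (ident B 0)"
proof -
  interpret A': preordered_cartesian_bicategory A by (rule A.pcb_A)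
  interpret B': preordered_cartesian_bicategory B by (rule B.pcb_A)
  show ?thesis
    by unfold_locales (simp_all add: A.Hom_A_iff B.Hom_A_iff B.ident_iso transfer_le add.assoc)
qed

end

lemma pcb_isomorphicI:
  assumes "pcb_embeddings M A FA B FB" "pcb_embeddings M B FB A FA"
  shows "pcb_isomorphic A B"
proof -
  interpret AB: pcb_embeddings M A FA B FB by fact
  interpret BA: pcb_embeddings M B FB A FA by fact
  have "composite_is_identity A (\<lambda>X. X) AB.transfer (\<lambda>X Y. ident B (X + Y)) (ident B 0)
      (\<lambda>X. X) BA.transfer (\<lambda>X Y. ident A (X + Y)) (ident A 0)"
  proof -
    have "BA.transfer (AB.transfer f) = f" if "AB.A.V f" for f
      using that by (intro AB.A.F_eqI) simp_all
    then show ?thesis by (simp add: composite_is_identity_def AB.A.Hom_A_iff)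
  qed
  moreover have "composite_is_identity B (\<lambda>X. X) BA.transfer (\<lambda>X Y. ident A (X + Y)) (ident A 0)
      (\<lambda>X. X) AB.transfer (\<lambda>X Y. ident B (X + Y)) (ident B 0)"
  proof -
    have "AB.transfer (BA.transfer f) = f" if "AB.B.V f" for f
      using that by (intro AB.B.F_eqI) simp_all
    then show ?thesis by (simp add: composite_is_identity_def AB.B.Hom_A_iff)
  qed
  ultimately show ?thesis
    unfolding pcb_isomorphic_def using AB.transfer_morphism BA.transfer_morphism by blast
qed


section \<open>The prop of terms\<close>

fun sort_of :: "'s msig \<Rightarrow> 's gcq \<Rightarrow> (nat \<times> nat) option" where
  "sort_of \<Sigma> Copy = Some (1, 2)"
| "sort_of \<Sigma> Discard = Some (1, 0)"
| "sort_of \<Sigma> Merge = Some (2, 1)"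
| "sort_of \<Sigma> New = Some (0, 1)"
| "sort_of \<Sigma> Id0 = Some (0, 0)"
| "sort_of \<Sigma> Id1 = Some (1, 1)"
| "sort_of \<Sigma> Swap = Some (2, 2)"
| "sort_of \<Sigma> (Sym R) = (if R \<in> symbols \<Sigma> then Some (ar \<Sigma> R, coar \<Sigma> R) else None)"
| "sort_of \<Sigma> (c \<triangleright> d) = (case sort_of \<Sigma> c of None \<Rightarrow> None | Some (n, z) \<Rightarrow>
     (case sort_of \<Sigma> d of None \<Rightarrow> None | Some (z', m) \<Rightarrow> if z = z' then Some (n, m) else None))"
| "sort_of \<Sigma> (c \<otimes> d) = (case sort_of \<Sigma> c of None \<Rightarrow> None | Some (n, m) \<Rightarrow>
     (case sort_of \<Sigma> d of None \<Rightarrow> None | Some (p, q) \<Rightarrow> Some (n + p, m + q)))"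

lemma has_sort_iff: "has_sort \<Sigma> c n m \<longleftrightarrow> sort_of \<Sigma> c = Some (n, m)"
proof
  show "has_sort \<Sigma> c n m \<Longrightarrow> sort_of \<Sigma> c = Some (n, m)"
    by (induction rule: has_sort.induct) auto
  show "sort_of \<Sigma> c = Some (n, m) \<Longrightarrow> has_sort \<Sigma> c n m"
    by (induction c arbitrary: n m) (auto split: option.splits if_splits intro: has_sort.intros(1-8) simp del: One_nat_def,
      (blast intro: has_sort.intros(9,10))+)
qed

lemma sort_of_terms [simp]:
  "sort_of \<Sigma> (idn n) = Some (n, n)" "sort_of \<Sigma> (swap1 n) = Some (Suc n, Suc n)"
  "sort_of \<Sigma> (swap n m) = Some (n + m, m + n)"
  "sort_of \<Sigma> (discard n) = Some (n, 0)" "sort_of \<Sigma> (copy n) = Some (n, n + n)"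
  "sort_of \<Sigma> (new n) = Some (0, n)" "sort_of \<Sigma> (merge n) = Some (n + n, n)"
proof -
  show 1: "sort_of \<Sigma> (idn n) = Some (n, n)" for n by (induction n) auto
  show 2: "sort_of \<Sigma> (swap1 n) = Some (Suc n, Suc n)" for n by (induction n) (auto simp: 1)
  show 3: "sort_of \<Sigma> (swap n m) = Some (n + m, m + n)" for n m by (induction n) (auto simp: 1 2)
  show "sort_of \<Sigma> (discard n) = Some (n, 0)" by (induction n) auto
  show "sort_of \<Sigma> (copy n) = Some (n, n + n)" by (induction n) (auto simp: 1 3 simp del: swap.simps)
  show "sort_of \<Sigma> (new n) = Some (0, n)" by (induction n) auto
  show "sort_of \<Sigma> (merge n) = Some (n + n, n)" by (induction n) (auto simp: 1 3)
qed

lemma axE_sort: "axE \<Sigma> n m c d \<Longrightarrow> sort_of \<Sigma> c = Some (n, m) \<and> sort_of \<Sigma> d = Some (n, m)"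
  by (induction rule: axE.induct) (simp_all add: has_sort_iff)

lemma axI_sort: "axI \<Sigma> n m c d \<Longrightarrow> sort_of \<Sigma> c = Some (n, m) \<and> sort_of \<Sigma> d = Some (n, m)"
  by (induction rule: axI.induct) (simp_all add: has_sort_iff del: idn.simps)

lemma gcq_eq_sort: "gcq_eq \<Sigma> n m c d \<Longrightarrow> sort_of \<Sigma> c = Some (n, m) \<and> sort_of \<Sigma> d = Some (n, m)"
  by (induction rule: gcq_eq.induct) (simp_all add: axE_sort has_sort_iff)

lemma gcq_le_sort: "gcq_le \<Sigma> n m c d \<Longrightarrow> sort_of \<Sigma> c = Some (n, m) \<and> sort_of \<Sigma> d = Some (n, m)"
  by (induction rule: gcq_le.induct) (simp_all add: axI_sort gcq_eq_sort)

locale gcq_signature =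
  fixes \<Sigma> :: "'s msig"
begin

definition tdom :: "'s gcq \<Rightarrow> nat" where "tdom c = fst (the (sort_of \<Sigma> c))"
definition tcod :: "'s gcq \<Rightarrow> nat" where "tcod c = snd (the (sort_of \<Sigma> c))"
definition ws :: "'s gcq \<Rightarrow> bool" where "ws c \<longleftrightarrow> sort_of \<Sigma> c \<noteq> None"
definition cl :: "'s gcq \<Rightarrow> 's gcq set" where "cl c = gcq_class \<Sigma> (tdom c) (tcod c) c"

lemma ws_iff: "sort_of \<Sigma> c = Some (n, m) \<longleftrightarrow> ws c \<and> tdom c = n \<and> tcod c = m"
  by (auto simp: ws_def tdom_def tcod_def)

lemma ws_sort: "ws c \<Longrightarrow> has_sort \<Sigma> c (tdom c) (tcod c)"
  by (simp add: has_sort_iff ws_iff)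

lemma ws_seq [simp]:
  assumes "ws c" "ws d" "tcod c = tdom d"
  shows "ws (c \<triangleright> d)" "tdom (c \<triangleright> d) = tdom c" "tcod (c \<triangleright> d) = tcod d"
  using assms by (auto simp: ws_def tdom_def tcod_def)

lemma ws_par [simp]:
  assumes "ws c" "ws d"
  shows "ws (c \<otimes> d)" "tdom (c \<otimes> d) = tdom c + tdom d" "tcod (c \<otimes> d) = tcod c + tcod d"
  using assms by (auto simp: ws_def tdom_def tcod_def)

lemma ws_terms [simp]:
  "ws Copy" "tdom Copy = 1" "tcod Copy = 2" "ws Discard" "tdom Discard = 1" "tcod Discard = 0"
  "ws Merge" "tdom Merge = 2" "tcod Merge = 1" "ws New" "tdom New = 0" "tcod New = 1"
  "ws Id0" "tdom Id0 = 0" "tcod Id0 = 0" "ws Id1" "tdom Id1 = 1" "tcod Id1 = 1" "ws Swap" "tdom Swap = 2" "tcod Swap = 2"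
  "ws (idn n)" "tdom (idn n) = n" "tcod (idn n) = n"
  "ws (swap1 n)" "tdom (swap1 n) = Suc n" "tcod (swap1 n) = Suc n"
  "ws (swap n m)" "tdom (swap n m) = n + m" "tcod (swap n m) = m + n"
  "ws (discard n)" "tdom (discard n) = n" "tcod (discard n) = 0"
  "ws (copy n)" "tdom (copy n) = n" "tcod (copy n) = n + n"
  "ws (new n)" "tdom (new n) = 0" "tcod (new n) = n"
  "ws (merge n)" "tdom (merge n) = n + n" "tcod (merge n) = n"
  "R \<in> symbols \<Sigma> \<Longrightarrow> ws (Sym R)" "R \<in> symbols \<Sigma> \<Longrightarrow> tdom (Sym R) = ar \<Sigma> R" "R \<in> symbols \<Sigma> \<Longrightarrow> tcod (Sym R) = coar \<Sigma> R"
  by (simp_all add: ws_def tdom_def tcod_def)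

lemma gcq_eq_ws: "gcq_eq \<Sigma> n m c d \<Longrightarrow> ws c \<and> tdom c = n \<and> tcod c = m \<and> ws d \<and> tdom d = n \<and> tcod d = m"
  using gcq_eq_sort [of \<Sigma> n m c d] by (simp add: ws_iff)

lemma gcq_le_ws: "gcq_le \<Sigma> n m c d \<Longrightarrow> ws c \<and> tdom c = n \<and> tcod c = m \<and> ws d \<and> tdom d = n \<and> tcod d = m"
  using gcq_le_sort [of \<Sigma> n m c d] by (simp add: ws_iff)

lemma cl_mem: "ws c \<Longrightarrow> c \<in> cl c"
  by (simp add: cl_def gcq_class_def gcq_eq.intros(2) ws_sort)

lemma cl_eq: "gcq_eq \<Sigma> n m c d \<Longrightarrow> cl c = cl d"
proof -
  assume e: "gcq_eq \<Sigma> n m c d"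
  then have "gcq_eq \<Sigma> n m c x \<longleftrightarrow> gcq_eq \<Sigma> n m d x" for x
    using gcq_eq.intros(3,4) by blast
  then show ?thesis using gcq_eq_ws [OF e] by (simp add: cl_def gcq_class_def)
qed

lemma cl_memD: "d \<in> cl c \<Longrightarrow> gcq_eq \<Sigma> (tdom c) (tcod c) c d"
  by (simp add: cl_def gcq_class_def)

lemma cl_eqD: "\<lbrakk>ws d; cl c = cl d\<rbrakk> \<Longrightarrow> gcq_eq \<Sigma> (tdom c) (tcod c) c d"
  using cl_memD cl_mem by blast

lemma cl_eq_axE: "axE \<Sigma> n m c d \<Longrightarrow> cl c = cl d"
  by (rule cl_eq, rule gcq_eq.intros(1))

definition V :: "'s gcq set \<Rightarrow> bool" where "V P \<longleftrightarrow> (\<exists>c. ws c \<and> P = cl c)"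
definition dm :: "'s gcq set \<Rightarrow> nat" where "dm P = tdom (SOME c. c \<in> P)"
definition cd :: "'s gcq set \<Rightarrow> nat" where "cd P = tcod (SOME c. c \<in> P)"
definition le' :: "'s gcq set \<Rightarrow> 's gcq set \<Rightarrow> bool" where
  "le' P Q \<longleftrightarrow> (\<exists>n m c d. gcq_le \<Sigma> n m c d \<and> P = cl c \<and> Q = cl d)"

lemma VE: assumes "V P" obtains c where "ws c" "P = cl c"
  using assms by (auto simp: V_def)

lemma cl_sort [simp]:
  assumes "ws c"
  shows "V (cl c)" "dm (cl c) = tdom c" "cd (cl c) = tcod c"
proof -
  have "(SOME d. d \<in> cl c) \<in> cl c" using cl_mem [OF assms] by (rule someI)
  then show "dm (cl c) = tdom c" "cd (cl c) = tcod c"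
    using gcq_eq_ws cl_memD by (fastforce simp: dm_def cd_def)+
qed (use assms V_def in blast)

lemma cl_seq:
  assumes "ws c" "ws d" "tcod c = tdom d"
  shows "seq (CB \<Sigma>) (cl c) (cl d) = cl (c \<triangleright> d)"
proof (intro subset_antisym subsetI)
  fix t assume "t \<in> seq (CB \<Sigma>) (cl c) (cl d)"
  then obtain c' d' n m where cd: "c' \<in> cl c" "d' \<in> cl d" "gcq_eq \<Sigma> n m (c' \<triangleright> d') t" by (auto simp: CB_def)
  have "gcq_eq \<Sigma> (tdom c) (tcod d) (c \<triangleright> d) (c' \<triangleright> d')"
    using cl_memD [OF cd(1)] cl_memD [OF cd(2)] assms by (intro gcq_eq.intros(5)) auto
  then have "cl (c \<triangleright> d) = cl t" using cl_eq cd(3) by blast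
  then show "t \<in> cl (c \<triangleright> d)" using cl_mem gcq_eq_ws [OF cd(3)] by blast
next
  fix t assume "t \<in> cl (c \<triangleright> d)"
  then show "t \<in> seq (CB \<Sigma>) (cl c) (cl d)" using cl_mem assms cl_memD by (fastforce simp: CB_def)
qed

lemma cl_par:
  assumes "ws c" "ws d"
  shows "oplus (CB \<Sigma>) (cl c) (cl d) = cl (c \<otimes> d)"
proof (intro subset_antisym subsetI)
  fix t assume "t \<in> oplus (CB \<Sigma>) (cl c) (cl d)"
  then obtain c' d' n m where cd: "c' \<in> cl c" "d' \<in> cl d" "gcq_eq \<Sigma> n m (c' \<otimes> d') t" by (auto simp: CB_def)
  have "gcq_eq \<Sigma> (tdom c + tdom d) (tcod c + tcod d) (c \<otimes> d) (c' \<otimes> d')"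
    using cl_memD [OF cd(1)] cl_memD [OF cd(2)] by (rule gcq_eq.intros(6))
  then have "cl (c \<otimes> d) = cl t" using cl_eq cd(3) by blast
  then show "t \<in> cl (c \<otimes> d)" using cl_mem gcq_eq_ws [OF cd(3)] by blast
next
  fix t assume "t \<in> cl (c \<otimes> d)"
  then show "t \<in> oplus (CB \<Sigma>) (cl c) (cl d)" using cl_mem assms cl_memD by (fastforce simp: CB_def)
qed

lemma CB_eqs:
  "ident (CB \<Sigma>) n = cl (idn n)" "symm (CB \<Sigma>) n m = cl (swap n m)"
  "mu (CB \<Sigma>) n = cl (merge n)" "eta (CB \<Sigma>) n = cl (new n)" "delta (CB \<Sigma>) n = cl (copy n)" "eps (CB \<Sigma>) n = cl (discard n)"
  by (simp_all add: CB_def cl_def mult_2)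

lemma Id1_par_Id0: "cl (Id1 \<otimes> Id0) = cl Id1"
  by (rule cl_eq_axE [OF axE.intros(6)], rule has_sort.intros(6))

lemma cl_idn_1: "cl (idn 1) = cl Id1"
  using Id1_par_Id0 by simp

lemma cl_swap_1_1: "cl (swap 1 1) = cl Swap"
proof -
  have S: "gcq_eq \<Sigma> 2 2 Swap Swap" by (rule gcq_eq.intros(2), rule has_sort.intros)
  have i0: "has_sort \<Sigma> c n m \<Longrightarrow> gcq_eq \<Sigma> n m (c \<otimes> Id0) c" for c n m
    by (rule gcq_eq.intros(1), rule axE.intros(6))
  have i1: "has_sort \<Sigma> c n m \<Longrightarrow> gcq_eq \<Sigma> n m (c \<triangleright> idn m) c" for c n m
    by (rule gcq_eq.intros(1), rule axE.intros(3))
  have I: "gcq_eq \<Sigma> 2 2 (Id1 \<otimes> Id1) (idn 2)"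
  proof -
    have "gcq_eq \<Sigma> 2 2 (Id1 \<otimes> (Id1 \<otimes> Id0)) (Id1 \<otimes> Id1)"
      using gcq_eq.intros(6) [OF gcq_eq.intros(2) [OF has_sort.intros(6)] i0 [OF has_sort.intros(6)]] by (simp add: numeral_2_eq_2)
    then show ?thesis by (simp add: numeral_2_eq_2 gcq_eq.intros(3))
  qed
  have s1: "gcq_eq \<Sigma> 2 2 (swap1 1) Swap"
  proof -
    have "gcq_eq \<Sigma> 2 2 ((Swap \<otimes> Id0) \<triangleright> (Id1 \<otimes> Id1)) (Swap \<triangleright> idn 2)"
      using i0 [OF has_sort.intros(7)] I by (rule gcq_eq.intros(5))
    then show ?thesis using gcq_eq.intros(4) i1 [OF has_sort.intros(7)] by fastforce
  qed
  have "gcq_eq \<Sigma> 2 2 (Id1 \<otimes> swap 0 1) (idn 2)"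
  proof -
    have "gcq_eq \<Sigma> 2 2 (Id1 \<otimes> idn 1) (idn 2)"
      using gcq_eq.intros(2) [of \<Sigma> "idn 2" 2 2] by (simp add: has_sort_iff numeral_2_eq_2)
    then show ?thesis by simp
  qed
  moreover have "gcq_eq \<Sigma> 2 2 (swap1 1 \<otimes> idn 0) Swap"
  proof -
    have "gcq_eq \<Sigma> 2 2 (swap1 1 \<otimes> Id0) (swap1 1)" by (rule i0) (simp add: has_sort_iff numeral_2_eq_2 del: swap1.simps)
    then show ?thesis using s1 gcq_eq.intros(4) by fastforce
  qed
  ultimately have "gcq_eq \<Sigma> 2 2 (swap 1 1) (idn 2 \<triangleright> Swap)"
    using gcq_eq.intros(5) by fastforce
  moreover have "gcq_eq \<Sigma> 2 2 (idn 2 \<triangleright> Swap) Swap"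
    by (rule gcq_eq.intros(1), rule axE.intros(2), rule has_sort.intros)
  ultimately show ?thesis by (rule cl_eq [OF gcq_eq.intros(4)])
qed

lemma cl_laws:
  "\<lbrakk>ws c; ws d; ws e; tcod c = tdom d; tcod d = tdom e\<rbrakk> \<Longrightarrow> cl ((c \<triangleright> d) \<triangleright> e) = cl (c \<triangleright> (d \<triangleright> e))"
  "ws c \<Longrightarrow> cl (idn (tdom c) \<triangleright> c) = cl c"
  "ws c \<Longrightarrow> cl (c \<triangleright> idn (tcod c)) = cl c"
  "\<lbrakk>ws c; ws d; ws e\<rbrakk> \<Longrightarrow> cl ((c \<otimes> d) \<otimes> e) = cl (c \<otimes> (d \<otimes> e))"
  "ws c \<Longrightarrow> cl (Id0 \<otimes> c) = cl c"
  "ws c \<Longrightarrow> cl (c \<otimes> Id0) = cl c"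
  "\<lbrakk>ws c; ws d; ws c'; ws d'; tcod c = tdom d; tcod c' = tdom d'\<rbrakk> \<Longrightarrow>
    cl ((c \<triangleright> d) \<otimes> (c' \<triangleright> d')) = cl ((c \<otimes> c') \<triangleright> (d \<otimes> d'))"
  "cl (idn n \<otimes> idn m) = cl (idn (n + m))"
  "\<lbrakk>ws c; ws d\<rbrakk> \<Longrightarrow> cl ((c \<otimes> d) \<triangleright> swap (tcod c) (tcod d)) = cl (swap (tdom c) (tdom d) \<triangleright> (d \<otimes> c))"
  "cl (swap n m \<triangleright> swap m n) = cl (idn (n + m))"
  "cl (swap n (m + p)) = cl ((swap n m \<otimes> idn p) \<triangleright> (idn m \<otimes> swap n p))"
  by (rule cl_eq_axE, rule axE.intros; simp add: has_sort_iff ws_iff)+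

lemma strict_prop_CB: "strict_prop V dm cd (seq (CB \<Sigma>)) (oplus (CB \<Sigma>)) (ident (CB \<Sigma>)) (symm (CB \<Sigma>))"
  by unfold_locales (auto elim!: VE simp: CB_eqs cl_seq cl_par cl_laws(1-10) cl_laws(11) [symmetric])

lemma I_1: "ident (CB \<Sigma>) 1 = cl Id1" and sw_1_1: "symm (CB \<Sigma>) 1 1 = cl Swap"
  unfolding CB_eqs by (fact cl_idn_1 cl_swap_1_1)+

lemma frobenius_prop_CB: "frobenius_prop V dm cd (seq (CB \<Sigma>)) (oplus (CB \<Sigma>)) (ident (CB \<Sigma>)) (symm (CB \<Sigma>))
   (cl Copy) (cl Discard) (cl Merge) (cl New)"
proof -
  interpret strict_prop V dm cd "seq (CB \<Sigma>)" "oplus (CB \<Sigma>)" "ident (CB \<Sigma>)" "symm (CB \<Sigma>)" by (rule strict_prop_CB)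
  show ?thesis
  proof (unfold_locales, unfold I_1 sw_1_1, simp_all add: cl_seq cl_par, goal_cases)
    case 7
    show ?case by (rule cl_eq_axE [symmetric], rule axE.intros)
  qed (rule cl_eq_axE, rule axE.intros)+
qed

sublocale frobenius_prop V dm cd "seq (CB \<Sigma>)" "oplus (CB \<Sigma>)" "ident (CB \<Sigma>)" "symm (CB \<Sigma>)"
   "cl Copy" "cl Discard" "cl Merge" "cl New"
  by (rule frobenius_prop_CB)

lemma cp_cl: "cp n = cl (copy n)"
proof (induction n)
  case (Suc n)
  have "cp (Suc n) = seq (CB \<Sigma>) (cl (Copy \<otimes> copy n)) (oplus (CB \<Sigma>) (cl Id1) (oplus (CB \<Sigma>) (cl (swap 1 n)) (cl (idn n))))"
    unfolding cp.simps(2) I_1 Suc CB_eqs(1) [of n] CB_eqs(2) [of 1 n] by (simp add: cl_par)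
  also have "\<dots> = cl (copy (Suc n))" by (simp add: cl_par cl_seq del: swap.simps One_nat_def)
  finally show ?case .
qed (simp add: CB_eqs(1) [of 0])

lemma dc_cl: "dc n = cl (discard n)"
  by (induction n) (simp_all add: cl_par dc.simps(2) CB_eqs(1) [of 0])

lemma nw_cl: "nw n = cl (new n)"
  by (induction n) (simp_all add: cl_par nw.simps(2) CB_eqs(1) [of 0])

lemma query_prop_CB: "query_prop V dm cd (seq (CB \<Sigma>)) (oplus (CB \<Sigma>)) (ident (CB \<Sigma>)) (symm (CB \<Sigma>))
   (cl Copy) (cl Discard) (cl Merge) (cl New) \<Sigma> (\<lambda>R. cl (Sym R))"
  by unfold_locales simp_all

lemma le'_cl: "ws c \<Longrightarrow> le' (cl c) Q \<longleftrightarrow> (\<exists>d. gcq_le \<Sigma> (tdom c) (tcod c) c d \<and> Q = cl d)"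
proof
  assume c: "ws c" and "le' (cl c) Q"
  then obtain n m c' d where cd: "gcq_le \<Sigma> n m c' d" "cl c = cl c'" "Q = cl d" by (auto simp: le'_def)
  have e: "gcq_eq \<Sigma> (tdom c) (tcod c) c c'" using cl_eqD cd gcq_le_ws by blast
  then have "tdom c = n" "tcod c = m" using gcq_eq_ws [OF e] gcq_le_ws [OF cd(1)] by auto
  then show "\<exists>d. gcq_le \<Sigma> (tdom c) (tcod c) c d \<and> Q = cl d"
    using e cd gcq_le.intros(2,3) by blast
qed (auto simp: le'_def)

lemma le'_cl_cl: "\<lbrakk>ws c; ws d\<rbrakk> \<Longrightarrow> le' (cl c) (cl d) \<longleftrightarrow> gcq_le \<Sigma> (tdom c) (tcod c) c d"
proof
  assume cd: "ws c" "ws d" and "le' (cl c) (cl d)"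
  then obtain d' where d': "gcq_le \<Sigma> (tdom c) (tcod c) c d'" "cl d = cl d'" using le'_cl by blast
  then have e: "gcq_eq \<Sigma> (tdom d) (tcod d) d d'" using cl_eqD gcq_le_ws by blast
  then have "gcq_eq \<Sigma> (tdom c) (tcod c) d' d" using gcq_eq.intros(3) [OF e] gcq_eq_ws [OF e] gcq_le_ws [OF d'(1)] by auto
  then show "gcq_le \<Sigma> (tdom c) (tcod c) c d" using d' gcq_le.intros(2,3) by blast
qed (auto simp: le'_cl)

lemma le'E:
  assumes "le' P Q"
  obtains c d where "ws c" "ws d" "tdom d = tdom c" "tcod d = tcod c" "P = cl c" "Q = cl d" "gcq_le \<Sigma> (tdom c) (tcod c) c d"
  using assms unfolding le'_def by (metis gcq_le_ws)

lemma le'_axI: "axI \<Sigma> n m c d \<Longrightarrow> le' (cl c) (cl d)"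
  unfolding le'_def using gcq_le.intros(1) by blast

lemma ordered_query_prop_CB: "ordered_query_prop V dm cd (seq (CB \<Sigma>)) (oplus (CB \<Sigma>)) (ident (CB \<Sigma>)) (symm (CB \<Sigma>))
   (cl Copy) (cl Discard) (cl Merge) (cl New) \<Sigma> (\<lambda>R. cl (Sym R)) le'"
proof -
  interpret query_prop V dm cd "seq (CB \<Sigma>)" "oplus (CB \<Sigma>)" "ident (CB \<Sigma>)" "symm (CB \<Sigma>)"
    "cl Copy" "cl Discard" "cl Merge" "cl New" \<Sigma> "\<lambda>R. cl (Sym R)" by (rule query_prop_CB)
  show ?thesis
  proof (unfold_locales, goal_cases)
    case (1 f)
    then show ?case by (elim VE) (auto simp: le'_cl_cl intro: gcq_le.intros(2) gcq_eq.intros(2) ws_sort)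
  next
    case (2 f g h)
    then obtain c d where "ws c" "ws d" "f = cl c" "g = cl d" "gcq_le \<Sigma> (tdom c) (tcod c) c d" "tdom d = tdom c" "tcod d = tcod c"
      by (elim le'E) blast
    then show ?case using 2(2) le'_cl gcq_le.intros(3) by metis
  next
    case (3 f f' g g')
    from 3(1) obtain c c' where c: "ws c" "ws c'" "tdom c' = tdom c" "tcod c' = tcod c" "f = cl c" "f' = cl c'" "gcq_le \<Sigma> (tdom c) (tcod c) c c'"
      by (rule le'E) blast
    from 3(2) obtain d d' where d: "ws d" "ws d'" "tdom d' = tdom d" "tcod d' = tcod d" "g = cl d" "g' = cl d'" "gcq_le \<Sigma> (tdom d) (tcod d) d d'"
      by (rule le'E) blast
    have "gcq_le \<Sigma> (tdom c) (tcod d) (c \<triangleright> d) (c' \<triangleright> d')"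
      using c d 3(3) by (intro gcq_le.intros(4)) auto
    then show ?case using c d 3(3) by (simp add: cl_seq le'_cl_cl)
  next
    case (4 f f' g g')
    from 4(1) obtain c c' where c: "ws c" "ws c'" "tdom c' = tdom c" "tcod c' = tcod c" "f = cl c" "f' = cl c'" "gcq_le \<Sigma> (tdom c) (tcod c) c c'"
      by (rule le'E) blast
    from 4(2) obtain d d' where d: "ws d" "ws d'" "tdom d' = tdom d" "tcod d' = tcod d" "g = cl d" "g' = cl d'" "gcq_le \<Sigma> (tdom d) (tcod d) d d'"
      by (rule le'E) blast
    have "gcq_le \<Sigma> (tdom c + tdom d) (tcod c + tcod d) (c \<otimes> d) (c' \<otimes> d')"
      using c d by (intro gcq_le.intros(5)) auto
    then show ?case using c d by (simp add: cl_par le'_cl_cl)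
  next
    case 5
    show ?case using le'_axI [OF axI.intros(1)] unfolding I_1 by (simp add: cl_seq)
  next
    case 6
    show ?case using le'_axI [OF axI.intros(2)] by (simp add: cl_seq CB_eqs(1) [of 0])
  next
    case 7
    show ?case using le'_axI [OF axI.intros(4)] by (simp add: cl_seq CB_eqs(1) [of 2] del: idn.simps)
  next
    case (8 R)
    show ?case using le'_axI [OF axI.intros(5) [OF 8]] 8 by (simp add: cp_cl cl_seq cl_par)
  next
    case (9 R)
    show ?case using le'_axI [OF axI.intros(6) [OF 9]] 9 by (simp add: dc_cl cl_seq)
  qed
qed

sublocale ordered_query_prop V dm cd "seq (CB \<Sigma>)" "oplus (CB \<Sigma>)" "ident (CB \<Sigma>)" "symm (CB \<Sigma>)"
   "cl Copy" "cl Discard" "cl Merge" "cl New" \<Sigma> "\<lambda>R. cl (Sym R)" le'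
  by (rule ordered_query_prop_CB)

lemma representable_cl: "ws c \<Longrightarrow> representable (cl c)"
proof (induction c)
  case (Seq c d)
  then have "ws c" "ws d" "tcod c = tdom d" by (auto simp: ws_def tdom_def tcod_def split: option.splits if_splits)
  then show ?case using representable_sq [of "cl c" "cl d"] Seq.IH by (simp add: cl_seq)
next
  case (Par c d)
  then have "ws c" "ws d" by (auto simp: ws_def split: option.splits if_splits)
  then show ?case using representable_pr [of "cl c" "cl d"] Par.IH by (simp add: cl_par)
next
  case (Sym R)
  then show ?case using representable_S [of R] by (simp add: ws_def split: if_splits)
next
  case Copy
  then show ?case using representable_sel [of "[0, 0]" 1] sel_1_00 by simp
next
  case Discard
  then show ?case using representable_sel [of "[]" 1] dc_1 by simp
next
  case Merge
  then show ?case using representable_M by simp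
next
  case New
  then show ?case using representable_N by simp
next
  case Id0
  then show ?case using representable_sel [of "[]" 0] by (simp add: dc_cl)
next
  case Id1
  then show ?case using representable_sel [of "[0]" 1] sel_1_0 I_1 by simp
next
  case Swap
  have "sel 2 [1, 0] = symm (CB \<Sigma>) 1 1" using sw_sel [of 1 1] by (simp add: numeral_2_eq_2 upt_rec)
  then show ?case using representable_sel [of "[1, 0]" 2] sw_1_1 by simp
qed

end


section \<open>Evaluation of terms by matrices\<close>

context matrices
begin

abbreviation (input) Sm :: "nat \<Rightarrow> nat \<Rightarrow> ('h, 'v) matrix" where
  "Sm n m \<equiv> rel (n + m) (m + n) (\<lambda>a b. b = drop n a @ take n a)"

definition conv :: "('h, 'v) matrix \<Rightarrow> ('h, 'v) matrix" where
  "conv X = (fst (snd X), fst X, \<lambda>H a b. val X H b a)"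

lemma val_conv: "val (conv X) H a b = val X H b a"
  by (simp add: conv_def val_def)

lemma conv_mats: "X \<in> mats n m \<Longrightarrow> conv X \<in> mats m n"
  by (rule matsI) (use matsD mats_val in \<open>auto simp: conv_def val_def\<close>)

lemma conv_rel: "conv (rel n m r) = rel m n (\<lambda>a b. r b a)"
  by (simp add: conv_def rel_def val_def conj_ac)

lemma conv_seq:
  assumes "X \<in> mats n z" "Y \<in> mats z m"
  shows "conv (matseq X Y) = matseq (conv Y) (conv X)"
  using assms matsD [OF assms(1)] matsD [OF assms(2)]
  by (intro mats_eqI [OF conv_mats [OF matseq_mats [OF assms]] matseq_mats [OF conv_mats [OF assms(2)] conv_mats [OF assms(1)]]])
    (simp add: val_conv val_seq [of X n z] val_seq [OF conv_mats [OF assms(2)]] mult.commute)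

lemma conv_par:
  assumes "X \<in> mats n m" "Y \<in> mats p q"
  shows "conv (matpar X Y) = matpar (conv X) (conv Y)"
  by (intro mats_eqI [OF conv_mats [OF matpar_mats [OF assms]] matpar_mats [OF conv_mats [OF assms(1)] conv_mats [OF assms(2)]]])
    (simp add: val_conv val_par [OF assms(1)] val_par [OF conv_mats [OF assms(1)]])

lemma conv_Sm: "conv (Sm n m) = Sm m n"
proof -
  have "b = drop n a @ take n a \<longleftrightarrow> a = drop m b @ take m b" if "length a = n + m" "length b = m + n" for a b :: "'v list"
    using that by auto
  then show ?thesis unfolding conv_rel by (intro rel_cong) blast
qed

lemma Delta_add:
  "matseq (matpar (Delta n) (Delta m)) (matpar (Id n) (matpar (Sm n m) (Id m))) = Delta (n + m)"
proof -
  have 1: "matpar (Delta n) (Delta m) = rel (n + m) (n + (n + (m + m))) (\<lambda>a b. b = take n a @ take n a @ drop n a @ drop n a)"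
    unfolding rel_par add.assoc [symmetric]
  proof (rule rel_cong)
    fix a b :: "'v list"
    assume "length a = n + m" "length b = n + n + m + m"
    then show "take (n + n) b = take n a @ take n a \<and> drop (n + n) b = drop n a @ drop n a \<longleftrightarrow>
        b = take n a @ take n a @ drop n a @ drop n a"
      using take_drop_eq_iff [of "take n a @ take n a" "n + n" b "drop n a @ drop n a"] by simp
  qed
  have 2: "matpar (Id n) (matpar (Sm n m) (Id m)) = rel (n + (n + (m + m))) (n + (m + (n + m)))
     (\<lambda>a b. b = take n a @ (drop n (take (n + m) (drop n a)) @ take n (drop n a)) @ drop (n + m) (drop n a))"
    unfolding rel_par add.assoc
  proof (rule rel_cong)
    fix a b :: "'v list"
    assume l: "length a = n + (n + (m + m))" "length b = n + (m + (n + m))"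
    have "take (m + n) (drop n b) = drop n (take (n + m) (drop n a)) @ take n (drop n a) \<and> drop (m + n) (drop n b) = drop (n + m) (drop n a)
      \<longleftrightarrow> drop n b = (drop n (take (n + m) (drop n a)) @ take n (drop n a)) @ drop (n + m) (drop n a)"
      using l by (intro take_drop_eq_iff) auto
    moreover have "take n b = take n a \<and> drop n b = v \<longleftrightarrow> b = take n a @ v" for v
      using l by (intro take_drop_eq_iff) auto
    ultimately show "(take n a = take n b \<and> take (m + n) (drop n b) = drop n (take (n + m) (drop n a)) @ take n (take (n + m) (drop n a))
        \<and> drop (n + m) (drop n a) = drop (m + n) (drop n b)) \<longleftrightarrow>
        b = take n a @ (drop n (take (n + m) (drop n a)) @ take n (drop n a)) @ drop (n + m) (drop n a)"
      by (metis min.absorb1 le_add1 take_take)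
  qed
  have "matseq (rel (n + m) (n + (n + (m + m))) (\<lambda>a b. b = take n a @ take n a @ drop n a @ drop n a))
     (rel (n + (n + (m + m))) (n + (m + (n + m)))
     (\<lambda>a b. b = take n a @ (drop n (take (n + m) (drop n a)) @ take n (drop n a)) @ drop (n + m) (drop n a))) =
     rel (n + m) (n + (m + (n + m))) (\<lambda>a b. b = a @ a)"
  proof (rule rel_seq_rel)
    fix a b :: "'v list"
    assume "length a = n + m"
    then obtain u v where "a = u @ v" "length u = n" "length v = m" by (metis length_eq_add_split)
    then show "b = a @ a \<longleftrightarrow> (\<exists>c. length c = n + (n + (m + m)) \<and> c = take n a @ take n a @ drop n a @ drop n a \<and>
        b = take n c @ (drop n (take (n + m) (drop n c)) @ take n (drop n c)) @ drop (n + m) (drop n c))"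
      by simp
  qed (auto dest: in_set_takeD in_set_dropD)
  then show ?thesis unfolding 1 2 by (simp add: add.assoc)
qed

lemma Mu_add:
  "matseq (matpar (Id n) (matpar (Sm m n) (Id m))) (matpar (Mu n) (Mu m)) = Mu (n + m)"
proof -
  have P: "matpar (Id n) (matpar (Sm n m) (Id m)) \<in> mats (n + (n + m + m)) (n + (m + n + m))"
    by (intro matpar_mats rel_mats)
  have D: "matpar (Delta n) (Delta m) \<in> mats (n + m) (n + (n + m + m))"
    using matpar_mats [OF rel_mats rel_mats, of n "n + n" "\<lambda>a b. b = a @ a" m "m + m" "\<lambda>a b. b = a @ a"] by (simp add: add.assoc)
  have "conv (matseq (matpar (Delta n) (Delta m)) (matpar (Id n) (matpar (Sm n m) (Id m)))) =
    matseq (matpar (conv (Id n)) (matpar (conv (Sm n m)) (conv (Id m)))) (matpar (conv (Delta n)) (conv (Delta m)))"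
    by (simp only: conv_seq [OF D P] conv_par [OF rel_mats rel_mats] conv_par [OF rel_mats matpar_mats [OF rel_mats rel_mats]])
  then show ?thesis unfolding Delta_add conv_Sm unfolding conv_rel by (simp add: eq_commute)
qed

lemma strict_prop_Mat:
  "strict_prop (\<lambda>X. X \<in> mats (fst X) (fst (snd X))) fst (\<lambda>X. fst (snd X)) matseq matpar (\<lambda>n. Id n) (\<lambda>n m. Sm n m)"
proof -
  have dims: "fst (rel n m r) = n" "fst (snd (rel n m r)) = m" for n m r by (simp_all add: rel_def)
  have sdims: "fst (matseq X Y) = fst X" "fst (snd (matseq X Y)) = fst (snd Y)"
    "fst (matpar X Y) = fst X + fst Y" "fst (snd (matpar X Y)) = fst (snd X) + fst (snd Y)" for X Y
    by (simp_all add: matseq_def matpar_def)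
  have add: "rel (n + (m + p)) (m + (p + n)) (\<lambda>a b. b = drop n a @ take n a) =
      matseq (matpar (Sm n m) (Id p)) (matpar (Id m) (Sm n p))" for n m p
    using symm_add_right [of n m p] by (simp add: add.assoc)
  show ?thesis
    by unfold_locales (auto simp: dims sdims matseq_assoc ident_matseq matseq_ident matpar_assoc unit_matpar matpar_unit
      mat_interchange ident_par symm_natural' symm_symm' add add.assoc intro: matseq_mats)
qed

lemma symm_add_left: "Sm (n + m) p = matseq (matpar (Id n) (Sm m p)) (matpar (Sm n p) (Id m))"
  using strict_prop.sw_add_left [OF strict_prop_Mat] .

end

definition tupH :: "'s msig \<Rightarrow> 's hypergraph \<Rightarrow> nat \<Rightarrow> nat list set" where
  "tupH \<Sigma> H n = (if finite_hypergraph \<Sigma> H then tuples (verts H) n else {})"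

lemma matrices_tupH: "matrices (tupH \<Sigma>)"
  by unfold_locales
    (auto simp: tupH_def tuples_def finite_hypergraph_def finite_lists_length_eq split: if_splits)

context gcq_signature
begin

sublocale matrices "tupH \<Sigma>"
  by (rule matrices_tupH)

definition sym_mat :: "'s \<Rightarrow> ('s hypergraph, nat) matrix" where
  "sym_mat R = (ar \<Sigma> R, coar \<Sigma> R, \<lambda>H a b. if a \<in> tupH \<Sigma> H (ar \<Sigma> R) \<and> b \<in> tupH \<Sigma> H (coar \<Sigma> R)
     then card {e \<in> edges H R. src H R e = a \<and> tgt H R e = b} else 0)"

primrec ev :: "'s gcq \<Rightarrow> ('s hypergraph, nat) matrix" where
  "ev Copy = Delta 1"
| "ev Discard = Eps 1"
| "ev Merge = Mu 1"
| "ev New = Eta 1"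
| "ev Id0 = Id 0"
| "ev Id1 = Id 1"
| "ev Swap = Sm 1 1"
| "ev (Sym R) = sym_mat R"
| "ev (c \<triangleright> d) = matseq (ev c) (ev d)"
| "ev (c \<otimes> d) = matpar (ev c) (ev d)"

lemma sym_mat_mats: "sym_mat R \<in> mats (ar \<Sigma> R) (coar \<Sigma> R)"
  by (rule matsI) (auto simp: sym_mat_def val_def split: if_splits)

lemma ev_mats: "has_sort \<Sigma> c n m \<Longrightarrow> ev c \<in> mats n m"
proof (induction rule: has_sort.induct)
  case (9 c n z d m)
  then show ?case by (metis ev.simps(9) matseq_mats)
next
  case (10 c n m d p q)
  then show ?case by (metis ev.simps(10) matpar_mats)
qed (use rel_mats [of 1 "1 + 1"] rel_mats [of "1 + 1" 1] rel_mats [of "1 + 1" "1 + 1"] in \<open>simp_all add: sym_mat_mats numeral_2_eq_2\<close>)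

lemma ev_idn: "ev (idn n) = Id n"
  by (induction n) (simp_all add: ident_par)

lemma ev_swap1: "ev (swap1 m) = Sm 1 m"
proof (induction m)
  case 0
  show ?case by (simp, rule rel_cong) auto
next
  case (Suc m)
  then show ?case using symm_add_right [of 1 1 m] by (simp add: ev_idn)
qed

lemma ev_swap: "ev (swap n m) = Sm n m"
proof (induction n)
  case 0
  show ?case by (simp add: ev_idn, rule rel_cong) auto
next
  case (Suc n)
  then show ?case using symm_add_left [of 1 n m] by (simp add: ev_idn ev_swap1)
qed

lemma ev_discard: "ev (discard n) = Eps n"
proof (induction n)
  case 0
  show ?case by (simp, rule rel_cong) auto
qed (simp add: rel_par)

lemma ev_new: "ev (new n) = Eta n"
proof (induction n)
  case 0
  show ?case by (simp, rule rel_cong) auto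
qed (simp add: rel_par)

lemma ev_copy: "ev (copy n) = Delta n"
proof (induction n)
  case 0
  show ?case by (simp, rule rel_cong) auto
next
  case (Suc n)
  then show ?case using Delta_add [of 1 n] by (simp add: ev_idn ev_swap del: swap.simps One_nat_def) simp
qed

lemma ev_merge: "ev (merge n) = Mu n"
proof (induction n)
  case 0
  show ?case by (simp, rule rel_cong) auto
next
  case (Suc n)
  then show ?case using Mu_add [of 1 n] by (simp add: ev_idn ev_swap del: swap.simps One_nat_def) simp
qed

lemma axE_ev: "axE \<Sigma> n m c d \<Longrightarrow> ev c = ev d"
proof (induction rule: axE.induct)
  case (1 c n x d y e m)
  then show ?case by (simp add: matseq_assoc [OF ev_mats ev_mats ev_mats])
next
  case (2 c n m)
  then show ?case by (simp add: ev_idn ident_matseq [OF ev_mats])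
next
  case (3 c n m)
  then show ?case by (simp add: ev_idn matseq_ident [OF ev_mats])
next
  case (4 c n m d p q e x y)
  then show ?case by (simp add: matpar_assoc [OF ev_mats ev_mats ev_mats])
next
  case (5 c n m)
  then show ?case by (simp add: unit_matpar [OF ev_mats])
next
  case (6 c n m)
  then show ?case by (simp add: matpar_unit [OF ev_mats])
next
  case (7 c n x d m c' p y d' q)
  then show ?case by (simp add: mat_interchange [OF ev_mats ev_mats ev_mats ev_mats])
next
  case (9 c n m d p q)
  then show ?case by (simp add: ev_swap symm_natural' [OF ev_mats ev_mats])
next
  case (11 n m p)
  show ?case using symm_add_right [of n m p] by (simp add: ev_swap ev_idn add.assoc)
qed (simp_all del: One_nat_def one_add_one idn.simps swap.simps add: ev_idn ident_par ev_swap symm_symm'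
   Delta_assoc Delta_lunit Delta_comm Mu_assoc Mu_lunit Mu_comm Frobenius_left Frobenius_right Special)

lemma axI_ev: "axI \<Sigma> n m c d \<Longrightarrow> matle (ev c) (ev d)"
proof (induction rule: axI.induct)
  case 4
  show ?case using Mu_Delta_le_Id [of 1] by (simp only: ev.simps ev_idn one_add_one)
qed (simp_all only: ev.simps ev_copy ev_discard Id_le_Eps_Eta Eta_Eps_le_Id Special matle_refl Lax_Delta [OF sym_mat_mats] Lax_Eps [OF sym_mat_mats])

lemma gcq_eq_ev: "gcq_eq \<Sigma> n m c d \<Longrightarrow> ev c = ev d"
  by (induction rule: gcq_eq.induct) (simp_all add: axE_ev)

lemma gcq_le_ev: "gcq_le \<Sigma> n m c d \<Longrightarrow> matle (ev c) (ev d)"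
proof (induction rule: gcq_le.induct)
  case (2 n m c d)
  then show ?case using gcq_eq_ev matle_refl by metis
next
  case (3 n m c d e)
  then show ?case using matle_trans by blast
next
  case (4 n z c c' m d d')
  then have "ev c \<in> mats n z" "ev c' \<in> mats n z" using gcq_le_sort ev_mats has_sort_iff by metis+
  then show ?case using 4 matseq_mono by simp
next
  case (5 n m c c' p q d d')
  then have "ev c \<in> mats n m" "ev c' \<in> mats n m" using gcq_le_sort ev_mats has_sort_iff by metis+
  then show ?case using 5 matpar_mono by simp
qed (simp add: axI_ev)

definition F :: "'s gcq set \<Rightarrow> ('s hypergraph, nat) matrix" where
  "F P = ev (SOME c. c \<in> P)"

lemma F_cl: "ws c \<Longrightarrow> F (cl c) = ev c"
proof -
  assume c: "ws c"
  then have "(SOME d. d \<in> cl c) \<in> cl c" using cl_mem someI by metis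
  then have "ev c = ev (SOME d. d \<in> cl c)" using cl_memD gcq_eq_ev by blast
  then show ?thesis by (simp add: F_def)
qed

lemma F_mats [simp]: "V P \<Longrightarrow> dm P = n \<Longrightarrow> cd P = m \<Longrightarrow> F P \<in> mats n m"
  using F_cl ev_mats ws_sort by (auto elim!: VE)

lemma F_seq: "\<lbrakk>V P; V Q; cd P = dm Q\<rbrakk> \<Longrightarrow> F (seq (CB \<Sigma>) P Q) = matseq (F P) (F Q)"
  by (auto elim!: VE simp: cl_seq F_cl)

lemma F_par: "\<lbrakk>V P; V Q\<rbrakk> \<Longrightarrow> F (oplus (CB \<Sigma>) P Q) = matpar (F P) (F Q)"
  by (auto elim!: VE simp: cl_par F_cl)

lemma F_I: "F (ident (CB \<Sigma>) n) = Id n"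
  by (simp add: CB_eqs(1) [of n] F_cl ev_idn)

lemma F_cp: "F (cp n) = Delta n" and F_dc: "F (dc n) = Eps n" and F_nw: "F (nw n) = Eta n"
  by (simp_all add: cp_cl dc_cl nw_cl F_cl ev_copy ev_discard ev_new)

end

definition atom_count :: "'s hypergraph \<Rightarrow> nat list \<Rightarrow> 's ratom \<Rightarrow> nat" where
  "atom_count H w = (\<lambda>(R, s, t). card {e \<in> edges H R. src H R e = map ((!) w) s \<and> tgt H R e = map ((!) w) t})"

context gcq_signature
begin

lemma F_gen: "F (cl Discard) = Eps 1" "F (cl Merge) = Mu 1" "F (cl (Sym R)) = (if R \<in> symbols \<Sigma> then sym_mat R else F (cl (Sym R)))"
  using has_sort_iff has_sort.intros F_cl [of Discard] F_cl [of Merge] F_cl [of "Sym R"] by auto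

lemma val_meet:
  assumes "eff K e" "V f" "dm f = K"
  shows "val (F (meet e f)) H a b = val (F e) H a [] * val (F f) H a b"
proof -
  have e: "F e \<in> mats K 0" and f: "F f \<in> mats K (cd f)" using assms by simp_all
  have "val (F (meet e f)) H a b = val (matseq (Delta K) (matpar (F e) (F f))) H a b"
    using assms by (simp add: meet_def F_seq F_par F_cp)
  also have "\<dots> = of_bool (a \<in> tupH \<Sigma> H K) * (val (F e) H (take K (a @ a)) (take 0 b) * val (F f) H (drop K (a @ a)) (drop 0 b))"
    using append_tupI [of a H K a K] val_par [OF e] by (subst val_rel_seq [where g = "a @ a"]) auto
  also have "\<dots> = val (F e) H a [] * val (F f) H a b"
    using mats_val [OF e, of H a "[]"] by (cases "a \<in> tupH \<Sigma> H K") (auto simp: length_tup)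
  finally show ?thesis .
qed

lemma F_proj:
  assumes "i < K"
  shows "F (proj K i) = rel K 1 (\<lambda>a b. b = [a ! i])"
proof -
  obtain r where K: "K = i + (1 + r)" using assms by (metis Suc_eq_plus1_left add_Suc_right less_iff_Suc_add)
  have "F (proj K i) = matpar (Eps i) (matpar (Id 1) (Eps r))"
    using K by (simp add: proj_def F_par F_I F_dc)
  also have "\<dots> = rel K 1 (\<lambda>a b. b = [a ! i])"
    unfolding rel_par K
  proof (simp, rule rel_cong)
    fix a b :: "nat list"
    assume "length a = Suc (i + r)" "length b = Suc 0"
    then show "take (Suc 0) (drop i a) = take (Suc 0) b \<longleftrightarrow> b = [a ! i]"
      by (auto simp: take_Suc hd_drop_conv_nth)
  qed
  finally show ?thesis .
qed

lemma F_sel: "set s \<subseteq> {..<K} \<Longrightarrow> F (sel K s) = rel K (length s) (\<lambda>a b. b = map ((!) a) s)"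
proof (induction s)
  case Nil
  show ?case by (simp add: F_dc, rule rel_cong) auto
next
  case (Cons i s)
  then have "F (sel K (i # s)) = matseq (Delta K) (matpar (rel K 1 (\<lambda>a b. b = [a ! i])) (rel K (length s) (\<lambda>a b. b = map ((!) a) s)))"
    by (simp add: sel.simps(2) F_seq F_par F_cp F_proj)
  also have "\<dots> = rel K (1 + length s) (\<lambda>a b. b = map ((!) a) (i # s))"
    unfolding rel_par
  proof (rule rel_seq_rel)
    fix a b :: "nat list"
    assume "length a = K" "length b = 1 + length s"
    then show "b = map ((!) a) (i # s) \<longleftrightarrow>
       (\<exists>c. length c = K + K \<and> c = a @ a \<and> take 1 b = [take K c ! i] \<and> drop 1 b = map ((!) (drop K c)) s)"
      using Cons.prems by (cases b) (auto simp: nth_append)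
  qed auto
  finally show ?case by simp
qed

lemma F_eq:
  assumes "i < K" "j < K"
  shows "F (eq K i j) = rel K 0 (\<lambda>a b. a ! i = a ! j)"
proof -
  have ME: "matseq (Mu 1) (Eps 1) = rel (1 + 1) 0 (\<lambda>a b. a ! 0 = a ! 1)"
  proof (rule rel_seq_rel)
    fix a b :: "nat list"
    assume "length a = 1 + 1"
    then obtain x y where "a = [x, y]" by (auto simp: length_Suc_conv)
    then show "a ! 0 = a ! 1 \<longleftrightarrow> (\<exists>c. length c = 1 \<and> a = c @ c \<and> True)"
      by (auto simp: length_Suc_conv)
  qed auto
  have "F (eq K i j) = matseq (rel K 2 (\<lambda>a b. b = [a ! i, a ! j])) (matseq (Mu 1) (Eps 1))"
    using assms F_sel [of "[i, j]" K] by (simp add: eq_def F_seq F_gen numeral_2_eq_2)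
  also have "\<dots> = rel K 0 (\<lambda>a b. a ! i = a ! j)"
    unfolding ME unfolding one_add_one
    by (rule rel_seq_rel) (use assms in auto)
  finally show ?thesis .
qed

lemma val_eqs:
  "set es \<subseteq> {..<K} \<times> {..<K} \<Longrightarrow>
    val (F (eqs K es)) H a [] = of_bool (a \<in> tupH \<Sigma> H K \<and> (\<forall>(i, j)\<in>set es. a ! i = a ! j))"
proof (induction es)
  case Nil
  then show ?case using Nil_tup [of a H K] by (auto simp: F_dc val_rel)
next
  case (Cons p es)
  then show ?case using Nil_tup [of a H K] by (auto simp: val_meet [of K] F_eq val_rel case_prod_unfold) (metis fst_conv snd_conv)
qed

lemma val_bend:
  assumes "R \<in> symbols \<Sigma>" "a \<in> tupH \<Sigma> H (ar \<Sigma> R + coar \<Sigma> R)"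
  shows "val (F (bend (cl (Sym R)))) H a [] = val (sym_mat R) H (take (ar \<Sigma> R) a) (drop (ar \<Sigma> R) a)"
proof -
  let ?n = "ar \<Sigma> R" and ?m = "coar \<Sigma> R"
  have a: "take ?n a \<in> tupH \<Sigma> H ?n" "drop ?n a \<in> tupH \<Sigma> H ?m" using assms take_tup drop_tup by blast+
  have z: "set (zip [0..<?m] [?m..<?m + ?m]) \<subseteq> {..<?m + ?m} \<times> {..<?m + ?m}"
    by (intro set_zip_lessThan) auto
  have cap: "val (F (cap ?m)) H c [] = of_bool (take ?m c = drop ?m c)" if c: "c \<in> tupH \<Sigma> H (?m + ?m)" for c
  proof -
    have "(\<forall>(i, j)\<in>set (zip [0..<?m] [?m..<?m + ?m]). c ! i = c ! j) \<longleftrightarrow> take ?m c = drop ?m c"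
    proof -
      have z2: "zip [0..<?m] [?m..<?m + ?m] = map (\<lambda>i. (i, ?m + i)) [0..<?m]" by (rule nth_equalityI) auto
      show ?thesis unfolding z2 using length_tup [OF c] by (auto simp: list_eq_iff_nth_eq)
    qed
    then show ?thesis using c unfolding cap_def val_eqs [OF z] by simp
  qed
  have "val (F (bend (cl (Sym R)))) H a [] = val (matseq (matpar (sym_mat R) (Id ?m)) (F (cap ?m))) H a []"
    using assms by (simp add: bend_def F_seq F_par F_I F_gen)
  also have "\<dots> = (\<Sum>c\<in>tupH \<Sigma> H (?m + ?m). val (matpar (sym_mat R) (Id ?m)) H a c * val (F (cap ?m)) H c [])"
    by (rule val_seq [OF matpar_mats [OF sym_mat_mats rel_mats]])
  also have "\<dots> = (\<Sum>c\<in>tupH \<Sigma> H (?m + ?m). if c = drop ?n a @ drop ?n a then val (sym_mat R) H (take ?n a) (drop ?n a) else 0)"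
  proof (rule sum.cong)
    fix c assume c: "c \<in> tupH \<Sigma> H (?m + ?m)"
    have E: "drop ?n a = drop ?m c \<and> take ?m c = drop ?m c \<longleftrightarrow> c = drop ?n a @ drop ?n a"
      using take_drop_eq_iff [of "drop ?n a" ?m c "drop ?n a"] length_tup [OF c] length_tup [OF a(2)] by auto
    have P: "val (matpar (sym_mat R) (Id ?m)) H a c = val (sym_mat R) H (take ?n a) (take ?m c) * of_bool (drop ?n a = drop ?m c)"
      using a drop_tup [OF c] by (simp add: val_par [OF sym_mat_mats] val_rel)
    show "val (matpar (sym_mat R) (Id ?m)) H a c * val (F (cap ?m)) H c [] =
        (if c = drop ?n a @ drop ?n a then val (sym_mat R) H (take ?n a) (drop ?n a) else 0)"
      unfolding P cap [OF c] E [symmetric] by simp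
  qed simp
  also have "\<dots> = val (sym_mat R) H (take ?n a) (drop ?n a)"
    using append_tupI [OF a(2) a(2)] by (simp add: sum.delta finite_tup)
  finally show ?thesis .
qed

lemma val_ratom:
  assumes "wf_rel \<Sigma> K r"
  shows "val (F (ratom K r)) H a [] = of_bool (a \<in> tupH \<Sigma> H K) * atom_count H a r"
proof (cases "a \<in> tupH \<Sigma> H K")
  case True
  obtain R s t where r: "r = (R, s, t)" by (cases r)
  have R: "R \<in> symbols \<Sigma>" "length s = ar \<Sigma> R" "length t = coar \<Sigma> R" "set s \<subseteq> {..<K}" "set t \<subseteq> {..<K}"
    using assms r by (auto simp: wf_rel_def)
  then have t: "map ((!) a) s \<in> tupH \<Sigma> H (ar \<Sigma> R)" "map ((!) a) t \<in> tupH \<Sigma> H (coar \<Sigma> R)"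
    using True length_tup [OF True] by (auto intro!: set_tup [OF True True] nth_mem)
  have "val (F (ratom K r)) H a [] = val (matseq (rel K (ar \<Sigma> R + coar \<Sigma> R) (\<lambda>a b. b = map ((!) a) (s @ t))) (F (bend (cl (Sym R))))) H a []"
    using R F_sel [of "s @ t" K] by (simp add: r ratom_def F_seq)
  also have "\<dots> = val (F (bend (cl (Sym R)))) H (map ((!) a) (s @ t)) []"
    using True append_tupI [OF t] by (subst val_rel_seq [where g = "map ((!) a) (s @ t)"]) auto
  also have "\<dots> = atom_count H a r"
    using R t append_tupI [OF t] by (simp add: val_bend r atom_count_def) (simp add: sym_mat_def val_def)
  finally show ?thesis using True by simp
next
  case False
  then show ?thesis using mats_val [of "F (ratom K r)" K 0 H a "[]"] assms by auto
qed

lemma val_rels: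
  "\<forall>r\<in>set rs. wf_rel \<Sigma> K r \<Longrightarrow> val (F (rels K rs)) H a [] = of_bool (a \<in> tupH \<Sigma> H K) * prod_list (map (atom_count H a) rs)"
proof (induction rs)
  case Nil
  then show ?case using Nil_tup [of a H K] by (auto simp: F_dc val_rel)
next
  case (Cons r rs)
  then show ?case by (auto simp: val_meet [of K] val_ratom)
qed

lemma val_nf:
  assumes "wf_body \<Sigma> (n + k) es rs t"
  shows "val (F (nf n k es rs t)) H a b = (\<Sum>w\<in>tupH \<Sigma> H (n + k).
    if take n w = a \<and> (\<forall>(i, j)\<in>set es. w ! i = w ! j) \<and> map ((!) w) t = b then prod_list (map (atom_count H w) rs) else 0)"
proof -
  let ?K = "n + k"
  have es: "set es \<subseteq> {..<?K} \<times> {..<?K}" and rs: "\<forall>r\<in>set rs. wf_rel \<Sigma> ?K r" and t: "set t \<subseteq> {..<?K}"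
    using assms by (auto simp: wf_body_def)
  have "val (F (nf n k es rs t)) H a b = val (matseq (matpar (Id n) (Eta k)) (F (body ?K es rs t))) H a b"
    using assms by (simp add: nf_def F_seq F_par F_I F_nw)
  also have "\<dots> = (\<Sum>w\<in>tupH \<Sigma> H ?K. val (matpar (Id n) (Eta k)) H a w * val (F (body ?K es rs t)) H w b)"
    using val_seq [OF matpar_mats [OF rel_mats rel_mats], of n n "(=)" 0 k "\<lambda>_ _. True" "F (body ?K es rs t)" H a b] by simp
  also have "\<dots> = (\<Sum>w\<in>tupH \<Sigma> H (n + k).
    if take n w = a \<and> (\<forall>(i, j)\<in>set es. w ! i = w ! j) \<and> map ((!) w) t = b then prod_list (map (atom_count H w) rs) else 0)"
  proof (rule sum.cong)
    fix w assume w: "w \<in> tupH \<Sigma> H ?K"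
    have "map ((!) w) t \<in> tupH \<Sigma> H (length t)" using t length_tup [OF w] by (intro set_tup [OF w w]) auto
    then have B: "val (F (body ?K es rs t)) H w b =
       of_bool ((\<forall>(i, j)\<in>set es. w ! i = w ! j) \<and> b = map ((!) w) t) * prod_list (map (atom_count H w) rs)"
      using w es rs t unfolding body_def
      by (simp add: val_meet [of ?K] val_eqs val_rels F_sel val_rel)
    have "val (matpar (Id n) (Eta k)) H a w = of_bool (take n w = a)"
    proof -
      have "val (matpar (Id n) (Eta k)) H a w = of_bool (take n a \<in> tupH \<Sigma> H n \<and> take n w \<in> tupH \<Sigma> H n \<and> take n a = take n w) *
         of_bool (drop n a \<in> tupH \<Sigma> H 0 \<and> drop n w \<in> tupH \<Sigma> H k)"
        by (simp add: val_par [OF rel_mats] val_rel)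
      moreover have "drop n a \<in> tupH \<Sigma> H 0 \<and> take n a = take n w \<longleftrightarrow> take n w = a"
        using tup_0 [of "drop n a" H] Nil_tup [OF w] length_tup [OF w] by auto
      ultimately show ?thesis using take_tup [OF w] drop_tup [OF w] by auto
    qed
    then show "val (matpar (Id n) (Eta k)) H a w * val (F (body ?K es rs t)) H w b =
      (if take n w = a \<and> (\<forall>(i, j)\<in>set es. w ! i = w ! j) \<and> map ((!) w) t = b then prod_list (map (atom_count H w) rs) else 0)"
      unfolding B by auto
  qed simp
  finally show ?thesis .
qed

end


section \<open>Hypergraphs\<close>

lemma Hyp_simps [simp]:
  "Obj (Hyp \<Sigma>) = {G. finite_hypergraph \<Sigma> G}" "Hom (Hyp \<Sigma>) = hyper_hom"
  by (simp_all add: Hyp_def)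

lemma hyper_hom_eqI:
  assumes "f \<in> hyper_hom G H" "g \<in> hyper_hom G H" "\<And>x. x \<in> verts G \<Longrightarrow> vmap f x = vmap g x"
    "\<And>R e. e \<in> edges G R \<Longrightarrow> emap f R e = emap g R e"
  shows "f = g"
proof -
  have "vmap f = vmap g" using assms by (intro PiE_ext [of "vmap f" "verts G" "\<lambda>_. verts H"]) (auto simp: hyper_hom_def)
  moreover have "emap f R = emap g R" for R
    using assms by (intro PiE_ext [of "emap f R" "edges G R" "\<lambda>_. edges H R"]) (auto simp: hyper_hom_def)
  ultimately show ?thesis using assms(1,2) by (intro hyper_mor.equality) (auto simp: hyper_hom_def)
qed

lemma hyper_homD:
  assumes "f \<in> hyper_hom G H"
  shows "source f = G" "target f = H" "x \<in> verts G \<Longrightarrow> vmap f x \<in> verts H" "e \<in> edges G R \<Longrightarrow> emap f R e \<in> edges H R"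
    "e \<in> edges G R \<Longrightarrow> src H R (emap f R e) = map (vmap f) (src G R e)"
    "e \<in> edges G R \<Longrightarrow> tgt H R (emap f R e) = map (vmap f) (tgt G R e)"
  using assms by (auto simp: hyper_hom_def)

lemma hyper_hom_map: "f \<in> hyper_hom G H \<Longrightarrow> xs \<in> tuples (verts G) n \<Longrightarrow> map (vmap f) xs \<in> tuples (verts H) n"
  using hyper_homD(3) by (fastforce simp: tuples_def)

lemma fin_hypD:
  assumes "finite_hypergraph \<Sigma> G"
  shows "finite (verts G)" "finite (Sigma (symbols \<Sigma>) (edges G))"
    "e \<in> edges G R \<Longrightarrow> R \<in> symbols \<Sigma> \<and> src G R e \<in> tuples (verts G) (ar \<Sigma> R) \<and> tgt G R e \<in> tuples (verts G) (coar \<Sigma> R)"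
  using assms by (auto simp: finite_hypergraph_def hypergraph_def PiE_iff)

lemma src_verts: "finite_hypergraph \<Sigma> G \<Longrightarrow> e \<in> edges G R \<Longrightarrow> set (src G R e) \<subseteq> verts G"
  and tgt_verts: "finite_hypergraph \<Sigma> G \<Longrightarrow> e \<in> edges G R \<Longrightarrow> set (tgt G R e) \<subseteq> verts G"
  using fin_hypD(3) by (fastforce simp: tuples_def)+

definition leg :: "nat \<Rightarrow> 's hyper_mor \<Rightarrow> nat list" where
  "leg n f = map (vmap f) [0..<n]"

definition point :: "nat \<Rightarrow> 's hypergraph \<Rightarrow> nat list \<Rightarrow> 's hyper_mor" where
  "point n G xs = \<lparr>source = disc n, target = G, vmap = (\<lambda>i\<in>{0..<n}. xs ! i), emap = (\<lambda>R e. undefined)\<rparr>"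

lemma length_leg [simp]: "length (leg n f) = n"
  by (simp add: leg_def)

lemma disc_simps [simp]: "verts (disc n) = {0..<n}" "edges (disc n) R = {}"
  by (simp_all add: disc_def)

lemma leg_point: "length xs = n \<Longrightarrow> leg n (point n G xs) = xs"
  by (rule nth_equalityI) (auto simp: leg_def point_def)

lemma point_hom: "xs \<in> tuples (verts G) n \<Longrightarrow> point n G xs \<in> hyper_hom (disc n) G"
  by (auto simp: point_def hyper_hom_def tuples_def)

lemma leg_tuples: "f \<in> hyper_hom (disc n) G \<Longrightarrow> leg n f \<in> tuples (verts G) n"
  by (auto simp: leg_def tuples_def hyper_hom_def)

lemma leg_inj: "\<lbrakk>f \<in> hyper_hom (disc n) G; g \<in> hyper_hom (disc n) G; leg n f = leg n g\<rbrakk> \<Longrightarrow> f = g"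
  by (rule hyper_hom_eqI) (auto simp: leg_def)

lemma point_leg: "f \<in> hyper_hom (disc n) G \<Longrightarrow> point n G (leg n f) = f"
  by (rule leg_inj [OF point_hom [OF leg_tuples]]) (simp_all add: leg_point)

lemma finite_hyper_hom:
  assumes "finite_hypergraph \<Sigma> G" "finite_hypergraph \<Sigma> H"
  shows "finite (hyper_hom G H)"
proof -
  let ?E = "Sigma (symbols \<Sigma>) (edges G)" and ?E' = "Sigma (symbols \<Sigma>) (edges H)"
  let ?f = "\<lambda>h :: 'a hyper_mor. (vmap h, \<lambda>p\<in>?E. (fst p, emap h (fst p) (snd p)))"
  have "?f h \<in> (verts G \<rightarrow>\<^sub>E verts H) \<times> (?E \<rightarrow>\<^sub>E ?E')" if h: "h \<in> hyper_hom G H" for h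
  proof -
    have "vmap h \<in> verts G \<rightarrow>\<^sub>E verts H" using h by (simp add: hyper_hom_def)
    moreover have "(\<lambda>p\<in>?E. (fst p, emap h (fst p) (snd p))) \<in> ?E \<rightarrow>\<^sub>E ?E'" using hyper_homD(4) [OF h] by auto
    ultimately show ?thesis by blast
  qed
  then have "?f ` hyper_hom G H \<subseteq> (verts G \<rightarrow>\<^sub>E verts H) \<times> (?E \<rightarrow>\<^sub>E ?E')" by blast
  moreover have "finite ((verts G \<rightarrow>\<^sub>E verts H) \<times> (?E \<rightarrow>\<^sub>E ?E'))"
    using assms fin_hypD by (intro finite_cartesian_product finite_PiE) auto
  ultimately have "finite (?f ` hyper_hom G H)" by (rule finite_subset)
  moreover have "inj_on ?f (hyper_hom G H)"
  proof (rule inj_onI)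
    fix h k assume h: "h \<in> hyper_hom G H" and k: "k \<in> hyper_hom G H" and e: "?f h = ?f k"
    show "h = k"
    proof (rule hyper_hom_eqI [OF h k])
      fix R e' assume "e' \<in> edges G R"
      then have "(R, e') \<in> ?E" using fin_hypD(3) [OF assms(1)] by blast
      moreover have "snd (?f h) (R, e') = snd (?f k) (R, e')" using e by simp
      ultimately show "emap h R e' = emap k R e'" by simp
    qed (use e in simp)
  qed
  ultimately show ?thesis by (rule finite_imageD)
qed

definition rep :: "(nat \<times> nat) list \<Rightarrow> nat \<Rightarrow> nat" where
  "rep es i = (LEAST j. (i, j) \<in> eqv es)"

lemma rep_eqv: "(i, rep es i) \<in> eqv es"
  unfolding rep_def by (rule LeastI [of _ i]) simp

lemma rep_eq_iff: "rep es i = rep es j \<longleftrightarrow> (i, j) \<in> eqv es"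
proof
  assume "(i, j) \<in> eqv es"
  then have "(i, k) \<in> eqv es \<longleftrightarrow> (j, k) \<in> eqv es" for k using eqv_sym eqv_trans by blast
  then show "rep es i = rep es j" by (simp add: rep_def)
qed (metis eqv_sym eqv_trans rep_eqv)

lemma rep_rep [simp]: "rep es (rep es i) = rep es i"
  by (metis rep_eq_iff rep_eqv)

lemma rep_mem: "\<lbrakk>set es \<subseteq> U \<times> U; i \<in> U\<rbrakk> \<Longrightarrow> rep es i \<in> U"
  using eqv_least [of es "\<lambda>i j. i \<in> U \<longleftrightarrow> j \<in> U" i "rep es i"] rep_eqv by blast

lemma rep_respects:
  assumes "\<And>x y. (x, y) \<in> set es \<Longrightarrow> f x = f y"
  shows "f (rep es i) = f i"
proof -
  have "f i = f (rep es i)"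
    by (rule eqv_least [of es "\<lambda>i j. f i = f j"]) (use assms rep_eqv in auto)
  then show ?thesis by simp
qed

definition hquot :: "(nat \<times> nat) list \<Rightarrow> 's hypergraph \<Rightarrow> 's hypergraph" where
  "hquot es G = \<lparr>verts = rep es ` verts G, edges = edges G,
     src = (\<lambda>R. \<lambda>e\<in>edges G R. map (rep es) (src G R e)), tgt = (\<lambda>R. \<lambda>e\<in>edges G R. map (rep es) (tgt G R e))\<rparr>"

definition hquot_map :: "(nat \<times> nat) list \<Rightarrow> 's hypergraph \<Rightarrow> 's hyper_mor" where
  "hquot_map es G = \<lparr>source = G, target = hquot es G, vmap = (\<lambda>v\<in>verts G. rep es v), emap = (\<lambda>R. \<lambda>e\<in>edges G R. e)\<rparr>"

definition hsum :: "'s hypergraph \<Rightarrow> 's hypergraph \<Rightarrow> 's hypergraph" where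
  "hsum A B = \<lparr>verts = (\<lambda>v. 2 * v) ` verts A \<union> (\<lambda>v. Suc (2 * v)) ` verts B,
     edges = (\<lambda>R. (\<lambda>v. 2 * v) ` edges A R \<union> (\<lambda>v. Suc (2 * v)) ` edges B R),
     src = (\<lambda>R. \<lambda>e\<in>(\<lambda>v. 2 * v) ` edges A R \<union> (\<lambda>v. Suc (2 * v)) ` edges B R.
       if even e then map (\<lambda>v. 2 * v) (src A R (e div 2)) else map (\<lambda>v. Suc (2 * v)) (src B R (e div 2))),
     tgt = (\<lambda>R. \<lambda>e\<in>(\<lambda>v. 2 * v) ` edges A R \<union> (\<lambda>v. Suc (2 * v)) ` edges B R.
       if even e then map (\<lambda>v. 2 * v) (tgt A R (e div 2)) else map (\<lambda>v. Suc (2 * v)) (tgt B R (e div 2)))\<rparr>"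

definition hinl :: "'s hypergraph \<Rightarrow> 's hypergraph \<Rightarrow> 's hyper_mor" where
  "hinl A B = \<lparr>source = A, target = hsum A B, vmap = (\<lambda>v\<in>verts A. 2 * v), emap = (\<lambda>R. \<lambda>e\<in>edges A R. 2 * e)\<rparr>"

definition hinr :: "'s hypergraph \<Rightarrow> 's hypergraph \<Rightarrow> 's hyper_mor" where
  "hinr A B = \<lparr>source = B, target = hsum A B, vmap = (\<lambda>v\<in>verts B. Suc (2 * v)), emap = (\<lambda>R. \<lambda>e\<in>edges B R. Suc (2 * e))\<rparr>"

lemma hyper_map_simps [simp]:
  "v \<in> verts A \<Longrightarrow> vmap (hinl A B) v = 2 * v" "e \<in> edges A R \<Longrightarrow> emap (hinl A B) R e = 2 * e"
  "v \<in> verts B \<Longrightarrow> vmap (hinr A B) v = Suc (2 * v)" "e \<in> edges B R \<Longrightarrow> emap (hinr A B) R e = Suc (2 * e)"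
  "v \<in> verts G \<Longrightarrow> vmap (hquot_map es G) v = rep es v" "e \<in> edges G R \<Longrightarrow> emap (hquot_map es G) R e = e"
  by (simp_all add: hinl_def hinr_def hquot_map_def)

lemma hinl_hom: "finite_hypergraph \<Sigma> A \<Longrightarrow> hinl A B \<in> hyper_hom A (hsum A B)"
  and hinr_hom: "finite_hypergraph \<Sigma> B \<Longrightarrow> hinr A B \<in> hyper_hom B (hsum A B)"
  using src_verts tgt_verts by (fastforce simp: hinl_def hinr_def hyper_hom_def hsum_def)+

lemma hquot_map_hom: "finite_hypergraph \<Sigma> G \<Longrightarrow> hquot_map es G \<in> hyper_hom G (hquot es G)"
  using src_verts tgt_verts by (fastforce simp: hquot_map_def hyper_hom_def hquot_def)

lemma finite_hypergraphI:
  assumes "finite (verts G)" "finite (Sigma (symbols \<Sigma>) (edges G))"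
    "\<And>R e. e \<in> edges G R \<Longrightarrow> R \<in> symbols \<Sigma> \<and> src G R e \<in> tuples (verts G) (ar \<Sigma> R) \<and> tgt G R e \<in> tuples (verts G) (coar \<Sigma> R)"
    "\<And>R e. e \<notin> edges G R \<Longrightarrow> src G R e = undefined \<and> tgt G R e = undefined"
  shows "finite_hypergraph \<Sigma> G"
  using assms unfolding finite_hypergraph_def hypergraph_def by (auto simp: PiE_iff extensional_def)

lemma hquot_fin: "finite_hypergraph \<Sigma> G \<Longrightarrow> finite_hypergraph \<Sigma> (hquot es G)"
  using fin_hypD [of \<Sigma> G] by (intro finite_hypergraphI) (fastforce simp: hquot_def tuples_def)+

lemma hsum_fin:
  assumes "finite_hypergraph \<Sigma> A" "finite_hypergraph \<Sigma> B"
  shows "finite_hypergraph \<Sigma> (hsum A B)"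
proof (rule finite_hypergraphI)
  have "Sigma (symbols \<Sigma>) (edges (hsum A B)) \<subseteq> map_prod id (\<lambda>v. 2 * v) ` Sigma (symbols \<Sigma>) (edges A) \<union>
      map_prod id (\<lambda>v. Suc (2 * v)) ` Sigma (symbols \<Sigma>) (edges B)"
    by (force simp: hsum_def)
  then show "finite (Sigma (symbols \<Sigma>) (edges (hsum A B)))"
    using fin_hypD(2) [OF assms(1)] fin_hypD(2) [OF assms(2)] by (meson finite_UnI finite_imageI finite_subset)
qed (use fin_hypD [OF assms(1)] fin_hypD [OF assms(2)] in \<open>fastforce simp: hsum_def tuples_def\<close>)+

lemma disc_fin [simp]: "finite_hypergraph \<Sigma> (disc n)"
  by (rule finite_hypergraphI) (auto simp: disc_def)

locale hypergraphs = fixes \<Sigma> :: "'s msig"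
begin

abbreviation cmp :: "'s hyper_mor \<Rightarrow> 's hyper_mor \<Rightarrow> 's hyper_mor" (infixl "\<Zsemi>" 66) where
  "f \<Zsemi> g \<equiv> seq (Hyp \<Sigma>) f g"

abbreviation idh :: "'s hypergraph \<Rightarrow> 's hyper_mor" where
  "idh \<equiv> ident (Hyp \<Sigma>)"

abbreviation fin :: "'s hypergraph \<Rightarrow> bool" where
  "fin \<equiv> finite_hypergraph \<Sigma>"

lemma seq_simps:
  assumes "f \<in> hyper_hom G H"
  shows "x \<in> verts G \<Longrightarrow> vmap (f \<Zsemi> g) x = vmap g (vmap f x)"
    "e \<in> edges G R \<Longrightarrow> emap (f \<Zsemi> g) R e = emap g R (emap f R e)"
  using hyper_homD(1) [OF assms] by (simp_all add: Hyp_def)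

lemma ident_simps [simp]: "x \<in> verts G \<Longrightarrow> vmap (idh G) x = x" "e \<in> edges G R \<Longrightarrow> emap (idh G) R e = e"
  by (simp_all add: Hyp_def)

lemma seq_hyper_hom:
  assumes "fin G" "f \<in> hyper_hom G H" "g \<in> hyper_hom H K"
  shows "f \<Zsemi> g \<in> hyper_hom G K"
proof -
  note f = hyper_homD [OF assms(2)] and g = hyper_homD [OF assms(3)]
  have m: "map (vmap g) (map (vmap f) xs) = map (vmap (f \<Zsemi> g)) xs" if "set xs \<subseteq> verts G" for xs
    using that seq_simps(1) [OF assms(2)] by auto
  have "\<forall>R. \<forall>e\<in>edges G R. src K R (emap (f \<Zsemi> g) R e) = map (vmap (f \<Zsemi> g)) (src G R e) \<and>
     tgt K R (emap (f \<Zsemi> g) R e) = map (vmap (f \<Zsemi> g)) (tgt G R e)"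
    using f g m [OF src_verts [OF assms(1)]] m [OF tgt_verts [OF assms(1)]] by (simp add: seq_simps [OF assms(2)] del: map_map)
  moreover have "source (f \<Zsemi> g) = G" "target (f \<Zsemi> g) = K" "vmap (f \<Zsemi> g) \<in> verts G \<rightarrow>\<^sub>E verts K"
    "\<forall>R. emap (f \<Zsemi> g) R \<in> edges G R \<rightarrow>\<^sub>E edges K R"
    using f g by (auto simp: Hyp_def)
  ultimately show ?thesis by (simp add: hyper_hom_def)
qed

lemma ident_hyper_hom: "fin G \<Longrightarrow> idh G \<in> hyper_hom G G"
  using src_verts tgt_verts by (fastforce simp: Hyp_def hyper_hom_def map_idI subset_iff intro!: map_idI [symmetric])

sublocale Hyp: category "Hyp \<Sigma>"
proof (unfold_locales, simp_all add: ident_hyper_hom seq_hyper_hom, goal_cases)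
  case (1 X Y X' Y' f)
  then show ?case by (metis hyper_homD(1,2))
next
  case (2 X Y f)
  then show ?case
    by (intro hyper_hom_eqI [OF seq_hyper_hom [of X _ X _ Y]])
      (auto simp: ident_hyper_hom seq_simps [OF ident_hyper_hom])
next
  case (3 X Y f)
  then show ?case
    by (intro hyper_hom_eqI [OF seq_hyper_hom [of X _ Y _ Y]])
      (auto simp: ident_hyper_hom seq_simps hyper_homD)
next
  case (4 W X Y Z f g h)
  note fg = seq_hyper_hom [OF 4(1,5,6)] and gh = seq_hyper_hom [OF 4(2,6,7)]
  show ?case
    by (rule hyper_hom_eqI [OF seq_hyper_hom [OF 4(1) fg 4(7)] seq_hyper_hom [OF 4(1,5) gh]])
      (simp_all add: seq_simps [OF fg] seq_simps [OF 4(5)] seq_simps [OF 4(6)] hyper_homD [OF 4(5)])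
qed

lemma leg_seq: "l \<in> hyper_hom (disc n) A \<Longrightarrow> leg n (l \<Zsemi> u) = map (vmap u) (leg n l)"
  by (simp add: leg_def seq_simps)

lemma seq_eq_iff:
  assumes "l \<in> hyper_hom (disc n) A" "u \<in> hyper_hom A H" "l' \<in> hyper_hom (disc n) B" "v \<in> hyper_hom B H"
  shows "l \<Zsemi> u = l' \<Zsemi> v \<longleftrightarrow> map (vmap u) (leg n l) = map (vmap v) (leg n l')"
  using leg_inj [OF seq_hyper_hom [OF disc_fin assms(1,2)] seq_hyper_hom [OF disc_fin assms(3,4)]]
    leg_seq [OF assms(1)] leg_seq [OF assms(3)] by metis

lemma seq_eq_point_iff:
  assumes "l \<in> hyper_hom (disc n) A" "u \<in> hyper_hom A H" "a \<in> hyper_hom (disc n) H"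
  shows "l \<Zsemi> u = a \<longleftrightarrow> map (vmap u) (leg n l) = leg n a"
  using leg_inj [OF seq_hyper_hom [OF disc_fin assms(1,2)] assms(3)] leg_seq [OF assms(1)] by metis

lemma hquot_universal:
  assumes G: "fin G" and es: "set es \<subseteq> verts G \<times> verts G" and u: "u \<in> hyper_hom G H"
    and resp: "\<And>x y. (x, y) \<in> set es \<Longrightarrow> vmap u x = vmap u y"
  shows "\<exists>!h. h \<in> hyper_hom (hquot es G) H \<and> hquot_map es G \<Zsemi> h = u"
proof
  let ?h = "\<lparr>source = hquot es G, target = H, vmap = (\<lambda>x\<in>rep es ` verts G. vmap u x), emap = emap u\<rparr>"
  note q = hquot_map_hom [OF G, of es]
  have r: "vmap u (rep es x) = vmap u x" for x by (rule rep_respects) (fact resp)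
  have ur: "map (vmap ?h) (map (rep es) xs) = map (vmap u) xs" if "set xs \<subseteq> verts G" for xs
    using that r by auto
  have h: "?h \<in> hyper_hom (hquot es G) H"
  proof -
    have "\<forall>R. \<forall>e\<in>edges G R. src H R (emap u R e) = map (vmap ?h) (src (hquot es G) R e) \<and>
        tgt H R (emap u R e) = map (vmap ?h) (tgt (hquot es G) R e)"
      using hyper_homD(5,6) [OF u] ur [OF src_verts [OF G]] ur [OF tgt_verts [OF G]]
      by (simp add: hquot_def del: map_map)
    then show ?thesis using u r by (auto simp: hyper_hom_def hquot_def)
  qed
  have "hquot_map es G \<Zsemi> ?h = u"
    by (rule hyper_hom_eqI [OF seq_hyper_hom [OF G q h] u])
      (auto simp: seq_simps [OF q] r)
  then show "?h \<in> hyper_hom (hquot es G) H \<and> hquot_map es G \<Zsemi> ?h = u" using h by blast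
  fix k assume k: "k \<in> hyper_hom (hquot es G) H \<and> hquot_map es G \<Zsemi> k = u"
  show "k = ?h"
  proof (rule hyper_hom_eqI [OF conjunct1 [OF k] h])
    fix x assume "x \<in> verts (hquot es G)"
    then obtain y where y: "y \<in> verts G" "x = rep es y" by (auto simp: hquot_def)
    then have "vmap k x = vmap u y" using seq_simps(1) [OF q y(1), of k] k by (simp add: hquot_map_def)
    then show "vmap k x = vmap ?h x" using y r by auto
  next
    fix R e assume "e \<in> edges (hquot es G) R"
    then show "emap k R e = emap ?h R e"
      using seq_simps(2) [OF q, of e R k] k by (simp add: hquot_map_def hquot_def)
  qed
qed

lemma hsum_universal:
  assumes A: "fin A" and B: "fin B" and u: "u \<in> hyper_hom A H" and v: "v \<in> hyper_hom B H"
  shows "\<exists>!h. h \<in> hyper_hom (hsum A B) H \<and> hinl A B \<Zsemi> h = u \<and> hinr A B \<Zsemi> h = v"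
proof
  let ?h = "\<lparr>source = hsum A B, target = H,
     vmap = (\<lambda>x\<in>verts (hsum A B). if even x then vmap u (x div 2) else vmap v (x div 2)),
     emap = (\<lambda>R. \<lambda>e\<in>edges (hsum A B) R. if even e then emap u R (e div 2) else emap v R (e div 2))\<rparr>"
  note l = hinl_hom [OF A, of B] and r = hinr_hom [OF B, of A]
  have m1: "map (vmap ?h) (map (\<lambda>v. 2 * v) xs) = map (vmap u) xs" if "set xs \<subseteq> verts A" for xs
    using that by (auto simp: hsum_def)
  have m2: "map (vmap ?h) (map (\<lambda>v. Suc (2 * v)) xs) = map (vmap v) xs" if "set xs \<subseteq> verts B" for xs
    using that by (auto simp: hsum_def)
  have h: "?h \<in> hyper_hom (hsum A B) H"
  proof -
    have "src H R (emap ?h R e) = map (vmap ?h) (src (hsum A B) R e) \<and>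
        tgt H R (emap ?h R e) = map (vmap ?h) (tgt (hsum A B) R e)" if e: "e \<in> edges (hsum A B) R" for R e
    proof (cases "even e")
      case True
      then obtain e' where e': "e = 2 * e'" "e' \<in> edges A R" using e by (auto simp: hsum_def)
      then have "src (hsum A B) R e = map (\<lambda>v. 2 * v) (src A R e')" "tgt (hsum A B) R e = map (\<lambda>v. 2 * v) (tgt A R e')"
        by (auto simp: hsum_def)
      then show ?thesis
        using e e' hyper_homD(5,6) [OF u e'(2)] m1 [OF src_verts [OF A e'(2)]] m1 [OF tgt_verts [OF A e'(2)]]
        by (simp del: map_map)
    next
      case False
      then obtain e' where e': "e = Suc (2 * e')" "e' \<in> edges B R" using e by (auto simp: hsum_def)
      then have "src (hsum A B) R e = map (\<lambda>v. Suc (2 * v)) (src B R e')" "tgt (hsum A B) R e = map (\<lambda>v. Suc (2 * v)) (tgt B R e')"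
        by (auto simp: hsum_def)
      then show ?thesis
        using e e' hyper_homD(5,6) [OF v e'(2)] m2 [OF src_verts [OF B e'(2)]] m2 [OF tgt_verts [OF B e'(2)]]
        by (simp del: map_map)
    qed
    moreover have "vmap ?h \<in> verts (hsum A B) \<rightarrow>\<^sub>E verts H" "\<forall>R. emap ?h R \<in> edges (hsum A B) R \<rightarrow>\<^sub>E edges H R"
      using hyper_homD(3,4) [OF u] hyper_homD(3,4) [OF v] by (auto simp: hsum_def)
    ultimately show ?thesis unfolding hyper_hom_def by simp
  qed
  have "hinl A B \<Zsemi> ?h = u"
    by (rule hyper_hom_eqI [OF seq_hyper_hom [OF A l h] u]) (auto simp: seq_simps [OF l] hsum_def)
  moreover have "hinr A B \<Zsemi> ?h = v"
    by (rule hyper_hom_eqI [OF seq_hyper_hom [OF B r h] v]) (auto simp: seq_simps [OF r] hsum_def)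
  ultimately show "?h \<in> hyper_hom (hsum A B) H \<and> hinl A B \<Zsemi> ?h = u \<and> hinr A B \<Zsemi> ?h = v" using h by blast
  fix k assume k: "k \<in> hyper_hom (hsum A B) H \<and> hinl A B \<Zsemi> k = u \<and> hinr A B \<Zsemi> k = v"
  have vk: "vmap k (2 * x) = vmap u x" if "x \<in> verts A" for x
    using seq_simps(1) [OF l that, of k] k that by (simp add: hinl_def)
  have vk': "vmap k (Suc (2 * x)) = vmap v x" if "x \<in> verts B" for x
    using seq_simps(1) [OF r that, of k] k that by (simp add: hinr_def)
  have ek: "emap k R (2 * x) = emap u R x" if "x \<in> edges A R" for x R
    using seq_simps(2) [OF l that, of k] k that by (simp add: hinl_def)
  have ek': "emap k R (Suc (2 * x)) = emap v R x" if "x \<in> edges B R" for x R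
    using seq_simps(2) [OF r that, of k] k that by (simp add: hinr_def)
  show "k = ?h"
    by (rule hyper_hom_eqI [OF conjunct1 [OF k] h]) (auto simp: hsum_def vk vk' ek ek')
qed

lemma pushout_exists:
  assumes A: "fin A" and B: "fin B" and f: "f \<in> hyper_hom (disc m) A" and g: "g \<in> hyper_hom (disc m) B"
  shows "\<exists>D i j. is_pushout (Hyp \<Sigma>) (disc m) A B D f g i j"
proof -
  let ?es = "zip (map (\<lambda>v. 2 * v) (leg m f)) (map (\<lambda>v. Suc (2 * v)) (leg m g))" and ?S = "hsum A B"
  let ?q = "hquot_map ?es ?S" and ?D = "hquot ?es ?S"
  let ?i = "hinl A B \<Zsemi> ?q" and ?j = "hinr A B \<Zsemi> ?q"
  note S = hsum_fin [OF A B] and l = hinl_hom [OF A, of B] and r = hinr_hom [OF B, of A]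
  note q = hquot_map_hom [OF S, of ?es] and D = hquot_fin [OF S, of ?es]
  note i = seq_hyper_hom [OF A l q] and j = seq_hyper_hom [OF B r q]
  have lf: "set (leg m f) \<subseteq> verts A" and lg: "set (leg m g) \<subseteq> verts B"
    using leg_tuples [OF f] leg_tuples [OF g] by (auto simp: tuples_def)
  have es: "set ?es \<subseteq> verts ?S \<times> verts ?S"
  proof -
    have "set ?es \<subseteq> (\<lambda>v. 2 * v) ` verts A \<times> (\<lambda>v. Suc (2 * v)) ` verts B"
    proof
      fix p assume "p \<in> set ?es"
      then obtain k where k: "k < m" "p = (2 * leg m f ! k, Suc (2 * leg m g ! k))" by (auto simp: set_zip)
      then have "leg m f ! k \<in> verts A" "leg m g ! k \<in> verts B" using lf lg by (simp_all add: subset_iff)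
      then show "p \<in> (\<lambda>v. 2 * v) ` verts A \<times> (\<lambda>v. Suc (2 * v)) ` verts B" using k by blast
    qed
    then show ?thesis by (auto simp: hsum_def)
  qed
  have fg: "f \<Zsemi> ?i = g \<Zsemi> ?j"
  proof -
    have "vmap f x \<in> verts A" "vmap g x \<in> verts B" if "x < m" for x
      using that hyper_homD(3) [OF f, of x] hyper_homD(3) [OF g, of x] by auto
    then have "vmap ?i (vmap f x) = rep ?es (2 * vmap f x)" "vmap ?j (vmap g x) = rep ?es (Suc (2 * vmap g x))" if "x < m" for x
      using that by (simp_all add: seq_simps [OF l] seq_simps [OF r] hsum_def)
    moreover have "(2 * vmap f x, Suc (2 * vmap g x)) \<in> eqv ?es" if "x < m" for x
      using that by (intro eqv_mem) (auto simp: set_zip leg_def intro!: exI [of _ x])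
    ultimately show ?thesis
      unfolding seq_eq_iff [OF f i g j] by (auto simp: leg_def rep_eq_iff)
  qed
  have "\<exists>!h. h \<in> hyper_hom ?D E \<and> ?i \<Zsemi> h = u \<and> ?j \<Zsemi> h = v"
    if E: "fin E" and u: "u \<in> hyper_hom A E" and v: "v \<in> hyper_hom B E" and uv: "f \<Zsemi> u = g \<Zsemi> v" for E u v
  proof -
    obtain c where c: "c \<in> hyper_hom ?S E" "hinl A B \<Zsemi> c = u" "hinr A B \<Zsemi> c = v"
      and uniq: "\<And>c'. \<lbrakk>c' \<in> hyper_hom ?S E; hinl A B \<Zsemi> c' = u; hinr A B \<Zsemi> c' = v\<rbrakk> \<Longrightarrow> c' = c"
      using hsum_universal [OF A B u v] by blast
    have "vmap c x = vmap c y" if xy: "(x, y) \<in> set ?es" for x y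
    proof -
      obtain k where k: "k < m" "x = 2 * vmap f k" "y = Suc (2 * vmap g k)"
        using xy by (auto simp: set_zip leg_def)
      have "vmap c x = vmap u (vmap f k)"
        using seq_simps(1) [OF l, of "vmap f k" c] c(2) k hyper_homD(3) [OF f, of k] by (simp add: hinl_def)
      moreover have "vmap c y = vmap v (vmap g k)"
        using seq_simps(1) [OF r, of "vmap g k" c] c(3) k hyper_homD(3) [OF g, of k] by (simp add: hinr_def)
      moreover have "vmap u (vmap f k) = vmap v (vmap g k)"
        using uv k unfolding seq_eq_iff [OF f u g v] by (simp add: leg_def)
      ultimately show ?thesis by simp
    qed
    then obtain h where h: "h \<in> hyper_hom ?D E" "?q \<Zsemi> h = c" and uniq': "\<And>h'. \<lbrakk>h' \<in> hyper_hom ?D E; ?q \<Zsemi> h' = c\<rbrakk> \<Longrightarrow> h' = h"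
      using hquot_universal [OF S es c(1)] by blast
    have a: "?i \<Zsemi> h' = hinl A B \<Zsemi> (?q \<Zsemi> h')" "?j \<Zsemi> h' = hinr A B \<Zsemi> (?q \<Zsemi> h')" if "h' \<in> hyper_hom ?D E" for h'
      using Hyp.seq_assoc [of A ?S ?D E "hinl A B" ?q h'] Hyp.seq_assoc [of B ?S ?D E "hinr A B" ?q h'] A B S D E l r q that by simp_all
    show ?thesis
    proof (rule ex1I [of _ h])
      show "h \<in> hyper_hom ?D E \<and> ?i \<Zsemi> h = u \<and> ?j \<Zsemi> h = v" using h c a by simp
      show "h' = h" if "h' \<in> hyper_hom ?D E \<and> ?i \<Zsemi> h' = u \<and> ?j \<Zsemi> h' = v" for h'
        using that a [of h'] by (intro uniq' uniq) (auto intro: seq_hyper_hom [OF S q])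
    qed
  qed
  then have "is_pushout (Hyp \<Sigma>) (disc m) A B ?D f g ?i ?j"
    using A B D f g i j fg unfolding is_pushout_def by simp
  then show ?thesis by blast
qed

end


section \<open>Homomorphism counts determine cospans\<close>

type_synonym 's hcospan = "('s hypergraph, 's hyper_mor) cospan"

definition homs :: "nat \<Rightarrow> nat \<Rightarrow> 's hcospan \<Rightarrow> 's hypergraph \<Rightarrow> nat list \<Rightarrow> nat list \<Rightarrow> 's hyper_mor set" where
  "homs n m = (\<lambda>(l, A, r) H a b. {h \<in> hyper_hom A H. map (vmap h) (leg n l) = a \<and> map (vmap h) (leg m r) = b})"

definition img :: "'s hyper_mor \<Rightarrow> nat set \<times> ('s \<Rightarrow> nat set)" where
  "img h = (vmap h ` verts (source h), \<lambda>R. emap h R ` edges (source h) R)"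

definition subgraph :: "'s hypergraph \<Rightarrow> nat set \<times> ('s \<Rightarrow> nat set) \<Rightarrow> 's hypergraph" where
  "subgraph H p = \<lparr>verts = fst p, edges = snd p, src = (\<lambda>R. restrict (src H R) (snd p R)), tgt = (\<lambda>R. restrict (tgt H R) (snd p R))\<rparr>"

lemma subgraph_simps [simp]:
  "verts (subgraph H p) = fst p" "edges (subgraph H p) = snd p"
  "e \<in> snd p R \<Longrightarrow> src (subgraph H p) R e = src H R e" "e \<in> snd p R \<Longrightarrow> tgt (subgraph H p) R e = tgt H R e"
  by (simp_all add: subgraph_def)

lemma img_subset: "h \<in> hyper_hom A H \<Longrightarrow> fst (img h) \<subseteq> verts H" "h \<in> hyper_hom A H \<Longrightarrow> snd (img h) R \<subseteq> edges H R"
  using hyper_homD by (fastforce simp: img_def)+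

lemma img_fin:
  assumes "finite_hypergraph \<Sigma> A" "finite_hypergraph \<Sigma> H" "h \<in> hyper_hom A H"
  shows "finite_hypergraph \<Sigma> (subgraph H (img h))"
proof (rule finite_hypergraphI)
  note sub = img_subset [OF assms(3)]
  show "finite (verts (subgraph H (img h)))" using sub(1) finite_subset [OF _ fin_hypD(1) [OF assms(2)]] by simp
  have "Sigma (symbols \<Sigma>) (edges (subgraph H (img h))) \<subseteq> Sigma (symbols \<Sigma>) (edges H)"
    using sub by auto
  then show "finite (Sigma (symbols \<Sigma>) (edges (subgraph H (img h))))"
    using fin_hypD(2) [OF assms(2)] finite_subset by blast
  show "src (subgraph H (img h)) R e = undefined \<and> tgt (subgraph H (img h)) R e = undefined"
    if "e \<notin> edges (subgraph H (img h)) R" for R e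
    using that by (simp add: subgraph_def)
  fix R e assume "e \<in> edges (subgraph H (img h)) R"
  then obtain e' where e': "e' \<in> edges A R" "e = emap h R e'" "e \<in> snd (img h) R"
    using hyper_homD(1) [OF assms(3)] by (auto simp: img_def)
  have "set (map (vmap h) xs) \<subseteq> fst (img h)" if "set xs \<subseteq> verts A" for xs
    using that hyper_homD(1) [OF assms(3)] by (auto simp: img_def)
  then have "set (src H R e) \<subseteq> fst (img h)" "set (tgt H R e) \<subseteq> fst (img h)"
    using src_verts [OF assms(1) e'(1)] tgt_verts [OF assms(1) e'(1)] hyper_homD(5,6) [OF assms(3) e'(1)] e'(2) by metis+
  moreover have "e \<in> edges H R" using hyper_homD(4) [OF assms(3) e'(1)] e' by simp
  ultimately show "R \<in> symbols \<Sigma> \<and> src (subgraph H (img h)) R e \<in> tuples (verts (subgraph H (img h))) (ar \<Sigma> R)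
      \<and> tgt (subgraph H (img h)) R e \<in> tuples (verts (subgraph H (img h))) (coar \<Sigma> R)"
    using fin_hypD(3) [OF assms(2), of e R] e' by (auto simp: tuples_def)
qed

definition surjs :: "nat \<Rightarrow> nat \<Rightarrow> 's hcospan \<Rightarrow> 's hypergraph \<Rightarrow> nat list \<Rightarrow> nat list \<Rightarrow> 's hyper_mor set" where
  "surjs n m c H a b = {h \<in> homs n m c H a b. img h = (verts H, edges H)}"

lemma card_homs_img:
  assumes "fst p \<subseteq> verts H" "\<And>R. snd p R \<subseteq> edges H R"
  shows "card {h \<in> homs n m c H a b. img h = p} = card (surjs n m c (subgraph H p) a b)"
proof (rule bij_betw_same_card [of "\<lambda>h. h\<lparr>target := subgraph H p\<rparr>"])
  obtain l A r where c: "c = (l, A, r)" by (cases c)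
  let ?K = "subgraph H p"
  have "h \<in> hyper_hom A H \<and> img h = p \<longleftrightarrow> target h = H \<and> h\<lparr>target := ?K\<rparr> \<in> hyper_hom A ?K \<and> img (h\<lparr>target := ?K\<rparr>) = p" for h
    using assms by (auto simp: hyper_hom_def img_def PiE_iff subset_iff)
  then have iff: "h \<in> homs n m c H a b \<and> img h = p \<longleftrightarrow> target h = H \<and> h\<lparr>target := ?K\<rparr> \<in> surjs n m c ?K a b" for h
    unfolding surjs_def homs_def c by auto
  have ex: "\<exists>h. target h = H \<and> k = h\<lparr>target := ?K\<rparr>" if "k \<in> surjs n m c ?K a b" for k
    using that hyper_homD(2) [of k A ?K] unfolding surjs_def homs_def c
    by (intro exI [of _ "k\<lparr>target := H\<rparr>"]) (auto intro!: hyper_mor.equality)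
  have inj: "h = h'" if "target h = H" "target h' = H" "h\<lparr>target := ?K\<rparr> = h'\<lparr>target := ?K\<rparr>" for h h' :: "'a hyper_mor"
    using that by (cases h, cases h') auto
  show "bij_betw (\<lambda>h. h\<lparr>target := ?K\<rparr>) {h \<in> homs n m c H a b. img h = p} (surjs n m c ?K a b)"
  proof (intro bij_betw_imageI inj_onI equalityI subsetI)
    fix h h' assume "h \<in> {h \<in> homs n m c H a b. img h = p}" "h' \<in> {h \<in> homs n m c H a b. img h = p}"
      "h\<lparr>target := ?K\<rparr> = h'\<lparr>target := ?K\<rparr>"
    then show "h = h'" using iff inj by simp
  next
    fix k assume "k \<in> (\<lambda>h. h\<lparr>target := ?K\<rparr>) ` {h \<in> homs n m c H a b. img h = p}"
    then show "k \<in> surjs n m c ?K a b" using iff by auto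
  next
    fix k assume k: "k \<in> surjs n m c ?K a b"
    then obtain h where "target h = H" "k = h\<lparr>target := ?K\<rparr>" using ex by blast
    then show "k \<in> (\<lambda>h. h\<lparr>target := ?K\<rparr>) ` {h \<in> homs n m c H a b. img h = p}" using iff [of h] k by blast
  qed
qed

definition hsize :: "'s msig \<Rightarrow> 's hypergraph \<Rightarrow> nat" where
  "hsize \<Sigma> H = card (verts H) + card (Sigma (symbols \<Sigma>) (edges H))"

lemma hsize_subgraph:
  assumes H: "finite_hypergraph \<Sigma> H" and sub: "fst p \<subseteq> verts H" "\<And>R. snd p R \<subseteq> edges H R" and neq: "p \<noteq> (verts H, edges H)"
  shows "hsize \<Sigma> (subgraph H p) < hsize \<Sigma> H"
proof -
  let ?E = "Sigma (symbols \<Sigma>) (snd p)" and ?E' = "Sigma (symbols \<Sigma>) (edges H)"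
  note finH = fin_hypD [OF H]
  have E: "?E \<subseteq> ?E'" using sub by blast
  show ?thesis
  proof (cases "fst p = verts H")
    case True
    then obtain R where "snd p R \<noteq> edges H R" using neq by (metis ext prod.collapse)
    then obtain e where "e \<in> edges H R" "e \<notin> snd p R" using sub by blast
    then have "(R, e) \<in> ?E'" "(R, e) \<notin> ?E" using finH(3) by blast+
    then have "card ?E < card ?E'" using E finH(2) by (metis psubset_card_mono psubsetI)
    then show ?thesis using True by (simp add: hsize_def)
  next
    case False
    then have "card (fst p) < card (verts H)" using sub finH(1) by (metis psubset_card_mono psubsetI)
    then show ?thesis using card_mono [OF finH(2) E] by (simp add: hsize_def)
  qed
qed

context hypergraphs
begin

sublocale matrices "tupH \<Sigma>"
  by (rule matrices_tupH)

abbreviation csp :: "nat \<Rightarrow> nat \<Rightarrow> 's hcospan set" where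
  "csp n m \<equiv> cospans (Hyp \<Sigma>) (disc n) (disc m)"

lemma csp_iff: "(l, A, r) \<in> csp n m \<longleftrightarrow> fin A \<and> l \<in> hyper_hom (disc n) A \<and> r \<in> hyper_hom (disc m) A"
  by (simp add: cospans_def)

lemma finite_homs: "c \<in> csp n m \<Longrightarrow> fin H \<Longrightarrow> finite (homs n m c H a b)"
  by (rule finite_subset [OF _ finite_hyper_hom [of \<Sigma> "fst (snd c)" H]]) (auto simp: homs_def cospans_def)

text \<open>Lovasz's argument: a morphism factors uniquely through its image, so the numbers of
  surjections onto \<open>H\<close> are determined, by induction on the size of \<open>H\<close>, by the numbers of morphisms.\<close>

lemma card_surjs:
  assumes c: "c \<in> csp n m" and d: "d \<in> csp n m"
    and homs: "\<And>H a b. fin H \<Longrightarrow> card (homs n m c H a b) = card (homs n m d H a b)"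
    and H: "fin H"
  shows "card (surjs n m c H a b) = card (surjs n m d H a b)"
  using H
proof (induction "hsize \<Sigma> H" arbitrary: H rule: less_induct)
  case less
  let ?p = "(verts H, edges H)" and ?I = "img ` homs n m c H a b \<union> img ` homs n m d H a b"
  have fin_homs: "finite (homs n m c H a b)" "finite (homs n m d H a b)" using finite_homs c d less.prems by blast+
  then have I: "finite (insert ?p ?I)" by simp
  have I': "finite (?I - {?p})" using fin_homs by simp
  have sum: "card (homs n m x H a b) = card (surjs n m x H a b) + (\<Sum>p\<in>?I - {?p}. card {h \<in> homs n m x H a b. img h = p})"
    if x: "x = c \<or> x = d" for x
  proof -
    have "card (homs n m x H a b) = (\<Sum>p\<in>insert ?p ?I. card {h \<in> homs n m x H a b. img h = p})"
      unfolding card_eq_sum using fin_homs x I by (intro sum.group [symmetric]) auto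
    also have "\<dots> = card {h \<in> homs n m x H a b. img h = ?p} + (\<Sum>p\<in>insert ?p ?I - {?p}. card {h \<in> homs n m x H a b. img h = p})"
      by (rule sum.remove [OF I]) simp
    finally show ?thesis by (simp add: surjs_def)
  qed
  have "card {h \<in> homs n m c H a b. img h = p} = card {h \<in> homs n m d H a b. img h = p}" if p: "p \<in> ?I - {?p}" for p
  proof -
    obtain A h where h: "fin A" "h \<in> hyper_hom A H" "img h = p"
      using p c d by (auto simp: homs_def cospans_def)
    then have sub: "fst p \<subseteq> verts H" "\<And>R. snd p R \<subseteq> edges H R" using img_subset [OF h(2)] by auto
    have "card (surjs n m c (subgraph H p) a b) = card (surjs n m d (subgraph H p) a b)"
      using hsize_subgraph [OF less.prems sub] img_fin [OF h(1) less.prems h(2)] h(3) p by (intro less.hyps) auto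
    then show ?thesis by (simp add: card_homs_img [OF sub])
  qed
  then have "(\<Sum>p\<in>?I - {?p}. card {h \<in> homs n m c H a b. img h = p}) = (\<Sum>p\<in>?I - {?p}. card {h \<in> homs n m d H a b. img h = p})"
    by (rule sum.cong [OF refl])
  then show ?case using homs [OF less.prems, of a b] sum [OF disjI1 [OF refl]] sum [OF disjI2 [OF refl]] by linarith
qed

lemma bij_iso:
  assumes A: "fin A" and B: "fin B" and h: "h \<in> hyper_hom A B"
    and v: "bij_betw (vmap h) (verts A) (verts B)" and e: "\<And>R. bij_betw (emap h R) (edges A R) (edges B R)"
  shows "is_iso (Hyp \<Sigma>) A B h"
proof -
  let ?v = "inv_into (verts A) (vmap h)" and ?e = "\<lambda>R. inv_into (edges A R) (emap h R)"
  let ?g = "\<lparr>source = B, target = A, vmap = (\<lambda>x\<in>verts B. ?v x), emap = (\<lambda>R. \<lambda>x\<in>edges B R. ?e R x)\<rparr>"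
  note hD = hyper_homD [OF h]
  have v1: "?v (vmap h x) = x" if "x \<in> verts A" for x using that v by (meson bij_betw_inv_into_left)
  have v2: "vmap h (?v x) = x" "?v x \<in> verts A" if "x \<in> verts B" for x
    using that v by (meson bij_betw_inv_into_right bij_betw_inv_into bij_betwE)+
  have e1: "?e R (emap h R x) = x" if "x \<in> edges A R" for x R using that e by (meson bij_betw_inv_into_left)
  have e2: "emap h R (?e R x) = x" "?e R x \<in> edges A R" if "x \<in> edges B R" for x R
    using that e by (meson bij_betw_inv_into_right bij_betw_inv_into bij_betwE)+
  have vh: "map (vmap ?g) (map (vmap h) xs) = xs" if "set xs \<subseteq> verts A" for xs
    using that v1 hD(3) by (auto intro!: map_idI)
  have g: "?g \<in> hyper_hom B A"
  proof -
    have "src A R (emap ?g R x) = map (vmap ?g) (src B R x) \<and> tgt A R (emap ?g R x) = map (vmap ?g) (tgt B R x)"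
      if x: "x \<in> edges B R" for R x
    proof -
      have "src B R x = map (vmap h) (src A R (?e R x))" "tgt B R x = map (vmap h) (tgt A R (?e R x))"
        using hD(5,6) [OF e2(2) [OF x]] e2(1) [OF x] by simp_all
      then show ?thesis
        using vh [OF src_verts [OF A e2(2) [OF x]]] vh [OF tgt_verts [OF A e2(2) [OF x]]] x by (simp del: map_map)
    qed
    then show ?thesis unfolding hyper_hom_def using v2 e2 by auto
  qed
  have "h \<Zsemi> ?g = idh A"
    by (rule hyper_hom_eqI [OF seq_hyper_hom [OF A h g] ident_hyper_hom [OF A]]) (auto simp: seq_simps [OF h] v1 e1 hD)
  moreover have "?g \<Zsemi> h = idh B"
    by (rule hyper_hom_eqI [OF seq_hyper_hom [OF B g h] ident_hyper_hom [OF B]]) (auto simp: seq_simps [OF g] v2 e2)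
  ultimately show ?thesis using g h unfolding is_iso_def is_inverse_def by auto
qed

lemma cospan_morphism_iff:
  assumes "(l, A, r) \<in> csp n m" "(l', B, r') \<in> csp n m"
  shows "cospan_morphism (Hyp \<Sigma>) (l, A, r) (l', B, r') h \<longleftrightarrow> h \<in> homs n m (l, A, r) B (leg n l') (leg m r')"
  using assms seq_eq_point_iff [of l n A h B l'] seq_eq_point_iff [of r m A h B r']
  by (auto simp: cospan_morphism_def homs_def csp_iff)

lemma ident_homs: "(l, A, r) \<in> csp n m \<Longrightarrow> idh A \<in> homs n m (l, A, r) A (leg n l) (leg m r)"
  using leg_tuples [of l n A] leg_tuples [of r m A]
  by (auto simp: homs_def csp_iff ident_hyper_hom tuples_def subset_iff intro!: map_idI)

lemma seq_homs:
  assumes A: "(l, A, r) \<in> csp n m" and h: "h \<in> homs n m (l, A, r) B (leg n l') (leg m r')"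
    and k: "k \<in> homs n m (l', B, r') H a b"
  shows "h \<Zsemi> k \<in> homs n m (l, A, r) H a b"
proof -
  have h': "h \<in> hyper_hom A B" using h by (simp add: homs_def)
  have "map (vmap (h \<Zsemi> k)) xs = map (vmap k) (map (vmap h) xs)" if "set xs \<subseteq> verts A" for xs
    using that by (auto simp: seq_simps [OF h'])
  then have "map (vmap (h \<Zsemi> k)) (leg n l) = map (vmap k) (map (vmap h) (leg n l))"
    "map (vmap (h \<Zsemi> k)) (leg m r) = map (vmap k) (map (vmap h) (leg m r))"
    using A leg_tuples [of l n A] leg_tuples [of r m A] by (auto simp: csp_iff tuples_def)
  then show ?thesis using A h k seq_hyper_hom [OF _ h', of k H] by (simp add: homs_def csp_iff del: map_map)
qed

definition mat :: "nat \<Rightarrow> nat \<Rightarrow> 's hcospan \<Rightarrow> ('s hypergraph, nat) matrix" where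
  "mat n m c = (n, m, \<lambda>H a b. if fin H then card (homs n m c H a b) else 0)"

lemma val_mat: "val (mat n m c) H a b = (if fin H then card (homs n m c H a b) else 0)"
  by (simp add: mat_def val_def)

lemma homs_tup: "\<lbrakk>c \<in> csp n m; fin H; h \<in> homs n m c H a b\<rbrakk> \<Longrightarrow> a \<in> tupH \<Sigma> H n \<and> b \<in> tupH \<Sigma> H m"
  using hyper_hom_map leg_tuples by (fastforce simp: homs_def cospans_def tupH_def)

lemma mat_mats: "c \<in> csp n m \<Longrightarrow> mat n m c \<in> mats n m"
proof (rule matsI)
  fix H a b assume c: "c \<in> csp n m" and "val (mat n m c) H a b \<noteq> 0"
  then have "fin H" "homs n m c H a b \<noteq> {}" by (auto simp: val_mat split: if_splits)
  then show "a \<in> tupH \<Sigma> H n \<and> b \<in> tupH \<Sigma> H m" using homs_tup [OF c] by blast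
qed (simp_all add: mat_def)

lemma mat_inj:
  assumes c: "(l, A, r) \<in> csp n m" and d: "(l', B, r') \<in> csp n m" and eq: "mat n m (l, A, r) = mat n m (l', B, r')"
  shows "\<exists>h. cospan_morphism (Hyp \<Sigma>) (l, A, r) (l', B, r') h \<and> is_iso (Hyp \<Sigma>) A B h"
proof -
  have A: "fin A" and B: "fin B" using c d by (auto simp: csp_iff)
  have hc: "card (homs n m (l, A, r) H a b) = card (homs n m (l', B, r') H a b)" if "fin H" for H a b
    using arg_cong [OF eq, of "\<lambda>X. val X H a b"] that by (simp add: val_mat)
  have s: "card (surjs n m (l, A, r) H a b) = card (surjs n m (l', B, r') H a b)" if "fin H" for H a b
    using card_surjs [OF c d _ that] hc by blast
  have id: "idh G \<in> surjs n m (x, G, y) G (leg n x) (leg m y)" if "(x, G, y) \<in> csp n m" for x G y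
    using ident_homs [OF that] hyper_homD(1) [OF ident_hyper_hom [of G]] that
    by (auto simp: surjs_def img_def csp_iff)
  have fs: "finite (surjs n m x H a b)" if "x \<in> csp n m" "fin H" for x H a b
    using finite_homs [OF that] by (simp add: surjs_def)
  have "surjs n m (l, A, r) B (leg n l') (leg m r') \<noteq> {}"
    using s [OF B, of "leg n l'" "leg m r'"] id [OF d] fs [OF d B] by (metis card_gt_0_iff card.empty emptyE less_irrefl)
  then obtain h where h: "h \<in> surjs n m (l, A, r) B (leg n l') (leg m r')" by blast
  have "surjs n m (l', B, r') A (leg n l) (leg m r) \<noteq> {}"
    using s [OF A, of "leg n l" "leg m r"] id [OF c] fs [OF c A] by (metis card_gt_0_iff card.empty emptyE less_irrefl)
  then obtain k where k: "k \<in> surjs n m (l', B, r') A (leg n l) (leg m r)" by blast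
  have hh: "h \<in> hyper_hom A B" and kh: "k \<in> hyper_hom B A" using h k by (auto simp: surjs_def homs_def)
  have hv: "vmap h ` verts A = verts B" and he: "\<And>R. emap h R ` edges A R = edges B R"
    using h hyper_homD(1) [OF hh] by (simp_all add: surjs_def img_def fun_eq_iff)
  have kv: "vmap k ` verts B = verts A" and ke: "\<And>R. emap k R ` edges B R = edges A R"
    using k hyper_homD(1) [OF kh] by (simp_all add: surjs_def img_def fun_eq_iff)
  have "card (verts A) = card (verts B)"
    using card_image_le [OF fin_hypD(1) [OF A], of "vmap h"] card_image_le [OF fin_hypD(1) [OF B], of "vmap k"] hv kv by simp
  then have "inj_on (vmap h) (verts A)" using hv fin_hypD(1) [OF A] by (simp add: eq_card_imp_inj_on)
  then have v: "bij_betw (vmap h) (verts A) (verts B)" using hv by (simp add: bij_betw_def)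
  have fE: "finite (edges G R)" if "fin G" for G R
  proof (cases "R \<in> symbols \<Sigma>")
    case True
    have "finite (snd ` Sigma (symbols \<Sigma>) (edges G))" using fin_hypD(2) [OF that] by blast
    moreover have "edges G R \<subseteq> snd ` Sigma (symbols \<Sigma>) (edges G)" using True by force
    ultimately show ?thesis using finite_subset by blast
  next
    case False
    then have "edges G R = {}" using fin_hypD(3) [OF that] by blast
    then show ?thesis by simp
  qed
  have "bij_betw (emap h R) (edges A R) (edges B R)" for R
  proof -
    have "card (edges A R) = card (edges B R)"
      using card_image_le [OF fE [OF A], of "emap h R" R] card_image_le [OF fE [OF B], of "emap k R" R] he [of R] ke [of R] by simp
    then have "inj_on (emap h R) (edges A R)" using he fE [OF A] by (simp add: eq_card_imp_inj_on)
    then show ?thesis using he by (simp add: bij_betw_def)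
  qed
  then have "is_iso (Hyp \<Sigma>) A B h" using bij_iso [OF A B hh v] by blast
  moreover have "cospan_morphism (Hyp \<Sigma>) (l, A, r) (l', B, r') h"
    using cospan_morphism_iff [OF c d] h by (simp add: surjs_def)
  ultimately show ?thesis by blast
qed

lemma card_homs_le:
  assumes c: "(l, A, r) \<in> csp n m" and d: "(l', B, r') \<in> csp n m"
    and h: "h \<in> homs n m (l, A, r) B (leg n l') (leg m r')" and k: "k \<in> hyper_hom B A" "k \<Zsemi> h = idh B" and H: "fin H"
  shows "card (homs n m (l', B, r') H a b) \<le> card (homs n m (l, A, r) H a b)"
proof (rule card_inj_on_le [of "\<lambda>u. h \<Zsemi> u"])
  show "(\<lambda>u. h \<Zsemi> u) ` homs n m (l', B, r') H a b \<subseteq> homs n m (l, A, r) H a b"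
    using seq_homs [OF c h] by blast
  show "finite (homs n m (l, A, r) H a b)" by (rule finite_homs [OF c H])
  have "k \<Zsemi> (h \<Zsemi> u) = u" if "u \<in> hyper_hom B H" for u
    using that h k c d H Hyp.seq_assoc [of B A B H k h u] Hyp.ident_seq [of B H u] by (simp add: csp_iff homs_def)
  then show "inj_on (\<lambda>u. h \<Zsemi> u) (homs n m (l', B, r') H a b)"
    by (intro inj_on_inverseI [of _ "\<lambda>u. k \<Zsemi> u"]) (simp add: homs_def)
qed

lemma cospan_rel_iff:
  "(c, d) \<in> cospan_rel (Hyp \<Sigma>) (disc n) (disc m) \<longleftrightarrow> c \<in> csp n m \<and> d \<in> csp n m \<and> mat n m c = mat n m d"
proof (cases "c \<in> csp n m \<and> d \<in> csp n m")
  case True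
  obtain l A r l' B r' where cd: "c = (l, A, r)" "d = (l', B, r')" by (cases c, cases d)
  have c: "(l, A, r) \<in> csp n m" and d: "(l', B, r') \<in> csp n m" using True cd by auto
  have "mat n m c = mat n m d" if h: "cospan_morphism (Hyp \<Sigma>) c d h" "is_iso (Hyp \<Sigma>) A B h" for h
  proof -
    obtain k where k: "k \<in> hyper_hom B A" "h \<Zsemi> k = idh A" "k \<Zsemi> h = idh B" "h \<in> hyper_hom A B"
      using h(2) by (auto simp: is_iso_def is_inverse_def)
    have h': "h \<in> homs n m (l, A, r) B (leg n l') (leg m r')" using h(1) cospan_morphism_iff [OF c d] cd by simp
    have "map (vmap k) (map (vmap h) xs) = xs" if "set xs \<subseteq> verts A" for xs
    proof -
      have "vmap k (vmap h x) = x" if "x \<in> verts A" for x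
        using seq_simps(1) [OF k(4) that, of k] k(2) that by simp
      then show ?thesis using that by (auto intro!: map_idI)
    qed
    then have "map (vmap k) (map (vmap h) (leg n l)) = leg n l" "map (vmap k) (map (vmap h) (leg m r)) = leg m r"
      using c leg_tuples [of l n A] leg_tuples [of r m A] by (auto simp: csp_iff tuples_def simp del: map_map)
    then have "map (vmap k) (leg n l') = leg n l" "map (vmap k) (leg m r') = leg m r"
      using h' by (simp_all add: homs_def del: map_map)
    then have k': "k \<in> homs n m (l', B, r') A (leg n l) (leg m r)" using k(1) by (simp add: homs_def)
    have "card (homs n m c H a b) = card (homs n m d H a b)" if "fin H" for H a b
      unfolding cd using card_homs_le [OF c d h' k(1,3) that] card_homs_le [OF d c k' k(4,2) that] by (rule antisym [rotated])
    then show ?thesis by (auto simp: mat_def fun_eq_iff)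
  qed
  then show ?thesis using mat_inj [OF c d] True cd by (auto simp: cospan_rel_def)
qed (auto simp: cospan_rel_def)

end


section \<open>Composition of cospans\<close>

lemma disc_mor_hom: "(\<And>v. v < n \<Longrightarrow> f v < m) \<Longrightarrow> disc_mor n m f \<in> hyper_hom (disc n) (disc m)"
  by (auto simp: disc_mor_def hyper_hom_def)

lemma vmap_disc_mor [simp]: "v < n \<Longrightarrow> vmap (disc_mor n m f) v = f v"
  by (simp add: disc_mor_def)

lemma leg_disc_mor [simp]: "leg n (disc_mor n m f) = map f [0..<n]"
  by (simp add: leg_def)

context hypergraphs
begin

lemma pushout_transport:
  assumes p: "is_pushout (Hyp \<Sigma>) Y A B D f g i j" and iso: "is_iso (Hyp \<Sigma>) D D' k" and D': "fin D'"
  shows "is_pushout (Hyp \<Sigma>) Y A B D' f g (i \<Zsemi> k) (j \<Zsemi> k)"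
proof -
  have fin: "fin Y" "fin A" "fin B" "fin D" and hom: "f \<in> hyper_hom Y A" "g \<in> hyper_hom Y B" "i \<in> hyper_hom A D" "j \<in> hyper_hom B D"
    and fg: "f \<Zsemi> i = g \<Zsemi> j"
    and univ: "\<And>E u v. \<lbrakk>fin E; u \<in> hyper_hom A E; v \<in> hyper_hom B E; f \<Zsemi> u = g \<Zsemi> v\<rbrakk> \<Longrightarrow>
      \<exists>!h. h \<in> hyper_hom D E \<and> i \<Zsemi> h = u \<and> j \<Zsemi> h = v"
    using p by (auto simp: is_pushout_def)
  obtain k' where k: "k \<in> hyper_hom D D'" "k' \<in> hyper_hom D' D" "k \<Zsemi> k' = idh D" "k' \<Zsemi> k = idh D'"
    using iso by (auto simp: is_iso_def is_inverse_def)
  note ik = seq_hyper_hom [OF fin(2) hom(3) k(1)] and jk = seq_hyper_hom [OF fin(3) hom(4) k(1)]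
  have "f \<Zsemi> (i \<Zsemi> k) = g \<Zsemi> (j \<Zsemi> k)"
    using Hyp.seq_assoc [of Y A D D' f i k] Hyp.seq_assoc [of Y B D D' g j k] fin D' hom k fg by simp
  moreover have "\<exists>!h. h \<in> hyper_hom D' E \<and> (i \<Zsemi> k) \<Zsemi> h = u \<and> (j \<Zsemi> k) \<Zsemi> h = v"
    if E: "fin E" "u \<in> hyper_hom A E" "v \<in> hyper_hom B E" "f \<Zsemi> u = g \<Zsemi> v" for E u v
  proof -
    obtain h where h: "h \<in> hyper_hom D E" "i \<Zsemi> h = u" "j \<Zsemi> h = v"
      and uniq: "\<And>h'. \<lbrakk>h' \<in> hyper_hom D E; i \<Zsemi> h' = u; j \<Zsemi> h' = v\<rbrakk> \<Longrightarrow> h' = h"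
      using univ [OF E] by blast
    have a: "(i \<Zsemi> k) \<Zsemi> h' = i \<Zsemi> (k \<Zsemi> h')" "(j \<Zsemi> k) \<Zsemi> h' = j \<Zsemi> (k \<Zsemi> h')"
      "k' \<Zsemi> (k \<Zsemi> h') = h'" if "h' \<in> hyper_hom D' E" for h'
      using Hyp.seq_assoc [of A D D' E i k h'] Hyp.seq_assoc [of B D D' E j k h'] Hyp.seq_assoc [of D' D D' E k' k h']
        Hyp.ident_seq [of D' E h'] fin D' hom k E that by simp_all
    have b: "k \<Zsemi> (k' \<Zsemi> h) = h"
      using Hyp.seq_assoc [of D D' D E k k' h] Hyp.ident_seq [of D E h] fin D' k E h by simp
    note k'h = seq_hyper_hom [OF D' k(2) h(1)]
    show ?thesis
    proof (rule ex1I [of _ "k' \<Zsemi> h"])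
      show "k' \<Zsemi> h \<in> hyper_hom D' E \<and> (i \<Zsemi> k) \<Zsemi> (k' \<Zsemi> h) = u \<and> (j \<Zsemi> k) \<Zsemi> (k' \<Zsemi> h) = v"
        using k'h a [OF k'h] b h by simp
      fix h' assume h': "h' \<in> hyper_hom D' E \<and> (i \<Zsemi> k) \<Zsemi> h' = u \<and> (j \<Zsemi> k) \<Zsemi> h' = v"
      then have "k \<Zsemi> h' = h" using a [of h'] by (intro uniq) (auto intro: seq_hyper_hom [OF fin(4) k(1)])
      then show "h' = k' \<Zsemi> h" using a(3) [of h'] h' by simp
    qed
  qed
  ultimately show ?thesis using fin D' hom ik jk by (simp add: is_pushout_def)
qed

lemma coproduct_iff_pushout:
  assumes "fin A" "fin B"
  shows "is_coproduct (Hyp \<Sigma>) A B D i j \<longleftrightarrow> is_pushout (Hyp \<Sigma>) (disc 0) A B D (point 0 A []) (point 0 B []) i j"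
proof -
  have p: "point 0 X [] \<in> hyper_hom (disc 0) X" for X :: "'s hypergraph" by (rule point_hom) (simp add: tuples_def)
  have triv: "point 0 A [] \<Zsemi> u = point 0 B [] \<Zsemi> v" if "u \<in> hyper_hom A E" "v \<in> hyper_hom B E" for E u v
    using seq_eq_iff [OF p that(1) p that(2)] by (simp add: leg_def)
  show ?thesis
  proof
    assume "is_coproduct (Hyp \<Sigma>) A B D i j"
    then show "is_pushout (Hyp \<Sigma>) (disc 0) A B D (point 0 A []) (point 0 B []) i j"
      unfolding is_coproduct_def is_pushout_def using p triv triv [of i D j] by simp
  next
    assume "is_pushout (Hyp \<Sigma>) (disc 0) A B D (point 0 A []) (point 0 B []) i j"
    then show "is_coproduct (Hyp \<Sigma>) A B D i j"
      unfolding is_coproduct_def is_pushout_def using triv by simp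
  qed
qed

lemma map_leg_seq:
  assumes "l \<in> hyper_hom (disc n) A" "i \<in> hyper_hom A D" "h \<in> hyper_hom D H" "fin A" "fin D" "fin H"
  shows "map (vmap h) (leg n (l \<Zsemi> i)) = map (vmap (i \<Zsemi> h)) (leg n l)"
  using leg_seq [OF seq_hyper_hom [OF disc_fin assms(1,2)], of h] leg_seq [OF assms(1), of "i \<Zsemi> h"]
    Hyp.seq_assoc [of "disc n" A D H l i h] assms by simp

lemma pushout_bij:
  assumes p: "is_pushout (Hyp \<Sigma>) Y A B D f g i j" and H: "fin H"
  shows "bij_betw (\<lambda>h. (i \<Zsemi> h, j \<Zsemi> h)) (hyper_hom D H) {(u, v). u \<in> hyper_hom A H \<and> v \<in> hyper_hom B H \<and> f \<Zsemi> u = g \<Zsemi> v}"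
proof -
  have fin: "fin Y" "fin A" "fin B" "fin D" and hom: "f \<in> hyper_hom Y A" "g \<in> hyper_hom Y B" "i \<in> hyper_hom A D" "j \<in> hyper_hom B D"
    and fg: "f \<Zsemi> i = g \<Zsemi> j"
    and univ: "\<And>u v. \<lbrakk>u \<in> hyper_hom A H; v \<in> hyper_hom B H; f \<Zsemi> u = g \<Zsemi> v\<rbrakk> \<Longrightarrow>
      \<exists>!h. h \<in> hyper_hom D H \<and> i \<Zsemi> h = u \<and> j \<Zsemi> h = v"
    using p H by (auto simp: is_pushout_def)
  have mem: "i \<Zsemi> h \<in> hyper_hom A H" "j \<Zsemi> h \<in> hyper_hom B H" "f \<Zsemi> (i \<Zsemi> h) = g \<Zsemi> (j \<Zsemi> h)" if "h \<in> hyper_hom D H" for h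
    using that seq_hyper_hom [OF fin(2) hom(3)] seq_hyper_hom [OF fin(3) hom(4)] fin hom H fg
      Hyp.seq_assoc [of Y A D H f i h] Hyp.seq_assoc [of Y B D H g j h] by simp_all
  show ?thesis
  proof (rule bij_betw_imageI)
    show "inj_on (\<lambda>h. (i \<Zsemi> h, j \<Zsemi> h)) (hyper_hom D H)"
      using univ mem by (intro inj_onI) (metis prod.inject)
    show "(\<lambda>h. (i \<Zsemi> h, j \<Zsemi> h)) ` hyper_hom D H = {(u, v). u \<in> hyper_hom A H \<and> v \<in> hyper_hom B H \<and> f \<Zsemi> u = g \<Zsemi> v}"
      using mem univ by (auto simp: image_iff) metis
  qed
qed

lemma mat_composite:
  assumes c: "(l, A, r) \<in> csp n z" and d: "(l', B, r') \<in> csp z m" and p: "is_pushout (Hyp \<Sigma>) (disc z) A B D r l' i j"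
  shows "(l \<Zsemi> i, D, r' \<Zsemi> j) \<in> csp n m" "mat n m (l \<Zsemi> i, D, r' \<Zsemi> j) = matseq (mat n z (l, A, r)) (mat z m (l', B, r'))"
proof -
  have fin: "fin A" "fin B" "fin D" and i: "i \<in> hyper_hom A D" and j: "j \<in> hyper_hom B D"
    and hom: "l \<in> hyper_hom (disc n) A" "r \<in> hyper_hom (disc z) A" "l' \<in> hyper_hom (disc z) B" "r' \<in> hyper_hom (disc m) B"
    using p c d by (auto simp: is_pushout_def csp_iff)
  show e: "(l \<Zsemi> i, D, r' \<Zsemi> j) \<in> csp n m"
    using fin seq_hyper_hom [OF disc_fin hom(1) i] seq_hyper_hom [OF disc_fin hom(4) j] by (simp add: csp_iff)
  show "mat n m (l \<Zsemi> i, D, r' \<Zsemi> j) = matseq (mat n z (l, A, r)) (mat z m (l', B, r'))"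
  proof (rule mats_eqI [OF mat_mats [OF e] matseq_mats [OF mat_mats [OF c] mat_mats [OF d]]])
    fix H a b assume "a \<in> tupH \<Sigma> H n"
    then have H: "fin H" by (auto simp: tupH_def split: if_splits)
    let ?f = "\<lambda>h. (i \<Zsemi> h, j \<Zsemi> h)" and ?X = "\<Union>x\<in>tupH \<Sigma> H z. homs n z (l, A, r) H a x \<times> homs z m (l', B, r') H x b"
    note bij = pushout_bij [OF p H]
    have "?f ` homs n m (l \<Zsemi> i, D, r' \<Zsemi> j) H a b =
        {(u, v). u \<in> hyper_hom A H \<and> v \<in> hyper_hom B H \<and> r \<Zsemi> u = l' \<Zsemi> v \<and> map (vmap u) (leg n l) = a \<and> map (vmap v) (leg m r') = b}"
    proof -
      have "homs n m (l \<Zsemi> i, D, r' \<Zsemi> j) H a b = {h \<in> hyper_hom D H. map (vmap (fst (?f h))) (leg n l) = a \<and> map (vmap (snd (?f h))) (leg m r') = b}"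
        using map_leg_seq [OF hom(1) i _ fin(1,3) H] map_leg_seq [OF hom(4) j _ fin(2,3) H] by (auto simp: homs_def)
      then have "?f ` homs n m (l \<Zsemi> i, D, r' \<Zsemi> j) H a b =
          {q \<in> ?f ` hyper_hom D H. map (vmap (fst q)) (leg n l) = a \<and> map (vmap (snd q)) (leg m r') = b}"
        by auto
      then show ?thesis unfolding bij_betw_imp_surj_on [OF bij] by auto
    qed
    also have "\<dots> = ?X"
    proof -
      have "map (vmap u) (leg z r) \<in> tupH \<Sigma> H z" if "u \<in> hyper_hom A H" for u
        using hyper_hom_map [OF that leg_tuples [OF hom(2)]] H by (simp add: tupH_def)
      then show ?thesis
        using seq_eq_iff [OF hom(2) _ hom(3)] by (auto simp: homs_def) metis
    qed
    finally have im: "?f ` homs n m (l \<Zsemi> i, D, r' \<Zsemi> j) H a b = ?X" .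
    have inj: "inj_on ?f (homs n m (l \<Zsemi> i, D, r' \<Zsemi> j) H a b)"
      by (rule inj_on_subset [OF bij_betw_imp_inj_on [OF bij]]) (auto simp: homs_def)
    have "card (homs n m (l \<Zsemi> i, D, r' \<Zsemi> j) H a b) = card ?X"
      unfolding im [symmetric] by (rule card_image [OF inj, symmetric])
    also have "\<dots> = (\<Sum>x\<in>tupH \<Sigma> H z. card (homs n z (l, A, r) H a x \<times> homs z m (l', B, r') H x b))"
      using finite_homs [OF c H] finite_homs [OF d H]
      by (intro card_UN_disjoint) (auto simp: finite_tup homs_def)
    finally show "val (mat n m (l \<Zsemi> i, D, r' \<Zsemi> j)) H a b = val (matseq (mat n z (l, A, r)) (mat z m (l', B, r'))) H a b"
      using H by (simp add: val_seq [OF mat_mats [OF c]] val_mat card_cartesian_product)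
  qed
qed

lemma mat_coproduct:
  assumes c: "(l, A, r) \<in> csp n m" and d: "(l', B, r') \<in> csp n' m'" and p: "is_coproduct (Hyp \<Sigma>) A B D i j"
    and e: "(s, D, t) \<in> csp (n + n') (m + m')"
    and s: "leg (n + n') s = leg n (l \<Zsemi> i) @ leg n' (l' \<Zsemi> j)" and t: "leg (m + m') t = leg m (r \<Zsemi> i) @ leg m' (r' \<Zsemi> j)"
  shows "mat (n + n') (m + m') (s, D, t) = matpar (mat n m (l, A, r)) (mat n' m' (l', B, r'))"
proof -
  have fin: "fin A" "fin B" "fin D" and i: "i \<in> hyper_hom A D" and j: "j \<in> hyper_hom B D"
    and hom: "l \<in> hyper_hom (disc n) A" "r \<in> hyper_hom (disc m) A" "l' \<in> hyper_hom (disc n') B" "r' \<in> hyper_hom (disc m') B"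
    using p c d by (auto simp: is_coproduct_def csp_iff)
  show ?thesis
  proof (rule mats_eqI [OF mat_mats [OF e] matpar_mats [OF mat_mats [OF c] mat_mats [OF d]]])
    fix H a b assume "a \<in> tupH \<Sigma> H (n + n')"
    then have H: "fin H" by (auto simp: tupH_def split: if_splits)
    let ?f = "\<lambda>h. (i \<Zsemi> h, j \<Zsemi> h)"
      and ?X = "homs n m (l, A, r) H (take n a) (take m b) \<times> homs n' m' (l', B, r') H (drop n a) (drop m b)"
    note bij = pushout_bij [OF p [unfolded coproduct_iff_pushout [OF fin(1,2)]] H]
    have p0: "point 0 X [] \<in> hyper_hom (disc 0) X" for X :: "'s hypergraph" by (rule point_hom) (simp add: tuples_def)
    have triv: "point 0 A [] \<Zsemi> u = point 0 B [] \<Zsemi> v" if "u \<in> hyper_hom A H" "v \<in> hyper_hom B H" for u v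
      using seq_eq_iff [OF p0 that(1) p0 that(2)] by (simp add: leg_def)
    have split: "xs @ ys = a \<longleftrightarrow> xs = take k a \<and> ys = drop k a" if "length xs = k" for xs ys a :: "nat list" and k
      using that by (metis append_eq_conv_conj)
    have im: "?f ` homs (n + n') (m + m') (s, D, t) H a b = ?X"
    proof -
      have "map (vmap h) (leg (n + n') s) = map (vmap (i \<Zsemi> h)) (leg n l) @ map (vmap (j \<Zsemi> h)) (leg n' l')"
        "map (vmap h) (leg (m + m') t) = map (vmap (i \<Zsemi> h)) (leg m r) @ map (vmap (j \<Zsemi> h)) (leg m' r')" if "h \<in> hyper_hom D H" for h
        using map_leg_seq [OF hom(1) i that fin(1,3) H] map_leg_seq [OF hom(2) i that fin(1,3) H]
          map_leg_seq [OF hom(3) j that fin(2,3) H] map_leg_seq [OF hom(4) j that fin(2,3) H] by (simp_all add: s t)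
      then have "homs (n + n') (m + m') (s, D, t) H a b = {h \<in> hyper_hom D H.
          map (vmap (fst (?f h))) (leg n l) @ map (vmap (snd (?f h))) (leg n' l') = a \<and>
          map (vmap (fst (?f h))) (leg m r) @ map (vmap (snd (?f h))) (leg m' r') = b}"
        by (auto simp: homs_def)
      then have "?f ` homs (n + n') (m + m') (s, D, t) H a b = {q \<in> ?f ` hyper_hom D H.
          map (vmap (fst q)) (leg n l) @ map (vmap (snd q)) (leg n' l') = a \<and>
          map (vmap (fst q)) (leg m r) @ map (vmap (snd q)) (leg m' r') = b}"
        by auto
      then show ?thesis unfolding bij_betw_imp_surj_on [OF bij] using triv
        by (auto simp: homs_def split)
    qed
    have inj: "inj_on ?f (homs (n + n') (m + m') (s, D, t) H a b)"
      by (rule inj_on_subset [OF bij_betw_imp_inj_on [OF bij]]) (auto simp: homs_def)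
    have "card (homs (n + n') (m + m') (s, D, t) H a b) = card ?X"
      unfolding im [symmetric] by (rule card_image [OF inj, symmetric])
    then show "val (mat (n + n') (m + m') (s, D, t)) H a b = val (matpar (mat n m (l, A, r)) (mat n' m' (l', B, r'))) H a b"
      using H by (simp add: val_par [OF mat_mats [OF c]] val_mat card_cartesian_product)
  qed
qed

lemma copair_eq:
  assumes u: "u \<in> hyper_hom (disc x) E" and v: "v \<in> hyper_hom (disc y) E"
  shows "copair (Hyp \<Sigma>) ordinals x y E u v \<in> hyper_hom (disc (x + y)) E"
    "leg (x + y) (copair (Hyp \<Sigma>) ordinals x y E u v) = leg x u @ leg y v"
proof -
  have xs: "leg x u @ leg y v \<in> tuples (verts E) (x + y)"
    using leg_tuples [OF u] leg_tuples [OF v] by (auto simp: tuples_def)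
  have l: "disc_mor x (x + y) (\<lambda>v. v) \<in> hyper_hom (disc x) (disc (x + y))" by (rule disc_mor_hom) simp
  have r: "disc_mor y (x + y) (\<lambda>v. x + v) \<in> hyper_hom (disc y) (disc (x + y))" by (rule disc_mor_hom) simp
  have "h \<in> hyper_hom (disc (x + y)) E \<and> inl ordinals x y \<Zsemi> h = u \<and> inr ordinals x y \<Zsemi> h = v \<longleftrightarrow> h = point (x + y) E (leg x u @ leg y v)" for h
  proof -
    have "inl ordinals x y \<Zsemi> h = u \<and> inr ordinals x y \<Zsemi> h = v \<longleftrightarrow> leg (x + y) h = leg x u @ leg y v"
      if h: "h \<in> hyper_hom (disc (x + y)) E"
    proof -
      have "leg (x + y) h = map (vmap h) (leg x (disc_mor x (x + y) (\<lambda>v. v))) @ map (vmap h) (leg y (disc_mor y (x + y) (\<lambda>v. x + v)))"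
        by (rule nth_equalityI) (auto simp: leg_def nth_append)
      then show ?thesis
        using seq_eq_point_iff [OF l h u] seq_eq_point_iff [OF r h v] by (simp add: ordinals_def)
    qed
    then show ?thesis
      using point_hom [OF xs] leg_point [of "leg x u @ leg y v" "x + y" E] point_leg [of h "x + y" E] by auto
  qed
  then have "copair (Hyp \<Sigma>) ordinals x y E u v = point (x + y) E (leg x u @ leg y v)"
    by (simp add: copair_def ordinals_def)
  then show "copair (Hyp \<Sigma>) ordinals x y E u v \<in> hyper_hom (disc (x + y)) E"
    "leg (x + y) (copair (Hyp \<Sigma>) ordinals x y E u v) = leg x u @ leg y v"
    using point_hom [OF xs] leg_point [of "leg x u @ leg y v" "x + y" E] by simp_all
qed

lemma from_zero_hom: "from_zero (Hyp \<Sigma>) ordinals E \<in> hyper_hom (disc 0) E"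
proof -
  have p: "point 0 E [] \<in> hyper_hom (disc 0) E" by (rule point_hom) (simp add: tuples_def)
  have u: "h = point 0 E []" if "h \<in> hyper_hom (disc 0) E" for h
    by (rule leg_inj [OF that p]) (simp add: leg_def)
  have ob: "ob ordinals (zero ordinals) = (disc 0 :: 's hypergraph)" by (simp add: ordinals_def)
  have "from_zero (Hyp \<Sigma>) ordinals E = point 0 E []"
    unfolding from_zero_def ob Hyp_simps by (rule the_equality, rule p, rule u)
  then show ?thesis using p by simp
qed

text \<open>By \<open>mat_inj\<close>, the cospans with a given matrix form at most one isomorphism class.\<close>

definition arrow :: "nat \<Rightarrow> nat \<Rightarrow> ('s hypergraph, nat) matrix \<Rightarrow> 's hcospan set \<Rightarrow> bool" where
  "arrow n m X P \<longleftrightarrow> P = {e \<in> csp n m. mat n m e = X} \<and> P \<noteq> {}"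

lemma arrowE:
  assumes "arrow n m X P"
  obtains l A r where "(l, A, r) \<in> P" "(l, A, r) \<in> csp n m" "mat n m (l, A, r) = X"
proof -
  obtain e where e: "e \<in> P" using assms by (auto simp: arrow_def)
  then have "e \<in> csp n m \<and> mat n m e = X" using assms by (auto simp: arrow_def)
  then show thesis using that e by (cases e) auto
qed

lemma arrow_mem: "arrow n m X P \<Longrightarrow> c \<in> P \<Longrightarrow> c \<in> csp n m \<and> mat n m c = X"
  by (auto simp: arrow_def)

lemma arrow_class: "c \<in> csp n m \<Longrightarrow> arrow n m (mat n m c) (cospan_class (Hyp \<Sigma>) (disc n) (disc m) c)"
  by (auto simp: arrow_def cospan_class_def cospan_rel_iff)

lemma arrow_mats: "arrow n m X P \<Longrightarrow> X \<in> mats n m"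
  by (elim arrowE) (use mat_mats in blast)

lemma csp_unique:
  assumes "(l, A, r) \<in> csp n m"
  shows "card (verts (source l)) = n" "card (verts (source r)) = m"
  using assms hyper_homD(1) [of l "disc n" A] hyper_homD(1) [of r "disc m" A] by (simp_all add: csp_iff)

definition Phi :: "'s hcospan set \<Rightarrow> ('s hypergraph, nat) matrix" where
  "Phi P = (let c = SOME c. c \<in> P in mat (card (verts (source (fst c)))) (card (verts (source (snd (snd c))))) c)"

lemma Phi_arrow: "arrow n m X P \<Longrightarrow> Phi P = X"
proof -
  assume P: "arrow n m X P"
  then have "(SOME c. c \<in> P) \<in> P" by (metis arrowE someI)
  then have "(SOME c. c \<in> P) \<in> csp n m" "mat n m (SOME c. c \<in> P) = X" using arrow_mem [OF P] by blast+
  then show "Phi P = X" using csp_unique by (cases "SOME c. c \<in> P") (auto simp: Phi_def)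
qed

lemma arrow_seq:
  assumes P: "arrow n z X P" and Q: "arrow z m Y Q"
  shows "arrow n m (matseq X Y) (cospan_seq (Hyp \<Sigma>) P Q)"
proof -
  have le: "e \<in> csp n m \<and> mat n m e = matseq X Y" if e: "e \<in> cospan_seq (Hyp \<Sigma>) P Q" for e
  proof -
    obtain l A r l' B r' W D i j where e': "e = (l \<Zsemi> i, D, r' \<Zsemi> j)" and c: "(l, A, r) \<in> P" and d: "(l', B, r') \<in> Q"
      and p: "is_pushout (Hyp \<Sigma>) W A B D r l' i j"
      using e by (auto simp: cospan_seq_def)
    have c': "(l, A, r) \<in> csp n z" "mat n z (l, A, r) = X" and d': "(l', B, r') \<in> csp z m" "mat z m (l', B, r') = Y"
      using arrow_mem [OF P c] arrow_mem [OF Q d] by auto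
    have "r \<in> hyper_hom W A" using p by (simp add: is_pushout_def)
    then have "W = disc z" using c' hyper_homD(1) [of r W A] hyper_homD(1) [of r "disc z" A] by (simp add: csp_iff)
    then show ?thesis using mat_composite [OF c'(1) d'(1), of D i j] p c' d' e' by simp
  qed
  obtain l A r where c: "(l, A, r) \<in> P" "(l, A, r) \<in> csp n z" "mat n z (l, A, r) = X" by (rule arrowE [OF P]) blast
  obtain l' B r' where d: "(l', B, r') \<in> Q" "(l', B, r') \<in> csp z m" "mat z m (l', B, r') = Y" by (rule arrowE [OF Q]) blast
  obtain D i j where p: "is_pushout (Hyp \<Sigma>) (disc z) A B D r l' i j"
    using pushout_exists c(2) d(2) unfolding csp_iff by blast
  have fin: "fin A" "fin B" "fin D" and i: "i \<in> hyper_hom A D" and j: "j \<in> hyper_hom B D"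
    and hom: "l \<in> hyper_hom (disc n) A" "r' \<in> hyper_hom (disc m) B"
    using p c d by (auto simp: is_pushout_def csp_iff)
  have e0: "(l \<Zsemi> i, D, r' \<Zsemi> j) \<in> cospan_seq (Hyp \<Sigma>) P Q"
    using c d p unfolding cospan_seq_def by blast
  have ge: "(s, E, t) \<in> cospan_seq (Hyp \<Sigma>) P Q" if e: "(s, E, t) \<in> csp n m" "mat n m (s, E, t) = matseq X Y" for s E t
  proof -
    obtain k where k: "cospan_morphism (Hyp \<Sigma>) (l \<Zsemi> i, D, r' \<Zsemi> j) (s, E, t) k" "is_iso (Hyp \<Sigma>) D E k"
      using mat_inj [OF conjunct1 [OF le [OF e0]] e(1)] le [OF e0] e(2) by auto
    have E: "fin E" using e by (simp add: csp_iff)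
    have "k \<in> hyper_hom D E" "s = l \<Zsemi> (i \<Zsemi> k)" "t = r' \<Zsemi> (j \<Zsemi> k)"
      using k(1) fin E i j hom Hyp.seq_assoc [of "disc n" A D E l i k] Hyp.seq_assoc [of "disc m" B D E r' j k]
      by (auto simp: cospan_morphism_def)
    then show ?thesis using c d pushout_transport [OF p k(2) E] unfolding cospan_seq_def by blast
  qed
  have "cospan_seq (Hyp \<Sigma>) P Q = {e \<in> csp n m. mat n m e = matseq X Y}"
    using le ge by auto
  then show ?thesis using e0 unfolding arrow_def by blast
qed

lemma arrow_oplus:
  assumes P: "arrow n m X P" and Q: "arrow n' m' Y Q"
  shows "arrow (n + n') (m + m') (matpar X Y) (cospan_oplus (Hyp \<Sigma>) ordinals P Q)"
proof -
  let ?c = "copair (Hyp \<Sigma>) ordinals"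
  have ob: "ob ordinals = disc" by (simp add: ordinals_def)
  have comp: "(?c n n' D (l \<Zsemi> i) (l' \<Zsemi> j), D, ?c m m' D (r \<Zsemi> i) (r' \<Zsemi> j)) \<in> csp (n + n') (m + m') \<and>
      mat (n + n') (m + m') (?c n n' D (l \<Zsemi> i) (l' \<Zsemi> j), D, ?c m m' D (r \<Zsemi> i) (r' \<Zsemi> j)) = matpar X Y"
    if c: "(l, A, r) \<in> P" and d: "(l', B, r') \<in> Q" and p: "is_coproduct (Hyp \<Sigma>) A B D i j" for l A r l' B r' D i j
  proof -
    have c': "(l, A, r) \<in> csp n m" "mat n m (l, A, r) = X" and d': "(l', B, r') \<in> csp n' m'" "mat n' m' (l', B, r') = Y"
      using arrow_mem [OF P c] arrow_mem [OF Q d] by auto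
    have fin: "fin D" and i: "i \<in> hyper_hom A D" and j: "j \<in> hyper_hom B D"
      and hom: "l \<in> hyper_hom (disc n) A" "r \<in> hyper_hom (disc m) A" "l' \<in> hyper_hom (disc n') B" "r' \<in> hyper_hom (disc m') B"
      using p c' d' by (auto simp: is_coproduct_def csp_iff)
    note li = seq_hyper_hom [OF disc_fin hom(1) i] and ri = seq_hyper_hom [OF disc_fin hom(2) i]
      and lj = seq_hyper_hom [OF disc_fin hom(3) j] and rj = seq_hyper_hom [OF disc_fin hom(4) j]
    have "(?c n n' D (l \<Zsemi> i) (l' \<Zsemi> j), D, ?c m m' D (r \<Zsemi> i) (r' \<Zsemi> j)) \<in> csp (n + n') (m + m')"
      using fin copair_eq(1) [OF li lj] copair_eq(1) [OF ri rj] by (simp add: csp_iff)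
    then show ?thesis using mat_coproduct [OF c'(1) d'(1) p _ copair_eq(2) [OF li lj] copair_eq(2) [OF ri rj]] c' d' by simp
  qed
  have le: "e \<in> csp (n + n') (m + m') \<and> mat (n + n') (m + m') e = matpar X Y" if e: "e \<in> cospan_oplus (Hyp \<Sigma>) ordinals P Q" for e
  proof -
    obtain x y x' y' l A r l' B r' D i j where e': "e = (?c x x' D (l \<Zsemi> i) (l' \<Zsemi> j), D, ?c y y' D (r \<Zsemi> i) (r' \<Zsemi> j))"
      and c: "(l, A, r) \<in> P" "(l, A, r) \<in> csp x y" and d: "(l', B, r') \<in> Q" "(l', B, r') \<in> csp x' y'"
      and p: "is_coproduct (Hyp \<Sigma>) A B D i j"
      using e unfolding cospan_oplus_def ob by blast
    have "x = n" "y = m" "x' = n'" "y' = m'"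
      using csp_unique [OF c(2)] csp_unique [OF d(2)] csp_unique [of l A r n m] csp_unique [of l' B r' n' m']
        arrow_mem [OF P c(1)] arrow_mem [OF Q d(1)] by auto
    then show ?thesis using comp [OF c(1) d(1) p] e' by simp
  qed
  obtain l A r where c: "(l, A, r) \<in> P" "(l, A, r) \<in> csp n m" "mat n m (l, A, r) = X" by (rule arrowE [OF P]) blast
  obtain l' B r' where d: "(l', B, r') \<in> Q" "(l', B, r') \<in> csp n' m'" "mat n' m' (l', B, r') = Y" by (rule arrowE [OF Q]) blast
  have fin: "fin A" "fin B" and hom: "l \<in> hyper_hom (disc n) A" "r \<in> hyper_hom (disc m) A" "l' \<in> hyper_hom (disc n') B" "r' \<in> hyper_hom (disc m') B"
    using c d by (auto simp: csp_iff)
  have p0: "point 0 G [] \<in> hyper_hom (disc 0) G" for G :: "'s hypergraph" by (rule point_hom) (simp add: tuples_def)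
  obtain D i j where p': "is_pushout (Hyp \<Sigma>) (disc 0) A B D (point 0 A []) (point 0 B []) i j"
    using pushout_exists [OF fin p0 p0] by blast
  then have p: "is_coproduct (Hyp \<Sigma>) A B D i j" using coproduct_iff_pushout [OF fin] by simp
  have D: "fin D" and i: "i \<in> hyper_hom A D" and j: "j \<in> hyper_hom B D" using p by (auto simp: is_coproduct_def)
  note li = seq_hyper_hom [OF disc_fin hom(1) i] and ri = seq_hyper_hom [OF disc_fin hom(2) i]
    and lj = seq_hyper_hom [OF disc_fin hom(3) j] and rj = seq_hyper_hom [OF disc_fin hom(4) j]
  let ?e = "(?c n n' D (l \<Zsemi> i) (l' \<Zsemi> j), D, ?c m m' D (r \<Zsemi> i) (r' \<Zsemi> j))"
  have mem: "(?c n n' G (l \<Zsemi> x) (l' \<Zsemi> y), G, ?c m m' G (r \<Zsemi> x) (r' \<Zsemi> y)) \<in> cospan_oplus (Hyp \<Sigma>) ordinals P Q"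
    if "is_coproduct (Hyp \<Sigma>) A B G x y" for G x y
    using c d that unfolding cospan_oplus_def ob by blast
  have ge: "(s, E, t) \<in> cospan_oplus (Hyp \<Sigma>) ordinals P Q"
    if e: "(s, E, t) \<in> csp (n + n') (m + m')" "mat (n + n') (m + m') (s, E, t) = matpar X Y" for s E t
  proof -
    obtain k where k: "cospan_morphism (Hyp \<Sigma>) ?e (s, E, t) k" "is_iso (Hyp \<Sigma>) D E k"
      using mat_inj [OF conjunct1 [OF le [OF mem [OF p]]] e(1)] le [OF mem [OF p]] e(2) by auto
    have E: "fin E" and s: "s \<in> hyper_hom (disc (n + n')) E" and t: "t \<in> hyper_hom (disc (m + m')) E"
      using e by (simp_all add: csp_iff)
    have k': "k \<in> hyper_hom D E" using k(1) by (simp add: cospan_morphism_def)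
    have q: "is_coproduct (Hyp \<Sigma>) A B E (i \<Zsemi> k) (j \<Zsemi> k)"
      using pushout_transport [OF p' k(2) E] coproduct_iff_pushout [OF fin] by simp
    note ik = seq_hyper_hom [OF fin(1) i k'] and jk = seq_hyper_hom [OF fin(2) j k']
    note lik = seq_hyper_hom [OF disc_fin hom(1) ik] and rik = seq_hyper_hom [OF disc_fin hom(2) ik]
      and ljk = seq_hyper_hom [OF disc_fin hom(3) jk] and rjk = seq_hyper_hom [OF disc_fin hom(4) jk]
    have as: "l \<Zsemi> (i \<Zsemi> k) = (l \<Zsemi> i) \<Zsemi> k" "r \<Zsemi> (i \<Zsemi> k) = (r \<Zsemi> i) \<Zsemi> k"
      "l' \<Zsemi> (j \<Zsemi> k) = (l' \<Zsemi> j) \<Zsemi> k" "r' \<Zsemi> (j \<Zsemi> k) = (r' \<Zsemi> j) \<Zsemi> k"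
      using fin D E hom i j k' Hyp.seq_assoc [of "disc n" A D E l i k] Hyp.seq_assoc [of "disc m" A D E r i k]
        Hyp.seq_assoc [of "disc n'" B D E l' j k] Hyp.seq_assoc [of "disc m'" B D E r' j k] by simp_all
    have L: "leg n (l \<Zsemi> (i \<Zsemi> k)) = map (vmap k) (leg n (l \<Zsemi> i))" "leg m (r \<Zsemi> (i \<Zsemi> k)) = map (vmap k) (leg m (r \<Zsemi> i))"
      "leg n' (l' \<Zsemi> (j \<Zsemi> k)) = map (vmap k) (leg n' (l' \<Zsemi> j))" "leg m' (r' \<Zsemi> (j \<Zsemi> k)) = map (vmap k) (leg m' (r' \<Zsemi> j))"
      by (simp_all add: as leg_seq [OF li] leg_seq [OF ri] leg_seq [OF lj] leg_seq [OF rj])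
    have "s = ?c n n' E (l \<Zsemi> (i \<Zsemi> k)) (l' \<Zsemi> (j \<Zsemi> k))"
    proof (rule leg_inj [OF s copair_eq(1) [OF lik ljk]])
      have "s = ?c n n' D (l \<Zsemi> i) (l' \<Zsemi> j) \<Zsemi> k" using k(1) by (simp add: cospan_morphism_def)
      then show "leg (n + n') s = leg (n + n') (?c n n' E (l \<Zsemi> (i \<Zsemi> k)) (l' \<Zsemi> (j \<Zsemi> k)))"
        by (simp add: leg_seq [OF copair_eq(1) [OF li lj]] copair_eq(2) [OF li lj] copair_eq(2) [OF lik ljk] L del: map_map)
    qed
    moreover have "t = ?c m m' E (r \<Zsemi> (i \<Zsemi> k)) (r' \<Zsemi> (j \<Zsemi> k))"
    proof (rule leg_inj [OF t copair_eq(1) [OF rik rjk]])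
      have "t = ?c m m' D (r \<Zsemi> i) (r' \<Zsemi> j) \<Zsemi> k" using k(1) by (simp add: cospan_morphism_def)
      then show "leg (m + m') t = leg (m + m') (?c m m' E (r \<Zsemi> (i \<Zsemi> k)) (r' \<Zsemi> (j \<Zsemi> k)))"
        by (simp add: leg_seq [OF copair_eq(1) [OF ri rj]] copair_eq(2) [OF ri rj] copair_eq(2) [OF rik rjk] L del: map_map)
    qed
    ultimately show ?thesis using mem [OF q] by simp
  qed
  have "cospan_oplus (Hyp \<Sigma>) ordinals P Q = {e \<in> csp (n + n') (m + m'). mat (n + n') (m + m') e = matpar X Y}"
    using le ge by auto
  then show ?thesis using mem [OF p] unfolding arrow_def by blast
qed

end

lemma map_nth_length: "length b = x \<Longrightarrow> map ((!) b) [0..<x] = b"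
  using map_nth by blast

context hypergraphs
begin

lemma homs_disc:
  assumes f: "f \<in> hyper_hom (disc x) (disc y)" and H: "fin H"
  shows "{h \<in> hyper_hom (disc y) H. map (vmap h) (leg x f) = a \<and> leg y h = b} =
    (if b \<in> tupH \<Sigma> H y \<and> a = map ((!) b) (leg x f) then {point y H b} else {})"
proof -
  have iff: "h \<in> hyper_hom (disc y) H \<and> leg y h = b \<longleftrightarrow> b \<in> tupH \<Sigma> H y \<and> h = point y H b" for h
    using H point_hom [of b H y] leg_point [of b y H] leg_tuples [of h y H] point_leg [of h y H]
    by (auto simp: tupH_def tuples_def)
  have eq: "map (vmap (point y H b)) (leg x f) = map ((!) b) (leg x f)"
    using leg_tuples [OF f] by (auto simp: tuples_def point_def)
  have "h \<in> hyper_hom (disc y) H \<and> map (vmap h) (leg x f) = a \<and> leg y h = b \<longleftrightarrow>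
      (b \<in> tupH \<Sigma> H y \<and> a = map ((!) b) (leg x f)) \<and> h = point y H b" for h
    using iff [of h] eq by metis
  then show ?thesis by auto
qed

lemma mats_right:
  assumes f: "f \<in> hyper_hom (disc x) (disc y)"
  shows "arrow x y (rel x y (\<lambda>a b. a = map ((!) b) (leg x f))) (right_way (Hyp \<Sigma>) (disc x) (disc y) f)"
    and "arrow y x (rel y x (\<lambda>a b. b = map ((!) a) (leg x f))) (wrong_way (Hyp \<Sigma>) (disc x) (disc y) f)"
proof -
  have i: "idh (disc y) \<in> hyper_hom (disc y) (disc y)" by (simp add: ident_hyper_hom)
  have c: "(f, disc y, idh (disc y)) \<in> csp x y" and d: "(idh (disc y), disc y, f) \<in> csp y x" using f i by (simp_all add: csp_iff)
  have l: "leg y (idh (disc y)) = [0..<y]" by (auto simp: leg_def intro!: map_idI)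
  have f': "set (leg x f) \<subseteq> {..<y}" using leg_tuples [OF f] by (auto simp: tuples_def)
  have t: "map ((!) b) (leg x f) \<in> tupH \<Sigma> H x" if "b \<in> tupH \<Sigma> H y" for b H
    using that f' length_tup [OF that] by (intro set_tup [OF that that]) (auto intro!: nth_mem)
  have "mat x y (f, disc y, idh (disc y)) = rel x y (\<lambda>a b. a = map ((!) b) (leg x f))"
  proof (rule mats_eqI [OF mat_mats [OF c] rel_mats])
    fix H a b assume "a \<in> tupH \<Sigma> H x"
    then have H: "fin H" by (auto simp: tupH_def split: if_splits)
    have "homs x y (f, disc y, idh (disc y)) H a b = {h \<in> hyper_hom (disc y) H. map (vmap h) (leg x f) = a \<and> leg y h = b}"
      by (simp add: homs_def l) (simp add: leg_def)
    then show "val (mat x y (f, disc y, idh (disc y))) H a b = val (rel x y (\<lambda>a b. a = map ((!) b) (leg x f))) H a b"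
      using H t [of b H] by (simp add: val_mat val_rel homs_disc [OF f H])
  qed
  then show "arrow x y (rel x y (\<lambda>a b. a = map ((!) b) (leg x f))) (right_way (Hyp \<Sigma>) (disc x) (disc y) f)"
    using arrow_class [OF c] by (simp add: right_way_def)
  have "mat y x (idh (disc y), disc y, f) = rel y x (\<lambda>a b. b = map ((!) a) (leg x f))"
  proof (rule mats_eqI [OF mat_mats [OF d] rel_mats])
    fix H a b assume "a \<in> tupH \<Sigma> H y"
    then have H: "fin H" by (auto simp: tupH_def split: if_splits)
    have "homs y x (idh (disc y), disc y, f) H a b = {h \<in> hyper_hom (disc y) H. map (vmap h) (leg x f) = b \<and> leg y h = a}"
      by (simp add: homs_def l) (auto simp add: leg_def)
    then show "val (mat y x (idh (disc y), disc y, f)) H a b = val (rel y x (\<lambda>a b. b = map ((!) a) (leg x f))) H a b"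
      using H t [of a H] by (simp add: val_mat val_rel homs_disc [OF f H])
  qed
  then show "arrow y x (rel y x (\<lambda>a b. b = map ((!) a) (leg x f))) (wrong_way (Hyp \<Sigma>) (disc x) (disc y) f)"
    using arrow_class [OF d] by (simp add: wrong_way_def)
qed

lemma arrow_rel_cong:
  "\<lbrakk>arrow x y (rel x y r) P; \<And>a b. length a = x \<Longrightarrow> length b = y \<Longrightarrow> r a b \<longleftrightarrow> s a b\<rbrakk> \<Longrightarrow> arrow x y (rel x y s) P"
  using rel_cong by metis

lemma DC_simps [simp]:
  "Obj (DiscCospan \<Sigma>) = UNIV" "oplus_obj (DiscCospan \<Sigma>) = (+)" "unit_obj (DiscCospan \<Sigma>) = 0"
  "Hom (DiscCospan \<Sigma>) x y = csp x y // cospan_rel (Hyp \<Sigma>) (disc x) (disc y)"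
  "seq (DiscCospan \<Sigma>) = cospan_seq (Hyp \<Sigma>)" "oplus (DiscCospan \<Sigma>) = cospan_oplus (Hyp \<Sigma>) ordinals"
  "le (DiscCospan \<Sigma>) = cospan_le (Hyp \<Sigma>)"
  by (simp_all add: DiscCospan_def Cospan_def ordinals_def)

lemma Hom_arrow: "P \<in> Hom (DiscCospan \<Sigma>) x y \<longleftrightarrow> (\<exists>X. arrow x y X P)"
proof
  assume "P \<in> Hom (DiscCospan \<Sigma>) x y"
  then obtain c where "c \<in> csp x y" "P = cospan_class (Hyp \<Sigma>) (disc x) (disc y) c"
    by (auto simp: cospan_class_def elim: quotientE)
  then show "\<exists>X. arrow x y X P" using arrow_class by blast
next
  assume "\<exists>X. arrow x y X P"
  then obtain X where P: "arrow x y X P" by blast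
  then obtain c where c: "c \<in> P" by (auto simp: arrow_def)
  then have "c \<in> csp x y" "mat x y c = X" using arrow_mem [OF P] by blast+
  then have "P = cospan_rel (Hyp \<Sigma>) (disc x) (disc y) `` {c}" using P by (auto simp: arrow_def cospan_rel_iff)
  then show "P \<in> Hom (DiscCospan \<Sigma>) x y" using \<open>c \<in> csp x y\<close> by (auto intro: quotientI)
qed

lemma arrow_HomD: "arrow x y X P \<Longrightarrow> P \<in> Hom (DiscCospan \<Sigma>) x y \<and> Phi P = X"
  using Hom_arrow Phi_arrow by blast

lemma Hom_arrow_Phi: "P \<in> Hom (DiscCospan \<Sigma>) x y \<Longrightarrow> arrow x y (Phi P) P"
  using Hom_arrow Phi_arrow by metis

lemma cospan_le_iff:
  assumes P: "arrow n m X P" and Q: "arrow n m Y Q"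
  shows "cospan_le (Hyp \<Sigma>) P Q \<longleftrightarrow> matle X Y"
proof
  assume "cospan_le (Hyp \<Sigma>) P Q"
  then obtain l A r l' B r' h where c: "(l, A, r) \<in> P" and d: "(l', B, r') \<in> Q" and h: "cospan_morphism (Hyp \<Sigma>) (l', B, r') (l, A, r) h"
    unfolding cospan_le_def by (metis prod_cases3)
  have c': "(l, A, r) \<in> csp n m" "mat n m (l, A, r) = X" and d': "(l', B, r') \<in> csp n m" "mat n m (l', B, r') = Y"
    using arrow_mem [OF P c] arrow_mem [OF Q d] by auto
  show "matle X Y"
    unfolding matle_def
  proof (intro allI impI)
    fix H a b assume pos: "val X H a b > 0"
    then have H: "fin H" and "homs n m (l, A, r) H a b \<noteq> {}" using c'(2) by (auto simp: val_mat split: if_splits)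
    then obtain k where "k \<in> homs n m (l, A, r) H a b" by blast
    then have "h \<Zsemi> k \<in> homs n m (l', B, r') H a b"
      using seq_homs [OF d'(1)] h cospan_morphism_iff [OF d'(1) c'(1)] by blast
    then have "card (homs n m (l', B, r') H a b) > 0" using finite_homs [OF d'(1) H] by (auto simp: card_gt_0_iff)
    then show "val Y H a b > 0" using d'(2) H by (auto simp: val_mat)
  qed
next
  assume le: "matle X Y"
  obtain l A r where c: "(l, A, r) \<in> P" "(l, A, r) \<in> csp n m" "mat n m (l, A, r) = X" by (rule arrowE [OF P]) blast
  obtain l' B r' where d: "(l', B, r') \<in> Q" "(l', B, r') \<in> csp n m" "mat n m (l', B, r') = Y" by (rule arrowE [OF Q]) blast
  have A: "fin A" using c(2) by (simp add: csp_iff)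
  have "val X A (leg n l) (leg m r) > 0"
    using ident_homs [OF c(2)] finite_homs [OF c(2) A] A by (auto simp: c(3) [symmetric] val_mat card_gt_0_iff)
  then have "val Y A (leg n l) (leg m r) > 0" using le by (simp add: matle_def)
  then have "homs n m (l', B, r') A (leg n l) (leg m r) \<noteq> {}"
    by (auto simp: d(3) [symmetric] val_mat split: if_splits)
  then show "cospan_le (Hyp \<Sigma>) P Q"
    using c d cospan_morphism_iff [OF d(2) c(2)] unfolding cospan_le_def by blast
qed

lemma idh_disc: "idh (disc n) \<in> hyper_hom (disc n) (disc n)" "leg n (idh (disc n)) = [0..<n]"
  by (auto simp: ident_hyper_hom leg_def intro!: map_idI)

lemma inl_hom: "disc_mor x (x + y) (\<lambda>v. v) \<in> hyper_hom (disc x) (disc (x + y))"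
  and inr_hom: "disc_mor y (x + y) (\<lambda>v. x + v) \<in> hyper_hom (disc y) (disc (x + y))"
  by (auto intro: disc_mor_hom)

lemma arrow_ident: "arrow x x (Id x) (ident (DiscCospan \<Sigma>) x)"
proof -
  have "arrow x x (rel x x (\<lambda>a b. a = map ((!) b) [0..<x])) (ident (DiscCospan \<Sigma>) x)"
    using mats_right(1) [OF idh_disc(1), of x] by (simp add: DiscCospan_def Cospan_def ordinals_def idh_disc)
  then show ?thesis by (rule arrow_rel_cong) (auto simp: map_nth_length)
qed

lemma arrow_assoc: "arrow (x + y + z) (x + y + z) (Id (x + y + z)) (assoc (DiscCospan \<Sigma>) x y z)"
proof -
  let ?E = "disc (x + (y + z))"
  note l = inl_hom [of x "y + z"] and r = inr_hom [of "y + z" x]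
  note l2 = seq_hyper_hom [OF disc_fin inl_hom [of y z] r] and r2 = seq_hyper_hom [OF disc_fin inr_hom [of z y] r]
  note c = copair_eq [OF l l2]
  note d = copair_eq [OF c(1) r2]
  let ?f = "copair (Hyp \<Sigma>) ordinals (x + y) z ?E (copair (Hyp \<Sigma>) ordinals x y ?E (disc_mor x (x + (y + z)) (\<lambda>v. v))
      (disc_mor y (y + z) (\<lambda>v. v) \<Zsemi> disc_mor (y + z) (x + (y + z)) (\<lambda>v. x + v)))
      (disc_mor z (y + z) (\<lambda>v. y + v) \<Zsemi> disc_mor (y + z) (x + (y + z)) (\<lambda>v. x + v))"
  have "leg (x + y + z) ?f = [0..<x + y + z]"
  proof -
    have "leg (x + y + z) ?f = [0..<x] @ map (\<lambda>v. x + v) [0..<y] @ map (\<lambda>v. x + (y + v)) [0..<z]"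
      by (simp add: c(2) d(2) leg_seq [OF inl_hom [of y z]] leg_seq [OF inr_hom [of z y]])
    also have "\<dots> = [0..<x + y + z]" by (rule nth_equalityI) (auto simp: nth_append)
    finally show ?thesis .
  qed
  then have "arrow (x + y + z) (x + (y + z)) (rel (x + y + z) (x + (y + z)) (\<lambda>a b. a = map ((!) b) [0..<x + y + z])) (assoc (DiscCospan \<Sigma>) x y z)"
    using mats_right(1) [OF d(1)] by (simp add: DiscCospan_def Cospan_def ordinals_def Let_def)
  then have "arrow (x + y + z) (x + y + z) (rel (x + y + z) (x + y + z) (\<lambda>a b. a = map ((!) b) [0..<x + y + z])) (assoc (DiscCospan \<Sigma>) x y z)"
    by (simp only: add.assoc)
  then show ?thesis by (rule arrow_rel_cong) (auto simp: map_nth_length)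
qed

lemma ordinals_simps: "ob ordinals = disc" "zero ordinals = 0" "plus ordinals = (+)"
  "inl ordinals = (\<lambda>n m. disc_mor n (n + m) (\<lambda>v. v))" "inr ordinals = (\<lambda>n m. disc_mor m (n + m) (\<lambda>v. n + v))"
  by (simp_all add: ordinals_def)

lemma arrow_lunit: "arrow x x (Id x) (lunit (DiscCospan \<Sigma>) x)"
proof -
  note c = copair_eq [OF from_zero_hom idh_disc(1) [of x]]
  have "arrow x x (rel x x (\<lambda>a b. a = map ((!) b) [0..<x])) (lunit (DiscCospan \<Sigma>) x)"
    using mats_right(1) [OF c(1)] c(2) by (simp add: DiscCospan_def Cospan_def ordinals_simps idh_disc leg_def [of 0])
  then show ?thesis by (rule arrow_rel_cong) (auto simp: map_nth_length)
qed

lemma arrow_runit: "arrow x x (Id x) (runit (DiscCospan \<Sigma>) x)"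
proof -
  note c = copair_eq [OF idh_disc(1) [of x] from_zero_hom]
  have "arrow x x (rel x x (\<lambda>a b. a = map ((!) b) [0..<x])) (runit (DiscCospan \<Sigma>) x)"
    using mats_right(1) [OF c(1)] c(2) by (simp add: DiscCospan_def Cospan_def ordinals_simps idh_disc leg_def [of 0])
  then show ?thesis by (rule arrow_rel_cong) (auto simp: map_nth_length)
qed

lemma arrow_symm: "arrow (x + y) (y + x) (rel (x + y) (y + x) (\<lambda>a b. b = drop x a @ take x a)) (symm (DiscCospan \<Sigma>) x y)"
proof -
  note c = copair_eq [OF inr_hom [of x y] inl_hom [of y x]]
  have "leg (x + y) (copair (Hyp \<Sigma>) ordinals x y (disc (y + x)) (disc_mor x (y + x) (\<lambda>v. y + v)) (disc_mor y (y + x) (\<lambda>v. v))) = [y..<y + x] @ [0..<y]"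
    unfolding c(2) by (rule nth_equalityI) (auto simp: nth_append)
  then have "arrow (x + y) (y + x) (rel (x + y) (y + x) (\<lambda>a b. a = map ((!) b) ([y..<y + x] @ [0..<y]))) (symm (DiscCospan \<Sigma>) x y)"
    using mats_right(1) [OF c(1)] by (simp add: DiscCospan_def Cospan_def ordinals_simps)
  then show ?thesis
  proof (rule arrow_rel_cong)
    fix a b :: "nat list" assume ab: "length a = x + y" "length b = y + x"
    then obtain b1 b2 where b: "b = b1 @ b2" "length b1 = y" "length b2 = x" by (metis length_eq_add_split)
    then have m: "map ((!) b) ([y..<y + x] @ [0..<y]) = b2 @ b1" by (intro nth_equalityI) (auto simp: nth_append)
    obtain a1 a2 where a: "a = a1 @ a2" "length a1 = x" "length a2 = y" using length_eq_add_split [OF ab(1)] by blast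
    show "a = map ((!) b) ([y..<y + x] @ [0..<y]) \<longleftrightarrow> b = drop x a @ take x a"
      unfolding m using a b by auto
  qed
qed

lemma copair_id:
  "copair (Hyp \<Sigma>) ordinals x x (disc x) (idh (disc x)) (idh (disc x)) \<in> hyper_hom (disc (x + x)) (disc x)"
  "leg (x + x) (copair (Hyp \<Sigma>) ordinals x x (disc x) (idh (disc x)) (idh (disc x))) = [0..<x] @ [0..<x]"
  using copair_eq [OF idh_disc(1) [of x] idh_disc(1) [of x]] idh_disc(2) by simp_all

lemma arrow_mu: "arrow (x + x) x (Mu x) (mu (DiscCospan \<Sigma>) x)"
proof -
  have "arrow (x + x) x (rel (x + x) x (\<lambda>a b. a = map ((!) b) ([0..<x] @ [0..<x]))) (mu (DiscCospan \<Sigma>) x)"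
    using mats_right(1) [OF copair_id(1)] copair_id(2) by (simp add: DiscCospan_def Cospan_def ordinals_simps)
  then show ?thesis by (rule arrow_rel_cong) (auto simp: map_nth_length)
qed

lemma arrow_delta: "arrow x (x + x) (Delta x) (delta (DiscCospan \<Sigma>) x)"
proof -
  have "arrow x (x + x) (rel x (x + x) (\<lambda>a b. b = map ((!) a) ([0..<x] @ [0..<x]))) (delta (DiscCospan \<Sigma>) x)"
    using mats_right(2) [OF copair_id(1)] copair_id(2) by (simp add: DiscCospan_def Cospan_def ordinals_simps)
  then show ?thesis by (rule arrow_rel_cong) (auto simp: map_nth_length)
qed

lemma arrow_eta: "arrow 0 x (Eta x) (eta (DiscCospan \<Sigma>) x)"
proof -
  have "arrow 0 x (rel 0 x (\<lambda>a b. a = map ((!) b) [])) (eta (DiscCospan \<Sigma>) x)"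
    using mats_right(1) [OF from_zero_hom [of "disc x"]] by (simp add: DiscCospan_def Cospan_def ordinals_simps leg_def)
  then show ?thesis by (rule arrow_rel_cong) auto
qed

lemma arrow_eps: "arrow x 0 (Eps x) (eps (DiscCospan \<Sigma>) x)"
proof -
  have "arrow x 0 (rel x 0 (\<lambda>a b. b = map ((!) a) [])) (eps (DiscCospan \<Sigma>) x)"
    using mats_right(2) [OF from_zero_hom [of "disc x"]] by (simp add: DiscCospan_def Cospan_def ordinals_simps leg_def)
  then show ?thesis by (rule arrow_rel_cong) auto
qed

lemma strict_Mat: "strict_pcb Mat"
proof -
  interpret preordered_cartesian_bicategory Mat by (rule Mat_pcb)
  show ?thesis by unfold_locales simp_all
qed

lemma DC_embedding: "pcb_embedding Mat (DiscCospan \<Sigma>) Phi"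
proof -
  interpret strict_pcb Mat by (rule strict_Mat)
  show ?thesis
  proof (unfold_locales, goal_cases)
    case (4 f X Y)
    then show ?case using arrow_mats [OF Hom_arrow_Phi] by (simp del: DC_simps)
  next
    case (5 f X Y g)
    then show ?case using Hom_arrow_Phi [of f X Y] Hom_arrow_Phi [of g X Y] by (simp add: arrow_def)
  next
    case (8 f X Y g Z)
    then show ?case using arrow_HomD [OF arrow_seq [OF Hom_arrow_Phi Hom_arrow_Phi]] by (metis DC_simps(5))
  next
    case (9 f X Y g Z)
    then show ?case using arrow_HomD [OF arrow_seq [OF Hom_arrow_Phi Hom_arrow_Phi]] by (metis DC_simps(5) Mat_simps(4))
  next
    case (10 f X Y g X' Y')
    then show ?case using arrow_HomD [OF arrow_oplus [OF Hom_arrow_Phi Hom_arrow_Phi]] by (metis DC_simps(6))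
  next
    case (11 f X Y g X' Y')
    then show ?case using arrow_HomD [OF arrow_oplus [OF Hom_arrow_Phi Hom_arrow_Phi]] by (metis DC_simps(6) Mat_simps(6))
  next
    case (20 f X Y g)
    then show ?case using cospan_le_iff [OF Hom_arrow_Phi Hom_arrow_Phi] by (metis DC_simps(7) Mat_simps(12))
  qed (use arrow_HomD [OF arrow_ident] arrow_HomD [OF arrow_assoc] arrow_HomD [OF arrow_lunit] arrow_HomD [OF arrow_runit]
      arrow_HomD [OF arrow_symm] arrow_HomD [OF arrow_mu] arrow_HomD [OF arrow_eta] arrow_HomD [OF arrow_delta] arrow_HomD [OF arrow_eps]
      in \<open>simp_all del: DC_simps(4)\<close>)
qed

end


section \<open>Presentations of cospans\<close>

text \<open>Variables that are provably equal are represented by the least one of them; the edges are the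
  positions of the atoms in the list.\<close>

definition pres_graph :: "nat \<Rightarrow> (nat \<times> nat) list \<Rightarrow> 's ratom list \<Rightarrow> 's hypergraph" where
  "pres_graph K es rs = \<lparr>verts = rep es ` {..<K}, edges = (\<lambda>R. {i. i < length rs \<and> fst (rs ! i) = R}),
     src = (\<lambda>R. \<lambda>i\<in>{i. i < length rs \<and> fst (rs ! i) = R}. map (rep es) (fst (snd (rs ! i)))),
     tgt = (\<lambda>R. \<lambda>i\<in>{i. i < length rs \<and> fst (rs ! i) = R}. map (rep es) (snd (snd (rs ! i))))\<rparr>"

definition pres :: "nat \<Rightarrow> nat \<Rightarrow> (nat \<times> nat) list \<Rightarrow> 's ratom list \<Rightarrow> nat list \<Rightarrow> 's hcospan" where
  "pres n k es rs t = (point n (pres_graph (n + k) es rs) (map (rep es) [0..<n]), pres_graph (n + k) es rs,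
     point (length t) (pres_graph (n + k) es rs) (map (rep es) t))"

lemma pres_graph_simps [simp]:
  "verts (pres_graph K es rs) = rep es ` {..<K}"
  "edges (pres_graph K es rs) R = {i. i < length rs \<and> fst (rs ! i) = R}"
  "i < length rs \<Longrightarrow> fst (rs ! i) = R \<Longrightarrow> src (pres_graph K es rs) R i = map (rep es) (fst (snd (rs ! i)))"
  "i < length rs \<Longrightarrow> fst (rs ! i) = R \<Longrightarrow> tgt (pres_graph K es rs) R i = map (rep es) (snd (snd (rs ! i)))"
  by (simp_all add: pres_graph_def)

lemma wf_body_nth:
  assumes "wf_body \<Sigma> K es rs t" "i < length rs"
  shows "fst (rs ! i) \<in> symbols \<Sigma>" "length (fst (snd (rs ! i))) = ar \<Sigma> (fst (rs ! i))"
    "length (snd (snd (rs ! i))) = coar \<Sigma> (fst (rs ! i))"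
    "set (fst (snd (rs ! i))) \<subseteq> {..<K}" "set (snd (snd (rs ! i))) \<subseteq> {..<K}"
proof -
  have "wf_rel \<Sigma> K (rs ! i)" using assms by (simp add: wf_body_def)
  then show "fst (rs ! i) \<in> symbols \<Sigma>" "length (fst (snd (rs ! i))) = ar \<Sigma> (fst (rs ! i))"
    "length (snd (snd (rs ! i))) = coar \<Sigma> (fst (rs ! i))"
    "set (fst (snd (rs ! i))) \<subseteq> {..<K}" "set (snd (snd (rs ! i))) \<subseteq> {..<K}"
    by (auto simp: wf_rel_def split: prod.splits)
qed

lemma wf_body_sets: "wf_body \<Sigma> K es rs t \<Longrightarrow> set es \<subseteq> {..<K} \<times> {..<K} \<and> set t \<subseteq> {..<K}"
  by (simp add: wf_body_def)

lemma prod_list_nth: "prod_list (map f rs) = (\<Prod>i<length rs. f (rs ! i))" for f :: "'a \<Rightarrow> nat"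
  by (simp add: prod.list_conv_set_nth atLeast0LessThan)

context hypergraphs
begin

lemma pres_graph_fin:
  assumes wf: "wf_body \<Sigma> K es rs t"
  shows "fin (pres_graph K es rs)"
proof (rule finite_hypergraphI)
  have "Sigma (symbols \<Sigma>) (edges (pres_graph K es rs)) \<subseteq> (\<lambda>i. (fst (rs ! i), i)) ` {..<length rs}" by auto
  then show "finite (Sigma (symbols \<Sigma>) (edges (pres_graph K es rs)))" by (rule finite_subset) simp
  fix R e assume "e \<in> edges (pres_graph K es rs) R"
  then show "R \<in> symbols \<Sigma> \<and> src (pres_graph K es rs) R e \<in> tuples (verts (pres_graph K es rs)) (ar \<Sigma> R)
      \<and> tgt (pres_graph K es rs) R e \<in> tuples (verts (pres_graph K es rs)) (coar \<Sigma> R)"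
    using wf_body_nth [OF wf, of e] by (auto simp: tuples_def)
qed (auto simp: pres_graph_def)

lemma pres_csp:
  assumes wf: "wf_body \<Sigma> (n + k) es rs t"
  shows "pres n k es rs t \<in> csp n (length t)"
    "leg n (fst (pres n k es rs t)) = map (rep es) [0..<n]"
    "leg (length t) (snd (snd (pres n k es rs t))) = map (rep es) t"
proof -
  have "map (rep es) [0..<n] \<in> tuples (verts (pres_graph (n + k) es rs)) n"
    "map (rep es) t \<in> tuples (verts (pres_graph (n + k) es rs)) (length t)"
    using wf_body_sets [OF wf] by (auto simp: tuples_def)
  then show "pres n k es rs t \<in> csp n (length t)"
    using pres_graph_fin [OF wf] by (auto simp: pres_def csp_iff intro!: point_hom)
qed (simp_all add: pres_def leg_point)

lemma card_pres_homs:
  assumes wf: "wf_body \<Sigma> K es rs t" and w: "w \<in> tupH \<Sigma> H K" and resp: "\<forall>(i, j)\<in>set es. w ! i = w ! j"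
  shows "card {h \<in> hyper_hom (pres_graph K es rs) H. \<forall>i<K. vmap h (rep es i) = w ! i} = prod_list (map (atom_count H w) rs)"
proof -
  let ?Q = "pres_graph K es rs" and ?f = "\<lambda>h. \<lambda>i\<in>{..<length rs}. emap h (fst (rs ! i)) i"
  let ?A = "\<lambda>i. {e \<in> edges H (fst (rs ! i)). src H (fst (rs ! i)) e = map ((!) w) (fst (snd (rs ! i))) \<and>
     tgt H (fst (rs ! i)) e = map ((!) w) (snd (snd (rs ! i)))}"
  let ?X = "{h \<in> hyper_hom ?Q H. \<forall>i<K. vmap h (rep es i) = w ! i}"
  let ?g = "\<lambda>p. \<lparr>source = ?Q, target = H, vmap = (\<lambda>x\<in>rep es ` {..<K}. w ! x), emap = (\<lambda>R. \<lambda>i\<in>{i. i < length rs \<and> fst (rs ! i) = R}. p i)\<rparr>"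
  have wrep: "w ! rep es i = w ! i" for i by (rule rep_respects) (use resp in auto)
  have repK: "rep es i < K" if "i < K" for i using rep_mem [of es "{..<K}" i] wf_body_sets [OF wf] that by auto
  have wv: "w ! i \<in> verts H" if "i < K" for i
    using w that nth_mem [of i w] by (auto simp: tupH_def tuples_def split: if_splits)
  have vm: "map (vmap h) (map (rep es) s) = map ((!) w) s" if "\<forall>i<K. vmap h (rep es i) = w ! i" "set s \<subseteq> {..<K}" for h :: "'s hyper_mor" and s
    using that by auto
  have f: "?f h \<in> PiE {..<length rs} ?A" if h: "h \<in> ?X" for h
  proof -
    have "emap h (fst (rs ! i)) i \<in> ?A i" if i: "i < length rs" for i
      using h hyper_homD(4-6) [of h ?Q H i "fst (rs ! i)"] vm [of h] wf_body_nth(4,5) [OF wf i] i by simp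
    then show ?thesis by auto
  qed
  have g: "?g p \<in> ?X" if p: "p \<in> PiE {..<length rs} ?A" for p
  proof -
    have v: "\<forall>i<K. vmap (?g p) (rep es i) = w ! i" using wrep by auto
    have "src H R (emap (?g p) R i) = map (vmap (?g p)) (src ?Q R i) \<and> tgt H R (emap (?g p) R i) = map (vmap (?g p)) (tgt ?Q R i)"
      if i: "i \<in> edges ?Q R" for R i
      using PiE_mem [OF p, of i] vm [OF v wf_body_nth(4) [OF wf, of i]] vm [OF v wf_body_nth(5) [OF wf, of i]] i by (auto simp del: map_map)
    moreover have "\<forall>R. emap (?g p) R \<in> edges ?Q R \<rightarrow>\<^sub>E edges H R"
      using PiE_mem [OF p] by (auto simp: PiE_iff)
    ultimately have "?g p \<in> hyper_hom ?Q H"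
      using wv repK by (auto simp: hyper_hom_def)
    then show ?thesis using v by blast
  qed
  have "bij_betw ?f ?X (PiE {..<length rs} ?A)"
  proof (rule bij_betw_byWitness [where f' = ?g])
    show "\<forall>h\<in>?X. ?g (?f h) = h"
    proof
      fix h assume h: "h \<in> ?X"
      show "?g (?f h) = h"
        by (rule hyper_hom_eqI [of _ ?Q H]) (use h g [OF f [OF h]] wrep in auto)
    qed
    show "\<forall>p\<in>PiE {..<length rs} ?A. ?f (?g p) = p"
      by (auto simp: PiE_iff extensional_def fun_eq_iff)
    show "?f ` ?X \<subseteq> PiE {..<length rs} ?A" using f by blast
    show "?g ` PiE {..<length rs} ?A \<subseteq> ?X" using g by blast
  qed
  then have "card ?X = card (PiE {..<length rs} ?A)" by (rule bij_betw_same_card)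
  also have "\<dots> = (\<Prod>i<length rs. card (?A i))" by (simp add: card_PiE)
  also have "\<dots> = prod_list (map (atom_count H w) rs)"
    unfolding prod_list_nth by (simp add: atom_count_def case_prod_unfold)
  finally show ?thesis .
qed

lemma card_homs_pres:
  assumes wf: "wf_body \<Sigma> (n + k) es rs t" and H: "fin H"
  shows "card (homs n (length t) (pres n k es rs t) H a b) = (\<Sum>w\<in>tupH \<Sigma> H (n + k).
    if take n w = a \<and> (\<forall>(i, j)\<in>set es. w ! i = w ! j) \<and> map ((!) w) t = b then prod_list (map (atom_count H w) rs) else 0)"
proof -
  let ?K = "n + k" and ?Q = "pres_graph (n + k) es rs"
  let ?g = "\<lambda>h. map (\<lambda>i. vmap h (rep es i)) [0..<?K]"
  let ?S = "homs n (length t) (pres n k es rs t) H a b"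
  have S: "?S = {h \<in> hyper_hom ?Q H. take n (?g h) = a \<and> map ((!) (?g h)) t = b}"
  proof -
    have "take n (?g h) = map (vmap h) (map (rep es) [0..<n])" for h :: "'s hyper_mor"
      by (simp add: take_map comp_def)
    moreover have "map ((!) (?g h)) t = map (vmap h) (map (rep es) t)" for h :: "'s hyper_mor"
      using wf_body_sets [OF wf] by auto
    ultimately show ?thesis
      using pres_csp(2,3) [OF wf] by (simp add: homs_def pres_def del: map_map)
  qed
  have gt: "?g h \<in> tupH \<Sigma> H ?K" if "h \<in> hyper_hom ?Q H" for h
    using hyper_homD(3) [OF that] H by (auto simp: tupH_def tuples_def)
  have fS: "finite ?S" by (rule finite_homs [OF pres_csp(1) [OF wf] H])
  have "card ?S = (\<Sum>w\<in>tupH \<Sigma> H ?K. card {h \<in> ?S. ?g h = w})"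
    unfolding card_eq_sum using fS gt S by (intro sum.group [symmetric]) (auto simp: finite_tup)
  also have "\<dots> = (\<Sum>w\<in>tupH \<Sigma> H ?K.
    if take n w = a \<and> (\<forall>(i, j)\<in>set es. w ! i = w ! j) \<and> map ((!) w) t = b then prod_list (map (atom_count H w) rs) else 0)"
  proof (rule sum.cong [OF refl])
    fix w assume w: "w \<in> tupH \<Sigma> H ?K"
    have gw: "?g h = w \<longleftrightarrow> (\<forall>i<?K. vmap h (rep es i) = w ! i)" for h :: "'s hyper_mor"
      using length_tup [OF w] by (auto simp: list_eq_iff_nth_eq)
    have resp: "\<forall>(i, j)\<in>set es. w ! i = w ! j" if "h \<in> ?S" "?g h = w" for h
    proof -
      have "w ! i = w ! j" if ij: "(i, j) \<in> set es" for i j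
      proof -
        have "i < ?K" "j < ?K" "rep es i = rep es j" using ij wf_body_sets [OF wf] by (auto simp: rep_eq_iff eqv_mem)
        then show ?thesis using \<open>?g h = w\<close> gw by metis
      qed
      then show ?thesis by blast
    qed
    show "card {h \<in> ?S. ?g h = w} = (if take n w = a \<and> (\<forall>(i, j)\<in>set es. w ! i = w ! j) \<and> map ((!) w) t = b
        then prod_list (map (atom_count H w) rs) else 0)"
    proof (cases "take n w = a \<and> (\<forall>(i, j)\<in>set es. w ! i = w ! j) \<and> map ((!) w) t = b")
      case True
      have "{h \<in> ?S. ?g h = w} = {h \<in> hyper_hom ?Q H. ?g h = w}" unfolding S using True by auto
      then show ?thesis using card_pres_homs [OF wf w] True unfolding gw by simp
    next
      case False
      then have "{h \<in> ?S. ?g h = w} = {}" using resp unfolding S by blast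
      then show ?thesis using False by (simp only: if_False card.empty)
    qed
  qed
  finally show ?thesis .
qed

lemma pres_exists:
  assumes c: "(l, A, r) \<in> csp n m"
  shows "\<exists>k es rs t. wf_body \<Sigma> (n + k) es rs t \<and> length t = m \<and> mat n m (pres n k es rs t) = mat n m (l, A, r)"
proof -
  have A: "fin A" and l: "set (leg n l) \<subseteq> verts A" and r: "set (leg m r) \<subseteq> verts A"
    using c leg_tuples [of l n A] leg_tuples [of r m A] by (auto simp: csp_iff tuples_def)
  obtain vs where vs: "set vs = verts A" "distinct vs" using finite_distinct_list [OF fin_hypD(1) [OF A]] by blast
  obtain ps where ps: "set ps = Sigma (symbols \<Sigma>) (edges A)" "distinct ps"
    using finite_distinct_list [OF fin_hypD(2) [OF A]] by blast
  define k where "k = length vs"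
  have "\<forall>v\<in>verts A. \<exists>i. i < k \<and> vs ! i = v" using vs by (metis in_set_conv_nth k_def)
  then obtain ix where ix: "\<And>v. v \<in> verts A \<Longrightarrow> ix v < k \<and> vs ! ix v = v" by metis
  let ?K = "n + k"
  define c where "c v = n + ix v" for v
  define q where "q x = (if x < n then leg n l ! x else vs ! (x - n))" for x
  define es where "es = map (\<lambda>i. (i, c (leg n l ! i))) [0..<n]"
  define rs where "rs = map (\<lambda>p. (fst p, map c (src A (fst p) (snd p)), map c (tgt A (fst p) (snd p)))) ps"
  define t where "t = map c (leg m r)"
  let ?Q = "pres_graph ?K es rs"
  have cK: "c v < ?K" and qc: "q (c v) = v" if "v \<in> verts A" for v
    using ix [OF that] by (simp_all add: c_def q_def)
  have lA: "leg n l ! i \<in> verts A" if "i < n" for i using l that nth_mem [of i "leg n l"] by auto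
  have qA: "q x \<in> verts A" if "x < ?K" for x
    using that lA vs nth_mem [of "x - n" vs] by (auto simp: q_def k_def)
  have q_es: "q (rep es i) = q i" for i
  proof (rule rep_respects)
    fix x y assume "(x, y) \<in> set es"
    then have "x < n" "y = c (leg n l ! x)" by (auto simp: es_def)
    then show "q x = q y" using qc [OF lA, of x] by (simp add: q_def [of x])
  qed
  have c_eqv: "(x, c (q x)) \<in> eqv es" if x: "x < ?K" for x
  proof (cases "x < n")
    case True
    then show ?thesis by (intro eqv_mem) (auto simp: es_def q_def)
  next
    case False
    then have "x - n < k" using x by simp
    then have "ix (vs ! (x - n)) = x - n"
      using ix [of "vs ! (x - n)"] vs nth_mem [of "x - n" vs] nth_eq_iff_index_eq [OF vs(2)] by (auto simp: k_def)
    then show ?thesis using False by (simp add: c_def q_def)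
  qed
  have ps_nth: "fst (ps ! i) \<in> symbols \<Sigma> \<and> snd (ps ! i) \<in> edges A (fst (ps ! i))" if "i < length ps" for i
    using nth_mem [OF that] ps(1) by auto
  have sv: "set (src A (fst (ps ! i)) (snd (ps ! i))) \<subseteq> verts A" "set (tgt A (fst (ps ! i)) (snd (ps ! i))) \<subseteq> verts A"
    if "i < length ps" for i
    using ps_nth [OF that] src_verts [OF A] tgt_verts [OF A] by blast+
  have wf: "wf_body \<Sigma> ?K es rs t"
  proof -
    have "set es \<subseteq> {..<?K} \<times> {..<?K}" using cK [OF lA] by (auto simp: es_def)
    moreover have "set t \<subseteq> {..<?K}" using r cK by (auto simp: t_def)
    moreover have "wf_rel \<Sigma> ?K x" if x: "x \<in> set rs" for x
    proof -
      obtain R e where e: "(R, e) \<in> set ps" "x = (R, map c (src A R e), map c (tgt A R e))" using x by (auto simp: rs_def)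
      then have "e \<in> edges A R" using ps by auto
      then show ?thesis
        using e(2) fin_hypD(3) [OF A, of e R] cK by (auto simp: wf_rel_def tuples_def)
    qed
    ultimately show ?thesis by (simp add: wf_body_def)
  qed
  have len: "length rs = length ps" "length t = m" by (simp_all add: rs_def t_def)
  have rs_nth: "rs ! i = (fst (ps ! i), map c (src A (fst (ps ! i)) (snd (ps ! i))), map c (tgt A (fst (ps ! i)) (snd (ps ! i))))"
    if "i < length ps" for i
    using that by (simp add: rs_def)
  let ?h = "\<lparr>source = ?Q, target = A, vmap = (\<lambda>x\<in>rep es ` {..<?K}. q x),
     emap = (\<lambda>R. \<lambda>i\<in>{i. i < length rs \<and> fst (rs ! i) = R}. snd (ps ! i))\<rparr>"
  have repK: "rep es i < ?K" if "i < ?K" for i using rep_mem [of es "{..<?K}" i] wf_body_sets [OF wf] that by auto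
  have vm: "map (vmap ?h) (map (rep es) (map c xs)) = xs" if "set xs \<subseteq> verts A" for xs
    using that cK qc by (auto simp: q_es intro!: map_idI)
  have h: "?h \<in> hyper_hom ?Q A"
  proof -
    have "src A R (emap ?h R i) = map (vmap ?h) (src ?Q R i) \<and> tgt A R (emap ?h R i) = map (vmap ?h) (tgt ?Q R i)"
      if i: "i \<in> edges ?Q R" for R i
    proof -
      have ip: "i < length ps" "fst (ps ! i) = R" using i rs_nth [of i] by (auto simp: len)
      then show ?thesis using vm [OF sv(1) [OF ip(1)]] vm [OF sv(2) [OF ip(1)]] rs_nth [OF ip(1)] by (simp add: len del: map_map)
    qed
    moreover have "vmap ?h \<in> verts ?Q \<rightarrow>\<^sub>E verts A" using repK qA by (auto simp: q_es)
    moreover have "emap ?h R \<in> edges ?Q R \<rightarrow>\<^sub>E edges A R" for R using ps_nth by (auto simp: len rs_nth)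
    ultimately show ?thesis unfolding hyper_hom_def by simp
  qed
  have "bij_betw (vmap ?h) (verts ?Q) (verts A)"
  proof (rule bij_betw_imageI)
    show "inj_on (vmap ?h) (verts ?Q)"
    proof (rule inj_onI)
      fix x y assume "x \<in> verts ?Q" "y \<in> verts ?Q" and e: "vmap ?h x = vmap ?h y"
      then obtain i j where ij: "i < ?K" "j < ?K" "x = rep es i" "y = rep es j" by auto
      then have "q i = q j" using e by (simp add: q_es)
      then have "(i, j) \<in> eqv es" using c_eqv [OF ij(1)] c_eqv [OF ij(2)] eqv_sym eqv_trans by metis
      then show "x = y" using ij by (simp add: rep_eq_iff)
    qed
    show "vmap ?h ` verts ?Q = verts A"
    proof (intro equalityI subsetI)
      fix v assume "v \<in> verts A"
      then have "v = vmap ?h (rep es (c v))" "rep es (c v) \<in> verts ?Q" using cK qc by (auto simp: q_es)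
      then show "v \<in> vmap ?h ` verts ?Q" by blast
    qed (use hyper_homD(3) [OF h] in blast)
  qed
  moreover have "bij_betw (emap ?h R) (edges ?Q R) (edges A R)" for R
  proof (rule bij_betw_imageI)
    have E: "edges ?Q R = {i. i < length ps \<and> fst (ps ! i) = R}" by (auto simp: len rs_nth)
    have em: "emap ?h R i = snd (ps ! i)" if "i < length ps" "fst (ps ! i) = R" for i using that by (simp add: len rs_nth)
    show "inj_on (emap ?h R) (edges ?Q R)"
      unfolding E
    proof (rule inj_onI)
      fix i j assume "i \<in> {i. i < length ps \<and> fst (ps ! i) = R}" "j \<in> {i. i < length ps \<and> fst (ps ! i) = R}"
        "emap ?h R i = emap ?h R j"
      then have "i < length ps" "j < length ps" "ps ! i = ps ! j" using em [of i] em [of j] by (auto simp: prod_eq_iff)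
      then show "i = j" using nth_eq_iff_index_eq [OF ps(2)] by blast
    qed
    show "emap ?h R ` edges ?Q R = edges A R"
    proof (intro equalityI subsetI)
      fix e assume e: "e \<in> edges A R"
      then have "(R, e) \<in> set ps" using ps fin_hypD(3) [OF A e] by auto
      then obtain i where "i < length ps" "ps ! i = (R, e)" by (auto simp: in_set_conv_nth)
      then show "e \<in> emap ?h R ` edges ?Q R" unfolding E using em by (intro image_eqI [of _ _ i]) auto
    qed (use hyper_homD(4) [OF h] in blast)
  qed
  ultimately have iso: "is_iso (Hyp \<Sigma>) ?Q A ?h" using bij_iso [OF pres_graph_fin [OF wf] A h] by blast
  have d: "(point n ?Q (map (rep es) [0..<n]), ?Q, point m ?Q (map (rep es) t)) \<in> csp n m"
    using pres_csp(1) [OF wf] len by (simp add: pres_def)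
  have "map (vmap ?h) (map (rep es) [0..<n]) = map q [0..<n]" by (auto simp: q_es)
  also have "\<dots> = leg n l" by (rule nth_equalityI) (auto simp: q_def)
  finally have "map (vmap ?h) (map (rep es) [0..<n]) = leg n l" .
  moreover have "map (vmap ?h) (map (rep es) t) = leg m r" using vm [OF r] by (simp only: t_def)
  ultimately have "?h \<in> homs n m (point n ?Q (map (rep es) [0..<n]), ?Q, point m ?Q (map (rep es) t)) A (leg n l) (leg m r)"
    using h len by (simp add: homs_def leg_point del: map_map)
  then have "cospan_morphism (Hyp \<Sigma>) (pres n k es rs t) (l, A, r) ?h"
    using cospan_morphism_iff [OF d assms(1)] len by (simp add: pres_def)
  then have "(pres n k es rs t, (l, A, r)) \<in> cospan_rel (Hyp \<Sigma>) (disc n) (disc m)"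
    using iso d assms(1) len unfolding cospan_rel_def by (auto simp: pres_def)
  then show ?thesis using wf len unfolding cospan_rel_iff by blast
qed

lemma pres_morphism:
  assumes wf: "wf_body \<Sigma> (n + k) es rs t" and wf': "wf_body \<Sigma> (n + k') es' rs' t'"
    and h: "h \<in> hyper_hom (pres_graph (n + k) es rs) (pres_graph (n + k') es' rs')"
    and hn: "map (vmap h) (map (rep es) [0..<n]) = map (rep es') [0..<n]" and ht: "map (vmap h) (map (rep es) t) = map (rep es') t'"
  defines "f \<equiv> \<lambda>i. vmap h (rep es i)"
  shows "i < n + k \<Longrightarrow> f i < n + k'" "i < n + k \<Longrightarrow> rep es' (f i) = f i" "i < n \<Longrightarrow> (f i, i) \<in> eqv es'"
    "(i, j) \<in> set es \<Longrightarrow> (f i, f j) \<in> eqv es'" "list_all2 (\<lambda>i j. (i, j) \<in> eqv es') (map f t) t'"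
    "i < length rs \<Longrightarrow> emap h (fst (rs ! i)) i < length rs' \<and> fst (rs' ! emap h (fst (rs ! i)) i) = fst (rs ! i)"
    "i < length rs \<Longrightarrow> rel_sim es' (ren f (rs ! i)) (rs' ! emap h (fst (rs ! i)) i)"
proof -
  have sim: "list_all2 (\<lambda>i j. (i, j) \<in> eqv es') (map f xs) ys" if "map f xs = map (rep es') ys" for xs ys
  proof (rule list_all2_all_nthI)
    show "length (map f xs) = length ys" using that map_eq_imp_length_eq by fastforce
    show "(map f xs ! i, ys ! i) \<in> eqv es'" if i: "i < length (map f xs)" for i
    proof -
      have "length (map f xs) = length ys" using \<open>map f xs = map (rep es') ys\<close> map_eq_imp_length_eq by fastforce
      then have "map f xs ! i = rep es' (ys ! i)" using \<open>map f xs = map (rep es') ys\<close> i by simp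
      then show ?thesis using rep_eqv eqv_sym by metis
    qed
  qed
  have fv: "f i \<in> rep es' ` {..<n + k'}" if "i < n + k" for i
    using hyper_homD(3) [OF h, of "rep es i"] that by (simp add: f_def)
  show "f i < n + k'" if "i < n + k" for i
    using fv [OF that] rep_mem [of es' "{..<n + k'}"] wf_body_sets [OF wf'] by auto
  show "rep es' (f i) = f i" if "i < n + k" for i using fv [OF that] by auto
  show "(f i, i) \<in> eqv es'" if "i < n" for i
  proof -
    have "f i = rep es' i" using arg_cong [OF hn, of "\<lambda>xs. xs ! i"] that by (simp add: f_def)
    then show ?thesis using rep_eqv eqv_sym by metis
  qed
  show "(f i, f j) \<in> eqv es'" if "(i, j) \<in> set es" for i j
  proof -
    have "rep es i = rep es j" using that by (simp add: rep_eq_iff eqv_mem)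
    then show ?thesis by (simp add: f_def)
  qed
  show "list_all2 (\<lambda>i j. (i, j) \<in> eqv es') (map f t) t'" using ht by (intro sim) (simp add: f_def comp_def)
  show e: "emap h (fst (rs ! i)) i < length rs' \<and> fst (rs' ! emap h (fst (rs ! i)) i) = fst (rs ! i)" if "i < length rs" for i
    using hyper_homD(4) [OF h, of i "fst (rs ! i)"] that by simp
  show "rel_sim es' (ren f (rs ! i)) (rs' ! emap h (fst (rs ! i)) i)" if i: "i < length rs" for i
  proof -
    let ?j = "emap h (fst (rs ! i)) i"
    have "map f (fst (snd (rs ! i))) = map (rep es') (fst (snd (rs' ! ?j)))"
      "map f (snd (snd (rs ! i))) = map (rep es') (snd (snd (rs' ! ?j)))"
      using hyper_homD(5,6) [OF h, of i "fst (rs ! i)"] e [OF i] i by (simp_all add: f_def comp_def)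
    then show ?thesis using sim e [OF i] by (auto simp: rel_sim_def ren_def case_prod_unfold)
  qed
qed

end


section \<open>Completeness\<close>

context gcq_signature
begin

sublocale hypergraphs \<Sigma> .

lemma F_nf_eq_mat:
  assumes "wf_body \<Sigma> (n + k) es rs t"
  shows "F (nf n k es rs t) = mat n (length t) (pres n k es rs t)"
proof (rule mats_eqI [OF F_mats mat_mats [OF pres_csp(1) [OF assms]]])
  fix H a b assume "a \<in> tupH \<Sigma> H n"
  then have "fin H" by (auto simp: tupH_def split: if_splits)
  then show "val (F (nf n k es rs t)) H a b = val (mat n (length t) (pres n k es rs t)) H a b"
    using card_homs_pres [OF assms] by (simp add: val_nf [OF assms] val_mat)
qed (use assms in simp_all)

lemma nf_mat_inj:
  assumes wf: "wf_body \<Sigma> (n + k) es rs t" and wf': "wf_body \<Sigma> (n + k') es' rs' t'" and len: "length t = length t'"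
    and eq: "mat n (length t) (pres n k es rs t) = mat n (length t) (pres n k' es' rs' t')"
  shows "nf n k es rs t = nf n k' es' rs' t'"
proof -
  let ?m = "length t" and ?Q = "pres_graph (n + k) es rs" and ?Q' = "pres_graph (n + k') es' rs'"
  have c: "(point n ?Q (map (rep es) [0..<n]), ?Q, point ?m ?Q (map (rep es) t)) \<in> csp n ?m"
    and d: "(point n ?Q' (map (rep es') [0..<n]), ?Q', point ?m ?Q' (map (rep es') t')) \<in> csp n ?m"
    using pres_csp(1) [OF wf] pres_csp(1) [OF wf'] len by (simp_all add: pres_def)
  obtain h where h: "cospan_morphism (Hyp \<Sigma>) (point n ?Q (map (rep es) [0..<n]), ?Q, point ?m ?Q (map (rep es) t))
      (point n ?Q' (map (rep es') [0..<n]), ?Q', point ?m ?Q' (map (rep es') t')) h" and iso: "is_iso (Hyp \<Sigma>) ?Q ?Q' h"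
    using mat_inj [OF c d] eq len by (auto simp: pres_def)
  obtain g where g: "g \<in> hyper_hom ?Q' ?Q" "h \<Zsemi> g = idh ?Q" "g \<Zsemi> h = idh ?Q'" and hh: "h \<in> hyper_hom ?Q ?Q'"
    using iso by (auto simp: is_iso_def is_inverse_def)
  have hl: "map (vmap h) (map (rep es) [0..<n]) = map (rep es') [0..<n]" "map (vmap h) (map (rep es) t) = map (rep es') t'"
    using h cospan_morphism_iff [OF c d] len by (simp_all add: homs_def leg_point del: map_map)
  have gh: "vmap g (vmap h x) = x" if "x \<in> verts ?Q" for x
    using seq_simps(1) [OF hh that, of g] g(2) that by (simp del: pres_graph_simps)
  have hg: "vmap h (vmap g x) = x" if "x \<in> verts ?Q'" for x
    using seq_simps(1) [OF g(1) that, of h] g(3) that by (simp del: pres_graph_simps)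
  have ghe: "emap g R (emap h R x) = x" if "x \<in> edges ?Q R" for x R
    using seq_simps(2) [OF hh that, of g] g(2) that by (simp del: pres_graph_simps)
  have hge: "emap h R (emap g R x) = x" if "x \<in> edges ?Q' R" for x R
    using seq_simps(2) [OF g(1) that, of h] g(3) that by (simp del: pres_graph_simps)
  have gm: "map (vmap g) (map (vmap h) xs) = xs" if "set xs \<subseteq> verts ?Q" for xs
    using that gh by (auto intro!: map_idI)
  have s: "set (map (rep es) [0..<n]) \<subseteq> verts ?Q" "set (map (rep es) t) \<subseteq> verts ?Q" using wf_body_sets [OF wf] by auto
  have gl: "map (vmap g) (map (rep es') [0..<n]) = map (rep es) [0..<n]" "map (vmap g) (map (rep es') t') = map (rep es) t"
    using gm [OF s(1)] gm [OF s(2)] by (simp_all only: hl)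
  note H = pres_morphism [OF wf wf' hh hl] and G = pres_morphism [OF wf' wf g(1) gl]
  let ?f = "\<lambda>i. vmap h (rep es i)" and ?g = "\<lambda>i. vmap g (rep es' i)"
  let ?p = "\<lambda>i. emap h (fst (rs ! i)) i" and ?p' = "\<lambda>j. emap g (fst (rs' ! j)) j"
  have p'p: "?p' (?p i) = i" if "i < length rs" for i using H(6) [OF that] ghe [of i "fst (rs ! i)"] that by simp
  have pp': "?p (?p' j) = j" if "j < length rs'" for j using G(6) [OF that] hge [of j "fst (rs' ! j)"] that by simp
  have bij: "bij_betw ?p {0..<length rs} {0..<length rs'}"
    by (rule bij_betw_byWitness [where f' = ?p']) (use H(6) G(6) p'p pp' in auto)
  let ?rs = "map (\<lambda>i. rs' ! ?p i) [0..<length rs]"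
  have ms: "mset ?rs = mset rs'"
  proof -
    have "mset ?rs = image_mset ((!) rs') (image_mset ?p (mset_set {0..<length rs}))"
      by (simp add: multiset.map_comp comp_def)
    also have "image_mset ?p (mset_set {0..<length rs}) = mset_set {0..<length rs'}"
      using bij by (simp add: bij_betw_def image_mset_mset_set)
    also have "image_mset ((!) rs') (mset_set {0..<length rs'}) = mset (map ((!) rs') [0..<length rs'])" by simp
    also have "\<dots> = mset rs'" by (simp only: map_nth)
    finally show ?thesis .
  qed
  show ?thesis
  proof (rule nf_eqI [OF wf wf', of ?f ?g, OF H(1) G(1) H(3) G(3) H(4) G(4) _ _ _ ms H(5)])
    show "(?g (?f i), i) \<in> eqv es" if "i < n + k" for i
    proof -
      have "?g (?f i) = rep es i" using H(2) [OF that] gh [of "rep es i"] that by simp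
      then show ?thesis using rep_eqv eqv_sym by metis
    qed
    show "(?f (?g i), i) \<in> eqv es'" if "i < n + k'" for i
    proof -
      have "?f (?g i) = rep es' i" using G(2) [OF that] hg [of "rep es' i"] that by simp
      then show ?thesis using rep_eqv eqv_sym by metis
    qed
    show "list_all2 (rel_sim es') (map (ren ?f) rs) ?rs"
      by (rule list_all2_all_nthI) (use H(7) in auto)
  qed
qed

lemma nf_mat_le:
  assumes wf: "wf_body \<Sigma> (n + k) es rs t" and wf': "wf_body \<Sigma> (n + k') es' rs' t'" and len: "length t = length t'"
    and le: "matle (mat n (length t) (pres n k es rs t)) (mat n (length t) (pres n k' es' rs' t'))"
  shows "le' (nf n k es rs t) (nf n k' es' rs' t')"
proof -
  let ?m = "length t" and ?Q = "pres_graph (n + k) es rs" and ?Q' = "pres_graph (n + k') es' rs'"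
  have c: "(point n ?Q (map (rep es) [0..<n]), ?Q, point ?m ?Q (map (rep es) t)) \<in> csp n ?m"
    and d: "(point n ?Q' (map (rep es') [0..<n]), ?Q', point ?m ?Q' (map (rep es') t')) \<in> csp n ?m"
    using pres_csp(1) [OF wf] pres_csp(1) [OF wf'] len by (simp_all add: pres_def)
  obtain P P' where P: "arrow n ?m (mat n ?m (pres n k es rs t)) P" and P': "arrow n ?m (mat n ?m (pres n k' es' rs' t')) P'"
    using arrow_class [OF c] arrow_class [OF d] len by (auto simp: pres_def)
  have Q: "fin ?Q" by (rule pres_graph_fin [OF wf])
  have "val (mat n ?m (pres n k es rs t)) ?Q (map (rep es) [0..<n]) (map (rep es) t) > 0"
    using ident_homs [OF c] finite_homs [OF c Q] Q by (auto simp: pres_def val_mat card_gt_0_iff leg_point)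
  then have "val (mat n ?m (pres n k' es' rs' t')) ?Q (map (rep es) [0..<n]) (map (rep es) t) > 0"
    using le by (simp add: matle_def)
  then obtain h where "h \<in> homs n ?m (pres n k' es' rs' t') ?Q (map (rep es) [0..<n]) (map (rep es) t)"
    by (fastforce simp: val_mat card_gt_0_iff split: if_splits)
  then have h: "h \<in> hyper_hom ?Q' ?Q" "map (vmap h) (map (rep es') [0..<n]) = map (rep es) [0..<n]"
    "map (vmap h) (map (rep es') t') = map (rep es) t"
    using len by (simp_all add: homs_def pres_def leg_point del: map_map)
  note H = pres_morphism [OF wf' wf h]
  show ?thesis
  proof (rule nf_leI [OF wf wf', of "\<lambda>i. vmap h (rep es' i)", OF H(1) H(3) H(4) _ H(5)])
    show "\<exists>r\<in>set rs. rel_sim es (ren (\<lambda>i. vmap h (rep es' i)) r') r" if "r' \<in> set rs'" for r'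
      using that H(6,7) nth_mem by (metis in_set_conv_nth)
  qed
qed

lemma Hom_CB: "P \<in> Hom (CB \<Sigma>) n m \<longleftrightarrow> V P \<and> dm P = n \<and> cd P = m"
proof
  assume "P \<in> Hom (CB \<Sigma>) n m"
  then obtain c where "has_sort \<Sigma> c n m" "P = gcq_class \<Sigma> n m c" by (auto simp: CB_def)
  then have "ws c" "tdom c = n" "tcod c = m" "P = cl c" by (simp_all add: has_sort_iff ws_iff cl_def)
  then show "V P \<and> dm P = n \<and> cd P = m" by simp
next
  assume "V P \<and> dm P = n \<and> cd P = m"
  then obtain c where c: "ws c" "P = cl c" "tdom c = n" "tcod c = m" by (auto elim!: VE)
  then have "has_sort \<Sigma> c n m" "P = gcq_class \<Sigma> n m c" using ws_sort [of c] by (simp_all add: cl_def)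
  then show "P \<in> Hom (CB \<Sigma>) n m" by (auto simp: CB_def)
qed

lemma le_CB:
  assumes "V P" "V Q"
  shows "le (CB \<Sigma>) P Q \<longleftrightarrow> le' P Q"
proof -
  have "le (CB \<Sigma>) P Q \<longleftrightarrow> (\<exists>c\<in>P. \<exists>d\<in>Q. \<exists>n m. gcq_le \<Sigma> n m c d)" by (simp add: CB_def)
  also have "\<dots> \<longleftrightarrow> le' P Q"
  proof
  assume "\<exists>c\<in>P. \<exists>d\<in>Q. \<exists>n m. gcq_le \<Sigma> n m c d"
  then obtain c d n m where cd: "c \<in> P" "d \<in> Q" "gcq_le \<Sigma> n m c d" by blast
  have "P = cl c" using assms(1) cd(1) by (auto elim!: VE dest: cl_memD cl_eq)
  moreover have "Q = cl d" using assms(2) cd(2) by (auto elim!: VE dest: cl_memD cl_eq)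
  ultimately show "le' P Q" using cd(3) unfolding le'_def by blast
next
  assume "le' P Q"
  then obtain c d where "ws c" "ws d" "P = cl c" "Q = cl d" "gcq_le \<Sigma> (tdom c) (tcod c) c d" by (rule le'E) blast
  then show "\<exists>c\<in>P. \<exists>d\<in>Q. \<exists>n m. gcq_le \<Sigma> n m c d" using cl_mem by blast
  qed
  finally show ?thesis .
qed

lemma V_nf: "V P \<Longrightarrow> \<exists>k es rs t. wf_body \<Sigma> (dm P + k) es rs t \<and> length t = cd P \<and> P = nf (dm P) k es rs t"
proof -
  assume "V P"
  then have "representable P" by (auto elim!: VE intro: representable_cl)
  then obtain n k es rs t where wf: "wf_body \<Sigma> (n + k) es rs t" "P = nf n k es rs t" by (auto simp: representable_def)
  then have d: "dm P = n" "cd P = length t" by simp_all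
  show ?thesis unfolding d using wf by blast
qed

lemma F_inj': "\<lbrakk>V P; V Q; dm P = dm Q; cd P = cd Q; F P = F Q\<rbrakk> \<Longrightarrow> P = Q"
  using V_nf [of P] V_nf [of Q] F_nf_eq_mat nf_mat_inj by metis

lemma F_le: "\<lbrakk>V P; V Q; dm P = dm Q; cd P = cd Q\<rbrakk> \<Longrightarrow> le' P Q \<longleftrightarrow> matle (F P) (F Q)"
proof
  assume "le' P Q"
  then obtain c d where "ws c" "ws d" "P = cl c" "Q = cl d" "gcq_le \<Sigma> (tdom c) (tcod c) c d" by (rule le'E) blast
  then show "matle (F P) (F Q)" using F_cl gcq_le_ev by simp
next
  assume "V P" "V Q" "dm P = dm Q" "cd P = cd Q" "matle (F P) (F Q)"
  then show "le' P Q" using V_nf [of P] V_nf [of Q] F_nf_eq_mat nf_mat_le by metis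
qed

lemma CB_simps [simp]: "Obj (CB \<Sigma>) = UNIV" "oplus_obj (CB \<Sigma>) = (+)" "unit_obj (CB \<Sigma>) = 0"
  "assoc (CB \<Sigma>) x y z = ident (CB \<Sigma>) (x + y + z)" "lunit (CB \<Sigma>) x = ident (CB \<Sigma>) x" "runit (CB \<Sigma>) x = ident (CB \<Sigma>) x"
  by (simp_all add: CB_def)

lemma F_structure:
  "V (mu (CB \<Sigma>) n) \<and> dm (mu (CB \<Sigma>) n) = n + n \<and> cd (mu (CB \<Sigma>) n) = n \<and> F (mu (CB \<Sigma>) n) = Mu n"
  "V (eta (CB \<Sigma>) n) \<and> dm (eta (CB \<Sigma>) n) = 0 \<and> cd (eta (CB \<Sigma>) n) = n \<and> F (eta (CB \<Sigma>) n) = Eta n"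
  "V (delta (CB \<Sigma>) n) \<and> dm (delta (CB \<Sigma>) n) = n \<and> cd (delta (CB \<Sigma>) n) = n + n \<and> F (delta (CB \<Sigma>) n) = Delta n"
  "V (eps (CB \<Sigma>) n) \<and> dm (eps (CB \<Sigma>) n) = n \<and> cd (eps (CB \<Sigma>) n) = 0 \<and> F (eps (CB \<Sigma>) n) = Eps n"
  "F (symm (CB \<Sigma>) n m) = Sm n m"
  unfolding CB_eqs by (simp_all add: F_cl ev_merge ev_new ev_copy ev_discard ev_swap del: One_nat_def)

lemma CB_embedding: "pcb_embedding Mat (CB \<Sigma>) F"
proof -
  interpret strict_pcb Mat by (rule strict_Mat)
  show ?thesis
  proof (unfold_locales, unfold Hom_CB, goal_cases)
    case (5 f X Y g)
    then show ?case by (intro F_inj') auto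
  next
    case (9 f X Y g Z)
    then show ?case by (simp add: F_seq)
  next
    case (11 f X Y g X' Y')
    then show ?case by (simp add: F_par)
  next
    case (20 f X Y g)
    then show ?case by (simp add: le_CB F_le)
  qed (use F_structure in \<open>simp_all add: F_I\<close>)
qed

lemma CB_image: "f \<in> Hom (CB \<Sigma>) x y \<Longrightarrow> \<exists>g\<in>Hom (DiscCospan \<Sigma>) x y. Phi g = F f"
proof -
  assume "f \<in> Hom (CB \<Sigma>) x y"
  then have "V f" "dm f = x" "cd f = y" by (simp_all add: Hom_CB)
  then obtain k es rs t where wf: "wf_body \<Sigma> (x + k) es rs t" "length t = y" "f = nf x k es rs t" using V_nf by metis
  then show ?thesis using arrow_HomD [OF arrow_class [OF pres_csp(1) [OF wf(1)]]] F_nf_eq_mat [OF wf(1)] by metis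
qed

lemma DC_image: "f \<in> Hom (DiscCospan \<Sigma>) x y \<Longrightarrow> \<exists>g\<in>Hom (CB \<Sigma>) x y. F g = Phi f"
proof -
  assume "f \<in> Hom (DiscCospan \<Sigma>) x y"
  then obtain l A r where c: "(l, A, r) \<in> csp x y" "mat x y (l, A, r) = Phi f" using Hom_arrow_Phi arrowE by metis
  then obtain k es rs t where wf: "wf_body \<Sigma> (x + k) es rs t" "length t = y" "mat x y (pres x k es rs t) = Phi f"
    using pres_exists by metis
  then have "nf x k es rs t \<in> Hom (CB \<Sigma>) x y" by (simp add: Hom_CB)
  then show ?thesis using F_nf_eq_mat [OF wf(1)] wf by auto
qed

end

theorem mainTheorem2:
  fixes \<Sigma> :: "'s msig"
  shows "preordered_cartesian_bicategory (DiscCospan \<Sigma>) \<and>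
         preordered_cartesian_bicategory (CB \<Sigma>) \<and>
         pcb_isomorphic (DiscCospan \<Sigma>) (CB \<Sigma>)"
proof -
  interpret gcq_signature \<Sigma> .
  interpret D: pcb_embedding Mat "DiscCospan \<Sigma>" Phi by (rule DC_embedding)
  interpret C: pcb_embedding Mat "CB \<Sigma>" F by (rule CB_embedding)
  have "pcb_embeddings Mat (DiscCospan \<Sigma>) Phi (CB \<Sigma>) F"
    by unfold_locales (rule DC_image)
  moreover have "pcb_embeddings Mat (CB \<Sigma>) F (DiscCospan \<Sigma>) Phi"
    by unfold_locales (rule CB_image)
  ultimately show ?thesis using D.pcb_A C.pcb_A pcb_isomorphicI by blast
qed

end
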